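(* Let $G$ be a $2$-edge-connected, unweighted, undirected graph with $n$ vertices and $m$ edges, and let $T$ be a spanning tree of $G$ (a tree spanner). Then a best swap edge for every edge $e\in E(T)$ can be computed in $O(n^2)$ time and $O(n^2)$ space.
   Context: For vertices $x,y$ and a graph $H$, $d_H(x,y)$ denotes the number of edges of a shortest $x$–$y$ path in $H$. The stretch factor of a spanning tree $T'$ of a graph $H$ is $\sigma_H(T')=\max_{x,y\in V(H)} d_{T'}(x,y)/d_H(x,y)$ (over distinct $x,y$). For $e\in E(T)$, $G-e$ is $G$ with edge $e$ removed, and the set of swap edges $S(e)$ is the set of edges of $E(G)\setminus\{e\}$ whose endpoints lie in different connected components of $T-e$. For $f\in S(e)$, $T_{e/f}$ is the spanning tree obtained from $T$ by replacing $e$ with $f$. An edge $f^*\in S(e)$ is a best swap edge for $e$ if $f^*\in\arg\min_{f\in S(e)}\sigma_{G-e}(T_{e/f})$. *)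

theory Defs
  imports "HOL-Library.Landau_Symbols"
begin

section \<open>Finite simple undirected graphs\<close>

text \<open>A graph is given by its vertex set \<open>V\<close> and its edge set \<open>E\<close>; an edge is the set
  of its two endpoints. \<open>G - e\<close> is \<open>(V, E - {e})\<close>.\<close>

definition simple_graph :: "'a set \<Rightarrow> 'a set set \<Rightarrow> bool" where
  "simple_graph V E \<longleftrightarrow> finite V \<and> (\<forall>e\<in>E. e \<subseteq> V \<and> card e = 2)"

definition graph_path :: "'a set \<Rightarrow> 'a set set \<Rightarrow> 'a \<Rightarrow> 'a list \<Rightarrow> 'a \<Rightarrow> bool" where
  "graph_path V E x p y \<longleftrightarrow>
     p \<noteq> [] \<and> hd p = x \<and> last p = y \<and> set p \<subseteq> V \<and> distinct p \<and>
     successively (\<lambda>u v. {u, v} \<in> E) p"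

definition graph_connected :: "'a set \<Rightarrow> 'a set set \<Rightarrow> bool" where
  "graph_connected V E \<longleftrightarrow> V \<noteq> {} \<and> (\<forall>x\<in>V. \<forall>y\<in>V. \<exists>p. graph_path V E x p y)"

definition graph_component :: "'a set \<Rightarrow> 'a set set \<Rightarrow> 'a \<Rightarrow> 'a set" where
  "graph_component V E x = {y \<in> V. \<exists>p. graph_path V E x p y}"

definition two_edge_connected :: "'a set \<Rightarrow> 'a set set \<Rightarrow> bool" where
  "two_edge_connected V E \<longleftrightarrow>
     card V > 1 \<and> graph_connected V E \<and> (\<forall>e\<in>E. graph_connected V (E - {e}))"

definition graph_cycle :: "'a set \<Rightarrow> 'a set set \<Rightarrow> 'a list \<Rightarrow> bool" where
  "graph_cycle V E p \<longleftrightarrow>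
     length p \<ge> 3 \<and> set p \<subseteq> V \<and> distinct p \<and>
     successively (\<lambda>u v. {u, v} \<in> E) p \<and> {last p, hd p} \<in> E"

definition graph_tree :: "'a set \<Rightarrow> 'a set set \<Rightarrow> bool" where
  "graph_tree V F \<longleftrightarrow> graph_connected V F \<and> \<not> (\<exists>p. graph_cycle V F p)"

definition graph_spanning_tree :: "'a set \<Rightarrow> 'a set set \<Rightarrow> 'a set set \<Rightarrow> bool" where
  "graph_spanning_tree V E F \<longleftrightarrow> F \<subseteq> E \<and> graph_tree V F"

text \<open>Meaningful only if \<open>x\<close> and \<open>y\<close> are in the same component.\<close>
definition graph_dist :: "'a set \<Rightarrow> 'a set set \<Rightarrow> 'a \<Rightarrow> 'a \<Rightarrow> nat" where
  "graph_dist V E x y = (LEAST k. \<exists>p. graph_path V E x p y \<and> length p = Suc k)"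

definition stretch :: "'a set \<Rightarrow> 'a set set \<Rightarrow> 'a set set \<Rightarrow> real" where
  "stretch V E F =
     Max {real (graph_dist V F x y) / real (graph_dist V E x y) | x y. x \<in> V \<and> y \<in> V \<and> x \<noteq> y}"

definition swap_edges :: "'a set \<Rightarrow> 'a set set \<Rightarrow> 'a set set \<Rightarrow> 'a set \<Rightarrow> 'a set set" where
  "swap_edges V E F e =
     {f \<in> E - {e}. \<exists>x y. f = {x, y} \<and>
        graph_component V (F - {e}) x \<noteq> graph_component V (F - {e}) y}"

definition swap_tree :: "'a set set \<Rightarrow> 'a set \<Rightarrow> 'a set \<Rightarrow> 'a set set" where
  "swap_tree F e f = insert f (F - {e})"

definition best_swap_edge ::
    "'a set \<Rightarrow> 'a set set \<Rightarrow> 'a set set \<Rightarrow> 'a set \<Rightarrow> 'a set \<Rightarrow> bool" where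
  "best_swap_edge V E F e f \<longleftrightarrow>
     is_arg_min (\<lambda>g. stretch V (E - {e}) (swap_tree F e g)) (\<lambda>g. g \<in> swap_edges V E F e) f"


section \<open>A unit-cost word RAM\<close>

text \<open>
  Programs are structured. A program uses a fixed finite number of registers and of random access
  arrays (the memory segments of the machine), both addressed by numerals in the program text.

  The machine has two parameters: \<open>W\<close>, all words being natural numbers below \<open>W\<close>, and \<open>L\<close>, the
  number of cells of each array. A computation that produces a number \<open>\<ge> W\<close> or accesses an
  array outside \<open>{..<L}\<close> is stuck, i.e. it has no terminating run. Without the bound on words,
  unit-cost arithmetic would be unrealistically powerful.
\<close>

datatype binop = Add | Sub | Mul | Div | Mod | Less | Eq

fun binop_val :: "binop \<Rightarrow> nat \<Rightarrow> nat \<Rightarrow> nat" where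
  "binop_val Add a b = a + b"
| "binop_val Sub a b = a - b"
| "binop_val Mul a b = a * b"
| "binop_val Div a b = a div b"
| "binop_val Mod a b = a mod b"
| "binop_val Less a b = of_bool (a < b)"
| "binop_val Eq a b = of_bool (a = b)"

datatype exp =
    Const nat
  | Reg nat
  | Read nat exp
  | Binop binop exp exp

datatype com =
    Skip
  | Assign nat exp
  | Write nat exp exp
  | Seq com com
  | If exp com com
  | While exp com

record ram_state =
  reg :: "nat \<Rightarrow> nat"
  arr :: "nat \<Rightarrow> nat \<Rightarrow> nat"

inductive eval :: "nat \<Rightarrow> nat \<Rightarrow> ram_state \<Rightarrow> exp \<Rightarrow> nat \<Rightarrow> bool" for W L s where
  Const: "k < W \<Longrightarrow> eval W L s (Const k) k"
| Reg: "reg s x < W \<Longrightarrow> eval W L s (Reg x) (reg s x)"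
| Read: "eval W L s e i \<Longrightarrow> i < L \<Longrightarrow> arr s a i < W \<Longrightarrow> eval W L s (Read a e) (arr s a i)"
| Binop: "eval W L s e1 v1 \<Longrightarrow> eval W L s e2 v2 \<Longrightarrow> binop_val b v1 v2 < W \<Longrightarrow>
    eval W L s (Binop b e1 e2) (binop_val b v1 v2)"

fun exp_cost :: "exp \<Rightarrow> nat" where
  "exp_cost (Const k) = 1"
| "exp_cost (Reg x) = 1"
| "exp_cost (Read a e) = 1 + exp_cost e"
| "exp_cost (Binop b e1 e2) = 1 + exp_cost e1 + exp_cost e2"

text \<open>\<open>run W L c s t s'\<close>: started in state \<open>s\<close>, the program \<open>c\<close> halts in state \<open>s'\<close> after
  \<open>t\<close> elementary steps. In conditions, nonzero means true.\<close>

inductive run :: "nat \<Rightarrow> nat \<Rightarrow> com \<Rightarrow> ram_state \<Rightarrow> nat \<Rightarrow> ram_state \<Rightarrow> bool" for W L where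
  Skip: "run W L Skip s 1 s"
| Assign: "eval W L s e v \<Longrightarrow>
    run W L (Assign x e) s (1 + exp_cost e) (s\<lparr>reg := (reg s)(x := v)\<rparr>)"
| Write: "eval W L s e1 i \<Longrightarrow> i < L \<Longrightarrow> eval W L s e2 v \<Longrightarrow>
    run W L (Write a e1 e2) s (1 + exp_cost e1 + exp_cost e2)
      (s\<lparr>arr := (arr s)(a := (arr s a)(i := v))\<rparr>)"
| Seq: "run W L c1 s t1 s1 \<Longrightarrow> run W L c2 s1 t2 s2 \<Longrightarrow> run W L (Seq c1 c2) s (t1 + t2) s2"
| IfTrue: "eval W L s b v \<Longrightarrow> v \<noteq> 0 \<Longrightarrow> run W L c1 s t s' \<Longrightarrow>
    run W L (If b c1 c2) s (1 + exp_cost b + t) s'"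
| IfFalse: "eval W L s b 0 \<Longrightarrow> run W L c2 s t s' \<Longrightarrow>
    run W L (If b c1 c2) s (1 + exp_cost b + t) s'"
| WhileFalse: "eval W L s b 0 \<Longrightarrow> run W L (While b c) s (1 + exp_cost b) s"
| WhileTrue: "eval W L s b v \<Longrightarrow> v \<noteq> 0 \<Longrightarrow> run W L c s t1 s1 \<Longrightarrow>
    run W L (While b c) s1 t2 s2 \<Longrightarrow> run W L (While b c) s (1 + exp_cost b + t1 + t2) s2"

inductive_cases eval_cases:
  "eval W L s (Const k) v" "eval W L s (Reg x) v" "eval W L s (Read a e) v"
  "eval W L s (Binop b e1 e2) v"

inductive_cases run_cases:
  "run W L Skip s t s'" "run W L (Assign x e) s t s'" "run W L (Write a e1 e2) s t s'"
  "run W L (Seq c1 c2) s t s'" "run W L (If b c1 c2) s t s'" "run W L (While b c) s t s'"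

lemma eval_deterministic: "eval W L s e v \<Longrightarrow> eval W L s e v' \<Longrightarrow> v' = v"
proof (induction arbitrary: v' rule: eval.induct)
  case (Const k)
  then show ?case by (auto elim: eval_cases(1))
next
  case (Reg x)
  then show ?case by (auto elim: eval_cases(2))
next
  case (Read e i a)
  from Read.prems show ?case by (rule eval_cases(3)) (auto dest!: Read.IH)
next
  case (Binop e1 v1 e2 v2 b)
  from Binop.prems show ?case by (rule eval_cases(4)) (auto dest!: Binop.IH)
qed

lemma run_deterministic:
  "run W L c s t s' \<Longrightarrow> run W L c s t' s'' \<Longrightarrow> t' = t \<and> s'' = s'"
proof (induction arbitrary: t' s'' rule: run.induct)
  case (Skip s)
  from Skip.prems show ?case by (rule run_cases(1)) simp
next
  case (Assign s e v x)
  note det = eval_deterministic[OF Assign.hyps(1)]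
  from Assign.prems show ?case by (rule run_cases(2)) (auto dest!: det)
next
  case (Write s e1 i e2 v a)
  note det = eval_deterministic[OF Write.hyps(1)] eval_deterministic[OF Write.hyps(3)]
  from Write.prems show ?case by (rule run_cases(3)) (auto dest!: det)
next
  case (Seq c1 s t1 s1 c2 t2 s2)
  from Seq.prems show ?case by (rule run_cases(4)) (auto dest!: Seq.IH)
next
  case (IfTrue s b v c1 t s' c2)
  note det = eval_deterministic[OF IfTrue.hyps(1)]
  from IfTrue.prems \<open>v \<noteq> 0\<close> show ?case
    by (elim run_cases(5)) (auto dest!: det IfTrue.IH)
next
  case (IfFalse s b c2 t s' c1)
  note det = eval_deterministic[OF IfFalse.hyps(1)]
  from IfFalse.prems show ?case
    by (elim run_cases(5)) (auto dest!: det IfFalse.IH)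
next
  case (WhileFalse s b c)
  note det = eval_deterministic[OF WhileFalse.hyps(1)]
  from WhileFalse.prems show ?case
    by (rule run_cases(6)) (auto dest!: det)
next
  case (WhileTrue s b v c t1 s1 t2 s2)
  note det = eval_deterministic[OF WhileTrue.hyps(1)]
  from WhileTrue.prems show ?case
    by (rule run_cases(6)) (use \<open>v \<noteq> 0\<close> in \<open>auto dest!: det WhileTrue.IH\<close>)
qed

fun exp_regs :: "exp \<Rightarrow> nat set" where
  "exp_regs (Const k) = {}"
| "exp_regs (Reg x) = {x}"
| "exp_regs (Read a e) = exp_regs e"
| "exp_regs (Binop b e1 e2) = exp_regs e1 \<union> exp_regs e2"

fun exp_arrs :: "exp \<Rightarrow> nat set" where
  "exp_arrs (Const k) = {}"
| "exp_arrs (Reg x) = {}"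
| "exp_arrs (Read a e) = insert a (exp_arrs e)"
| "exp_arrs (Binop b e1 e2) = exp_arrs e1 \<union> exp_arrs e2"

fun com_regs :: "com \<Rightarrow> nat set" where
  "com_regs Skip = {}"
| "com_regs (Assign x e) = insert x (exp_regs e)"
| "com_regs (Write a e1 e2) = exp_regs e1 \<union> exp_regs e2"
| "com_regs (Seq c1 c2) = com_regs c1 \<union> com_regs c2"
| "com_regs (If b c1 c2) = exp_regs b \<union> com_regs c1 \<union> com_regs c2"
| "com_regs (While b c) = exp_regs b \<union> com_regs c"

fun com_arrs :: "com \<Rightarrow> nat set" where
  "com_arrs Skip = {}"
| "com_arrs (Assign x e) = exp_arrs e"
| "com_arrs (Write a e1 e2) = insert a (exp_arrs e1 \<union> exp_arrs e2)"
| "com_arrs (Seq c1 c2) = com_arrs c1 \<union> com_arrs c2"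
| "com_arrs (If b c1 c2) = exp_arrs b \<union> com_arrs c1 \<union> com_arrs c2"
| "com_arrs (While b c) = exp_arrs b \<union> com_arrs c"

text \<open>Total number of words of the machine on which the program runs.\<close>
definition com_space :: "com \<Rightarrow> nat \<Rightarrow> nat" where
  "com_space c L = card (com_regs c) + card (com_arrs c) * L"


section \<open>Input and output\<close>

definition edge_of :: "'a \<times> 'a \<Rightarrow> 'a set" where
  "edge_of p = {fst p, snd p}"

text \<open>The list enumerates the edges, each exactly once, in any order and orientation.\<close>
definition edge_listing :: "('a \<times> 'a) list \<Rightarrow> 'a set set \<Rightarrow> bool" where
  "edge_listing es E \<longleftrightarrow> distinct (map edge_of es) \<and> set (map edge_of es) = E"

definition array_of :: "nat list \<Rightarrow> nat \<Rightarrow> nat" where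
  "array_of xs i = (if i < length xs then xs ! i else 0)"

text \<open>For a graph with vertices \<open>0, \<dots>, n - 1\<close>: registers 0 and 1 hold the numbers of vertices and
  of edges, arrays 0 and 1 the endpoints of the edges of the graph, arrays 2 and 3 those of
  the edges of the spanning tree. All other words are 0.\<close>
definition input_state :: "nat \<Rightarrow> (nat \<times> nat) list \<Rightarrow> (nat \<times> nat) list \<Rightarrow> ram_state" where
  "input_state n es ts =
     \<lparr>reg = (\<lambda>_. 0)(0 := n, 1 := length es),
      arr = (\<lambda>_ _. 0)(0 := array_of (map fst es), 1 := array_of (map snd es),
                      2 := array_of (map fst ts), 3 := array_of (map snd ts))\<rparr>"

text \<open>The \<open>i\<close>-th output edge is read off arrays 4 and 5.\<close>
definition output_edge :: "ram_state \<Rightarrow> nat \<Rightarrow> nat set" where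
  "output_edge s i = {arr s 4 i, arr s 5 i}"

end

theory Submission
  imports Defs
begin

text \<open>
  Root the tree and number the vertices so that parents come first. After removing the edge above
  \<open>a\<close>, the tree distance between the ends of a non-tree edge \<open>{x, y}\<close> with \<open>x\<close> below \<open>a\<close> and \<open>y\<close>
  not below \<open>a\<close> becomes \<open>d x u + d y v + 1\<close> if \<open>{u, v}\<close> is the swap edge; the stretch factor is
  attained on an edge, and the edges that do not cross the cut contribute the same for every swap
  edge. So one has to minimise \<open>K a u v\<close>, the maximum of \<open>d x u + d y v\<close> over the crossing edges.

  For fixed \<open>u\<close> this is the eccentricity of \<open>v\<close> in the set of points \<open>y\<close> of weight \<open>d x u\<close>. By the
  four-point condition it is determined by a diametral pair, and such pairs can be updated in constant
  time when a point is inserted; rerooting yields the pairs of all \<open>u\<close> in linear time per \<open>a\<close>.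
  The eccentricity equals the distance from the centre of the pair plus a constant, so the best \<open>v\<close>
  is the neighbour of \<open>u\<close> outside the subtree of \<open>a\<close> that is nearest to the centre \<open>c\<close>. Let
  \<open>ld u v\<close> be the depth of the lowest common ancestor; \<open>v\<close> is outside iff \<open>ld u v < dep a\<close>. If
  \<open>ld u v \<le> ld u c\<close>, the nearest \<open>v\<close> is found in a table indexed by \<open>u\<close> and \<open>c\<close>. If
  \<open>ld u v > ld u c\<close>, then \<open>d c v\<close> differs from \<open>dep v\<close> by a constant, and the best \<open>v\<close> is the
  answer to a range minimum query over the levels from \<open>ld u c + 1\<close> to \<open>dep a - 1\<close>. Such
  queries take constant time after linear preprocessing: sparse tables for blocks of logarithmic
  length, and bit masks of suffix minima within the blocks.
\<close>

section \<open>Trees given by a parent function\<close>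

text \<open>There are about n^2 pairs of a tree edge and a lower endpoint u, so each pair may cost
  only constant time; any logarithmic factor is too much. Three facts make this possible. Seen from
  a vertex u below the removed edge, the neighbours outside the subtree depend on that edge only
  through its depth; hence tables indexed by u and a level, or by u and a centre, are shared by all
  tree edges and have O(n^2) cells. A diametral pair represents its whole point set for insertion,
  union and eccentricity, but points cannot be deleted from it; therefore rerooting combines
  prefixes and suffixes of the children of a vertex. A bit mask for a block of logarithmic length is
  a number below the table size, so its lowest set bit can be looked up.

  That the stretch factor is attained on an edge follows by adding the tree distances along a
  shortest path of the graph without the removed edge. All the geometry rests on the four-point
  condition, proved by one induction along the numbering. A midpoint may be the middle of an edge,
  so every u causes two queries.\<close>

function tdist :: "(nat \<Rightarrow> nat) \<Rightarrow> nat \<Rightarrow> nat \<Rightarrow> nat" where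
  "tdist par i j =
     (if i = j then 0
      else if j < i then (if par i < i then Suc (tdist par (par i) j) else 0)
      else (if par j < j then Suc (tdist par i (par j)) else 0))"
  by auto
text \<open>The guards \<open>par i < i\<close> and \<open>par j < j\<close> let
  \<open>i + j\<close> decrease for every \<open>par\<close>; the value 0 in the failing case is
  only a default, excluded in the locale below.\<close>

termination by (relation "measure (\<lambda>(par, i, j). i + j)") auto

declare tdist.simps [simp del]

locale ptree =
  fixes n :: nat and par :: "nat \<Rightarrow> nat"
  assumes n_pos: "0 < n"
    and par_less: "\<And>i. 0 < i \<Longrightarrow> i < n \<Longrightarrow> par i < i"
begin

abbreviation d :: "nat \<Rightarrow> nat \<Rightarrow> nat" where "d \<equiv> tdist par"

abbreviation dep :: "nat \<Rightarrow> nat" where "dep \<equiv> d 0"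

text \<open>The subtree rooted at \<open>a\<close>: the condition says that \<open>a\<close> lies on
  the path from the root to \<open>x\<close>.\<close>

definition sub :: "nat \<Rightarrow> nat set" where
  "sub a = {x. x < n \<and> d a x + dep a = dep x}"

definition ld :: "nat \<Rightarrow> nat \<Rightarrow> nat" where
  "ld x y = (dep x + dep y - d x y) div 2"

lemma d_refl [simp]: "d x x = 0"
  by (simp add: tdist.simps)

text \<open>Parents have smaller numbers, so the larger of two distinct vertices is not an ancestor
  of the smaller one and the path leaves it through its parent. This is what the recursion
  encodes.\<close>

lemma d_left: "j < i \<Longrightarrow> i < n \<Longrightarrow> d i j = Suc (d (par i) j)"
  using par_less[of i] by (subst tdist.simps) auto

lemma d_right: "j < i \<Longrightarrow> i < n \<Longrightarrow> d j i = Suc (d j (par i))"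
  using par_less[of i] by (subst tdist.simps) auto

lemma par_lt [simp]: "0 < i \<Longrightarrow> i < n \<Longrightarrow> par i < n"
  using par_less[of i] by simp

lemma d_sym: "x < n \<Longrightarrow> y < n \<Longrightarrow> d x y = d y x"
proof (induction "x + y" arbitrary: x y rule: less_induct)
  case less
  consider "x = y" | "x < y" | "y < x" by linarith
  then show ?case
  proof cases
    case 2
    then have "par y < y" using less.prems par_less[of y] by simp
    then show ?thesis
      using 2 less.prems less.hyps[of x "par y"] d_left[of x y] d_right[of x y] by simp
  next
    case 3
    then have "par x < x" using less.prems par_less[of x] by simp
    then show ?thesis
      using 3 less.prems less.hyps[of "par x" y] d_left[of y x] d_right[of y x] by simp
  qed simp
qed

lemma d_max: "x < n \<Longrightarrow> y < x \<Longrightarrow> d x y = Suc (d (par x) y)" "x < n \<Longrightarrow> y < x \<Longrightarrow> d y x = Suc (d (par x) y)"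
  using d_left[of y x] d_sym[of x y] by auto

lemma d_pos: "x < n \<Longrightarrow> y < n \<Longrightarrow> x \<noteq> y \<Longrightarrow> 0 < d x y"
  using d_max[of x y] d_max[of y x] by (cases "x < y") auto

lemma d_eq_0 [simp]: "x < n \<Longrightarrow> y < n \<Longrightarrow> d x y = 0 \<longleftrightarrow> x = y"
  using d_pos[of x y] by (cases "x = y") auto

text \<open>Replace the largest of three distinct vertices by its parent. Both distances that
  involve it drop by one, so the inequality for the smaller triple implies the one for the
  original.\<close>

lemma d_tri: "x < n \<Longrightarrow> y < n \<Longrightarrow> z < n \<Longrightarrow> d x z \<le> d x y + d y z"
proof (induction "x + y + z" arbitrary: x y z rule: less_induct)
  case less
  show ?case
  proof (cases "x = y \<or> y = z \<or> x = z")
    case False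
    then consider "y < x" "z < x" | "x < y" "z < y" | "x < z" "y < z" by linarith
    then show ?thesis
    proof cases
      case 1
      then have "par x < x" using less.prems par_less[of x] by simp
      then show ?thesis
        using 1 less.prems less.hyps[of "par x" y z] by (simp add: d_max)
    next
      case 2
      then have p: "par y < y" using less.prems par_less[of y] by simp
      have "d x (par y) = d (par y) x" by (rule d_sym) (use p less.prems in auto)
      then show ?thesis
        using p 2 less.prems less.hyps[of x "par y" z] by (simp add: d_max)
    next
      case 3
      then have p: "par z < z" using less.prems par_less[of z] by simp
      have "d x (par z) = d (par z) x" "d y (par z) = d (par z) y"
        by (rule d_sym; use p less.prems in auto)+
      then show ?thesis
        using p 3 less.prems less.hyps[of x y "par z"] by (simp add: d_max)
    qed
  qed auto
qed

text \<open>Each of the three pairings contains every vertex exactly once. Replacing the largest of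
  four distinct vertices by its parent thus lowers all three sums by one; if two vertices coincide,
  the triangle inequality suffices.\<close>

lemma four_point:
  "x < n \<Longrightarrow> y < n \<Longrightarrow> z < n \<Longrightarrow> w < n \<Longrightarrow>
   d x y + d z w \<le> max (d x z + d y w) (d x w + d y z)"
proof (induction "x + y + z + w" arbitrary: x y z w rule: less_induct)
  case less
  note lt = less.prems
  have sym: "d a b = d b a" if "a \<in> {x, y, z, w}" "b \<in> {x, y, z, w}" for a b
    by (rule d_sym) (use that lt in auto)
  show ?case
  proof (cases "x = y \<or> x = z \<or> x = w \<or> y = z \<or> y = w \<or> z = w")
    case True
    then show ?thesis
      using d_tri[of z x w] d_tri[of x z y] sym[of x y] sym[of x z] sym[of x w] sym[of y z]
        sym[of y w] sym[of z w] lt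
      by (elim disjE) auto
  next
    case False
    have step: "\<And>a b. b < n \<Longrightarrow> par b < b \<Longrightarrow> a < n \<Longrightarrow> d a (par b) = d (par b) a"
      by (rule d_sym) auto
    consider "y < x" "z < x" "w < x" | "x < y" "z < y" "w < y"
      | "x < z" "y < z" "w < z" | "x < w" "y < w" "z < w" using False by linarith
    then show ?thesis
    proof cases
      case 1
      then have p: "par x < x" using lt par_less[of x] by simp
      then show ?thesis using less.hyps[of "par x" y z w] 1 lt by (simp add: d_max)
    next
      case 2
      then have p: "par y < y" using lt par_less[of y] by simp
      then show ?thesis using less.hyps[of x "par y" z w] 2 lt step[of y] by (simp add: d_max)
    next
      case 3
      then have p: "par z < z" using lt par_less[of z] by simp
      then show ?thesis using less.hyps[of x y "par z" w] 3 lt step[of z] by (simp add: d_max)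
    next
      case 4
      then have p: "par w < w" using lt par_less[of w] by simp
      then show ?thesis using less.hyps[of x y z "par w"] 4 lt step[of w] by (simp add: d_max)
    qed
  qed
qed

lemma d_less: "x < n \<Longrightarrow> y < n \<Longrightarrow> d x y \<le> max x y"
proof (induction "x + y" arbitrary: x y rule: less_induct)
  case less
  have *: "d (par u) v < u" if "u < n" "v < u" "u + v = x + y" for u v
    using less.hyps[of "par u" v] par_less[of u] that by simp
  consider "x = y" | "x < y" | "y < x" by linarith
  then show ?case
    by cases (use *[of x y] *[of y x] less.prems d_max[of x y] d_max[of y x] in auto)
qed

lemma d_lt_n: "x < n \<Longrightarrow> y < n \<Longrightarrow> d x y < n"
  using d_less[of x y] by simp

text \<open>A tree is bipartite by the parity of the depth. This makes the halving in
  \<open>ld\<close> exact and later separates two adjacent centres.\<close>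

lemma d_parity: "x < n \<Longrightarrow> y < n \<Longrightarrow> even (d x y + dep x + dep y)"
proof (induction "x + y" arbitrary: x y rule: less_induct)
  case less
  have *: "even (d u v + dep u + dep v)" if "u < n" "v < u" "u + v = x + y" for u v
    using less.hyps[of "par u" v] par_less[of u] that d_max(1)[of u v] d_max(2)[of u 0] d_sym[of 0 "par u"]
    by simp
  consider "x = y" | "x < y" | "y < x" by linarith
  then show ?case
    by cases (use *[of x y] *[of y x] less.prems d_sym[of x y] in \<open>auto simp: add_ac\<close>)
qed

lemma dep_par: "0 < a \<Longrightarrow> a < n \<Longrightarrow> dep a = Suc (dep (par a))"
  using d_right[of 0 a] by simp

lemma d_par: "0 < a \<Longrightarrow> a < n \<Longrightarrow> d a (par a) = 1" "0 < a \<Longrightarrow> a < n \<Longrightarrow> d (par a) a = 1"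
  using d_left[of "par a" a] d_right[of "par a" a] par_less[of a] by auto

lemma d_le_dep: "x < n \<Longrightarrow> y < n \<Longrightarrow> d x y \<le> dep x + dep y"
  using d_tri[of x 0 y] n_pos d_sym[of x 0] by simp

lemma ld2: "x < n \<Longrightarrow> y < n \<Longrightarrow> 2 * ld x y + d x y = dep x + dep y"
proof -
  have "2 * ((a + b - m) div 2) + m = a + b" if "m \<le> a + b" "even (m + a + b)" for a b m :: nat
    using that by presburger
  then show "x < n \<Longrightarrow> y < n \<Longrightarrow> ?thesis" unfolding ld_def using d_le_dep[of x y] d_parity[of x y] by blast
qed

lemma ld_sym: "x < n \<Longrightarrow> y < n \<Longrightarrow> ld x y = ld y x"
  using ld2[of x y] ld2[of y x] d_sym[of x y] by simp

lemma ld_le: "x < n \<Longrightarrow> y < n \<Longrightarrow> ld x y \<le> dep x"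
  using ld2[of x y] d_tri[of 0 x y] n_pos by simp

text \<open>The four-point condition with the root as fourth point; depths of lowest common
  ancestors form an ultrametric.\<close>

lemma ld_ultra: "x < n \<Longrightarrow> y < n \<Longrightarrow> z < n \<Longrightarrow> min (ld x y) (ld y z) \<le> ld x z"
  using four_point[of x z y 0] ld2[of x y] ld2[of y z] ld2[of x z] d_sym[of x 0] d_sym[of y 0]
    d_sym[of z 0] d_sym[of z y] n_pos
  by auto

lemma sub_less: "x \<in> sub a \<Longrightarrow> x < n"
  by (simp add: sub_def)

lemma sub_self [simp]: "a < n \<Longrightarrow> a \<in> sub a"
  by (simp add: sub_def)

lemma d_sub: "0 < a \<Longrightarrow> a < n \<Longrightarrow> x \<in> sub a \<Longrightarrow> d (par a) x = Suc (d a x)"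
  using d_tri[of 0 "par a" x] d_tri[of "par a" a x] d_par[of a] dep_par[of a] n_pos
  by (auto simp: sub_def)

text \<open>By parity and the triangle inequality the distances from \<open>a\<close> and from
  \<open>par a\<close> differ by exactly one. If \<open>a\<close> were the nearer one, the
  four-point condition with the root would put \<open>x\<close> below \<open>a\<close>.\<close>

lemma d_nsub:
  assumes "0 < a" "a < n" "x < n" "x \<notin> sub a"
  shows "d a x = Suc (d (par a) x)"
proof (rule ccontr)
  assume ne: "d a x \<noteq> Suc (d (par a) x)"
  have p: "par a < n" using assms by simp
  have "d a x \<le> Suc (d (par a) x)" using d_tri[of a "par a" x] assms p d_par[of a] by simp
  moreover have "d a x \<noteq> d (par a) x"
    using d_parity[of a x] d_parity[of "par a" x] dep_par[of a] assms p by auto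
  ultimately have lt: "d a x < d (par a) x" using ne by linarith
  have "dep a + d (par a) x \<le> max (dep (par a) + d a x) (dep x + 1)"
    using four_point[of 0 a "par a" x] assms p d_par[of a] n_pos by simp
  then have "dep a + d a x \<le> dep x" using lt dep_par[of a] assms by auto
  moreover have "dep x \<le> dep a + d a x" using d_tri[of 0 a x] assms n_pos by simp
  ultimately show False using assms by (simp add: sub_def)
qed

text \<open>In the four-point condition for \<open>par a\<close>, \<open>x\<close>,
  \<open>a\<close>, \<open>y\<close> the alternative pairing \<open>d (par a) y + d x a\<close> is
  two too small, so the maximum is \<open>1 + d x y\<close>.\<close>

lemma d_cross:
  assumes "0 < a" "a < n" "x \<in> sub a" "y < n" "y \<notin> sub a"
  shows "d x y = Suc (d a x + d (par a) y)"
proof -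
  have x: "x < n" using assms sub_less by auto
  have p: "par a < n" using assms by simp
  have "d (par a) x + d a y \<le> max (d (par a) a + d x y) (d (par a) y + d x a)"
    using four_point[of "par a" x a y] assms x p by simp
  then have "Suc (d a x + d (par a) y) \<le> d x y"
    using d_sub[of a x] d_nsub[of a y] assms d_par[of a] d_sym[of x a] x by auto
  moreover have "d x y \<le> Suc (d a x + d (par a) y)"
    using d_tri[of x a y] d_nsub[of a y] assms x d_sym[of x a] by simp
  ultimately show ?thesis by simp
qed

text \<open>A path that leaves the subtree passes through \<open>par a\<close> by
  \<open>d_cross\<close>, which caps the common depth at \<open>dep a - 1\<close>.\<close>

lemma sub_iff_ld:
  assumes "a < n" "x \<in> sub a" "y < n"
  shows "y \<in> sub a \<longleftrightarrow> dep a \<le> ld x y"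
proof (cases "a = 0")
  case True
  then show ?thesis using assms by (simp add: sub_def)
next
  case False
  have x: "x < n" using assms sub_less by auto
  show ?thesis
  proof (cases "y \<in> sub a")
    case True
    have "d x y \<le> d a x + d a y" using d_tri[of x a y] d_sym[of a x] assms x by simp
    then show ?thesis using True assms ld2[of x y] x by (auto simp: sub_def)
  next
    case nin: False
    then have "d x y = Suc (d a x + d (par a) y)" using d_cross[of a x y] assms False by simp
    moreover have "dep y \<le> dep (par a) + d (par a) y"
      using d_tri[of 0 "par a" y] assms False n_pos by simp
    ultimately show ?thesis
      using nin assms ld2[of x y] x dep_par[of a] False by (auto simp: sub_def)
  qed
qed

lemma ld_sub: "a < n \<Longrightarrow> u \<in> sub a \<Longrightarrow> ld u a = dep a"
  using ld2[of u a] d_sym[of u a] sub_less[of u a] by (auto simp: sub_def)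

lemma sub_0 [simp]: "sub 0 = {..<n}"
  by (auto simp: sub_def)

lemma sub_par:
  assumes "x \<in> sub a" "x \<noteq> a" "a < n"
  shows "0 < x" "par x \<in> sub a"
proof -
  have x: "x < n" using assms sub_less by auto
  show x0: "0 < x" using assms x by (cases "x = 0") (auto simp: sub_def)
  have a: "a \<notin> sub x"
    using assms x d_pos[of a x] d_pos[of x a] by (auto simp: sub_def)
  show "par x \<in> sub a"
    using d_nsub[of x a] a assms x x0 dep_par[of x] d_sym[of x a] d_sym[of "par x" a]
    by (auto simp: sub_def)
qed

lemma par_sub: "par x \<in> sub a \<Longrightarrow> 0 < x \<Longrightarrow> x < n \<Longrightarrow> a < n \<Longrightarrow> x \<in> sub a"
  using d_tri[of a "par x" x] d_tri[of 0 a x] dep_par[of x] d_par[of x] n_pos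
  by (auto simp: sub_def)

lemma sub_mono: "x \<in> sub p \<Longrightarrow> y \<in> sub x \<Longrightarrow> p < n \<Longrightarrow> y \<in> sub p"
  using d_tri[of p x y] d_tri[of 0 p y] n_pos by (auto simp: sub_def)

lemma par_nsub: "0 < a \<Longrightarrow> a < n \<Longrightarrow> par a \<notin> sub a"
  using dep_par[of a] by (auto simp: sub_def)

lemma sub_child: "0 < i \<Longrightarrow> i < n \<Longrightarrow> sub i \<subseteq> sub (par i)"
  using sub_mono[of i "par i"] par_sub[of i "par i"] by auto

text \<open>Siblings have distance 2. A common descendant would be nearer to both than to the
  parent, against the four-point condition.\<close>

lemma sub_disjoint:
  assumes "0 < i" "i < n" "0 < j" "j < n" "par i = par j" "i \<noteq> j"
  shows "sub i \<inter> sub j = {}"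
proof (rule ccontr)
  assume "sub i \<inter> sub j \<noteq> {}"
  then obtain x where x: "x \<in> sub i" "x \<in> sub j" by auto
  have p: "par i < n" "x < n" using assms x sub_less by auto
  have "d i j = 2"
    using assms d_max[of i j] d_max[of j i] d_par[of i] d_par[of j] by (cases "i < j") auto
  moreover have "d (par i) x + d i j \<le> max (d (par i) i + d x j) (d (par i) j + d x i)"
    using four_point[of "par i" x i j] p assms by simp
  ultimately show False
    using d_sub[of i x] d_sub[of j x] x assms p d_sym[of x i] d_sym[of x j] d_par[of i] d_par[of j]
    by auto
qed

lemma sub_children:
  assumes "x \<in> sub p" "x \<noteq> p" "p < n"
  shows "\<exists>i. 0 < i \<and> i < n \<and> par i = p \<and> p < i \<and> x \<in> sub i"
  using assms
proof (induction x rule: less_induct)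
  case (less x)
  have x: "x < n" using less.prems sub_less by auto
  have x0: "0 < x" and px: "par x \<in> sub p" using sub_par less.prems by auto
  have lt: "par x < x" using par_less x x0 by simp
  show ?case
  proof (cases "par x = p")
    case True
    then show ?thesis using x x0 lt by (intro exI[of _ x]) auto
  next
    case False
    then obtain i where i: "0 < i" "i < n" "par i = p" "p < i" "par x \<in> sub i"
      using less.IH[OF lt px] less.prems by auto
    then show ?thesis using par_sub[of x i] x x0 by (intro exI[of _ i]) auto
  qed
qed

lemma adjacent_iff: "x < n \<Longrightarrow> y < n \<Longrightarrow> d x y = 1 \<longleftrightarrow> (0 < x \<and> par x = y) \<or> (0 < y \<and> par y = x)"
proof -
  assume x: "x < n" and y: "y < n"
  have *: "par u = v" if "v < u" "u < n" "d u v = 1" for u v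
    using that d_max[of u v] d_eq_0[of "par u" v] par_less[of u] by auto
  show ?thesis
    using *[of x y] *[of y x] x y d_sym[of x y] d_par[of x] d_par[of y]
    by (cases x y rule: linorder_cases) auto
qed

text \<open>Supplies the descending steps from which actual paths in the graph are built, when
  \<open>tdist\<close> is identified with the graph distance.\<close>

lemma step_towards:
  assumes "x < n" "z < n" "x \<noteq> z"
  shows "\<exists>y<n. d x y = 1 \<and> d z x = Suc (d z y)"
proof (cases "z \<in> sub x")
  case True
  then obtain i where i: "0 < i" "i < n" "par i = x" "z \<in> sub i"
    using sub_children[of z x] assms by auto
  then show ?thesis using d_sub[of i z] d_par[of i] d_sym[of z x] d_sym[of z i] assms by auto
next
  case False
  then have x0: "0 < x" using assms by (cases "x = 0") auto
  then show ?thesis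
    using d_nsub[of x z] False assms d_par[of x] d_sym[of z x] d_sym[of z "par x"]
    by (intro exI[of _ "par x"]) auto
qed

section \<open>Points on tree paths\<close>

definition anc :: "nat \<Rightarrow> nat \<Rightarrow> nat" where
  "anc x k = (par ^^ k) x"

lemma anc_0 [simp]: "anc x 0 = x"
  by (simp add: anc_def)

lemma anc_Suc: "anc x (Suc k) = anc (par x) k" "anc x (Suc k) = par (anc x k)"
  by (simp_all add: anc_def funpow_swap1)

lemma anc_sub: "x < n \<Longrightarrow> k \<le> dep x \<Longrightarrow> anc x k < n \<and> x \<in> sub (anc x k) \<and> dep (anc x k) + k = dep x"
proof (induction k)
  case (Suc k)
  define c where "c = anc x k"
  have c: "c < n" "x \<in> sub c" "dep c + k = dep x" using Suc by (auto simp: c_def)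
  then have c0: "0 < c" using Suc.prems by (cases "c = 0") auto
  have "c \<in> sub (par c)" using c c0 sub_child[of c] by auto
  then show ?case
    using c c0 dep_par[of c] sub_mono[of c "par c" x] unfolding anc_Suc(2) c_def[symmetric] by auto
qed auto

text \<open>As long as the climb from \<open>x\<close> has not passed the lowest common ancestor,
  \<open>y\<close> is outside the subtree of the current vertex, so each step to the parent
  approaches \<open>y\<close>.\<close>

lemma anc_path:
  "x < n \<Longrightarrow> y < n \<Longrightarrow> k + ld x y \<le> dep x \<Longrightarrow> d x (anc x k) = k \<and> d (anc x k) y + k = d x y"
proof (induction k)
  case (Suc k)
  define c where "c = anc x k"
  have c: "c < n" "x \<in> sub c" "dep c + k = dep x" using anc_sub[of x k] Suc by (auto simp: c_def)
  then have c0: "0 < c" using Suc.prems by (cases "c = 0") auto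
  have "y \<notin> sub c" using sub_iff_ld[of c x y] c Suc.prems by auto
  then have "d c y = Suc (d (par c) y)" using d_nsub[of c y] c c0 Suc.prems by simp
  moreover have "d (par c) x = Suc (d c x)" using d_sub[of c x] c c0 by simp
  ultimately show ?case using Suc d_sym[of c x] d_sym[of "par c" x] c c0
    unfolding anc_Suc(2) c_def[symmetric] by auto
qed auto

text \<open>The vertex at distance \<open>k\<close> from \<open>x\<close> on the path to
  \<open>y\<close>. Up to the lowest common ancestor it is an ancestor of \<open>x\<close>,
  afterwards an ancestor of \<open>y\<close>; so a table of ancestors finds it in constant
  time.\<close>

definition point :: "nat \<Rightarrow> nat \<Rightarrow> nat \<Rightarrow> nat" where
  "point x y k = (if k + ld x y \<le> dep x then anc x k else anc y (d x y - k))"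

lemma point:
  assumes "x < n" "y < n" "k \<le> d x y"
  shows "point x y k < n" "d x (point x y k) = k" "d (point x y k) y + k = d x y"
proof -
  have "point x y k < n \<and> d x (point x y k) = k \<and> d (point x y k) y + k = d x y"
  proof (cases "k + ld x y \<le> dep x")
    case True
    then show ?thesis using anc_path[of x y k] anc_sub[of x k] assms by (simp add: point_def)
  next
    case False
    then have "d x y - k + ld y x \<le> dep y" using ld2[of x y] ld_sym[of x y] assms by auto
    moreover define c where "c = anc y (d x y - k)"
    ultimately have "c < n" "d y c = d x y - k" "d c x + (d x y - k) = d y x"
      using anc_path[of y x "d x y - k"] anc_sub[of y "d x y - k"] assms by auto
    moreover have "point x y k = c" using False by (simp add: point_def c_def)
    ultimately show ?thesis using assms d_sym[of x y] d_sym[of x c] d_sym[of y c] by auto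
  qed
  then show "point x y k < n" "d x (point x y k) = k" "d (point x y k) y + k = d x y" by auto
qed

text \<open>If \<open>c\<close> were below \<open>a\<close>, both halves of the path would cross the
  edge above \<open>a\<close>, and going through \<open>par a\<close> directly would be
  shorter.\<close>

lemma between_nsub:
  assumes "0 < a" "a < n" "x < n" "y < n" "x \<notin> sub a" "y \<notin> sub a" "c < n" "d x c + d c y = d x y"
  shows "c \<notin> sub a"
proof
  assume "c \<in> sub a"
  then have "d c x = Suc (d a c + d (par a) x)" "d c y = Suc (d a c + d (par a) y)"
    using d_cross assms by auto
  moreover have "d x y \<le> d (par a) x + d (par a) y"
    using d_tri[of x "par a" y] d_sym[of x "par a"] assms by simp
  ultimately show False using assms d_sym[of c x] by simp
qed

end

context ptree
begin

section \<open>Weighted point sets\<close>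

definition wdist :: "nat \<times> nat \<Rightarrow> nat \<times> nat \<Rightarrow> nat" where
  "wdist p q = d (fst p) (fst q) + snd p + snd q"

definition ecc :: "(nat \<times> nat) \<times> (nat \<times> nat) \<Rightarrow> nat \<Rightarrow> nat" where
  "ecc q v = max (d (fst (fst q)) v + snd (fst q)) (d (fst (snd q)) v + snd (snd q))"

definition wf_pts :: "(nat \<times> nat) set \<Rightarrow> bool" where
  "wf_pts X \<longleftrightarrow> (\<forall>p\<in>X. fst p < n \<and> snd p \<le> n)"

text \<open>A diametral pair of a set of weighted points. The empty set is encoded by
  the vertex \<open>n\<close>, which does not exist.\<close>
definition diam_pair :: "(nat \<times> nat) set \<Rightarrow> (nat \<times> nat) \<times> (nat \<times> nat) \<Rightarrow> bool" where
  "diam_pair X q \<longleftrightarrow> wf_pts X \<and>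
     (if X = {} then fst (fst q) = n \<and> fst (snd q) = n \<and> snd (fst q) \<le> n \<and> snd (snd q) \<le> n
      else fst q \<in> X \<and> snd q \<in> X \<and> (\<forall>r\<in>X. \<forall>s\<in>X. wdist r s \<le> wdist (fst q) (snd q)))"

lemma wdist_sym: "fst p < n \<Longrightarrow> fst q < n \<Longrightarrow> wdist p q = wdist q p"
  unfolding wdist_def using d_sym[of "fst p" "fst q"] by simp

text \<open>The four-point condition for \<open>p\<close>, \<open>q\<close>, \<open>r\<close>,
  \<open>v\<close>, where the maximality of the pair bounds the distances from \<open>r\<close> to
  \<open>p\<close> and to \<open>q\<close>. It shows that two extreme points determine all
  eccentricities.\<close>

lemma wdist_le_max:
  assumes "wf_pts X" "p \<in> X" "q \<in> X" "\<forall>r\<in>X. \<forall>s\<in>X. wdist r s \<le> wdist p q" "r \<in> X" "v < n"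
  shows "d (fst r) v + snd r \<le> max (d (fst p) v + snd p) (d (fst q) v + snd q)"
proof -
  have lt: "fst p < n" "fst q < n" "fst r < n" using assms by (auto simp: wf_pts_def)
  have "d (fst p) (fst q) + d (fst r) v \<le>
      max (d (fst p) (fst r) + d (fst q) v) (d (fst p) v + d (fst q) (fst r))"
    using four_point[of "fst p" "fst q" "fst r" v] lt assms by simp
  moreover have "wdist p r \<le> wdist p q" "wdist q r \<le> wdist p q"
    using assms by auto
  ultimately show ?thesis unfolding wdist_def by auto
qed

lemma ecc_ge: "diam_pair X q \<Longrightarrow> r \<in> X \<Longrightarrow> v < n \<Longrightarrow> d (fst r) v + snd r \<le> ecc q v"
  using wdist_le_max[of X "fst q" "snd q" r v] unfolding diam_pair_def ecc_def
  by (metis empty_iff)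

lemma diam_pair_in: "diam_pair X q \<Longrightarrow> X \<noteq> {} \<Longrightarrow> fst q \<in> X \<and> snd q \<in> X"
  by (simp add: diam_pair_def)

lemma diam_pair_empty_iff: "diam_pair X q \<Longrightarrow> fst (fst q) = n \<longleftrightarrow> X = {}"
  "diam_pair X q \<Longrightarrow> fst (snd q) = n \<longleftrightarrow> X = {}"
  by (auto simp: diam_pair_def wf_pts_def split: if_splits)

lemma diam_pair_bounds:
  assumes "diam_pair X q"
  shows "fst (fst q) \<le> n" "fst (snd q) \<le> n" "snd (fst q) \<le> n" "snd (snd q) \<le> n"
  using assms by (auto simp: diam_pair_def wf_pts_def less_imp_le split: if_splits)

text \<open>Ties keep the older points. \<open>2 * snd r\<close> is the weighted distance from
  \<open>r\<close> to itself; it competes because both members of a diametral pair may be the same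
  point.\<close>

definition ins :: "nat \<times> nat \<Rightarrow> (nat \<times> nat) \<times> (nat \<times> nat) \<Rightarrow> (nat \<times> nat) \<times> (nat \<times> nat)" where
  "ins r q =
     (if fst r = n then q
      else if fst (fst q) = n then (r, r)
      else if wdist (fst q) r \<le> wdist (fst q) (snd q) \<and> wdist (snd q) r \<le> wdist (fst q) (snd q)
        \<and> 2 * snd r \<le> wdist (fst q) (snd q) then q
      else if wdist (snd q) r \<le> wdist (fst q) r \<and> 2 * snd r \<le> wdist (fst q) r then (fst q, r)
      else if 2 * snd r \<le> wdist (snd q) r then (r, snd q)
      else (r, r))"

text \<open>By \<open>wdist_le_max\<close> no old point is farther from \<open>r\<close> than one of
  the two old extremes, so the new diameter is attained by the old pair, by \<open>r\<close> with
  one of its members, or by \<open>r\<close> with itself.\<close>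

lemma diam_pair_ins:
  assumes q: "diam_pair X q" and r: "fst r < n" "snd r \<le> n"
  shows "diam_pair (insert r X) (ins r q)"
proof (cases "X = {}")
  case True
  then show ?thesis using q r by (auto simp: diam_pair_def ins_def wf_pts_def)
next
  case False
  define a where "a = fst q"
  define b where "b = snd q"
  have ab: "a \<in> X" "b \<in> X" and mx: "\<forall>r\<in>X. \<forall>s\<in>X. wdist r s \<le> wdist a b" and wf: "wf_pts X"
    using q False by (auto simp: diam_pair_def a_def b_def)
  have lt: "fst a < n" "fst b < n" using ab wf by (auto simp: wf_pts_def)
  define m where "m = max (max (wdist a b) (wdist r r)) (max (wdist a r) (wdist b r))"
  have rr: "wdist r r = 2 * snd r" by (simp add: wdist_def)
  have "d (fst x) (fst r) + snd x \<le> max (d (fst a) (fst r) + snd a) (d (fst b) (fst r) + snd b)"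
    if "x \<in> X" for x
    using wdist_le_max[OF wf ab mx that r(1)] .
  then have xr: "wdist x r \<le> m" if "x \<in> X" for x
    using that by (fastforce simp: wdist_def m_def)
  have ltX: "fst x < n" if "x \<in> X" for x using that wf by (auto simp: wf_pts_def)
  have *: "\<forall>x\<in>insert r X. \<forall>y\<in>insert r X. wdist x y \<le> m"
  proof (intro ballI)
    fix x y assume xy: "x \<in> insert r X" "y \<in> insert r X"
    have "wdist r r \<le> m" "wdist a b \<le> m" by (auto simp: m_def)
    then show "wdist x y \<le> m"
      using xy xr mx wdist_sym[of r y] ltX[of y] r by (metis insert_iff order_trans)
  qed
  have ne: "fst a \<noteq> n" "fst r \<noteq> n" using lt r by auto
  have "wdist (fst (ins r q)) (snd (ins r q)) = m"
    using ne wdist_sym[of b r] lt r by (auto simp: ins_def a_def[symmetric] b_def[symmetric] m_def rr)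
  moreover have "fst (ins r q) \<in> insert r X" "snd (ins r q) \<in> insert r X"
    using ab by (auto simp: ins_def a_def[symmetric] b_def[symmetric])
  ultimately show ?thesis
    using * wf r unfolding diam_pair_def by (auto simp: wf_pts_def)
qed

text \<open>Points of \<open>Y\<close> are dominated in eccentricity by \<open>p\<close> and
  \<open>q\<close>, and these by \<open>z\<close>. Using this domination for both arguments of
  \<open>wdist\<close> shows that inserting just \<open>p\<close> and \<open>q\<close> has the
  effect of inserting all of \<open>Y\<close>.\<close>

lemma diam_pair_absorb:
  assumes Y: "diam_pair Y (p, q)" "Y \<noteq> {}" and X: "diam_pair (insert p (insert q X)) z"
  shows "diam_pair (X \<union> Y) z"
proof -
  let ?Z = "insert p (insert q X)"
  have z: "fst z \<in> ?Z" "snd z \<in> ?Z" "\<forall>r\<in>?Z. \<forall>s\<in>?Z. wdist r s \<le> wdist (fst z) (snd z)"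
    "wf_pts ?Z" using X by (auto simp: diam_pair_def)
  have pq: "p \<in> Y" "q \<in> Y" "wf_pts Y" using Y by (auto simp: diam_pair_def)
  have lt: "fst x < n" if "x \<in> X \<union> Y" for x using that pq z by (auto simp: wf_pts_def)
  have dom: "\<forall>v<n. d (fst r) v + snd r \<le> ecc z v" if "r \<in> X \<union> Y" for r
    using that
  proof
    assume "r \<in> X"
    then show ?thesis using ecc_ge[OF X, of r] by auto
  next
    assume "r \<in> Y"
    then have "d (fst r) v + snd r \<le> ecc (p, q) v" if "v < n" for v
      using ecc_ge[OF Y(1)] that by auto
    moreover have "ecc (p, q) v \<le> ecc z v" if "v < n" for v
      using ecc_ge[OF X, of p v] ecc_ge[OF X, of q v] that by (auto simp: ecc_def)
    ultimately show ?thesis using order_trans by blast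
  qed
  have lz: "fst (fst z) < n" "fst (snd z) < n" using z by (auto simp: wf_pts_def)
  have "wdist r s \<le> wdist (fst z) (snd z)" if rs: "r \<in> X \<union> Y" "s \<in> X \<union> Y" for r s
  proof -
    have 1: "d (fst x) v + snd x \<le> ecc z v" if "x \<in> X \<union> Y" "v < n" for x v using dom that by blast
    have zz: "wdist x y \<le> wdist (fst z) (snd z)" if "x \<in> {fst z, snd z}" "y \<in> {fst z, snd z}" for x y
      using z that by auto
    have "wdist x s \<le> wdist (fst z) (snd z)" if "x \<in> {fst z, snd z}" for x
    proof -
      have "d (fst s) (fst x) + snd s \<le> ecc z (fst x)" using 1[of s "fst x"] rs lz that by auto
      moreover have "wdist x s = wdist s x" using wdist_sym[of x s] lz lt rs that by auto
      ultimately show ?thesis using zz[of "fst z" x] zz[of "snd z" x] that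
        by (auto simp: ecc_def wdist_def)
    qed
    then have "wdist (fst z) s \<le> wdist (fst z) (snd z)" "wdist (snd z) s \<le> wdist (fst z) (snd z)"
      by auto
    then show ?thesis using 1[of r "fst s"] rs lt by (auto simp: ecc_def wdist_def)
  qed
  moreover have "fst z \<in> X \<union> Y" "snd z \<in> X \<union> Y" using z pq by auto
  moreover have "wf_pts (X \<union> Y)" using z pq by (auto simp: wf_pts_def)
  ultimately show ?thesis using Y by (auto simp: diam_pair_def)
qed

text \<open>When the reference vertex moves one edge away from all sources, every weight grows by
  one.\<close>

definition shift :: "nat \<Rightarrow> (nat \<times> nat) set \<Rightarrow> (nat \<times> nat) set" where
  "shift c X = (\<lambda>p. (fst p, snd p + c)) ` X"

definition shift_pt :: "nat \<Rightarrow> nat \<times> nat \<Rightarrow> nat \<times> nat" where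
  "shift_pt c p = (fst p, snd p + c)"

lemma diam_pair_shift:
  assumes "diam_pair X (p, q)" "wf_pts (shift c X)" "X \<noteq> {}"
  shows "diam_pair (shift c X) (shift_pt c p, shift_pt c q)"
proof -
  have w: "wdist (shift_pt c r) (shift_pt c s) = wdist r s + 2 * c" for r s
    by (simp add: wdist_def shift_pt_def)
  have sh: "shift c X = shift_pt c ` X" by (simp add: shift_def shift_pt_def[abs_def])
  show ?thesis
    using assms unfolding diam_pair_def sh by (simp add: w)
qed

lemma diam_pair_join:
  assumes X: "diam_pair X z" and Y: "diam_pair Y (p, q)" and wf: "wf_pts (shift c Y)"
  shows "diam_pair (X \<union> shift c Y) (ins (shift_pt c q) (ins (shift_pt c p) z))"
proof (cases "Y = {}")
  case True
  then have "fst p = n" "fst q = n" using Y by (auto simp: diam_pair_def)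
  then show ?thesis using True X by (auto simp: ins_def shift_pt_def shift_def)
next
  case False
  have Y': "diam_pair (shift c Y) (shift_pt c p, shift_pt c q)" "shift c Y \<noteq> {}"
    using diam_pair_shift[OF Y wf False] False by (auto simp: shift_def)
  have "shift_pt c p \<in> shift c Y" "shift_pt c q \<in> shift c Y"
    using diam_pair_in[OF Y'(1) Y'(2)] by auto
  then have b: "fst (shift_pt c p) < n" "snd (shift_pt c p) \<le> n" "fst (shift_pt c q) < n" "snd (shift_pt c q) \<le> n"
    using wf by (auto simp: wf_pts_def)
  have "diam_pair (insert (shift_pt c q) (insert (shift_pt c p) X))
      (ins (shift_pt c q) (ins (shift_pt c p) z))"
    by (intro diam_pair_ins X b)
  then show ?thesis by (intro diam_pair_absorb[OF Y']) (simp add: insert_commute)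
qed

section \<open>Centres\<close>

text \<open>The point that balances \<open>d y1 c + w1\<close> against \<open>d c y2 + w2\<close>,
  rounded down for \<open>c = 0\<close> and up for \<open>c = 1\<close>.\<close>

definition centre :: "(nat \<times> nat) \<times> (nat \<times> nat) \<Rightarrow> nat \<Rightarrow> nat" where
  "centre q c = (let (y1, w1) = fst q; (y2, w2) = snd q in point y1 y2 ((d y1 y2 + w2 + c - w1) div 2))"

text \<open>The midpoint of the path between the two points may be the middle of an edge; then the
  two endpoints of that edge together play the role of the centre.\<close>
lemma centre:
  assumes q: "diam_pair X q" and X: "X \<noteq> {}"
  shows "\<exists>R. \<forall>v<n. ecc q v = min (d (centre q 0) v) (d (centre q 1) v) + R"
    and "\<And>c. c \<le> 1 \<Longrightarrow> centre q c < n"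
    and "\<And>c. c \<le> 1 \<Longrightarrow> d (fst (fst q)) (centre q c) + d (centre q c) (fst (snd q)) = d (fst (fst q)) (fst (snd q))"
proof -
  obtain y1 w1 y2 w2 where q': "q = ((y1, w1), (y2, w2))" by (metis surj_pair)
  have y: "y1 < n" "y2 < n" using diam_pair_in[OF q X] q by (auto simp: diam_pair_def wf_pts_def q')
  \<comment> \<open>Comparing the diameter with the degenerate pairs shows that neither weight
    exceeds the other by more than the distance; so the balancing point lies on the path and no
    subtraction is truncated.\<close>
  have "wdist (y1, w1) (y1, w1) \<le> wdist (y1, w1) (y2, w2)" "wdist (y2, w2) (y2, w2) \<le> wdist (y1, w1) (y2, w2)"
    using q X unfolding diam_pair_def q' by force+
  then have w: "w1 \<le> d y1 y2 + w2" "w2 \<le> d y1 y2 + w1" by (auto simp: wdist_def)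
  define k where "k c = (d y1 y2 + w2 + c - w1) div 2" for c
  have k: "k c \<le> d y1 y2" if "c \<le> 1" for c using w that by (auto simp: k_def)
  have c: "centre q c = point y1 y2 (k c)" for c by (simp add: centre_def q' k_def)
  show lt: "centre q c < n" if "c \<le> 1" for c using point[of y1 y2 "k c"] k that y by (simp add: c)
  have dc: "d y1 (centre q c) = k c" "d (centre q c) y2 + k c = d y1 y2" if "c \<le> 1" for c
    using point[of y1 y2 "k c"] k that y by (simp_all add: c)
  show "d (fst (fst q)) (centre q c) + d (centre q c) (fst (snd q)) = d (fst (fst q)) (fst (snd q))"
    if "c \<le> 1" for c using dc[OF that] by (simp add: q')
  define e where "e = d y1 y2 + w2 - w1"
  have e: "d y1 y2 + w2 = w1 + e" using w by (simp add: e_def)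
  have ke: "k 0 = e div 2" "k 1 = Suc e div 2" using e by (auto simp: k_def)
  define R where "R = k 1 + w1"
  have "e = k 0 + k 1" unfolding ke by presburger
  then have k1: "k 1 + w1 = R" and k0: "d y1 y2 - k 0 + w2 = R" "k 0 \<le> d y1 y2"
    using e k[of 0] by (auto simp: R_def)
  have k01: "k 1 = k 0 \<or> k 1 = Suc (k 0)" unfolding ke by presburger
  have "ecc q v = min (d (centre q 0) v) (d (centre q 1) v) + R" if v: "v < n" for v
  proof -
    define c0 where "c0 = centre q 0"
    define c1 where "c1 = centre q 1"
    have l: "c0 < n" "c1 < n" using lt by (auto simp: c0_def c1_def)
    have D: "d y1 c0 = k 0" "d c0 y2 + k 0 = d y1 y2" "d y1 c1 = k 1" "d c1 y2 + k 1 = d y1 y2"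
      using dc[of 0] dc[of 1] by (auto simp: c0_def c1_def)
    have sy: "d y2 c0 = d c0 y2" "d y2 c1 = d c1 y2" "d y1 v = d v y1" "d y2 v = d v y2"
      "d c0 v = d v c0" "d c1 v = d v c1"
      using d_sym l y v by auto
    have e: "ecc q v = max (d y1 v + w1) (d y2 v + w2)" by (simp add: ecc_def q')
    have t: "d y1 v \<le> k 0 + d c0 v" "d y2 v \<le> d c0 y2 + d c0 v" "d y1 v \<le> k 1 + d c1 v"
      "d y2 v \<le> d c1 y2 + d c1 v"
      using d_tri[of y1 c0 v] d_tri[of y2 c0 v] d_tri[of y1 c1 v] d_tri[of y2 c1 v] D(1,3) sy(1,2) l y v
      by simp_all
    have k': "k 0 + w1 \<le> R" "d c0 y2 + w2 = R" "k 1 + w1 = R" "d c1 y2 + w2 \<le> R"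
      using k0 k1 k01 D(2,4) by linarith+
    have up: "ecc q v \<le> d c0 v + R" "ecc q v \<le> d c1 v + R"
      unfolding e max.bounded_iff using t k' by linarith+
    have f0: "d y1 y2 + d c0 v \<le> k 0 + d y2 v \<or> d y1 y2 + d c0 v \<le> d y1 v + d c0 y2"
      using four_point[of y1 y2 c0 v] y l v D(1) sy(1) by (simp add: le_max_iff_disj)
    have f1: "d y1 y2 + d c1 v \<le> k 1 + d y2 v \<or> d y1 y2 + d c1 v \<le> d y1 v + d c1 y2"
      using four_point[of y1 y2 c1 v] y l v D(3) sy(2) by (simp add: le_max_iff_disj)
    have "d c0 v + R \<le> d y1 v + w1 \<or> d c0 v + R \<le> d y2 v + w2 \<or>
      d c1 v + R \<le> d y1 v + w1 \<or> d c1 v + R \<le> d y2 v + w2"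
    proof (cases "k 1 = k 0")
      case True
      then show ?thesis using f0 D(2) k' by linarith
    next
      case False
      then have k01: "k 1 = Suc (k 0)" using k01 by simp
      \<comment> \<open>If all four alternatives failed, both bounds would be off by one and force
        \<open>d c0 v = d c1 v\<close>. Parity excludes this for neighbouring centres.\<close>
      have "odd (d y1 c0 + d y1 c1)" using D(1,3) k01 by simp
      then have "d c0 v \<noteq> d c1 v"
        using d_parity[of y1 c0] d_parity[of y1 c1] d_parity[of c0 v] d_parity[of c1 v] l y v
        by (metis even_add)
      then show ?thesis using f0 f1 D(2,4) k' k01 by linarith
    qed
    then have "min (d c0 v) (d c1 v) + R \<le> ecc q v" unfolding e by (auto simp: min_def max_def)
    then show ?thesis using up by (auto simp: c0_def c1_def)
  qed
  then show "\<exists>R. \<forall>v<n. ecc q v = min (d (centre q 0) v) (d (centre q 1) v) + R" by blast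
qed

section \<open>Nearest points\<close>

text \<open>\<open>2 * n\<close> exceeds every distance in the tree, so a comparison never prefers
  the missing vertex to an existing one.\<close>

definition dt :: "nat \<Rightarrow> nat \<Rightarrow> nat" where
  "dt x v = (if v = n then 2 * n else d x v)"

text \<open>The vertex \<open>n\<close> again stands for \<^emph>\<open>none\<close>.\<close>
definition nearest :: "nat \<Rightarrow> nat set \<Rightarrow> nat \<Rightarrow> bool" where
  "nearest c X v \<longleftrightarrow> X \<subseteq> {..<n} \<and> (if X = {} then v = n else v \<in> X \<and> (\<forall>x\<in>X. d c v \<le> d c x))"

lemma nearest_union:
  assumes "c < n" "nearest c X v" "nearest c Y w"
  shows "nearest c (X \<union> Y) (if dt c w < dt c v then w else v)"
proof -
  have "d c x < 2 * n" if "x < n" for x using d_lt_n[of c x] assms that by simp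
  then have lt: "dt c x = d c x" "dt c x < 2 * n" "x \<noteq> n" if "x < n" for x
    using that by (auto simp: dt_def)
  have n: "dt c n = 2 * n" by (simp add: dt_def)
  have X: "X \<subseteq> {..<n}" "Y \<subseteq> {..<n}" using assms by (auto simp: nearest_def)
  consider "X = {}" "Y = {}" | "X = {}" "Y \<noteq> {}" | "X \<noteq> {}" "Y = {}" | "X \<noteq> {}" "Y \<noteq> {}"
    by blast
  then show ?thesis
  proof cases
    case 4
    then have "v \<in> X" "\<forall>x\<in>X. d c v \<le> d c x" "w \<in> Y" "\<forall>x\<in>Y. d c w \<le> d c x"
      using assms by (auto simp: nearest_def)
    moreover from this X have "dt c v = d c v" "dt c w = d c w" using lt by auto
    ultimately show ?thesis using X 4 by (auto simp: nearest_def)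
  next
    case 2
    then have "v = n" "w < n" using assms X by (auto simp: nearest_def)
    then show ?thesis using 2 assms n lt[of w] by simp
  next
    case 3
    then have "w = n" "v < n" using assms X by (auto simp: nearest_def)
    then show ?thesis using 3 assms n lt[of v] by simp
  next
    case 1
    then show ?thesis using assms by (simp add: nearest_def)
  qed
qed

lemma nearest_shift:
  assumes "nearest c X v" "\<And>x. x \<in> X \<Longrightarrow> d c' x = Suc (d c x)"
  shows "nearest c' X v"
  using assms by (auto simp: nearest_def split: if_splits)

lemma nearest_le: "nearest c X v \<Longrightarrow> v \<le> n"
  by (auto simp: nearest_def less_imp_le split: if_splits)

end

section \<open>Verification of RAM programs\<close>

fun ev :: "ram_state \<Rightarrow> exp \<Rightarrow> nat" where
  "ev s (Const k) = k"
| "ev s (Reg x) = reg s x"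
| "ev s (Read a e) = arr s a (ev s e)"
| "ev s (Binop b e1 e2) = binop_val b (ev s e1) (ev s e2)"

text \<open>Only constants, sums and products can leave the word range: differences, quotients and
  remainders do not exceed their first operand, and comparisons yield 0 or 1.\<close>

fun ok :: "nat \<Rightarrow> nat \<Rightarrow> ram_state \<Rightarrow> exp \<Rightarrow> bool" where
  "ok W L s (Const k) \<longleftrightarrow> k < W"
| "ok W L s (Reg x) \<longleftrightarrow> True"
| "ok W L s (Read a e) \<longleftrightarrow> ok W L s e \<and> ev s e < L"
| "ok W L s (Binop b e1 e2) \<longleftrightarrow> ok W L s e1 \<and> ok W L s e2 \<and>
     (b = Add \<longrightarrow> ev s e1 + ev s e2 < W) \<and> (b = Mul \<longrightarrow> ev s e1 * ev s e2 < W)"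

text \<open>All words of a reachable state are below \<open>W\<close>, so that reading a word never gets stuck.\<close>
definition bnd :: "nat \<Rightarrow> ram_state \<Rightarrow> bool" where
  "bnd W s \<longleftrightarrow> 1 < W \<and> (\<forall>x. reg s x < W) \<and> (\<forall>a i. arr s a i < W)"

lemma eval_lt: "eval W L s e v \<Longrightarrow> v < W"
  by (induction rule: eval.induct) auto

lemma eval_ev: "bnd W s \<Longrightarrow> ok W L s e \<Longrightarrow> eval W L s e (ev s e)"
proof (induction e)
  case (Binop b e1 e2)
  then have 1: "eval W L s e1 (ev s e1)" "eval W L s e2 (ev s e2)" by auto
  then have "ev s e1 < W" "ev s e2 < W" by (auto dest: eval_lt)
  moreover have "x div y < W" "x mod y < W" if "x < W" for x y :: nat
    using that by (meson div_le_dividend mod_less_eq_dividend order_le_less_trans)+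
  ultimately have "binop_val b (ev s e1) (ev s e2) < W"
    using Binop.prems by (cases b) (auto simp: bnd_def)
  then show ?case using 1 by (auto intro: eval.intros)
qed (auto intro: eval.intros simp: bnd_def)

lemma run_bnd: "run W L c s t s' \<Longrightarrow> bnd W s \<Longrightarrow> bnd W s'"
  by (induction rule: run.induct) (auto simp: bnd_def dest: eval_lt)

text \<open>Syntactic sets of written registers and, in \<open>wra\<close>, written arrays. The
  frame condition \<open>fr\<close> built from them spares the invariants everything that a program
  leaves alone.\<close>

fun wrr :: "com \<Rightarrow> nat set" where
  "wrr Skip = {}"
| "wrr (Assign x e) = {x}"
| "wrr (Write a e1 e2) = {}"
| "wrr (Seq c1 c2) = wrr c1 \<union> wrr c2"
| "wrr (If b c1 c2) = wrr c1 \<union> wrr c2"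
| "wrr (While b c) = wrr c"

fun wra :: "com \<Rightarrow> nat set" where
  "wra Skip = {}"
| "wra (Assign x e) = {}"
| "wra (Write a e1 e2) = {a}"
| "wra (Seq c1 c2) = wra c1 \<union> wra c2"
| "wra (If b c1 c2) = wra c1 \<union> wra c2"
| "wra (While b c) = wra c"

definition fr :: "com \<Rightarrow> ram_state \<Rightarrow> ram_state \<Rightarrow> bool" where
  "fr c s s' \<longleftrightarrow> (\<forall>x. x \<notin> wrr c \<longrightarrow> reg s' x = reg s x) \<and> (\<forall>a. a \<notin> wra c \<longrightarrow> arr s' a = arr s a)"

lemma run_fr: "run W L c s t s' \<Longrightarrow> fr c s s'"
  by (induction rule: run.induct) (auto simp: fr_def)

text \<open>Total correctness with the time bound \<open>T\<close>. The premise \<open>bnd\<close>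
  is preserved by every run, so it is assumed once and never part of a postcondition.\<close>

definition wp :: "nat \<Rightarrow> nat \<Rightarrow> com \<Rightarrow> nat \<Rightarrow> (ram_state \<Rightarrow> bool) \<Rightarrow> ram_state \<Rightarrow> bool" where
  "wp W L c T Q s \<longleftrightarrow> (bnd W s \<longrightarrow> (\<exists>t s'. run W L c s t s' \<and> t \<le> T \<and> Q s'))"

lemma wp_mono:
  assumes "wp W L c T Q s" "T \<le> T'" "\<And>s'. bnd W s' \<Longrightarrow> fr c s s' \<Longrightarrow> Q s' \<Longrightarrow> Q' s'"
  shows "wp W L c T' Q' s"
  using assms unfolding wp_def by (meson order_trans run_bnd run_fr)

lemma wp_seq:
  assumes "wp W L c1 T1 (\<lambda>s1. wp W L c2 T2 Q s1) s"
  shows "wp W L (Seq c1 c2) (T1 + T2) Q s"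
  unfolding wp_def
proof
  assume b: "bnd W s"
  then obtain t1 s1 where 1: "run W L c1 s t1 s1" "t1 \<le> T1" "wp W L c2 T2 Q s1"
    using assms by (auto simp: wp_def)
  then obtain t2 s2 where 2: "run W L c2 s1 t2 s2" "t2 \<le> T2" "Q s2"
    using run_bnd[OF 1(1) b] by (auto simp: wp_def)
  then show "\<exists>t s'. run W L (Seq c1 c2) s t s' \<and> t \<le> T1 + T2 \<and> Q s'"
    using run.Seq[OF 1(1) 2(1)] 1(2) by (metis add_mono)
qed

lemma wp_bnd: "(bnd W s \<Longrightarrow> wp W L c T Q s) \<Longrightarrow> wp W L c T Q s"
  by (simp add: wp_def)

text \<open>Symbolic execution of loop-free code; loops are handled by separate rules.\<close>

fun vc :: "nat \<Rightarrow> nat \<Rightarrow> com \<Rightarrow> (ram_state \<Rightarrow> bool) \<Rightarrow> ram_state \<Rightarrow> bool" where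
  "vc W L Skip Q s \<longleftrightarrow> Q s"
| "vc W L (Assign x e) Q s \<longleftrightarrow> ok W L s e \<and> Q (s\<lparr>reg := (reg s)(x := ev s e)\<rparr>)"
| "vc W L (Write a e1 e2) Q s \<longleftrightarrow> ok W L s e1 \<and> ok W L s e2 \<and> ev s e1 < L \<and>
     Q (s\<lparr>arr := (arr s)(a := (arr s a)(ev s e1 := ev s e2))\<rparr>)"
| "vc W L (Seq c1 c2) Q s \<longleftrightarrow> vc W L c1 (vc W L c2 Q) s"
| "vc W L (If b c1 c2) Q s \<longleftrightarrow> ok W L s b \<and> (if ev s b \<noteq> 0 then vc W L c1 Q s else vc W L c2 Q s)"
| "vc W L (While b c) Q s \<longleftrightarrow> False"

text \<open>Only an upper bound is wanted, so a conditional is charged for both branches and the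
  bound does not depend on the state.\<close>

fun cst :: "com \<Rightarrow> nat" where
  "cst Skip = 1"
| "cst (Assign x e) = 1 + exp_cost e"
| "cst (Write a e1 e2) = 1 + exp_cost e1 + exp_cost e2"
| "cst (Seq c1 c2) = cst c1 + cst c2"
| "cst (If b c1 c2) = 1 + exp_cost b + (cst c1 + cst c2)"
| "cst (While b c) = 0"

lemma vc_wp: "vc W L c Q s \<Longrightarrow> wp W L c (cst c) Q s"
proof (induction c arbitrary: Q s)
  case Skip
  then show ?case using run.Skip by (auto simp: wp_def intro!: exI)
next
  case (Assign x e)
  then show ?case unfolding wp_def by (auto intro!: exI run.Assign eval_ev)
next
  case (Write a e1 e2)
  then show ?case unfolding wp_def by (auto intro!: exI run.Write eval_ev)
next
  case (Seq c1 c2)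
  then have "wp W L c1 (cst c1) (vc W L c2 Q) s" by simp
  then have "wp W L c1 (cst c1) (\<lambda>s1. wp W L c2 (cst c2) Q s1) s"
    by (rule wp_mono) (auto intro: Seq.IH)
  then show ?case using wp_seq by fastforce
next
  case (If b c1 c2)
  show ?case unfolding wp_def
  proof
    assume bs: "bnd W s"
    have e: "eval W L s b (ev s b)" using If.prems bs by (auto intro: eval_ev)
    show "\<exists>t s'. run W L (If b c1 c2) s t s' \<and> t \<le> cst (If b c1 c2) \<and> Q s'"
    proof (cases "ev s b = 0")
      case True
      then obtain t s' where r: "run W L c2 s t s'" "t \<le> cst c2" "Q s'"
        using If.IH(2)[of Q s] If.prems bs by (auto simp: wp_def)
      have "run W L (If b c1 c2) s (1 + exp_cost b + t) s'" using run.IfFalse[of W L s b c2 t s' c1] e True r by simp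
      then show ?thesis using r by (intro exI conjI) auto
    next
      case False
      then obtain t s' where r: "run W L c1 s t s'" "t \<le> cst c1" "Q s'"
        using If.IH(1)[of Q s] If.prems bs by (auto simp: wp_def)
      have "run W L (If b c1 c2) s (1 + exp_cost b + t) s'" using run.IfTrue[OF e False r(1)] .
      then show ?thesis using r by (intro exI conjI) auto
    qed
  qed
qed simp

lemma vc_mono:
  "vc W L c Q s \<Longrightarrow> (\<And>s'. fr c s s' \<Longrightarrow> Q s' \<Longrightarrow> Q' s') \<Longrightarrow> vc W L c Q' s"
proof (induction c arbitrary: Q Q' s)
  case (Seq c1 c2)
  have "vc W L c1 (vc W L c2 Q) s" using Seq.prems by simp
  then have "vc W L c1 (vc W L c2 Q') s"
  proof (rule Seq.IH(1))
    fix s1 assume 1: "fr c1 s s1" "vc W L c2 Q s1"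
    show "vc W L c2 Q' s1"
      by (rule Seq.IH(2)[OF 1(2)], rule Seq.prems(2)) (use 1(1) in \<open>auto simp: fr_def\<close>)
  qed
  then show ?case by simp
next
  case (If b c1 c2)
  show ?case
    using If.prems If.IH(1)[of Q s Q'] If.IH(2)[of Q s Q'] by (auto simp: fr_def split: if_splits)
qed (auto simp: fr_def)

text \<open>Each iteration may use that the state differs from the initial one only in what the body
  writes; \<open>m\<close> bounds the number of remaining iterations.\<close>

lemma wp_while:
  assumes I: "I s"
    and cond: "\<And>s'. I s' \<Longrightarrow> fr c s s' \<Longrightarrow> ok W L s' b"
    and body: "\<And>s'. I s' \<Longrightarrow> fr c s s' \<Longrightarrow> bnd W s' \<Longrightarrow> ev s' b \<noteq> 0 \<Longrightarrow>
      wp W L c T (\<lambda>s''. I s'' \<and> m s'' < m s') s'"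
  shows "wp W L (While b c) (m s * (T + exp_cost b + 1) + (exp_cost b + 1)) (\<lambda>s'. I s' \<and> ev s' b = 0) s"
proof -
  have "\<exists>t s''. run W L (While b c) s' t s'' \<and> t \<le> m s' * (T + exp_cost b + 1) + (exp_cost b + 1)
      \<and> I s'' \<and> ev s'' b = 0" if "I s'" "fr c s s'" "bnd W s'" for s'
    using that
  proof (induction "m s'" arbitrary: s' rule: less_induct)
    case less
    have e: "eval W L s' b (ev s' b)" using eval_ev less.prems cond by blast
    show ?case
    proof (cases "ev s' b = 0")
      case True
      then have "run W L (While b c) s' (1 + exp_cost b) s'" using run.WhileFalse[of W L s' b c] e by simp
      then show ?thesis using True less.prems by (intro exI conjI) auto
    next
      case False
      obtain t1 s1 where 1: "run W L c s' t1 s1" "t1 \<le> T" "I s1" "m s1 < m s'"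
        using body[OF less.prems False] less.prems by (auto simp: wp_def)
      have f: "fr c s s1" using run_fr[OF 1(1)] less.prems by (auto simp: fr_def)
      obtain t2 s2 where 2: "run W L (While b c) s1 t2 s2" "I s2" "ev s2 b = 0"
        "t2 \<le> m s1 * (T + exp_cost b + 1) + (exp_cost b + 1)"
        using less.hyps[OF 1(4) 1(3) f run_bnd[OF 1(1)]] less.prems by auto
      have "(m s1 + 1) * (T + exp_cost b + 1) \<le> m s' * (T + exp_cost b + 1)"
        using 1(4) by (intro mult_right_mono) auto
      then have "1 + exp_cost b + t1 + t2 \<le> m s' * (T + exp_cost b + 1) + (exp_cost b + 1)"
        using 1 2 by simp
      then show ?thesis using run.WhileTrue[OF e False 1(1) 2(1)] 2 by blast
    qed
  qed
  then show ?thesis using I by (auto simp: wp_def fr_def)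
qed

definition For :: "nat \<Rightarrow> nat \<Rightarrow> com \<Rightarrow> com" where
  "For x b c = Seq (Assign x (Const 0)) (While (Binop Less (Reg x) (Reg b))
     (Seq c (Assign x (Binop Add (Reg x) (Const 1)))))"

lemma wrr_For [simp]: "wrr (For x b c) = insert x (wrr c)" "wra (For x b c) = wra c"
  by (auto simp: For_def)

text \<open>The increment comes after the body, so the body has to establish the invariant for the
  state with the counter already advanced. Per iteration 8 pays for test and increment; 6 pays for
  initialisation and last test.\<close>

lemma wp_For:
  assumes x: "x \<notin> wrr c" "b \<notin> wrr c" "x \<noteq> b" and N: "reg s b = N"
    and I0: "I 0 (s\<lparr>reg := (reg s)(x := 0)\<rparr>)"
    and step: "\<And>i s'. i < N \<Longrightarrow> fr (For x b c) s s' \<Longrightarrow> reg s' x = i \<Longrightarrow> reg s' b = N \<Longrightarrow>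
      bnd W s' \<Longrightarrow> I i s' \<Longrightarrow> wp W L c T (\<lambda>s''. I (Suc i) (s''\<lparr>reg := (reg s'')(x := Suc i)\<rparr>)) s'"
  shows "wp W L (For x b c) (N * (T + 8) + 6) (\<lambda>s'. I N s' \<and> reg s' x = N) s"
proof (rule wp_bnd)
  assume bs: "bnd W s"
  define s0 where "s0 = s\<lparr>reg := (reg s)(x := 0)\<rparr>"
  define J where "J s' \<longleftrightarrow> I (reg s' x) s' \<and> reg s' x \<le> N \<and> reg s' b = N \<and> fr (For x b c) s s'" for s'
  let ?c = "Seq c (Assign x (Binop Add (Reg x) (Const 1)))"
  have "wp W L (While (Binop Less (Reg x) (Reg b)) ?c) ((N - reg s0 x) * ((T + 4) + 3 + 1) + (3 + 1))
     (\<lambda>s'. J s' \<and> ev s' (Binop Less (Reg x) (Reg b)) = 0) s0"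
  proof (rule wp_mono[OF wp_while[where I = J and m = "\<lambda>s. N - reg s x" and T = "T + 4"]])
    show "J s0" using I0 x N by (auto simp: J_def s0_def fr_def)
  next
    fix s' assume J: "J s'" and b: "bnd W s'" and e: "ev s' (Binop Less (Reg x) (Reg b)) \<noteq> 0"
    from e have lt: "reg s' x < N" using J by (auto simp: J_def)
    \<comment> \<open>The bound of the loop is itself the content of a register, hence a word, so
      the increment cannot overflow.\<close>
    have W: "Suc (reg s' x) < W" "1 < W"
      using lt bs N unfolding bnd_def by (metis Suc_lessI less_trans not_less_eq)+
    have "wp W L c T (\<lambda>s''. I (Suc (reg s' x)) (s''\<lparr>reg := (reg s'')(x := Suc (reg s' x))\<rparr>)) s'"
      using step[of "reg s' x" s'] lt J b by (auto simp: J_def)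
    then have "wp W L c T (\<lambda>s1. wp W L (Assign x (Binop Add (Reg x) (Const 1))) 4
       (\<lambda>s''. J s'' \<and> N - reg s'' x < N - reg s' x) s1) s'"
    proof (rule wp_mono)
      fix s1 assume f: "fr c s' s1" and I: "I (Suc (reg s' x)) (s1\<lparr>reg := (reg s1)(x := Suc (reg s' x))\<rparr>)"
      have r: "reg s1 x = reg s' x" "reg s1 b = N" using f x J by (auto simp: fr_def J_def)
      have "vc W L (Assign x (Binop Add (Reg x) (Const 1))) (\<lambda>s''. J s'' \<and> N - reg s'' x < N - reg s' x) s1"
        using I r lt W x f J by (auto simp: J_def fr_def)
      from vc_wp[OF this] show "wp W L (Assign x (Binop Add (Reg x) (Const 1))) 4
         (\<lambda>s''. J s'' \<and> N - reg s'' x < N - reg s' x) s1" by (rule wp_mono) auto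
    qed simp
    then show "wp W L ?c (T + 4) (\<lambda>s''. J s'' \<and> N - reg s'' x < N - reg s' x) s'" by (rule wp_seq)
  qed auto
  then have w: "wp W L (While (Binop Less (Reg x) (Reg b)) ?c) (N * (T + 8) + 4)
     (\<lambda>s'. J s' \<and> ev s' (Binop Less (Reg x) (Reg b)) = 0) s0"
    by (rule wp_mono) (auto simp: s0_def)
  have "vc W L (Assign x (Const 0)) (wp W L (While (Binop Less (Reg x) (Reg b)) ?c)
     (N * (T + 8) + 4) (\<lambda>s'. J s' \<and> ev s' (Binop Less (Reg x) (Reg b)) = 0)) s"
    using bs w by (simp add: s0_def bnd_def del: binop_val.simps)
  from vc_wp[OF this] have "wp W L (Assign x (Const 0)) 2 (wp W L (While (Binop Less (Reg x) (Reg b)) ?c)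
     (N * (T + 8) + 4) (\<lambda>s'. J s' \<and> ev s' (Binop Less (Reg x) (Reg b)) = 0)) s"
    by (rule wp_mono) auto
  from wp_seq[OF this] show ?thesis
    unfolding For_def by (rule wp_mono) (auto simp: J_def)
qed

section \<open>Program notation and operations on stored diametral pairs\<close>

notation Seq (infixr \<open>;;\<close> 60)

abbreviation plus_exp :: "exp \<Rightarrow> exp \<Rightarrow> exp" (infixl \<open>.+\<close> 65) where "a .+ b \<equiv> Binop Add a b"
abbreviation minus_exp :: "exp \<Rightarrow> exp \<Rightarrow> exp" (infixl \<open>.-\<close> 65) where "a .- b \<equiv> Binop Sub a b"
abbreviation times_exp :: "exp \<Rightarrow> exp \<Rightarrow> exp" (infixl \<open>.*\<close> 70) where "a .* b \<equiv> Binop Mul a b"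
abbreviation div_exp :: "exp \<Rightarrow> exp \<Rightarrow> exp" (infixl \<open>.div\<close> 70) where "a .div b \<equiv> Binop Div a b"
abbreviation mod_exp :: "exp \<Rightarrow> exp \<Rightarrow> exp" (infixl \<open>.mod\<close> 70) where "a .mod b \<equiv> Binop Mod a b"
abbreviation less_exp :: "exp \<Rightarrow> exp \<Rightarrow> exp" (infix \<open>.<\<close> 50) where "a .< b \<equiv> Binop Less a b"
abbreviation eq_exp :: "exp \<Rightarrow> exp \<Rightarrow> exp" (infix \<open>.=\<close> 50) where "a .= b \<equiv> Binop Eq a b"

abbreviation assign :: "nat \<Rightarrow> exp \<Rightarrow> com" (infix \<open>::=\<close> 61) where "x ::= e \<equiv> Assign x e"

definition Ix :: "exp \<Rightarrow> exp \<Rightarrow> exp" where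
  "Ix a b = a .* Reg 2 .+ b"

lemma ev_Ix [simp]: "ev s (Ix a b) = ev s a * reg s 2 + ev s b"
  by (simp add: Ix_def)

lemma index_eq: "y < S \<Longrightarrow> y' < S \<Longrightarrow> x * S + y = x' * S + y' \<longleftrightarrow> x = x' \<and> y = (y' :: nat)"
  by (metis add.commute div_mult_self3 div_less mod_less mod_mult_self3 add_0 less_nat_zero_code)

text \<open>A diametral pair consists of four words: registers 20 to 23, or cells with a common
  index in four consecutive arrays (\<open>quada\<close>).\<close>

definition quadr :: "ram_state \<Rightarrow> (nat \<times> nat) \<times> (nat \<times> nat)" where
  "quadr s = ((reg s 20, reg s 21), (reg s 22, reg s 23))"

definition quada :: "(nat \<Rightarrow> nat \<Rightarrow> nat) \<Rightarrow> nat \<Rightarrow> nat \<Rightarrow> (nat \<times> nat) \<times> (nat \<times> nat)" where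
  "quada A b i = ((A b i, A (b + 1) i), (A (b + 2) i, A (b + 3) i))"

definition LDQ :: "nat \<Rightarrow> nat \<Rightarrow> com" where
  "LDQ b r = 20 ::= Read b (Reg r) ;; 21 ::= Read (b + 1) (Reg r) ;;
     22 ::= Read (b + 2) (Reg r) ;; 23 ::= Read (b + 3) (Reg r)"

definition STQ :: "nat \<Rightarrow> nat \<Rightarrow> com" where
  "STQ b r = Write b (Reg r) (Reg 20) ;; Write (b + 1) (Reg r) (Reg 21) ;;
     Write (b + 2) (Reg r) (Reg 22) ;; Write (b + 3) (Reg r) (Reg 23)"

definition NIL :: com where
  "NIL = 20 ::= Reg 0 ;; 21 ::= Const 0 ;; 22 ::= Reg 0 ;; 23 ::= Const 0"

text \<open>The function \<open>ins\<close> on registers, the new point being in registers 24 and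
  25. A disjunction is a sum of tests, and the negated comparisons of \<open>ins\<close> decide the
  branch.\<close>

definition INS :: com where
  "INS = If (Reg 24 .= Reg 0) Skip
     (If (Reg 20 .= Reg 0)
        (20 ::= Reg 24 ;; 21 ::= Reg 25 ;; 22 ::= Reg 24 ;; 23 ::= Reg 25)
        (26 ::= Read 13 (Ix (Reg 20) (Reg 22)) .+ Reg 21 .+ Reg 23 ;;
         27 ::= Read 13 (Ix (Reg 20) (Reg 24)) .+ Reg 21 .+ Reg 25 ;;
         28 ::= Read 13 (Ix (Reg 22) (Reg 24)) .+ Reg 23 .+ Reg 25 ;;
         If ((Reg 26 .< Reg 27) .+ (Reg 26 .< Reg 28) .+ (Reg 26 .< Reg 25 .+ Reg 25))
           (If ((Reg 27 .< Reg 28) .+ (Reg 27 .< Reg 25 .+ Reg 25))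
              (If (Reg 28 .< Reg 25 .+ Reg 25)
                 (20 ::= Reg 24 ;; 21 ::= Reg 25 ;; 22 ::= Reg 24 ;; 23 ::= Reg 25)
                 (20 ::= Reg 24 ;; 21 ::= Reg 25))
              (22 ::= Reg 24 ;; 23 ::= Reg 25))
           Skip))"

text \<open>Absorbs a stored pair after adding \<open>c\<close> to its weights; by
  \<open>diam_pair_join\<close> this unites the two point sets.\<close>

definition INSP :: "nat \<Rightarrow> nat \<Rightarrow> nat \<Rightarrow> com" where
  "INSP b r c =
     24 ::= Read b (Reg r) ;; 25 ::= Read (b + 1) (Reg r) .+ Const c ;; INS ;;
     24 ::= Read (b + 2) (Reg r) ;; 25 ::= Read (b + 3) (Reg r) .+ Const c ;; INS"

lemma wr_macros [simp]:
  "wrr (LDQ b r) = {20, 21, 22, 23}" "wra (LDQ b r) = {}"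
  "wrr (STQ b r) = {}" "wra (STQ b r) = {b, b + 1, b + 2, b + 3}"
  "wrr NIL = {20, 21, 22, 23}" "wra NIL = {}"
  "wrr INS = {20, 21, 22, 23, 26, 27, 28}" "wra INS = {}"
  "wrr (INSP b r c) = {20, 21, 22, 23, 24, 25, 26, 27, 28}" "wra (INSP b r c) = {}"
  by (auto simp: LDQ_def STQ_def NIL_def INS_def INSP_def)

text \<open>
  Registers 0, 2, 3, 4 hold \<open>n\<close>, \<open>S = n + 1\<close>, \<open>S * S\<close> and \<open>n - 1\<close>; a matrix is stored row by row with
  stride \<open>S\<close>. Vertices are renumbered in breadth-first order of the tree. Use of the arrays:
  6: adjacency matrix of the tree; 7, 8, 10: label, parent and index of the parent edge of a vertex;
  9: inverse of 7, shifted by 1; 12: adjacency matrix of the non-tree edges; 13: tree distances;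
  14: ancestors; 15--18: diametral pairs of the neighbours \<open>v\<close> of \<open>u\<close> with \<open>ld u v \<le> l\<close>; 19: highest
  neighbour \<open>v\<close> of \<open>u\<close> with \<open>ld u v = l\<close>; 20: nearest neighbours; 21--25: range minimum queries;
  26--37: rerooting.
\<close>
locale machine =
  fixes W L n S :: nat
  assumes S_eq: "S = Suc n" and n_ge: "2 \<le> n" and L_ge: "16 * (S * S) \<le> L" and L_le: "L \<le> W"
begin

lemma n_less_S [simp]: "n < S" by (simp add: S_eq)

lemma less_S [simp]: "x < n \<Longrightarrow> x < S" "x \<le> n \<Longrightarrow> x < S" by (auto simp: S_eq)

lemma S_ge: "3 \<le> S" using n_ge S_eq by simp

lemma W_ge: "48 * S \<le> W" "144 \<le> W"
proof -
  have "3 * S \<le> S * S" using S_ge by simp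
  then show "48 * S \<le> W" using L_ge L_le by linarith
  then show "144 \<le> W" using S_ge by linarith
qed

lemma const_ok [simp]: "0 < W" "Suc 0 < W" "2 < W"
  using W_ge by auto

text \<open>The factor 16 in \<open>L_ge\<close>, together with \<open>3 \<le> S\<close>, leaves
  room for every sum of a few distances, depths and weights that occurs.\<close>

lemma small_W: "x \<le> 40 * S \<Longrightarrow> x < W" "x \<le> 40 * n \<Longrightarrow> x < W"
  using W_ge S_ge S_eq by linarith+

lemma index_less [simp]: "x < S \<Longrightarrow> y < S \<Longrightarrow> x * S + y < S * S"
proof -
  assume "x < S" "y < S"
  then have "(x + 1) * S \<le> S * S" by (intro mult_right_mono) auto
  then show ?thesis using \<open>y < S\<close> by simp
qed

lemma SS_L: "x < S * S \<Longrightarrow> x < L" "x \<le> 4 * (S * S) \<Longrightarrow> x < L" "x < L \<Longrightarrow> x < W"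
  using L_ge L_le S_ge by (auto simp: S_eq)

lemma index_L [simp]: "x < S \<Longrightarrow> y < S \<Longrightarrow> x * S + y < L"
  using index_less SS_L by blast

lemma index_W [simp]: "x < S \<Longrightarrow> y < S \<Longrightarrow> x * S + y < W" "x < S \<Longrightarrow> x * S < W"
  using index_L[of x y] index_L[of x 0] L_le S_ge by linarith+

lemma less_L [simp]: "x < S \<Longrightarrow> x < L" "x < n \<Longrightarrow> x < L" "x \<le> n \<Longrightarrow> x < L"
  using index_L[of 0 x] S_ge less_S by auto

lemma ok_Ix [simp]: "reg s 2 = S \<Longrightarrow> ev s a < S \<Longrightarrow> ev s b < S \<Longrightarrow> ok W L s (Ix a b) \<longleftrightarrow> ok W L s a \<and> ok W L s b"
  by (auto simp: Ix_def)

definition base :: "ram_state \<Rightarrow> bool" where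
  "base s \<longleftrightarrow> reg s 0 = n \<and> reg s 2 = S \<and> reg s 3 = S * S \<and> reg s 4 = n - 1"

lemma baseD: "base s \<Longrightarrow> reg s 0 = n \<and> reg s 2 = S \<and> reg s 3 = S * S \<and> reg s 4 = n - 1"
  by (simp add: base_def)

lemma base_fr: "fr c s s' \<Longrightarrow> wrr c \<inter> {0, 2, 3, 4} = {} \<Longrightarrow> base s' = base s"
  by (auto simp: base_def fr_def)

lemma vc_LDQ:
  assumes "reg s r < L" "r \<notin> {20, 21, 22, 23}" "\<And>s'. fr (LDQ b r) s s' \<Longrightarrow> quadr s' = quada (arr s) b (reg s r) \<Longrightarrow> Q s'"
  shows "vc W L (LDQ b r) Q s"
proof -
  have "vc W L (LDQ b r) (\<lambda>s'. quadr s' = quada (arr s) b (reg s r)) s"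
    using assms(1,2) by (simp add: LDQ_def quadr_def quada_def)
  then show ?thesis by (rule vc_mono) (use assms(3) in auto)
qed

lemma vc_STQ:
  assumes "reg s r < L"
    and "\<And>s'. fr (STQ b r) s s' \<Longrightarrow> (\<And>i. quada (arr s') b i = (if i = reg s r then quadr s else quada (arr s) b i)) \<Longrightarrow> Q s'"
  shows "vc W L (STQ b r) Q s"
proof -
  have "vc W L (STQ b r) (\<lambda>s'. \<forall>i. quada (arr s') b i = (if i = reg s r then quadr s else quada (arr s) b i)) s"
    using assms(1) by (simp add: STQ_def quadr_def quada_def)
  then show ?thesis by (rule vc_mono) (use assms(2) in auto)
qed

end

text \<open>\<open>N\<close> is adjacency by non-tree edges, in terms of the new vertex
  numbers.\<close>

locale tree_machine = machine W L n S + ptree n par for W L n S par +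
  fixes N :: "nat \<Rightarrow> nat \<Rightarrow> bool"
  assumes N_sym: "N u v \<Longrightarrow> N v u" and N_less: "N u v \<Longrightarrow> u < n \<and> v < n"
begin

definition has_d :: "ram_state \<Rightarrow> bool" where
  "has_d s \<longleftrightarrow> (\<forall>x<n. \<forall>y\<le>n. arr s 13 (x * S + y) = dt x y)"

lemma has_dD: "has_d s \<Longrightarrow> x < n \<Longrightarrow> y < n \<Longrightarrow> arr s 13 (x * S + y) = d x y"
  "has_d s \<Longrightarrow> x < n \<Longrightarrow> y \<le> n \<Longrightarrow> arr s 13 (x * S + y) = dt x y"
  "has_d s \<Longrightarrow> y < n \<Longrightarrow> arr s 13 y = d 0 y"
  "has_d s \<Longrightarrow> y \<le> n \<Longrightarrow> arr s 13 y = dt 0 y"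
  using n_pos unfolding has_d_def by (force simp: dt_def)+

lemma dt_le: "x < n \<Longrightarrow> y \<le> n \<Longrightarrow> dt x y \<le> 2 * n"
  using d_lt_n[of x y] by (auto simp: dt_def)

lemma has_d_fr: "fr c s s' \<Longrightarrow> 13 \<notin> wra c \<Longrightarrow> has_d s' = has_d s"
  by (simp add: has_d_def fr_def)

lemma vc_NIL:
  assumes "base s" "\<And>s'. fr NIL s s' \<Longrightarrow> diam_pair {} (quadr s') \<Longrightarrow> Q s'"
  shows "vc W L NIL Q s"
proof -
  have "vc W L NIL (\<lambda>s'. diam_pair {} (quadr s')) s"
    using assms(1) by (simp add: NIL_def quadr_def diam_pair_def base_def wf_pts_def)
  then show ?thesis by (rule vc_mono) (use assms(2) in auto)
qed

text \<open>The weight may be \<open>Suc n\<close>, because the pair of an empty set carries an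
  arbitrary weight up to \<open>n\<close> and may have been shifted by one.\<close>

lemma vc_INS:
  assumes b: "base s" "has_d s" and q: "diam_pair X (quadr s)"
    and r: "reg s 24 \<le> n" "reg s 25 \<le> Suc n"
    and Q: "\<And>s'. fr INS s s' \<Longrightarrow> quadr s' = ins (reg s 24, reg s 25) (quadr s) \<Longrightarrow> Q s'"
  shows "vc W L INS Q s"
proof -
  have rb: "reg s 0 = n" "reg s 2 = S" using baseD[OF b(1)] by auto
  consider "reg s 24 = n" | "reg s 24 \<noteq> n" "reg s 20 = n" | "reg s 24 \<noteq> n" "reg s 20 \<noteq> n" by blast
  then have *: "vc W L INS (\<lambda>s'. quadr s' = ins (reg s 24, reg s 25) (quadr s)) s"
  proof cases
    case 1
    then show ?thesis using rb by (simp add: INS_def quadr_def ins_def)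
  next
    case 2
    then show ?thesis using rb by (simp add: INS_def quadr_def ins_def)
  next
    case 3
    have ne: "X \<noteq> {}" using 3 diam_pair_empty_iff[OF q] by (auto simp: quadr_def)
    have lt: "reg s 20 < n" "reg s 22 < n" "reg s 24 < n" "reg s 21 \<le> n" "reg s 23 \<le> n"
      using 3 r diam_pair_bounds[OF q] diam_pair_empty_iff[OF q] ne by (auto simp: quadr_def)
    define A where "A = d (reg s 20) (reg s 22) + reg s 21 + reg s 23"
    define B where "B = d (reg s 20) (reg s 24) + reg s 21 + reg s 25"
    define C where "C = d (reg s 22) (reg s 24) + reg s 23 + reg s 25"
    have dd: "arr s 13 (reg s 20 * S + reg s 22) + reg s 21 + reg s 23 = A"
      "arr s 13 (reg s 20 * S + reg s 24) + reg s 21 + reg s 25 = B"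
      "arr s 13 (reg s 22 * S + reg s 24) + reg s 23 + reg s 25 = C"
      using lt has_dD(1)[OF b(2)] by (simp_all add: A_def B_def C_def)
    have dl: "arr s 13 (reg s 20 * S + reg s 22) < n" "arr s 13 (reg s 20 * S + reg s 24) < n"
       "arr s 13 (reg s 22 * S + reg s 24) < n"
      using lt d_lt_n has_dD(1)[OF b(2)] by auto
    have w: "A < W" "B < W" "C < W" "reg s 25 + reg s 25 < W"
      "arr s 13 (reg s 20 * S + reg s 22) + reg s 21 < W"
      "arr s 13 (reg s 20 * S + reg s 24) + reg s 21 < W"
      "arr s 13 (reg s 22 * S + reg s 24) + reg s 23 < W"
      by (rule small_W(2); use lt dl r n_ge dd in linarith)+
    have b3: "of_bool P + of_bool Q + of_bool R < W" "of_bool P + of_bool Q < W" for P Q R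
      by (rule small_W(2); use n_ge in \<open>auto simp: of_bool_def\<close>)+
    have ins: "ins (reg s 24, reg s 25) (quadr s) =
       (if B \<le> A \<and> C \<le> A \<and> reg s 25 + reg s 25 \<le> A then quadr s
        else if C \<le> B \<and> reg s 25 + reg s 25 \<le> B then (fst (quadr s), (reg s 24, reg s 25))
        else if reg s 25 + reg s 25 \<le> C then ((reg s 24, reg s 25), snd (quadr s))
        else ((reg s 24, reg s 25), (reg s 24, reg s 25)))"
      using 3 by (simp add: ins_def quadr_def wdist_def A_def B_def C_def mult_2 add_ac)
    have z: "of_bool P + of_bool Q + of_bool R = (0::nat) \<longleftrightarrow> \<not> P \<and> \<not> Q \<and> \<not> R"
      "of_bool P + of_bool Q = (0::nat) \<longleftrightarrow> \<not> P \<and> \<not> Q" for P Q R by auto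
    show ?thesis unfolding ins unfolding INS_def
      using 3 lt w by (simp add: rb dd b3 z not_less quadr_def)
  qed
  from * show ?thesis by (rule vc_mono) (use Q in auto)
qed

lemma vc_INSP:
  assumes b: "base s" "has_d s" and X: "diam_pair X (quadr s)" and Y: "diam_pair Y (quada (arr s) b (reg s r))"
    and wf: "wf_pts (shift c Y)" and c: "c \<le> 1" and r: "reg s r < L" "r \<notin> {20, 21, 22, 23, 24, 25, 26, 27, 28}"
    and Q: "\<And>s'. fr (INSP b r c) s s' \<Longrightarrow> diam_pair (X \<union> shift c Y) (quadr s') \<Longrightarrow> Q s'"
  shows "vc W L (INSP b r c) Q s"
proof -
  define i where "i = reg s r"
  define p where "p = (arr s b i, arr s (b + 1) i)"
  define q where "q = (arr s (b + 2) i, arr s (b + 3) i)"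
  have pq: "diam_pair Y (p, q)" using Y by (simp add: quada_def p_def q_def i_def)
  have bd: "fst p \<le> n" "fst q \<le> n" "snd p \<le> n" "snd q \<le> n" using diam_pair_bounds[OF pq] by auto
  have w: "snd p + c < W" "snd q + c < W" by (rule small_W(2); use bd c n_ge in linarith)+
  have cW: "c < W" using c n_ge by (intro small_W(2)) auto
  have X1: "diam_pair (if fst p = n then X else insert (shift_pt c p) X) (ins (shift_pt c p) (quadr s))"
  proof (cases "fst p = n")
    case True
    then show ?thesis using X by (simp add: ins_def shift_pt_def)
  next
    case False
    then have "Y \<noteq> {}" using diam_pair_empty_iff[OF pq] by auto
    then have "p \<in> Y" using diam_pair_in[OF pq] by simp
    then have "shift_pt c p \<in> shift c Y" by (auto simp: shift_def shift_pt_def)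
    then have "fst (shift_pt c p) < n" "snd (shift_pt c p) \<le> n" using wf by (auto simp: wf_pts_def)
    then show ?thesis using diam_pair_ins[OF X] False by simp
  qed
  have "vc W L (INSP b r c) (\<lambda>s'. diam_pair (X \<union> shift c Y) (quadr s')) s"
    unfolding INSP_def vc.simps
  proof (intro conjI)
    let ?s1 = "s\<lparr>reg := (reg s)(24 := ev s (Read b (Reg r)))\<rparr>"
    let ?s2 = "?s1\<lparr>reg := (reg ?s1)(25 := ev ?s1 (Read (b + 1) (Reg r) .+ Const c))\<rparr>"
    have r2: "reg ?s2 24 = fst p" "reg ?s2 25 = snd p + c" "quadr ?s2 = quadr s"
      using r by (auto simp: p_def i_def quadr_def)
    show "vc W L INS (\<lambda>s. ok W L s (Read (b + 2) (Reg r)) \<and> ok W L (s\<lparr>reg := (reg s)(24 := ev s (Read (b + 2) (Reg r)))\<rparr>)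
        (Read (b + 3) (Reg r) .+ Const c) \<and>
       vc W L INS (\<lambda>s'. diam_pair (X \<union> shift c Y) (quadr s'))
        (s\<lparr>reg := (reg s)(24 := ev s (Read (b + 2) (Reg r)))\<rparr>
          \<lparr>reg := (reg (s\<lparr>reg := (reg s)(24 := ev s (Read (b + 2) (Reg r)))\<rparr>))
            (25 := ev (s\<lparr>reg := (reg s)(24 := ev s (Read (b + 2) (Reg r)))\<rparr>) (Read (b + 3) (Reg r) .+ Const c))\<rparr>)) ?s2"
    proof (rule vc_INS)
      show "base ?s2" using b(1) by (simp add: base_def)
      show "has_d ?s2" using b(2) by (simp add: has_d_def)
      show "diam_pair X (quadr ?s2)" using X r2 by simp
      show "reg ?s2 24 \<le> n" "reg ?s2 25 \<le> Suc n" using r2 bd c by auto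
      fix s3 assume f: "fr INS ?s2 s3" and q3: "quadr s3 = ins (reg ?s2 24, reg ?s2 25) (quadr ?s2)"
      have a3: "arr s3 = arr s" and r3: "reg s3 r = i" "reg s3 0 = reg s 0" "reg s3 2 = reg s 2" "reg s3 3 = reg s 3" "reg s3 4 = reg s 4"
        using f r by (auto simp: fr_def i_def fun_eq_iff)
      have q3': "quadr s3 = ins (shift_pt c p) (quadr s)" using q3 unfolding r2 by (simp add: shift_pt_def)
      let ?s4 = "s3\<lparr>reg := (reg s3)(24 := ev s3 (Read (b + 2) (Reg r)))\<rparr>"
      let ?s5 = "?s4\<lparr>reg := (reg ?s4)(25 := ev ?s4 (Read (b + 3) (Reg r) .+ Const c))\<rparr>"
      have r5: "reg ?s5 24 = fst q" "reg ?s5 25 = snd q + c" "quadr ?s5 = quadr s3"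
        using r a3 r3 by (auto simp: q_def i_def quadr_def)
      have "vc W L INS (\<lambda>s'. diam_pair (X \<union> shift c Y) (quadr s')) ?s5"
      proof (rule vc_INS)
        show "base ?s5" using b(1) r3 by (simp add: base_def)
        show "has_d ?s5" using b(2) a3 by (simp add: has_d_def)
        show "diam_pair (if fst p = n then X else insert (shift_pt c p) X) (quadr ?s5)" using X1 r5 q3' by simp
        show "reg ?s5 24 \<le> n" "reg ?s5 25 \<le> Suc n" using r5 bd c by auto
        fix s6 assume "quadr s6 = ins (reg ?s5 24, reg ?s5 25) (quadr ?s5)"
        then have "quadr s6 = ins (shift_pt c q) (ins (shift_pt c p) (quadr s))"
          unfolding r5 q3' by (simp add: shift_pt_def)
        then show "diam_pair (X \<union> shift c Y) (quadr s6)" using diam_pair_join[OF X pq wf] by simp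
      qed
      then show "ok W L s3 (Read (b + 2) (Reg r)) \<and> ok W L ?s4 (Read (b + 3) (Reg r) .+ Const c) \<and>
         vc W L INS (\<lambda>s'. diam_pair (X \<union> shift c Y) (quadr s')) ?s5"
        using r a3 r3 w cW by (simp add: q_def i_def)
    qed
  qed (use r w cW in \<open>auto simp: p_def i_def\<close>)
  then show ?thesis by (rule vc_mono) (use Q in auto)
qed

end

section \<open>Sequencing rules, distance matrix and ancestor table\<close>

lemma wp_vc_seq: "vc W L c1 (\<lambda>s1. wp W L c2 T2 Q s1) s \<Longrightarrow> wp W L (c1 ;; c2) (cst c1 + T2) Q s"
  by (rule wp_seq, rule vc_wp)

lemma wp_vc: "vc W L c Q s \<Longrightarrow> cst c \<le> T \<Longrightarrow> wp W L c T Q s"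
  using vc_wp wp_mono by blast

lemma exp_cost_Ix [simp]: "exp_cost (Ix a b) = exp_cost a + exp_cost b + 3"
  by (simp add: Ix_def)

lemma index_eq_0:
  "y < S \<Longrightarrow> x * S + y = x' * S \<longleftrightarrow> x = x' \<and> y = (0 :: nat)"
  "y < S \<Longrightarrow> x' * S = x * S + y \<longleftrightarrow> x = x' \<and> y = (0 :: nat)"
  using index_eq[of y S 0 x x'] by auto

lemma index_eq_Suc:
  "y < S \<Longrightarrow> Suc y' < S \<Longrightarrow> x * S + y = Suc (x' * S + y') \<longleftrightarrow> x = x' \<and> y = Suc y'"
  "y < S \<Longrightarrow> Suc y' < S \<Longrightarrow> Suc (x' * S + y') = x * S + y \<longleftrightarrow> x = x' \<and> y = Suc y'"
  using index_eq[of y S "Suc y'" x x'] by auto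

text \<open>A row is the row of the parent plus one in the columns before the diagonal, and is
  mirrored into the column. Column \<open>n\<close> receives the distance \<open>2 * n\<close> of
  the missing vertex.\<close>

definition dist_com :: com where
  "dist_com = For 5 0 (6 ::= Read 8 (Reg 5) ;;
     For 7 5 (8 ::= Read 13 (Ix (Reg 6) (Reg 7)) .+ Const 1 ;;
       Write 13 (Ix (Reg 5) (Reg 7)) (Reg 8) ;; Write 13 (Ix (Reg 7) (Reg 5)) (Reg 8)) ;;
     Write 13 (Ix (Reg 5) (Reg 5)) (Const 0) ;; Write 13 (Ix (Reg 5) (Reg 0)) (Reg 0 .+ Reg 0))"

text \<open>The row of a vertex is the row of its parent moved by one cell. Cells beyond the depth
  of the vertex contain garbage, which is why \<open>has_anc\<close> is restricted.\<close>

definition anc_com :: com where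
  "anc_com = For 5 0 (Write 14 (Ix (Reg 5) (Const 0)) (Reg 5) ;; 6 ::= Read 8 (Reg 5) ;;
     For 7 4 (Write 14 (Ix (Reg 5) (Reg 7 .+ Const 1)) (Read 14 (Ix (Reg 6) (Reg 7)))))"

lemma wr_dist_com [simp]: "wrr dist_com = {5, 6, 7, 8}" "wra dist_com = {13}" by (auto simp: dist_com_def)
lemma wr_anc_com [simp]: "wrr anc_com = {5, 6, 7}" "wra anc_com = {14}" by (auto simp: anc_com_def)

lemma wp_ForA:
  assumes "x \<notin> wrr c" "b \<notin> wrr c" "x \<noteq> b" "reg s b = N" "I 0 (arr s)"
    and "\<And>i s'. i < N \<Longrightarrow> fr (For x b c) s s' \<Longrightarrow> reg s' x = i \<Longrightarrow> bnd W s' \<Longrightarrow> I i (arr s') \<Longrightarrow>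
      wp W L c T (\<lambda>s''. I (Suc i) (arr s'')) s'"
  shows "wp W L (For x b c) (N * (T + 8) + 6) (\<lambda>s'. I N (arr s')) s"
  by (rule wp_mono[OF wp_For[where I = "\<lambda>i s. I i (arr s)" and N = N and T = T]]) (use assms in auto)

text \<open>The invariant is indexed by the position in the row-by-row traversal; \<open>row\<close>
  turns the end of a row into the beginning of the next.\<close>

lemma wp_For2A:
  assumes "x \<notin> wrr c" "b \<notin> wrr c" "y \<notin> wrr c" "b' \<notin> wrr c" "distinct [x, y, b]" "x \<noteq> b'" "y \<noteq> b'"
    and N: "reg s b = N" "reg s b' = M" and I: "I 0 0 (arr s)"
    and row: "\<And>i A. i < N \<Longrightarrow> I i M A \<Longrightarrow> I (Suc i) 0 A"
    and step: "\<And>i j s'. i < N \<Longrightarrow> j < M \<Longrightarrow> fr (For x b (For y b' c)) s s' \<Longrightarrow> reg s' x = i \<Longrightarrow> reg s' y = j \<Longrightarrow>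
      bnd W s' \<Longrightarrow> I i j (arr s') \<Longrightarrow> wp W L c T (\<lambda>s''. I i (Suc j) (arr s'')) s'"
  shows "wp W L (For x b (For y b' c)) (N * ((M * (T + 8) + 6) + 8) + 6) (\<lambda>s'. I N 0 (arr s')) s"
proof (rule wp_ForA[where I = "\<lambda>i. I i 0"], goal_cases)
  case (6 i s1)
  show ?case
  proof (rule wp_mono[OF wp_ForA[where I = "I i" and N = M and T = T]], goal_cases)
    case (6 j s2)
    show ?case
    proof (rule step)
      show "fr (For x b (For y b' c)) s s2" using 6(2) \<open>fr _ s s1\<close> by (auto simp: fr_def)
      show "reg s2 x = i" using 6(2) \<open>reg s1 x = i\<close> assms by (auto simp: fr_def)
    qed (use 6 \<open>i < N\<close> in auto)
  next
    case 4
    show ?case using N(2) \<open>fr _ s s1\<close> assms by (auto simp: fr_def)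
  qed (use assms row 6 in auto)
qed (use assms in auto)

context machine
begin

lemma For_time1: "N \<le> S \<Longrightarrow> N * (c + 8) + 6 \<le> (c + 14) * S"
proof -
  assume "N \<le> S"
  then have "N * (c + 8) \<le> S * (c + 8)" by (rule mult_right_mono) simp
  moreover have "6 \<le> 6 * S" using S_ge by simp
  moreover have "(c + 14) * S = S * (c + 8) + 6 * S" by (simp add: algebra_simps)
  ultimately show ?thesis by linarith
qed

lemma For_time2: "N \<le> S \<Longrightarrow> T \<le> c * S \<Longrightarrow> N * (T + 8) + 6 \<le> (c + 14) * (S * S)"
proof -
  assume "N \<le> S" "T \<le> c * S"
  then have 1: "N * (T + 8) \<le> S * (c * S + 8)" by (intro mult_mono) auto
  define A where "A = S * S"
  have A: "S \<le> A" "1 \<le> A" using S_ge by (auto simp: A_def)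
  have "S * (c * S + 8) = c * A + 8 * S" by (simp add: A_def algebra_simps)
  moreover have "(c + 14) * A = c * A + 14 * A" by (simp add: algebra_simps)
  ultimately show ?thesis unfolding A_def[symmetric] using 1 A by linarith
qed

lemma For_time: "N \<le> S * S \<Longrightarrow> N * (c + 8) + 6 \<le> (c + 14) * (S * S)"
proof -
  assume "N \<le> S * S"
  then have "N * (c + 8) \<le> (S * S) * (c + 8)" by (rule mult_right_mono) simp
  moreover have "6 \<le> 6 * (S * S)" using S_ge by simp
  moreover have "(c + 14) * (S * S) = (S * S) * (c + 8) + 6 * (S * S)" by (simp add: algebra_simps)
  ultimately show ?thesis by linarith
qed

lemma For_le1: "N \<le> S \<Longrightarrow> T + 14 \<le> c \<Longrightarrow> N * (T + 8) + 6 \<le> c * S"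
  using For_time1[of N T] mult_right_mono[of "T + 14" c S] by linarith

lemma For_le2: "N \<le> S \<Longrightarrow> T \<le> c' * S \<Longrightarrow> c' + 14 \<le> c \<Longrightarrow> N * (T + 8) + 6 \<le> c * (S * S)"
  using For_time2[of N T c'] mult_right_mono[of "c' + 14" c "S * S"] by linarith

lemma For_le: "N \<le> S * S \<Longrightarrow> T + 14 \<le> c \<Longrightarrow> N * (T + 8) + 6 \<le> c * (S * S)"
  using For_time[of N T] mult_right_mono[of "T + 14" c "S * S"] by linarith

lemma index_Suc [simp]: "x < S \<Longrightarrow> Suc y < S \<Longrightarrow> Suc (x * S + y) < L" "x < S \<Longrightarrow> Suc y < S \<Longrightarrow> Suc (x * S + y) < W"
  using index_L[of x "Suc y"] index_W(1)[of x "Suc y"] by simp_all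

lemma index_0 [simp]: "x < S \<Longrightarrow> x * S < L"
  using index_L[of x 0] S_ge by simp

lemma le_S [simp]: "n \<le> S" "n - k \<le> S" "x < n \<Longrightarrow> x \<le> S"
  by (auto simp: S_eq)

end

context tree_machine
begin

text \<open>The loops also read the parent of the root, so cell 0 has to contain some legal
  vertex.\<close>

definition has_par :: "ram_state \<Rightarrow> bool" where
  "has_par s \<longleftrightarrow> (\<forall>i<n. arr s 8 i < n \<and> (0 < i \<longrightarrow> arr s 8 i = par i))"

lemma has_par_fr: "fr c s s' \<Longrightarrow> 8 \<notin> wra c \<Longrightarrow> has_par s' = has_par s"
  by (simp add: has_par_def fr_def)

lemma wp_dist_com:
  assumes b: "base s" "has_par s"
  shows "wp W L dist_com (1000 * (S * S)) has_d s"
proof -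
  let ?I = "\<lambda>i s'. (\<forall>x<i. \<forall>y<i. arr s' 13 (x * S + y) = d x y) \<and> (\<forall>x<i. arr s' 13 (x * S + n) = 2 * n)"
  show ?thesis unfolding dist_com_def
  proof (rule wp_mono[OF wp_For[where I = ?I and T = "100 * S" and N = n]], goal_cases)
    case (6 i s1)
    note f = \<open>fr _ s s1\<close>
    have r: "reg s1 0 = n" "reg s1 2 = S" "arr s1 8 = arr s 8" using f baseD[OF b(1)] by (auto simp: fr_def)
    have i: "reg s1 5 = i" "i < n" using 6 by auto
    define p where "p = arr s 8 i"
    have p: "p < n" "0 < i \<Longrightarrow> p = par i" using b(2) i by (auto simp: has_par_def p_def)
    have I1: "?I i s1" using 6 by simp
    let ?s2 = "s1\<lparr>reg := (reg s1)(6 := p)\<rparr>"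
    let ?J = "\<lambda>j s'. ?I i s' \<and> (\<forall>y<j. arr s' 13 (i * S + y) = d i y \<and> arr s' 13 (y * S + i) = d y i)"
    let ?c = "8 ::= Read 13 (Ix (Reg 6) (Reg 7)) .+ Const 1 ;;
       Write 13 (Ix (Reg 5) (Reg 7)) (Reg 8) ;; Write 13 (Ix (Reg 7) (Reg 5)) (Reg 8)"
    let ?e = "Write 13 (Ix (Reg 5) (Reg 5)) (Const 0) ;; Write 13 (Ix (Reg 5) (Reg 0)) (Reg 0 .+ Reg 0)"
    let ?Q = "\<lambda>s''. ?I (Suc i) (s''\<lparr>reg := (reg s'')(5 := Suc i)\<rparr>)"
    have "wp W L (For 7 5 ?c) (50 * S) (\<lambda>s3. wp W L ?e 30 ?Q s3) ?s2"
    proof (rule wp_mono[OF wp_For[where I = ?J and T = 30 and N = i]], goal_cases)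
      case (6 j s3)
      note f3 = \<open>fr _ ?s2 s3\<close>
      have r3: "reg s3 5 = i" "reg s3 6 = p" "reg s3 2 = S" "reg s3 7 = j" "j < i"
        using f3 r i 6 by (auto simp: fr_def)
      have lt: "j < n" "p < S" "i < S" "j < S" using r3 i p by auto
      have pi: "p = par i" "par i < i" using p r3 i par_less[of i] by auto
      have dij: "d i j = Suc (d p j)" "d j i = Suc (d p j)" using d_max[of i j] r3 i pi by auto
      have v: "arr s3 13 (p * S + j) = d p j" using 6 r3 pi by auto
      have "d p j < n" using d_lt_n p lt by simp
      then have w: "Suc (d p j) < W" by (intro small_W(2)) (use n_ge in linarith)
      show ?case
        by (rule wp_vc) (use 6(6) i(2) lt r3(5) in \<open>auto simp: r3(1-4) v w index_eq dij less_Suc_eq\<close>)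
    next
      case (8 s3)
      note f3 = \<open>fr _ ?s2 s3\<close>
      have r3: "reg s3 5 = i" "reg s3 2 = S" "reg s3 0 = n"
        using f3 r i by (auto simp: fr_def)
      have w: "n + n < W" by (intro small_W(2)) simp
      show ?case
        by (rule wp_vc) (use 8(3) i(2) in \<open>auto simp: r3 w index_eq less_Suc_eq mult_2\<close>)
    next
      case 7
      show ?case by (rule For_le1) (use i(2) in auto)
    qed (use I1 i in auto)
    then have "wp W L (For 7 5 ?c ;; ?e) (50 * S + 30) ?Q ?s2" by (rule wp_seq)
    then have "vc W L (6 ::= Read 8 (Reg 5)) (wp W L (For 7 5 ?c ;; ?e) (50 * S + 30) ?Q) s1"
      using i r by (simp add: p_def del: vc.simps(4))
    from wp_vc_seq[OF this] show ?case by (rule wp_mono) (use S_ge in auto)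
  next
    case (8 s')
    then show ?case by (auto simp: has_d_def dt_def)
  next
    case 7
    show ?case by (rule For_le2) auto
  qed (use baseD[OF b(1)] in auto)
qed

definition has_anc :: "ram_state \<Rightarrow> bool" where
  "has_anc s \<longleftrightarrow> (\<forall>x<n. \<forall>k<n. k \<le> dep x \<longrightarrow> arr s 14 (x * S + k) = anc x k)"

lemma wp_anc_com:
  assumes b: "base s" "has_par s"
  shows "wp W L anc_com (1000 * (S * S)) has_anc s"
proof -
  let ?I = "\<lambda>i s'. \<forall>x<i. \<forall>k<n. k \<le> dep x \<longrightarrow> arr s' 14 (x * S + k) = anc x k"
  show ?thesis unfolding anc_com_def
  proof (rule wp_mono[OF wp_For[where I = ?I and T = "100 * S" and N = n]], goal_cases)
    case (6 i s1)
    note f = \<open>fr _ s s1\<close>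
    have r: "reg s1 0 = n" "reg s1 2 = S" "reg s1 4 = n - 1" "arr s1 8 = arr s 8" using f baseD[OF b(1)] by (auto simp: fr_def)
    have i: "reg s1 5 = i" "i < n" using 6 by auto
    define p where "p = arr s 8 i"
    have p: "p < n" "0 < i \<Longrightarrow> p = par i" using b(2) i by (auto simp: has_par_def p_def)
    let ?s2 = "s1\<lparr>arr := (arr s1)(14 := (arr s1 14)(i * S := i)), reg := (reg s1)(6 := p)\<rparr>"
    have I1: "?I i ?s2" using 6(6) by (auto simp: index_eq_0)
    let ?J = "\<lambda>j s'. ?I i s' \<and> (\<forall>k<n. k \<le> j \<longrightarrow> k \<le> dep i \<longrightarrow> arr s' 14 (i * S + k) = anc i k)"
    let ?c = "Write 14 (Ix (Reg 5) (Reg 7 .+ Const 1)) (Read 14 (Ix (Reg 6) (Reg 7)))"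
    let ?Q = "\<lambda>s''. ?I (Suc i) (s''\<lparr>reg := (reg s'')(5 := Suc i)\<rparr>)"
    have "wp W L (For 7 4 ?c) (50 * S) ?Q ?s2"
    proof (rule wp_mono[OF wp_For[where I = ?J and T = 30 and N = "n - 1"]], goal_cases)
      case (6 j s3)
      note f3 = \<open>fr _ ?s2 s3\<close>
      have r3: "reg s3 5 = i" "reg s3 6 = p" "reg s3 2 = S" "reg s3 7 = j" "j < n - 1"
        using f3 r i 6 by (auto simp: fr_def)
      have lt: "j < n" "p < S" "i < S" "j < S" "Suc j < S" "Suc j < W" using r3 i p
        by (auto intro!: small_W(2))
      have v: "arr s3 14 (p * S + j) = anc i (Suc j)" if "Suc j \<le> dep i"
      proof -
        have i0: "0 < i" using that by (cases "i = 0") auto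
        then have "p = par i" "p < i" using p i par_less[of i] by auto
        then show ?thesis using 6 that dep_par[of i] i i0 lt anc_Suc(1)[of i j] by auto
      qed
      show ?case
        by (rule wp_vc) (use 6(6) v i(2) lt r3(5) in \<open>auto simp: r3(1-4) index_eq index_eq_Suc le_Suc_eq\<close>)
    next
      case (8 s3)
      then show ?case by (auto simp: less_Suc_eq)
    next
      case 7
      show ?case by (rule For_le1) auto
    qed (use I1 i r in auto)
    then have "vc W L (6 ::= Read 8 (Reg 5)) (wp W L (For 7 4 ?c) (50 * S) ?Q) (s1\<lparr>arr := (arr s1)(14 := (arr s1 14)(i * S := i))\<rparr>)"
      by (simp add: i r p_def)
    from wp_vc_seq[OF this] have "wp W L (6 ::= Read 8 (Reg 5) ;; For 7 4 ?c) (3 + 50 * S) ?Q (s1\<lparr>arr := (arr s1)(14 := (arr s1 14)(i * S := i))\<rparr>)"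
      by (rule wp_mono) auto
    then have "vc W L (Write 14 (Ix (Reg 5) (Const 0)) (Reg 5)) (wp W L (6 ::= Read 8 (Reg 5) ;; For 7 4 ?c) (3 + 50 * S) ?Q) s1"
      using i r by simp
    from wp_vc_seq[OF this] show ?case
      by (rule wp_mono) (use S_ge in auto)
  next
    case (8 s')
    then show ?case by (auto simp: has_anc_def)
  next
    case 7
    show ?case by (rule For_le2) auto
  qed (use baseD[OF b(1)] in auto)
qed

end

section \<open>Neighbour tables: diametral pairs by level, highest and nearest neighbours\<close>

lemma vc_Seq: "vc W L (c1 ;; c2) Q = vc W L c1 (vc W L c2 Q)"
  by (rule ext) simp

lemma cst_INS [simp]: "cst INS = 97"
  by (simp add: INS_def)

lemma cst_macros [simp]:
  "cst (LDQ b r) = 12" "cst (STQ b r) = 12" "cst NIL = 8" "cst (INSP b r c) = 210"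
  by (simp_all add: LDQ_def STQ_def NIL_def INSP_def)

definition ball_init_com :: com where
  "ball_init_com = For 5 3 (Write 15 (Reg 5) (Reg 0) ;; Write 16 (Reg 5) (Const 0) ;; Write 17 (Reg 5) (Reg 0) ;;
     Write 18 (Reg 5) (Const 0) ;; Write 19 (Reg 5) (Reg 0))"

text \<open>Register 29 becomes the index of the cell for the vertex in register 5 and the level at
  which its path to the vertex in register 6 turns.\<close>

definition ldX :: com where
  "ldX = 7 ::= (Read 13 (Reg 5) .+ Read 13 (Reg 6) .- Read 13 (Ix (Reg 5) (Reg 6))) .div Const 2 ;;
     29 ::= Ix (Reg 5) (Reg 7)"

definition ball_edges_com :: com where
  "ball_edges_com = For 5 0 (For 6 0 (If (Read 12 (Ix (Reg 5) (Reg 6)))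
     (ldX ;; LDQ 15 29 ;; 24 ::= Reg 6 ;; 25 ::= Const 0 ;; INS ;; STQ 15 29) Skip))"

definition ball_prefix_com :: com where
  "ball_prefix_com = For 5 0 (For 6 4 (7 ::= Reg 6 .+ Const 1 ;; 29 ::= Ix (Reg 5) (Reg 7) ;; 30 ::= Ix (Reg 5) (Reg 6) ;;
     LDQ 15 29 ;; INSP 15 30 0 ;; STQ 15 29))"

definition meet_min_com :: com where
  "meet_min_com = For 5 0 (For 6 0 (If (Read 12 (Ix (Reg 5) (Reg 6)))
     (ldX ;; If (Read 13 (Reg 6) .< Read 13 (Read 19 (Reg 29))) (Write 19 (Reg 29) (Reg 6)) Skip) Skip))"

definition near_init_com :: com where
  "near_init_com = For 5 0 (For 6 0 (If (Read 12 (Ix (Reg 5) (Reg 6)))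
     (Write 20 (Ix (Reg 5) (Reg 6)) (Reg 6)) (Write 20 (Ix (Reg 5) (Reg 6)) (Reg 0))))"

definition near_up_com :: com where
  "near_up_com = For 5 0 (For 6 4 (7 ::= Reg 4 .- Reg 6 ;; 8 ::= Read 8 (Reg 7) ;;
     29 ::= Read 20 (Ix (Reg 5) (Reg 7)) ;; 30 ::= Ix (Reg 5) (Reg 8) ;;
     If (Read 13 (Ix (Reg 7) (Reg 5)) .+ Read 13 (Reg 7) .= Read 13 (Reg 5)) Skip
       (If (Read 13 (Ix (Reg 8) (Reg 29)) .< Read 13 (Ix (Reg 8) (Read 20 (Reg 30))))
          (Write 20 (Reg 30) (Reg 29)) Skip)))"

definition near_down_com :: com where
  "near_down_com = For 5 0 (For 6 4 (7 ::= Reg 6 .+ Const 1 ;; 8 ::= Read 8 (Reg 7) ;;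
     29 ::= Read 20 (Ix (Reg 5) (Reg 8)) ;; 30 ::= Ix (Reg 5) (Reg 7) ;;
     If (Read 13 (Ix (Reg 7) (Reg 29)) .< Read 13 (Ix (Reg 7) (Read 20 (Reg 30))))
       (Write 20 (Reg 30) (Reg 29)) Skip))"

lemma wr_phases [simp]:
  "wrr ldX = {7, 29}" "wra ldX = {}"
  "wrr ball_init_com = {5}" "wra ball_init_com = {15, 16, 17, 18, 19}"
  "wrr ball_edges_com = {5, 6, 7, 20, 21, 22, 23, 24, 25, 26, 27, 28, 29}" "wra ball_edges_com = {15, 16, 17, 18}"
  "wrr ball_prefix_com = {5, 6, 7, 20, 21, 22, 23, 24, 25, 26, 27, 28, 29, 30}" "wra ball_prefix_com = {15, 16, 17, 18}"
  "wrr meet_min_com = {5, 6, 7, 29}" "wra meet_min_com = {19}"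
  "wrr near_init_com = {5, 6}" "wra near_init_com = {20}"
  "wrr near_up_com = {5, 6, 7, 8, 29, 30}" "wra near_up_com = {20}"
  "wrr near_down_com = {5, 6, 7, 8, 29, 30}" "wra near_down_com = {20}"
  by (auto simp: ball_init_com_def ldX_def ball_edges_com_def ball_prefix_com_def meet_min_com_def near_init_com_def near_up_com_def near_down_com_def)

context machine
begin

lemma For2_le: "N \<le> S \<Longrightarrow> M \<le> S \<Longrightarrow> T + 28 \<le> c \<Longrightarrow> N * ((M * (T + 8) + 6) + 8) + 6 \<le> c * (S * S)"
  by (rule For_le2[of N _ "T + 14"]) (use For_le1[of M T "T + 14"] in auto)

end

context tree_machine
begin

definition has_N :: "ram_state \<Rightarrow> bool" where
  "has_N s \<longleftrightarrow> (\<forall>u<n. \<forall>v<n. arr s 12 (u * S + v) \<noteq> 0 \<longleftrightarrow> N u v)"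

lemma has_N_fr: "fr c s s' \<Longrightarrow> 12 \<notin> wra c \<Longrightarrow> has_N s' = has_N s"
  by (simp add: has_N_def fr_def)

lemma ld_less_n: "x < n \<Longrightarrow> y < n \<Longrightarrow> ld x y < n"
  using ld_le[of x y] d_lt_n[of 0 x] n_pos by simp

lemma vc_ldX:
  assumes b: "base s" "has_d s" and x: "reg s 5 < n" "reg s 6 < n"
    and Q: "\<And>s'. fr ldX s s' \<Longrightarrow> reg s' 29 = reg s 5 * S + ld (reg s 5) (reg s 6) \<Longrightarrow> Q s'"
  shows "vc W L ldX Q s"
proof -
  have "dep (reg s 5) < n" "dep (reg s 6) < n" using d_lt_n n_pos x by auto
  then have w: "dep (reg s 5) + dep (reg s 6) < W" by (intro small_W(2)) linarith
  have l: "ld (reg s 5) (reg s 6) < S" using ld_less_n x by simp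
  have r: "reg s 2 = S" using b by (simp add: base_def)
  have "vc W L ldX (\<lambda>s'. reg s' 29 = reg s 5 * S + ld (reg s 5) (reg s 6)) s"
    using x l by (simp add: ldX_def r has_dD[OF b(2)] w ld_def)
  then show ?thesis by (rule vc_mono) (use Q in auto)
qed

definition BE :: "nat \<Rightarrow> nat \<Rightarrow> (nat \<times> nat) set" where
  "BE u l = {(v, 0) | v. N u v \<and> ld u v = l}"

text \<open>With \<open>l = dep a - 1\<close> these are the neighbours of \<open>u\<close> outside
  the subtree of \<open>a\<close>, for any \<open>a\<close> above \<open>u\<close> (see
  \<open>PT_single\<close>). This is why a table by level serves all tree edges.\<close>

definition BS :: "nat \<Rightarrow> nat \<Rightarrow> (nat \<times> nat) set" where
  "BS u l = {(v, 0) | v. N u v \<and> ld u v \<le> l}"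

definition has_ball :: "(nat \<Rightarrow> nat \<Rightarrow> nat) \<Rightarrow> bool" where
  "has_ball A \<longleftrightarrow> (\<forall>u<n. \<forall>l<n. diam_pair (BS u l) (quada A 15 (u * S + l)))"

text \<open>The last conjunct includes the padding cells of the rows, since the range minimum
  structure runs over the whole array.\<close>

definition has_M :: "(nat \<Rightarrow> nat \<Rightarrow> nat) \<Rightarrow> bool" where
  "has_M A \<longleftrightarrow> (\<forall>u<n. \<forall>l<n. nearest 0 {v. N u v \<and> ld u v = l} (A 19 (u * S + l))) \<and> (\<forall>p<S*S. A 19 p \<le> n)"

definition has_NN :: "(nat \<Rightarrow> nat \<Rightarrow> nat) \<Rightarrow> bool" where
  "has_NN A \<longleftrightarrow> (\<forall>u<n. \<forall>c<n. nearest c {v. N u v \<and> ld u v \<le> ld u c} (A 20 (u * S + c)))"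

definition all_nil :: "(nat \<Rightarrow> nat \<Rightarrow> nat) \<Rightarrow> bool" where
  "all_nil A \<longleftrightarrow> (\<forall>p<S*S. diam_pair {} (quada A 15 p) \<and> A 19 p = n)"

lemma wp_ball_init_com:
  assumes b: "base s"
  shows "wp W L ball_init_com (1000 * (S * S)) (\<lambda>s'. all_nil (arr s')) s"
proof -
  let ?I = "\<lambda>i A. \<forall>p<i. diam_pair {} (quada A 15 p) \<and> A 19 p = n"
  show ?thesis unfolding ball_init_com_def
  proof (rule wp_mono[OF wp_ForA[where I = ?I and T = 100 and N = "S * S"]], goal_cases)
    case (6 i s1)
    have r: "reg s1 0 = n" "reg s1 5 = i" using 6 baseD[OF b] by (auto simp: fr_def)
    have iL: "i < L" using 6 SS_L by simp
    show ?case
      by (rule wp_vc) (use 6(5) iL in \<open>auto simp: r quada_def diam_pair_def wf_pts_def less_Suc_eq\<close>)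
  next
    case 7
    show ?case by (rule For_le) auto
  qed (use baseD[OF b] in \<open>auto simp: all_nil_def\<close>)
qed

text \<open>The pairs already visited by two nested loops that stand at \<open>x\<close> and
  \<open>y\<close>.\<close>

definition upto :: "nat \<Rightarrow> nat \<Rightarrow> nat \<Rightarrow> nat \<Rightarrow> bool" where
  "upto x y u v \<longleftrightarrow> u < x \<or> u = x \<and> v < y"

lemma wp_ball_edges_com:
  assumes b: "base s" "has_d s" "has_N s" and nil: "all_nil (arr s)"
  shows "wp W L ball_edges_com (1000 * (S * S)) (\<lambda>s'. \<forall>u<n. \<forall>l<n. diam_pair (BE u l) (quada (arr s') 15 (u * S + l))) s"
proof -
  define P where "P x y u l = {(v, 0::nat) | v. N u v \<and> ld u v = l \<and> upto x y u v}" for x y u l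
  let ?I = "\<lambda>x y A. \<forall>u<n. \<forall>l<n. diam_pair (P x y u l) (quada A 15 (u * S + l))"
  show ?thesis unfolding ball_edges_com_def
  proof (rule wp_mono[OF wp_For2A[where I = ?I and T = 300 and N = n and M = n]], goal_cases)
    case (12 x y s1)
    note f = \<open>fr _ s s1\<close>
    have b1: "base s1" "has_d s1" "has_N s1"
      using b base_fr[OF f] has_d_fr[OF f] has_N_fr[OF f] by (auto simp: ldX_def)
    have r: "reg s1 5 = x" "reg s1 6 = y" "x < n" "y < n" "reg s1 2 = S" using 12 b1 by (auto simp: base_def)
    have I: "?I x y (arr s1)" using 12 by simp
    let ?Q = "\<lambda>s''. ?I x (Suc y) (arr s'')"
    show ?case
    proof (rule wp_vc)
      have Nxy: "arr s1 12 (x * S + y) \<noteq> 0 \<longleftrightarrow> N x y" using b1(3) r by (simp add: has_N_def)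
      show "vc W L (If (Read 12 (Ix (Reg 5) (Reg 6)))
        (ldX ;; LDQ 15 29 ;; 24 ::= Reg 6 ;; 25 ::= Const 0 ;; INS ;; STQ 15 29) Skip) ?Q s1"
      proof (cases "N x y")
        case False
        then have "P x (Suc y) u l = P x y u l" for u l by (auto simp: P_def upto_def less_Suc_eq)
        then show ?thesis using I Nxy False r by simp
      next
        case True
        define i where "i = x * S + ld x y"
        have l: "ld x y < n" using ld_less_n r by simp
        have iL: "i < L" using l r by (simp add: i_def)
        have P: "P x (Suc y) u l = (if u = x \<and> l = ld x y then insert (y, 0) (P x y u l) else P x y u l)" for u l
          using True by (auto simp: P_def upto_def less_Suc_eq)
        have "vc W L (ldX ;; LDQ 15 29 ;; 24 ::= Reg 6 ;; 25 ::= Const 0 ;; INS ;; STQ 15 29) ?Q s1"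
          unfolding vc.simps(4)
        proof (rule vc_ldX[OF b1(1,2)], goal_cases)
          case (3 s2)
          then have r2: "reg s2 29 = i" using r by (simp add: i_def)
          show ?case
          proof (rule vc_LDQ, goal_cases)
            case (3 s3)
            let ?s4 = "s3\<lparr>reg := (reg s3)(24 := y, 25 := 0)\<rparr>"
            have q4: "quadr ?s4 = quada (arr s1) 15 i" using 3 \<open>fr ldX s1 s2\<close> r2 by (simp add: fr_def quadr_def quada_def)
            have r4: "reg s3 6 = y" "base ?s4" "has_d ?s4" "arr s3 = arr s1" "reg s3 29 = i"
              using b1 r r2 3 \<open>fr ldX s1 s2\<close> by (auto simp: fr_def base_def has_d_def fun_eq_iff)
            have dp: "diam_pair (P x y x (ld x y)) (quada (arr s1) 15 i)" using I r l by (simp add: i_def)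
            have "vc W L INS (vc W L (STQ 15 29) ?Q) ?s4"
            proof (rule vc_INS[OF r4(2,3), where X = "P x y x (ld x y)"], goal_cases)
              case 1 show ?case unfolding q4 by (rule dp)
            next
              case (4 s5)
              have r5: "reg s5 29 = i" "arr s5 = arr s1" using 4 r4 by (auto simp: fr_def fun_eq_iff)
              have q5: "diam_pair (insert (y, 0) (P x y x (ld x y))) (quadr s5)"
                using 4 q4 diam_pair_ins[OF dp, of "(y, 0)"] r by simp
              show ?case
              proof (rule vc_STQ, goal_cases)
                case (2 s6)
                have "quada (arr s6) 15 (u * S + l) = (if u = x \<and> l = ld x y then quadr s5 else quada (arr s1) 15 (u * S + l))"
                  if "l < n" for u l using 2(2)[of "u * S + l"] that r5 \<open>ld x y < n\<close> by (simp add: i_def index_eq)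
                then show ?case using I q5 P by simp
              qed (use r5 iL in auto)
            qed (use r in auto)
            then show ?case using r4 by simp
          qed (use r2 iL in auto)
        qed (use r in auto)
        then show ?thesis using Nxy True r by simp
      qed
    qed (simp add: ldX_def)
  next
    case 13
    show ?case by (rule For2_le) auto
  next
    case (14 s')
    have "P n 0 u l = BE u l" if "u < n" for u l using that by (auto simp: P_def BE_def upto_def)
    then show ?case using 14 by simp
  next
    case (11 i A)
    have "P i n u l = P (Suc i) 0 u l" for u l using N_less by (auto simp: P_def upto_def less_Suc_eq)
    then show ?case using 11 by simp
  next
    case 10
    then show ?case using nil by (auto simp: all_nil_def P_def upto_def)
  qed (use baseD[OF b(1)] in \<open>auto simp: ldX_def\<close>)
qed

lemma shift_0 [simp]: "shift 0 X = X" by (auto simp: shift_def)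

lemma wf_BS: "wf_pts (BS u l)" using N_less by (auto simp: BS_def wf_pts_def)

lemma wp_ball_prefix_com:
  assumes b: "base s" "has_d s" and B: "\<forall>u<n. \<forall>l<n. diam_pair (BE u l) (quada (arr s) 15 (u * S + l))"
  shows "wp W L ball_prefix_com (1000 * (S * S)) (\<lambda>s'. has_ball (arr s')) s"
proof -
  define P where "P x l u k = (if u < x \<or> u = x \<and> k \<le> l then BS u k else BE u k)" for x l u k
  let ?I = "\<lambda>x l A. \<forall>u<n. \<forall>k<n. diam_pair (P x l u k) (quada A 15 (u * S + k))"
  have B0: "BS u 0 = BE u 0" for u by (auto simp: BS_def BE_def)
  have B1: "BE u (Suc k) \<union> BS u k = BS u (Suc k)" for u k by (auto simp: BS_def BE_def le_Suc_eq)
  show ?thesis unfolding ball_prefix_com_def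
  proof (rule wp_mono[OF wp_For2A[where I = ?I and T = 400 and N = n and M = "n - 1"]], goal_cases)
    case (12 x l s1)
    note f = \<open>fr _ s s1\<close>
    have b1: "base s1" "has_d s1" using b base_fr[OF f] has_d_fr[OF f] by auto
    have r: "reg s1 5 = x" "reg s1 6 = l" "x < n" "l < n - 1" "reg s1 2 = S" using 12 b1 by (auto simp: base_def)
    have lt: "l < n" "Suc l < n" "Suc l < S" using r by auto
    have I: "?I x l (arr s1)" using 12 by simp
    define Q where "Q = (\<lambda>s'' :: ram_state. ?I x (Suc l) (arr s''))"
    let ?s2 = "s1\<lparr>reg := (reg s1)(7 := Suc l, 29 := Suc (x * S + l), 30 := x * S + l)\<rparr>"
    have b2: "base ?s2" "has_d ?s2" using b1 by (auto simp: base_def has_d_def)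
    have dp: "diam_pair (BE x (Suc l)) (quada (arr s1) 15 (Suc (x * S + l)))"
      "diam_pair (BS x l) (quada (arr s1) 15 (x * S + l))"
      using I[rule_format, of x "Suc l"] I[rule_format, of x l] r lt by (auto simp: P_def)
    have vcL: "vc W L (LDQ 15 29) (vc W L (INSP 15 30 0) (vc W L (STQ 15 29) Q)) ?s2"
    proof (rule vc_LDQ, goal_cases)
      case (3 s3)
      have b3: "base s3" "has_d s3" using base_fr[OF 3(1)] has_d_fr[OF 3(1)] b2 by auto
      have r3: "reg s3 29 = Suc (x * S + l)" "reg s3 30 = x * S + l" "arr s3 = arr s1" using 3 by (auto simp: fr_def fun_eq_iff)
      have q3: "quadr s3 = quada (arr s1) 15 (Suc (x * S + l))" using 3 by simp
      show ?case
      proof (rule vc_INSP[OF b3, where X = "BE x (Suc l)" and Y = "BS x l"], goal_cases)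
        case 1 show ?case unfolding q3 by (rule dp)
      next
        case 2 show ?case unfolding r3 by (rule dp)
      next
        case 3 show ?case using wf_BS by simp
      next
        case (7 s4)
        have r4: "reg s4 29 = Suc (x * S + l)" "arr s4 = arr s1" using 7 r3 by (auto simp: fr_def fun_eq_iff)
        have q4: "diam_pair (BS x (Suc l)) (quadr s4)" using 7 B1 by simp
        show ?case
        proof (rule vc_STQ, goal_cases)
          case (2 s5)
          have "quada (arr s5) 15 (u * S + k) = (if u = x \<and> k = Suc l then quadr s4 else quada (arr s1) 15 (u * S + k))"
            if "k < n" for u k using 2(2)[of "u * S + k"] that r4 lt by (simp add: index_eq_Suc)
          moreover have "P x (Suc l) u k = (if u = x \<and> k = Suc l then BS x (Suc l) else P x l u k)" for u k
            by (auto simp: P_def)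
          ultimately show ?case using I q4 by (simp add: Q_def)
        qed (use r4 lt r in auto)
      qed (use r3 lt r in auto)
    qed (use lt r in auto)
    have w: "Suc l < W" using lt by (intro small_W(2)) linarith
    have "wp W L (7 ::= Reg 6 .+ Const 1 ;; 29 ::= Ix (Reg 5) (Reg 7) ;; 30 ::= Ix (Reg 5) (Reg 6) ;;
     LDQ 15 29 ;; INSP 15 30 0 ;; STQ 15 29) 400 Q s1"
      by (rule wp_vc, use vcL in \<open>simp add: r lt w vc_Seq\<close>, simp)
    then show ?case unfolding Q_def .
  next
    case 13
    show ?case by (rule For2_le) auto
  next
    case (14 s')
    then show ?case by (simp add: P_def has_ball_def)
  next
    case (11 i A)
    have "P i (n - 1) u k = P (Suc i) 0 u k" if "k < n" for u k using that B0 by (auto simp: P_def less_Suc_eq)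
    then show ?case using 11 by simp
  next
    case 10
    then show ?case using B B0 by (auto simp: P_def)
  qed (use baseD[OF b(1)] in \<open>auto\<close>)
qed

lemma wp_meet_min_com:
  assumes b: "base s" "has_d s" "has_N s" and nil: "\<forall>p<S*S. arr s 19 p = n"
  shows "wp W L meet_min_com (1000 * (S * S)) (\<lambda>s'. has_M (arr s')) s"
proof -
  define P where "P x y u l = {v. N u v \<and> ld u v = l \<and> upto x y u v}" for x y u l
  let ?I = "\<lambda>x y A. (\<forall>u<n. \<forall>l<n. nearest 0 (P x y u l) (A 19 (u * S + l))) \<and> (\<forall>p<S*S. A 19 p \<le> n)"
  show ?thesis unfolding meet_min_com_def
  proof (rule wp_mono[OF wp_For2A[where I = ?I and T = 300 and N = n and M = n]], goal_cases)
    case (12 x y s1)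
    note f = \<open>fr _ s s1\<close>
    have b1: "base s1" "has_d s1" "has_N s1"
      using b base_fr[OF f] has_d_fr[OF f] has_N_fr[OF f] by (auto simp: ldX_def)
    have r: "reg s1 5 = x" "reg s1 6 = y" "x < n" "y < n" "reg s1 2 = S" using 12 b1 by (auto simp: base_def)
    have I: "?I x y (arr s1)" using 12 by simp
    let ?Q = "\<lambda>s''. ?I x (Suc y) (arr s'')"
    have Nxy: "arr s1 12 (x * S + y) \<noteq> 0 \<longleftrightarrow> N x y" using b1(3) r by (simp add: has_N_def)
    show ?case
    proof (rule wp_vc)
      show "vc W L (If (Read 12 (Ix (Reg 5) (Reg 6)))
        (ldX ;; If (Read 13 (Reg 6) .< Read 13 (Read 19 (Reg 29))) (Write 19 (Reg 29) (Reg 6)) Skip) Skip) ?Q s1"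
      proof (cases "N x y")
        case False
        then have "P x (Suc y) u l = P x y u l" for u l by (auto simp: P_def upto_def less_Suc_eq)
        then show ?thesis using I Nxy False r by simp
      next
        case True
        define i where "i = x * S + ld x y"
        define m where "m = arr s1 19 i"
        have l: "ld x y < n" using ld_less_n r by simp
        have iL: "i < L" "i < S * S" using l r by (simp_all add: i_def)
        have m: "m \<le> n" using I iL by (simp add: m_def)
        have P: "P x (Suc y) u l = (if u = x \<and> l = ld x y then P x y u l \<union> {y} else P x y u l)" for u l
          using True by (auto simp: P_def upto_def less_Suc_eq)
        have "nearest 0 {y} y" using r by (simp add: nearest_def)
        from nearest_union[OF n_pos I[THEN conjunct1, rule_format, OF r(3) l] this]
        have nu: "nearest 0 (P x y x (ld x y) \<union> {y}) (if dt 0 y < dt 0 m then y else m)"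
          unfolding m_def i_def .
        have dy: "d 0 y = dt 0 y" using r by (simp add: dt_def)
        have "vc W L (ldX ;; If (Read 13 (Reg 6) .< Read 13 (Read 19 (Reg 29))) (Write 19 (Reg 29) (Reg 6)) Skip) ?Q s1"
          unfolding vc.simps(4)
        proof (rule vc_ldX[OF b1(1,2)], goal_cases)
          case (3 s2)
          have r2: "reg s2 29 = i" "arr s2 = arr s1" "reg s2 6 = y" using r 3 by (auto simp: i_def fr_def fun_eq_iff)
          have e: "u * S + l = i \<longleftrightarrow> u = x \<and> l = ld x y" if "l < n" for u l
            using that \<open>ld x y < n\<close> by (simp add: i_def index_eq)
          show ?case
          proof (cases "dt 0 y < dt 0 m")
            case True
            have "?I x (Suc y) ((arr s1)(19 := (arr s1 19)(i := y)))"
              using I nu True r by (simp add: P e)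
            then show ?thesis using True m r iL
              by (simp add: r2 m_def[symmetric] has_dD[OF b1(2)] dy)
          next
            case False
            have "?I x (Suc y) (arr s1)"
              using I nu False r e by (auto simp: P m_def i_def)
            then show ?thesis using False m r iL
              by (simp add: r2 m_def[symmetric] has_dD[OF b1(2)] dy)
          qed
        qed (use r in auto)
        then show ?thesis using Nxy True r by simp
      qed
    qed (simp add: ldX_def)
  next
    case 13
    show ?case by (rule For2_le) auto
  next
    case (14 s')
    have "P n 0 u l = {v. N u v \<and> ld u v = l}" if "u < n" for u l using that by (auto simp: P_def upto_def)
    then show ?case using 14 by (simp add: has_M_def)
  next
    case (11 i A)
    have "P i n u l = P (Suc i) 0 u l" for u l using N_less by (auto simp: P_def upto_def less_Suc_eq)
    then show ?case using 11 by simp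
  next
    case 10
    then show ?case using nil by (auto simp: P_def upto_def nearest_def)
  qed (use baseD[OF b(1)] in \<open>auto simp: ldX_def\<close>)
qed

lemma wp_near_init_com:
  assumes b: "base s" "has_N s"
  shows "wp W L near_init_com (1000 * (S * S)) (\<lambda>s'. \<forall>u<n. \<forall>c<n. nearest c {v. N u v \<and> v = c} (arr s' 20 (u * S + c))) s"
proof -
  let ?I = "\<lambda>x y A. \<forall>u<n. \<forall>c<n. upto x y u c \<longrightarrow> nearest c {v. N u v \<and> v = c} (A 20 (u * S + c))"
  show ?thesis unfolding near_init_com_def
  proof (rule wp_mono[OF wp_For2A[where I = ?I and T = 300 and N = n and M = n]], goal_cases)
    case (12 x y s1)
    note f = \<open>fr _ s s1\<close>
    have b1: "base s1" "has_N s1"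
      using b base_fr[OF f] has_N_fr[OF f] by auto
    have r: "reg s1 5 = x" "reg s1 6 = y" "reg s1 2 = S" "reg s1 0 = n" using 12 b1 by (auto simp: base_def)
    have lt: "x < n" "y < n" using 12 by auto
    have Nxy: "arr s1 12 (x * S + y) \<noteq> 0 \<longleftrightarrow> N x y" using b1(2) lt by (simp add: has_N_def)
    have I: "?I x y (arr s1)" using 12 by simp
    define v where "v = (if N x y then y else n)"
    have v: "nearest y {v. N x v \<and> v = y} v"
      using lt by (auto simp: v_def nearest_def)
    have "?I x (Suc y) ((arr s1)(20 := (arr s1 20)(x * S + y := v)))"
    proof (intro allI impI)
      fix u c assume uc: "u < n" "c < n" "upto x (Suc y) u c"
      then have "c < S" "y < S" using lt by auto
      then show "nearest c {v. N u v \<and> v = c} (((arr s1)(20 := (arr s1 20)(x * S + y := v))) 20 (u * S + c))"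
        using uc I v by (auto simp: index_eq upto_def less_Suc_eq)
    qed
    then show ?case
      by (intro wp_vc) (use lt Nxy in \<open>auto simp: r v_def split: if_splits\<close>)
  next
    case 13
    show ?case by (rule For2_le) auto
  qed (use baseD[OF b(1)] in \<open>auto simp: upto_def less_Suc_eq\<close>)
qed

lemma wp_near_up_com:
  assumes b: "base s" "has_d s" "has_par s"
    and G: "\<forall>u<n. \<forall>c<n. nearest c {v. N u v \<and> v = c} (arr s 20 (u * S + c))"
  shows "wp W L near_up_com (1000 * (S * S))
     (\<lambda>s'. \<forall>u<n. \<forall>c<n. nearest c {v. N u v \<and> v \<in> sub c \<and> ld u v \<le> ld u c} (arr s' 20 (u * S + c))) s"
proof -
  \<comment> \<open>The inner loop treats the vertices in descending order, at \<open>x\<close> the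
    vertex \<open>n - 1 - x\<close>; \<open>n - 1 < j + x\<close> marks those already passed to
    their parents.\<close>
  define P where "P u c x = {v. N u v \<and> (v = c \<or>
    (\<exists>j. 0 < j \<and> j < n \<and> par j = c \<and> n - 1 < j + x \<and> u \<notin> sub j \<and> v \<in> sub j))}" for u c x
  let ?I = "\<lambda>u x A. \<forall>w<n. \<forall>c<n. nearest c (P w c (if w < u then n - 1 else if w = u then x else 0)) (A 20 (w * S + c))"
  have P0: "P u c 0 = {v. N u v \<and> v = c}" for u c by (auto simp: P_def)
  have P1: "P u c (n - 1) = {v. N u v \<and> v \<in> sub c \<and> ld u v \<le> ld u c}" if "u < n" "c < n" for u c
  proof -
    have "v \<in> P u c (n - 1) \<longleftrightarrow> v \<in> sub c \<and> ld u v \<le> ld u c" if N: "N u v" for v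
    proof
      have v: "v < n" using N N_less by auto
      assume "v \<in> P u c (n - 1)"
      then consider "v = c" | j where "0 < j" "j < n" "par j = c" "u \<notin> sub j" "v \<in> sub j" by (auto simp: P_def)
      then show "v \<in> sub c \<and> ld u v \<le> ld u c"
      proof cases
        case 2
        then have "v \<in> sub c" using sub_child[of j] by auto
        moreover have "d v u = Suc (d j v + d c u)" using d_cross[of j v u] 2 \<open>u < n\<close> by simp
        then have "2 * ld u v = 2 * ld u c"
          using ld2[of u v] ld2[of u c] d_sym[of u v] d_sym[of u c] v that \<open>c < n\<close> \<open>u < n\<close> \<open>v \<in> sub c\<close>
            d_sub[of j v] 2 by (auto simp: sub_def)
        ultimately show ?thesis by simp
      qed (use \<open>c < n\<close> in auto)
    next
      have v: "v < n" using N N_less by auto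
      assume a: "v \<in> sub c \<and> ld u v \<le> ld u c"
      show "v \<in> P u c (n - 1)"
      proof (cases "v = c")
        case False
        then obtain j where j: "0 < j" "j < n" "par j = c" "v \<in> sub j" using sub_children[of v c] a \<open>c < n\<close> by auto
        have "u \<notin> sub j"
        proof
          assume u: "u \<in> sub j"
          then have "u \<in> sub c" using sub_child[of j] j by auto
          then have "ld u c = dep c" using ld_sub \<open>c < n\<close> by simp
          moreover have "dep j \<le> ld u v" using sub_iff_ld[of j u v] u j v by simp
          ultimately show False using a dep_par[of j] j by simp
        qed
        then show ?thesis using j N by (auto simp: P_def)
      qed (use N in \<open>auto simp: P_def\<close>)
    qed
    then show ?thesis using P_def by auto
  qed
  show ?thesis unfolding near_up_com_def
  proof (rule wp_mono[OF wp_For2A[where I = ?I and T = 300 and N = n and M = "n - 1"]], goal_cases)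
    case (12 u x s1)
    note f = \<open>fr _ s s1\<close>
    have b1: "base s1" "has_d s1" "has_par s1"
      using b base_fr[OF f] has_d_fr[OF f] has_par_fr[OF f] by auto
    have r: "reg s1 5 = u" "reg s1 6 = x" "reg s1 2 = S" "reg s1 4 = n - 1" "reg s1 0 = n" using 12 b1 by (auto simp: base_def)
    have lt: "u < n" "x < n - 1" using 12 by auto
    define c where "c = n - 1 - x"
    define p where "p = par c"
    have c: "0 < c" "c < n" "p < n" "p < c" "arr s1 8 c = p"
      using lt b1(3) par_less[of c] by (auto simp: c_def p_def has_par_def)
    have I: "?I u x (arr s1)" using 12 by simp
    define v where "v = arr s1 20 (u * S + c)"
    define w where "w = arr s1 20 (u * S + p)"
    have nv: "nearest c (P u c x) v" and nw: "nearest p (P u p x) w"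
      using I[rule_format, of u c] I[rule_format, of u p] lt c by (auto simp: v_def w_def)
    have vw: "v \<le> n" "w \<le> n" using nearest_le nv nw by auto
    have cond: "d c u + dep c = dep u \<longleftrightarrow> u \<in> sub c" using lt by (simp add: sub_def)
    have dW: "d c u + dep c < W" using d_lt_n[of c u] d_lt_n[of 0 c] c lt by (intro small_W(2)) linarith
    have Pc: "P u c' (Suc x) = (if c' = p \<and> u \<notin> sub c then P u p x \<union> P u c x else P u c' x)" if "c' < n" for c'
    proof -
      \<comment> \<open>Children have larger numbers than \<open>c\<close> and were merged before,
        so the entry of \<open>c\<close> already covers its whole subtree.\<close>
      have "P u c x = {v. N u v \<and> v \<in> sub c}" if u: "u \<notin> sub c"
      proof -
        have "v \<in> P u c x" if v: "N u v" "v \<in> sub c" for v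
        proof (cases "v = c")
          case False
          then obtain j where j: "0 < j" "j < n" "par j = c" "c < j" "v \<in> sub j" using sub_children[of v c] v c by auto
          moreover have "u \<notin> sub j" using u sub_child[of j] j by auto
          moreover have "n - 1 < j + x" using j lt by (simp add: c_def)
          ultimately show ?thesis using v by (auto simp: P_def)
        qed (use v in \<open>auto simp: P_def\<close>)
        moreover have "v \<in> sub c" if "v \<in> P u c x" for v
          using that sub_child c by (auto simp: P_def)
        ultimately show ?thesis by (auto simp: P_def)
      qed
      moreover have "n - 1 < j + Suc x \<longleftrightarrow> n - 1 < j + x \<or> j = c" for j using lt by (auto simp: c_def)
      ultimately show ?thesis using c by (auto simp: P_def p_def)
    qed
    have dl: "arr s1 13 (c * S + u) = d c u" "arr s1 13 c = dep c" "arr s1 13 u = dep u"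
      "arr s1 13 (p * S + v) = dt p v" "arr s1 13 (p * S + w) = dt p w"
      using has_dD[OF b1(2)] c lt vw by auto
    let ?z = "if u \<notin> sub c \<and> dt p v < dt p w then v else w"
    have upd: "?I u (Suc x) ((arr s1)(20 := (arr s1 20)(u * S + p := ?z)))"
    proof (intro allI impI)
      fix u' c' assume uc: "u' < n" "c' < n"
      have e: "u' * S + c' = u * S + p \<longleftrightarrow> u' = u \<and> c' = p" using uc c by (simp add: index_eq)
      have "nearest p (P u c x) v" if "u \<notin> sub c"
      proof (rule nearest_shift[OF nv])
        fix y assume "y \<in> P u c x"
        then have "y \<in> sub c" using sub_child c by (auto simp: P_def)
        then show "d p y = Suc (d c y)" using d_sub[of c y] c by (simp add: p_def)
      qed
      from nearest_union[OF c(3) nw this]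
      have "nearest p (P u p (Suc x)) ?z" using nw c by (auto simp: Pc)
      then show "nearest c' (P u' c' (if u' < u then n - 1 else if u' = u then Suc x else 0))
          (((arr s1)(20 := (arr s1 20)(u * S + p := ?z))) 20 (u' * S + c'))"
        using I[rule_format, OF uc] e uc by (auto simp: Pc)
    qed
    have triv: "(arr s1)(20 := (arr s1 20)(u * S + p := w)) = arr s1" by (simp add: w_def)
    show ?case
    proof (rule wp_vc)
      define J where "J A \<longleftrightarrow> ?I u (Suc x) A" for A :: "nat \<Rightarrow> nat \<Rightarrow> nat"
      have "J ((arr s1)(20 := (arr s1 20)(u * S + p := ?z)))" unfolding J_def by (rule upd)
      then have z: "u \<notin> sub c \<Longrightarrow> dt p v < dt p w \<Longrightarrow> J ((arr s1)(20 := (arr s1 20)(u * S + p := v)))"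
        "\<not> (u \<notin> sub c \<and> dt p v < dt p w) \<Longrightarrow> J (arr s1)"
        by (auto simp: triv)
      have Sx: "u < S" "c < S" "p < S" "v < S" "w < S" "n - Suc (0 + x) = c" "n - 1 - x = c" "c < L" "n - Suc x = c"
        using lt c vw by (auto simp: c_def)
      have "vc W L (7 ::= Reg 4 .- Reg 6 ;; 8 ::= Read 8 (Reg 7) ;;
         29 ::= Read 20 (Ix (Reg 5) (Reg 7)) ;; 30 ::= Ix (Reg 5) (Reg 8) ;;
         If (Read 13 (Ix (Reg 7) (Reg 5)) .+ Read 13 (Reg 7) .= Read 13 (Reg 5)) Skip
         (If (Read 13 (Ix (Reg 8) (Reg 29)) .< Read 13 (Ix (Reg 8) (Read 20 (Reg 30))))
            (Write 20 (Reg 30) (Reg 29)) Skip)) (\<lambda>s''. J (arr s'')) s1"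
        using z by (simp add: r Sx c dl dW cond v_def[symmetric] w_def[symmetric])
      then show "vc W L (7 ::= Reg 4 .- Reg 6 ;; 8 ::= Read 8 (Reg 7) ;;
         29 ::= Read 20 (Ix (Reg 5) (Reg 7)) ;; 30 ::= Ix (Reg 5) (Reg 8) ;;
         If (Read 13 (Ix (Reg 7) (Reg 5)) .+ Read 13 (Reg 7) .= Read 13 (Reg 5)) Skip
         (If (Read 13 (Ix (Reg 8) (Reg 29)) .< Read 13 (Ix (Reg 8) (Read 20 (Reg 30))))
            (Write 20 (Reg 30) (Reg 29)) Skip)) (\<lambda>s''. ?I u (Suc x) (arr s'')) s1"
        unfolding J_def .
    qed simp
  next
    case 13
    show ?case by (rule For2_le) auto
  next
    case (11 i A)
    have "(if w < i then n - 1 else if w = i then n - 1 else 0) =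
        (if w < Suc i then n - 1 else if w = Suc i then 0 else 0)" for w by auto
    then show ?case using 11(2) by simp
  next
    case (14 s')
    then show ?case by (simp add: P1[symmetric])
  qed (use baseD[OF b(1)] G in \<open>auto simp: P0 P1\<close>)
qed

lemma wp_near_down_com:
  assumes b: "base s" "has_d s" "has_par s"
    and G: "\<forall>u<n. \<forall>c<n. nearest c {v. N u v \<and> v \<in> sub c \<and> ld u v \<le> ld u c} (arr s 20 (u * S + c))"
  shows "wp W L near_down_com (1000 * (S * S)) (\<lambda>s'. has_NN (arr s')) s"
proof -
  define P where "P u c = {v. N u v \<and> v \<in> sub c \<and> ld u v \<le> ld u c}" for u c
  define H where "H u c = {v. N u v \<and> ld u v \<le> ld u c}" for u c
  let ?I = "\<lambda>u x A. \<forall>w<n. \<forall>c<n. nearest c (if w < u \<or> w = u \<and> c \<le> x then H w c else P w c) (A 20 (w * S + c))"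
  have H0: "P u 0 = H u 0" for u using N_less by (auto simp: P_def H_def)
  show ?thesis unfolding near_down_com_def
  proof (rule wp_mono[OF wp_For2A[where I = ?I and T = 300 and N = n and M = "n - 1"]], goal_cases)
    case (12 u x s1)
    note f = \<open>fr _ s s1\<close>
    have b1: "base s1" "has_d s1" "has_par s1"
      using b base_fr[OF f] has_d_fr[OF f] has_par_fr[OF f] by auto
    have r: "reg s1 5 = u" "reg s1 6 = x" "reg s1 2 = S" "reg s1 4 = n - 1" "reg s1 0 = n" using 12 b1 by (auto simp: base_def)
    have lt: "u < n" "x < n - 1" using 12 by auto
    define c where "c = Suc x"
    define p where "p = par c"
    have c: "0 < c" "c < n" "p < n" "p < c" "arr s1 8 c = p"
      using lt b1(3) par_less[of c] by (auto simp: c_def p_def has_par_def)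
    have I: "?I u x (arr s1)" using 12 by simp
    define v where "v = arr s1 20 (u * S + p)"
    define w where "w = arr s1 20 (u * S + c)"
    have nv: "nearest p (H u p) v" and nw: "nearest c (P u c) w"
      using I[rule_format, of u p] I[rule_format, of u c] lt c by (auto simp: v_def w_def c_def)
    have vw: "v \<le> n" "w \<le> n" using nearest_le nv nw by auto
    have dl: "arr s1 13 (c * S + v) = dt c v" "arr s1 13 (c * S + w) = dt c w"
      using has_dD[OF b1(2)] c lt vw by auto
    let ?z = "if dt c v < dt c w then v else w"
    have Hp: "H u p \<subseteq> H u c"
    proof -
      have "ld u p \<le> ld u c"
        using ld2[of u p] ld2[of u c] lt c dep_par[of c] d_tri[of u p c] d_par[of c] by (auto simp: p_def)
      then show ?thesis by (auto simp: H_def)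
    qed
    define Y where "Y = {v \<in> H u p. v \<notin> sub c}"
    have HY: "H u c = P u c \<union> Y"
    proof -
      have "y \<in> H u p" if y: "y \<in> H u c" "y \<notin> sub c" for y
      proof -
        have yn: "y < n" "N u y" using y N_less by (auto simp: H_def)
        have "ld u y \<le> ld u p"
        proof (cases "u \<in> sub c")
          case True
          then have "ld u y < dep c" using sub_iff_ld[of c u y] c y yn by auto
          moreover have "u \<in> sub p" using True sub_child[of c] c by (auto simp: p_def)
          then have "ld u p = dep p" using ld_sub c by simp
          ultimately show ?thesis using dep_par[of c] c by (simp add: p_def)
        next
          case False
          then have "d c u = Suc (d p u)" using d_nsub[of c u] c lt by (simp add: p_def)
          then have "2 * ld u c = 2 * ld u p"
            using ld2[of u p] ld2[of u c] lt c dep_par[of c] d_sym[of u c] d_sym[of u p] by (auto simp: p_def)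
          then show ?thesis using y by (simp add: H_def)
        qed
        then show ?thesis using yn by (simp add: H_def)
      qed
      then show ?thesis using Hp by (auto simp: Y_def P_def H_def)
    qed
    have dY: "d c y = Suc (d p y)" if "y \<in> Y" for y
      using that d_nsub[of c y] c N_less by (auto simp: Y_def H_def p_def)
    have nz: "nearest c (H u c) ?z"
    proof (cases "v \<in> sub c")
      case False
      have "nearest c Y v"
      proof (cases "H u p = {}")
        case True
        then show ?thesis using nv by (auto simp: nearest_def Y_def)
      next
        case ne: False
        then have "v \<in> Y" "Y \<subseteq> H u p" using nv False by (auto simp: nearest_def Y_def)
        then show ?thesis using nv dY ne by (auto simp: nearest_def)
      qed
      from nearest_union[OF c(2) nw this] show ?thesis unfolding HY .
    next
      \<comment> \<open>The best vertex of the parent may be below \<open>c\<close>. It is then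
        among the candidates of \<open>c\<close> as well, and even nearer to \<open>c\<close>, so
        nothing outside the subtree can beat the old entry.\<close>
      case True
      then have vn: "v < n" using sub_less by auto
      then have "v \<in> H u p" using nv by (auto simp: nearest_def split: if_splits)
      then have vP: "v \<in> P u c" using True Hp by (auto simp: P_def H_def)
      then have w: "w \<in> P u c" "d c w \<le> d c v" using nw by (auto simp: nearest_def split: if_splits)
      then have wn: "w < n" using N_less by (auto simp: P_def)
      have z: "?z = w" using w vn wn by (simp add: dt_def)
      have "d p v = Suc (d c v)" using d_sub[of c v] c True by (simp add: p_def)
      then have "d c w \<le> d c y" if "y \<in> Y" for y
        using that dY[OF that] nv w by (auto simp: nearest_def Y_def split: if_splits)
      then show ?thesis unfolding HY z using nw w wn N_less vP
        by (auto simp: nearest_def Y_def H_def split: if_splits)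
    qed
    have upd: "?I u (Suc x) ((arr s1)(20 := (arr s1 20)(u * S + c := ?z)))"
    proof (intro allI impI)
      fix u' c' assume uc: "u' < n" "c' < n"
      have e: "u' * S + c' = u * S + c \<longleftrightarrow> u' = u \<and> c' = c" using uc c by (simp add: index_eq)
      have "(u' < u \<or> u' = u \<and> c' \<le> Suc x) \<longleftrightarrow> (u' < u \<or> u' = u \<and> c' \<le> x) \<or> (u' = u \<and> c' = c)"
        by (auto simp: c_def)
      then show "nearest c' (if u' < u \<or> u' = u \<and> c' \<le> Suc x then H u' c' else P u' c')
          (((arr s1)(20 := (arr s1 20)(u * S + c := ?z))) 20 (u' * S + c'))"
        using I[rule_format, OF uc] e uc nz by auto
    qed
    have triv: "(arr s1)(20 := (arr s1 20)(u * S + c := w)) = arr s1" by (simp add: w_def)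
    show ?case
    proof (rule wp_vc)
      define J where "J A \<longleftrightarrow> ?I u (Suc x) A" for A :: "nat \<Rightarrow> nat \<Rightarrow> nat"
      have "J ((arr s1)(20 := (arr s1 20)(u * S + c := ?z)))" unfolding J_def by (rule upd)
      then have z: "dt c v < dt c w \<Longrightarrow> J ((arr s1)(20 := (arr s1 20)(u * S + c := v)))"
        "\<not> dt c v < dt c w \<Longrightarrow> J (arr s1)"
        by (auto simp: triv)
      have Sx: "u < S" "c < S" "p < S" "v < S" "w < S" "c < L" "c < W"
        using lt c vw by (auto intro!: small_W(2))
      have "vc W L (7 ::= Reg 6 .+ Const 1 ;; 8 ::= Read 8 (Reg 7) ;;
        29 ::= Read 20 (Ix (Reg 5) (Reg 8)) ;; 30 ::= Ix (Reg 5) (Reg 7) ;;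
        If (Read 13 (Ix (Reg 7) (Reg 29)) .< Read 13 (Ix (Reg 7) (Read 20 (Reg 30))))
         (Write 20 (Reg 30) (Reg 29)) Skip) (\<lambda>s''. J (arr s'')) s1"
        using z by (simp add: r c_def[symmetric] Sx c dl v_def[symmetric] w_def[symmetric])
      then show "vc W L (7 ::= Reg 6 .+ Const 1 ;; 8 ::= Read 8 (Reg 7) ;;
        29 ::= Read 20 (Ix (Reg 5) (Reg 8)) ;; 30 ::= Ix (Reg 5) (Reg 7) ;;
        If (Read 13 (Ix (Reg 7) (Reg 29)) .< Read 13 (Ix (Reg 7) (Read 20 (Reg 30))))
         (Write 20 (Reg 30) (Reg 29)) Skip) (\<lambda>s''. ?I u (Suc x) (arr s'')) s1"
        unfolding J_def .
    qed simp
  next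
    case 13
    show ?case by (rule For2_le) auto
  next
    case (11 i A)
    have "(if w < i \<or> w = i \<and> c \<le> n - 1 then H w c else P w c) =
        (if w < Suc i \<or> w = Suc i \<and> c \<le> 0 then H w c else P w c)" if "c < n" for w c
      using that H0 by (auto simp: less_Suc_eq)
    then show ?case using 11(2) by simp
  next
    case 10
    have "(if w < 0 \<or> w = 0 \<and> c \<le> 0 then H w c else P w c) = P w c" for w c
      using H0 by auto
    then show ?case using G by (simp add: P_def)
  qed (use baseD[OF b(1)] in \<open>auto simp: has_NN_def H_def\<close>)
qed

end

section \<open>Range minimum queries\<close>

lemma bit_top: "2 ^ t \<le> (c::nat) \<Longrightarrow> c < 2 ^ Suc t \<Longrightarrow> bit c t"
proof -
  assume "2 ^ t \<le> c" "c < 2 ^ Suc t"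
  then have "c div 2 ^ t = 1" by (intro div_nat_eqI) auto
  then show ?thesis by (simp add: bit_iff_odd)
qed

lemma bit_above: "(c::nat) < 2 ^ t \<Longrightarrow> bit c j \<Longrightarrow> j < t"
proof (rule ccontr)
  assume "c < 2 ^ t" "bit c j" "\<not> j < t"
  moreover from this have "(2::nat) ^ t \<le> 2 ^ j" by (intro power_increasing) auto
  ultimately show False by (simp add: bit_iff_odd)
qed

lemma bit_push: "(c::nat) < 2 ^ q \<Longrightarrow> bit (c + 2 ^ q) j \<longleftrightarrow> bit c j \<or> j = q"
proof -
  assume c: "c < 2 ^ q"
  then have "c + 2 ^ q = or c (2 ^ q)"
    by (intro disjunctive_add) (auto simp: bit_exp_iff dest: bit_above)
  then show ?thesis by (auto simp: bit_or_iff bit_exp_iff)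
qed

lemma bit_pop: "bit ((c::nat) mod 2 ^ t) j \<longleftrightarrow> j < t \<and> bit c j"
  by (simp add: bit_take_bit_iff flip: take_bit_eq_mod)

lemma bit_shift: "bit ((c::nat) div 2 ^ t) j \<longleftrightarrow> bit c (t + j)"
  by (simp add: bit_drop_bit_eq flip: drop_bit_eq_div)

lemma bit_less: "bit (c::nat) j \<Longrightarrow> j < c"
proof -
  assume b: "bit c j"
  have "2 ^ j \<le> c"
  proof (rule ccontr)
    assume "\<not> 2 ^ j \<le> c"
    then show False using b by (simp add: bit_iff_odd)
  qed
  then show ?thesis using less_exp[of j] by linarith
qed

lemma bit_nonzero: "(c::nat) \<noteq> 0 \<longleftrightarrow> (\<exists>j. bit c j)"
  by (metis bit_0_eq bit_eq_iff bot_apply bot_bool_def)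

lemma finite_bit [simp]: "finite {j. bit (c::nat) j}"
  by (rule finite_subset[of _ "{..<c}"]) (auto dest: bit_less)

definition log_com :: com where
  "log_com = For 5 3 (If (Reg 5 .< Const 2) (Write 21 (Reg 5) (Const 0))
     (Write 21 (Reg 5) (Read 21 (Reg 5 .div Const 2) .+ Const 1)))"

text \<open>Register 10 becomes the block length, the binary logarithm of \<open>S * S - 1\<close>
  rounded down.\<close>

definition pow_com :: com where
  "pow_com = 10 ::= Read 21 (Reg 3 .- Const 1) ;; Write 22 (Const 0) (Const 1) ;;
     For 5 10 (6 ::= Reg 5 .+ Const 1 ;; Write 22 (Reg 6) (Read 22 (Reg 5) .+ Read 22 (Reg 5)))"

text \<open>The position of the lowest set bit, computed by halving even numbers.\<close>

definition ctz_com :: com where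
  "ctz_com = For 5 3 (If (Reg 5 .mod Const 2) (Write 23 (Reg 5) (Const 0))
     (If (Reg 5) (Write 23 (Reg 5) (Read 23 (Reg 5 .div Const 2) .+ Const 1)) Skip))"

text \<open>One step of a monotone stack packed into the word in register 6. The top is the highest
  set bit, found by the logarithm table; reduction modulo its power of two pops it. At the start of
  a block the stack is reset.\<close>

definition maskBody :: com where
  "maskBody = 7 ::= Reg 5 .mod Reg 10 ;;
     If (Reg 7)
       (8 ::= Read 21 (Reg 6) ;; 9 ::= (Reg 5 .- Reg 7) .+ Reg 8 ;;
        If ((Const 0 .< Reg 6) .* ((Read 13 (Read 19 (Reg 9)) .< Read 13 (Read 19 (Reg 5))) .= Const 0))
          (6 ::= Reg 6 .mod Read 22 (Reg 8))
          (6 ::= Reg 6 .+ Read 22 (Reg 7) ;; Write 24 (Reg 5) (Reg 6) ;; 5 ::= Reg 5 .+ Const 1))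
       (6 ::= Const 1 ;; Write 24 (Reg 5) (Const 1) ;; 5 ::= Reg 5 .+ Const 1)"

definition mask_com :: com where
  "mask_com = 5 ::= Const 0 ;; 6 ::= Const 0 ;; While (Reg 5 .< Reg 3) maskBody"

definition block_min_com :: com where
  "block_min_com = 11 ::= Reg 3 .div Reg 10 ;;
     For 5 11 (6 ::= Reg 5 .* Reg 10 ;; 7 ::= Reg 6 .+ (Reg 10 .- Const 1) ;;
       Write 25 (Reg 5) (Read 19 (Reg 6 .+ Read 23 (Read 24 (Reg 7)))))"

definition spBody :: com where
  "spBody = 7 ::= Reg 6 .+ Read 22 (Reg 5 .+ Const 1) ;;
     If (Reg 11 .< Reg 7) Skip
       (7 ::= Reg 5 .* Reg 11 .+ Reg 6 ;; 8 ::= Read 25 (Reg 7) ;;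
        9 ::= Read 25 (Reg 7 .+ Read 22 (Reg 5)) ;; 7 ::= Reg 7 .+ Reg 11 ;;
        If (Read 13 (Reg 9) .< Read 13 (Reg 8)) (Write 25 (Reg 7) (Reg 9)) (Write 25 (Reg 7) (Reg 8)))"

definition sparse_com :: com where
  "sparse_com = 12 ::= Read 21 (Reg 11) ;; For 5 12 (For 6 11 spBody)"

lemma wr_phR [simp]:
  "wrr maskBody = {5, 6, 7, 8, 9}" "wra maskBody = {24}"
  "wrr spBody = {7, 8, 9}" "wra spBody = {25}"
  "wrr log_com = {5}" "wra log_com = {21}"
  "wrr pow_com = {5, 6, 10}" "wra pow_com = {22}"
  "wrr ctz_com = {5}" "wra ctz_com = {23}"
  "wrr mask_com = {5, 6, 7, 8, 9}" "wra mask_com = {24}"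
  "wrr block_min_com = {5, 6, 7, 11}" "wra block_min_com = {25}"
  "wrr sparse_com = {5, 6, 7, 8, 9, 12}" "wra sparse_com = {25}"
  by (auto simp: maskBody_def spBody_def log_com_def pow_com_def ctz_com_def mask_com_def block_min_com_def sparse_com_def)

text \<open>Row 0 of the distance matrix contains the depths, so the key is the depth of the stored
  neighbour, or \<open>2 * n\<close> if there is none.\<close>

definition key :: "(nat \<Rightarrow> nat \<Rightarrow> nat) \<Rightarrow> nat \<Rightarrow> nat" where
  "key A p = A 13 (A 19 p)"

definition minv :: "(nat \<Rightarrow> nat \<Rightarrow> nat) \<Rightarrow> nat \<Rightarrow> nat \<Rightarrow> nat \<Rightarrow> bool" where
  "minv A lo hi v \<longleftrightarrow> (\<exists>p. lo \<le> p \<and> p < hi \<and> v = A 19 p) \<and> (\<forall>p. lo \<le> p \<and> p < hi \<longrightarrow> A 13 v \<le> key A p)"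

text \<open>The two ranges may overlap, as in a sparse table.\<close>

lemma minv_union:
  assumes "minv A lo mid v" "minv A mid' hi w" "lo \<le> mid'" "mid' \<le> mid" "mid \<le> hi"
  shows "minv A lo hi (if A 13 w < A 13 v then w else v)"
  unfolding minv_def
proof (intro conjI allI impI)
  show "\<exists>p\<ge>lo. p < hi \<and> (if A 13 w < A 13 v then w else v) = A 19 p"
  proof -
    obtain p q where "lo \<le> p" "p < mid" "v = A 19 p" "mid' \<le> q" "q < hi" "w = A 19 q"
      using assms(1,2) by (auto simp: minv_def)
    then show ?thesis using assms(3-5) by (cases "A 13 w < A 13 v") (auto intro: exI[of _ q] exI[of _ p])
  qed
  fix p assume p: "lo \<le> p \<and> p < hi"
  show "A 13 (if A 13 w < A 13 v then w else v) \<le> key A p"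
  proof (cases "p < mid")
    case True
    then have "A 13 v \<le> key A p" using assms p by (auto simp: minv_def)
    then show ?thesis by auto
  next
    case False
    then have "A 13 w \<le> key A p" using assms p by (auto simp: minv_def)
    then show ?thesis by auto
  qed
qed

text \<open>A strict suffix minimum of the part of a block up to offset \<open>q\<close>. The first
  one at or after a given offset is a minimum of the rest of that part.\<close>

definition sfx :: "(nat \<Rightarrow> nat \<Rightarrow> nat) \<Rightarrow> nat \<Rightarrow> nat \<Rightarrow> nat \<Rightarrow> bool" where
  "sfx A bs q j \<longleftrightarrow> j \<le> q \<and> (\<forall>j'. j < j' \<and> j' \<le> q \<longrightarrow> key A (bs + j) < key A (bs + j'))"

section \<open>Construction of the tables for range minimum queries\<close>

context machine
begin

definition r_lg :: "(nat \<Rightarrow> nat \<Rightarrow> nat) \<Rightarrow> bool" where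
  "r_lg A \<longleftrightarrow> A 21 0 = 0 \<and> (\<forall>j. 0 < j \<and> j < S * S \<longrightarrow> 2 ^ A 21 j \<le> j \<and> j < 2 ^ Suc (A 21 j))"

text \<open>The upper bound on \<open>2 ^ sb\<close> makes every mask a legal index of the bit
  table; the lower bound and \<open>3 \<le> sb\<close> keep the sparse table linear in size.\<close>

definition r_sb :: "nat \<Rightarrow> bool" where
  "r_sb sb \<longleftrightarrow> 3 \<le> sb \<and> 2 ^ sb < S * S \<and> S * S \<le> 2 ^ Suc sb"

definition r_pow :: "(nat \<Rightarrow> nat \<Rightarrow> nat) \<Rightarrow> nat \<Rightarrow> bool" where
  "r_pow A sb \<longleftrightarrow> (\<forall>i\<le>sb. A 22 i = 2 ^ i)"

definition r_ctz :: "(nat \<Rightarrow> nat \<Rightarrow> nat) \<Rightarrow> bool" where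
  "r_ctz A \<longleftrightarrow> (\<forall>m. 0 < m \<and> m < S * S \<longrightarrow> bit m (A 23 m) \<and> (\<forall>j<A 23 m. \<not> bit m j))"

definition r_mask :: "(nat \<Rightarrow> nat \<Rightarrow> nat) \<Rightarrow> nat \<Rightarrow> bool" where
  "r_mask A sb \<longleftrightarrow> (\<forall>p<S*S. \<forall>j. bit (A 24 p) j \<longleftrightarrow> sfx A (p - p mod sb) (p mod sb) j)"

definition r_sp :: "(nat \<Rightarrow> nat \<Rightarrow> nat) \<Rightarrow> nat \<Rightarrow> bool" where
  "r_sp A sb \<longleftrightarrow> (\<forall>k i. i + 2 ^ k \<le> S * S div sb \<longrightarrow>
     minv A (i * sb) ((i + 2 ^ k) * sb) (A 25 (k * (S * S div sb) + i)))"

lemma SS_ge: "9 \<le> S * S"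
  using mult_mono[OF S_ge S_ge] by simp

lemma SS_W: "x \<le> S * S \<Longrightarrow> x < W" "x \<le> S * S \<Longrightarrow> x < L" "x < S * S \<Longrightarrow> Suc x < W"
  using L_ge L_le SS_ge by linarith+

lemma wp_log_com:
  assumes b: "base s"
  shows "wp W L log_com (1000 * (S * S)) (\<lambda>s'. r_lg (arr s')) s"
proof -
  let ?I = "\<lambda>i A. \<forall>j<i. if j = 0 then A 21 j = 0 else 2 ^ A 21 j \<le> j \<and> j < 2 ^ Suc (A 21 j)"
  show ?thesis unfolding log_com_def
  proof (rule wp_mono[OF wp_ForA[where I = ?I and T = 100 and N = "S * S"]], goal_cases)
    case (6 i s1)
    have r: "reg s1 5 = i" using 6 by auto
    have iL: "i < L" "i < W" "i div 2 < L" using 6 SS_W[of i] SS_W[of "i div 2"] by auto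
    define l where "l = arr s1 21 (i div 2)"
    have I: "?I i (arr s1)" using 6 by simp
    have l: "2 ^ Suc l \<le> i" "i < 2 ^ Suc (Suc l)" "Suc l < W" if "2 \<le> i"
    proof -
      have "i div 2 < i" "i div 2 \<noteq> 0" using that by auto
      then have "2 ^ l \<le> i div 2" "i div 2 < 2 ^ Suc l" using I[rule_format, of "i div 2"] by (auto simp: l_def)
      then show *: "2 ^ Suc l \<le> i" "i < 2 ^ Suc (Suc l)" by auto
      show "Suc l < W" using * less_exp[of "Suc l"] iL by linarith
    qed
    show ?case
    proof (rule wp_vc)
      show "vc W L (If (Reg 5 .< Const 2) (Write 21 (Reg 5) (Const 0))
         (Write 21 (Reg 5) (Read 21 (Reg 5 .div Const 2) .+ Const 1))) (\<lambda>s''. ?I (Suc i) (arr s'')) s1"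
        using I iL l by (cases "i < 2") (auto simp: r l_def[symmetric] less_Suc_eq less_2_cases_iff)
    qed simp
  next
    case 7
    show ?case by (rule For_le) auto
  next
    case (8 s')
    then show ?case using SS_ge by (auto simp: r_lg_def split: if_splits)
  qed (use baseD[OF b] in auto)
qed

lemma wp_pow_com:
  assumes b: "base s" "r_lg (arr s)"
  shows "wp W L pow_com (1000 * (S * S)) (\<lambda>s'. r_sb (reg s' 10) \<and> r_pow (arr s') (reg s' 10)) s"
proof -
  define sb where "sb = arr s 21 (S * S - 1)"
  have "0 < S * S - 1" "S * S - 1 < S * S" using SS_ge by linarith+
  then have l: "2 ^ sb \<le> S * S - 1" "S * S - 1 < 2 ^ Suc sb" using b(2) unfolding r_lg_def sb_def by blast+
  have "3 \<le> sb"
  proof (rule ccontr)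
    assume "\<not> 3 \<le> sb"
    then have "(2::nat) ^ Suc sb \<le> 2 ^ 3" by (intro power_increasing) auto
    then show False using l SS_ge by simp
  qed
  then have sb: "r_sb sb" using l SS_ge by (auto simp: r_sb_def)
  have sbS: "sb < S * S" using sb less_exp[of sb] unfolding r_sb_def by linarith
  let ?I = "\<lambda>i A. \<forall>j\<le>i. A 22 j = 2 ^ j"
  let ?c = "6 ::= Reg 5 .+ Const 1 ;; Write 22 (Reg 6) (Read 22 (Reg 5) .+ Read 22 (Reg 5))"
  let ?s2 = "s\<lparr>reg := (reg s)(10 := sb), arr := (arr s)(22 := (arr s 22)(0 := 1))\<rparr>"
  have "wp W L (For 5 10 ?c) (500 * (S * S)) (\<lambda>s'. r_sb (reg s' 10) \<and> r_pow (arr s') (reg s' 10)) ?s2"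
  proof (rule wp_mono[OF wp_ForA[where I = ?I and T = 100 and N = sb]], goal_cases)
    case (6 i s1)
    have r: "reg s1 5 = i" using 6 by auto
    have iL: "i < L" "Suc i < W" "Suc i < L" using 6 sbS SS_W[of i] SS_W[of "Suc i"] by auto
    have "(2::nat) ^ Suc i \<le> 2 ^ sb" using 6 by (intro power_increasing) auto
    then have "(2::nat) ^ i + 2 ^ i \<le> S * S" using sb by (simp add: r_sb_def)
    then have "(2::nat) ^ i + 2 ^ i < W" by (rule SS_W)
    then show ?case
      by (intro wp_vc) (use 6(5) iL in \<open>auto simp: r le_Suc_eq\<close>)
  next
    case 7
    show ?case by (rule For_le) (use sbS in auto)
  next
    case (8 s')
    then have "reg s' 10 = sb" by (auto simp: fr_def)
    then show ?case using 8 sb by (auto simp: r_pow_def)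
  qed auto
  then have "vc W L (Write 22 (Const 0) (Const 1)) (wp W L (For 5 10 ?c) (500 * (S * S)) (\<lambda>s'. r_sb (reg s' 10) \<and> r_pow (arr s') (reg s' 10)))
    (s\<lparr>reg := (reg s)(10 := sb)\<rparr>)"
    using SS_W[of 0] by simp
  from wp_vc_seq[OF this] have "wp W L (Write 22 (Const 0) (Const 1) ;; For 5 10 ?c) (600 * (S * S)) (\<lambda>s'. r_sb (reg s' 10) \<and> r_pow (arr s') (reg s' 10))
    (s\<lparr>reg := (reg s)(10 := sb)\<rparr>)" by (rule wp_mono) (use SS_ge S_ge in auto)
  then have "vc W L (10 ::= Read 21 (Reg 3 .- Const 1)) (wp W L (Write 22 (Const 0) (Const 1) ;; For 5 10 ?c) (600 * (S * S)) (\<lambda>s'. r_sb (reg s' 10) \<and> r_pow (arr s') (reg s' 10))) s"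
    using baseD[OF b(1)] SS_W[of "S * S - 1"] by (simp add: sb_def)
  from wp_vc_seq[OF this] show ?thesis unfolding pow_com_def by (rule wp_mono) (use SS_ge S_ge in auto)
qed

lemma wp_ctz_com:
  assumes b: "base s"
  shows "wp W L ctz_com (1000 * (S * S)) (\<lambda>s'. r_ctz (arr s')) s"
proof -
  let ?I = "\<lambda>i A. \<forall>m. 0 < m \<and> m < i \<longrightarrow> bit m (A 23 m) \<and> (\<forall>j<A 23 m. \<not> bit m j)"
  show ?thesis unfolding ctz_com_def
  proof (rule wp_mono[OF wp_ForA[where I = ?I and T = 100 and N = "S * S"]], goal_cases)
    case (6 i s1)
    have r: "reg s1 5 = i" using 6 by auto
    have iL: "i < L" "i < W" "i div 2 < L" using 6 SS_W[of i] SS_W[of "i div 2"] by auto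
    define c where "c = arr s1 23 (i div 2)"
    have I: "?I i (arr s1)" using 6 by simp
    have c: "bit i (Suc c)" "\<forall>j<Suc c. \<not> bit i j" "Suc c < W" if "even i" "0 < i"
    proof -
      have "i div 2 < i" "i div 2 \<noteq> 0" using that by auto
      then have *: "bit (i div 2) c" "\<forall>j<c. \<not> bit (i div 2) j" using I by (auto simp: c_def)
      then show b1: "bit i (Suc c)" by (simp add: bit_Suc)
      show "\<forall>j<Suc c. \<not> bit i j"
      proof (intro allI impI)
        fix j assume "j < Suc c"
        then show "\<not> bit i j" using * that by (cases j) (auto simp: bit_Suc bit_0)
      qed
      show "Suc c < W" using bit_less[OF b1] iL by linarith
    qed
    show ?case
    proof (rule wp_vc)
      show "vc W L (If (Reg 5 .mod Const 2) (Write 23 (Reg 5) (Const 0))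
         (If (Reg 5) (Write 23 (Reg 5) (Read 23 (Reg 5 .div Const 2) .+ Const 1)) Skip)) (\<lambda>s''. ?I (Suc i) (arr s'')) s1"
      proof (cases "even i")
        case False
        then have "i mod 2 = 1" "0 < i" by (auto simp: odd_iff_mod_2_eq_one elim: oddE)
        then show ?thesis using I iL False by (auto simp: r less_Suc_eq bit_0)
      next
        case True
        then have m: "i mod 2 = 0" by simp
        show ?thesis
        proof (cases "i = 0")
          case False
          then show ?thesis using I iL c True by (auto simp: r m c_def[symmetric] less_Suc_eq)
        qed (use I iL in \<open>auto simp: r\<close>)
      qed
    qed simp
  next
    case 7
    show ?case by (rule For_le) auto
  next
    case (8 s')
    then show ?case by (auto simp: r_ctz_def)
  qed (use baseD[OF b] in auto)
qed

end

context machine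
begin

definition has_keys :: "(nat \<Rightarrow> nat \<Rightarrow> nat) \<Rightarrow> bool" where
  "has_keys A \<longleftrightarrow> (\<forall>p<S*S. A 19 p \<le> n)"

lemma key_cong: "A' 13 = A 13 \<Longrightarrow> A' 19 = A 19 \<Longrightarrow> key A' = key A"
  by (simp add: key_def fun_eq_iff)

lemma sfx_cong: "A' 13 = A 13 \<Longrightarrow> A' 19 = A 19 \<Longrightarrow> sfx A' = sfx A"
  using key_cong[of A' A] by (simp add: sfx_def fun_eq_iff)

lemma mod_Suc_block: "0 < sb \<Longrightarrow> Suc r mod sb \<noteq> 0 \<Longrightarrow> Suc r mod sb = Suc (r mod sb) \<and> Suc r - Suc r mod sb = r - r mod (sb::nat)"
  by (auto simp: mod_Suc split: if_splits)

text \<open>A new cell ends the strict suffix minima with keys at least its own, and these are at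
  the top of the stack. Whatever remains, together with the new cell, is the new set of suffix
  minima.\<close>

lemma wp_mask_com:
  assumes b: "base s" and lg: "r_lg (arr s)" and sb: "r_sb sb" "reg s 10 = sb" and pw: "r_pow (arr s) sb"
    and hk: "has_keys (arr s)"
  shows "wp W L mask_com (1000 * (S * S)) (\<lambda>s'. r_mask (arr s') sb) s"
proof -
  let ?A = "arr s"
  have sb3: "3 \<le> sb" "2 ^ sb < S * S" using sb(1) by (auto simp: r_sb_def)
  \<comment> \<open>In the middle of the pops, \<open>c\<close> contains only suffix minima of the
    cells before \<open>r\<close>, and every suffix minimum already removed has a key at least that
    of \<open>r\<close>.\<close>
  define cok where "cok r c \<longleftrightarrow> r mod sb \<noteq> 0 \<longrightarrow> c < 2 ^ (r mod sb) \<and>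
     (\<forall>j. bit c j \<longrightarrow> sfx ?A (r - r mod sb) (r mod sb - 1) j) \<and>
     (\<forall>j. sfx ?A (r - r mod sb) (r mod sb - 1) j \<and> \<not> bit c j \<longrightarrow> key ?A r \<le> key ?A (r - r mod sb + j))"
    for r and c :: nat
  define mok where "mok A r \<longleftrightarrow> (\<forall>p<r. \<forall>j. bit (A 24 p) j \<longleftrightarrow> sfx ?A (p - p mod sb) (p mod sb) j)"
    for A :: "nat \<Rightarrow> nat \<Rightarrow> nat" and r
  define I where "I s' \<longleftrightarrow> reg s' 5 \<le> S * S \<and> cok (reg s' 5) (reg s' 6) \<and> mok (arr s') (reg s' 5)" for s' :: ram_state
  \<comment> \<open>Amortisation: a push adds at most one bit but advances the position, which
    counts twice; a pop removes a bit.\<close>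
  define m where "m s' = 2 * (S * S - reg s' 5) + card {j. bit (reg s' 6) j}" for s' :: ram_state
  let ?s0 = "s\<lparr>reg := (reg s)(5 := 0, 6 := 0)\<rparr>"
  have w: "wp W L (While (Reg 5 .< Reg 3) maskBody) (m ?s0 * (200 + exp_cost (Reg 5 .< Reg 3) + 1) + (exp_cost (Reg 5 .< Reg 3) + 1))
     (\<lambda>s'. I s' \<and> ev s' (Reg 5 .< Reg 3) = 0) ?s0"
  proof (rule wp_while, goal_cases)
    case 1
    then show ?case by (auto simp: I_def cok_def mok_def)
  next
    case (2 s')
    then show ?case by simp
  next
    case (3 s1)
    note f = \<open>fr maskBody ?s0 s1\<close>
    have r: "reg s1 10 = sb" "reg s1 3 = S * S" "arr s1 21 = ?A 21" "arr s1 22 = ?A 22"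
      "arr s1 13 = ?A 13" "arr s1 19 = ?A 19"
      using f sb baseD[OF b] by (auto simp: fr_def)
    define x where "x = reg s1 5"
    define c where "c = reg s1 6"
    define q where "q = x mod sb"
    have lt: "x < S * S" using 3(4) r by (auto simp: x_def)
    have I: "cok x c" "mok (arr s1) x" using 3(1) by (auto simp: I_def x_def c_def)
    have q: "q < sb" "q \<le> x" using sb3 by (auto simp: q_def)
    have xL: "x < L" "Suc x < W" using SS_W[of x] SS_W(3)[of x] lt by auto
    have kx: "?A 19 x < L" using hk lt by (auto simp: has_keys_def)
    have I': "I s2 \<longleftrightarrow> reg s2 5 \<le> S * S \<and> cok (reg s2 5) (reg s2 6) \<and> mok (arr s2) (reg s2 5)" for s2
      by (simp add: I_def)
    have push: "cok (Suc x) c' \<and> mok ((arr s1)(24 := (arr s1 24)(x := c'))) (Suc x)"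
      if c': "\<And>j. bit c' j \<longleftrightarrow> sfx ?A (x - q) q j" for c'
    proof
      show "mok ((arr s1)(24 := (arr s1 24)(x := c'))) (Suc x)"
        using I(2) c' by (auto simp: mok_def less_Suc_eq q_def)
      show "cok (Suc x) c'"
      proof (cases "Suc x mod sb = 0")
        case False
        then have *: "Suc x mod sb = Suc q" "Suc x - Suc x mod sb = x - q"
          using mod_Suc_block[of sb x] sb3 by (auto simp: q_def)
        have "c' < 2 ^ Suc q"
        proof (rule ccontr)
          assume a: "\<not> c' < 2 ^ Suc q"
          have "c' div 2 ^ Suc q \<noteq> 0" using a by (metis div_eq_0_iff power_eq_0_iff zero_neq_numeral)
          then obtain j where "bit (c' div 2 ^ Suc q) j" using bit_nonzero by blast
          then have "bit c' (Suc q + j)" unfolding bit_shift .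
          then show False using c' by (auto simp: sfx_def)
        qed
        then show ?thesis using c' unfolding cok_def * by auto
      qed (simp add: cok_def)
    qed
    show ?case
    proof (rule wp_vc)
      show "vc W L maskBody (\<lambda>s''. I s'' \<and> m s'' < m s1) s1"
      proof (cases "q = 0")
        case True
        have "bit 1 j \<longleftrightarrow> sfx ?A (x - q) q j" for j
          using True by (auto simp: sfx_def bit_1_iff)
        from push[OF this] have p: "cok (Suc x) 1" "mok ((arr s1)(24 := (arr s1 24)(x := 1))) (Suc x)" by auto
        have "{j. bit (Suc 0) j} = {0}" by (auto simp: bit_Suc_0_iff)
        then show ?thesis using p True lt xL
          by (simp add: maskBody_def r x_def[symmetric] q_def[symmetric] I' m_def)
      next
        case False
        have C: "c < 2 ^ q" "\<And>j. bit c j \<Longrightarrow> sfx ?A (x - q) (q - 1) j"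
          "\<And>j. sfx ?A (x - q) (q - 1) j \<Longrightarrow> \<not> bit c j \<Longrightarrow> key ?A x \<le> key ?A (x - q + j)"
          using I(1) False unfolding cok_def q_def[symmetric] by auto
        have "(2::nat) ^ q \<le> 2 ^ sb" using q by (intro power_increasing) auto
        then have cS: "c < S * S" "c + 2 ^ q \<le> S * S" "2 ^ q \<le> S * S" using C(1) sb3 False
          power_increasing[of "Suc q" sb "2::nat"] q by auto
        define t where "t = ?A 21 c"
        have pwq: "?A 22 q = 2 ^ q" using pw q by (simp add: r_pow_def)
        have t: "bit c t" "c < 2 ^ Suc t" "t < q" if "0 < c"
        proof -
          have 2: "2 ^ t \<le> c" "c < 2 ^ Suc t" using lg cS that by (auto simp: r_lg_def t_def)
          then show "bit c t" by (rule bit_top)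
          then show "t < q" using C(1) bit_above by blast
          show "c < 2 ^ Suc t" by (rule 2)
        qed
        \<comment> \<open>The loop condition reads the top of the stack even if the stack is empty,
          so the logarithm of 0 must lead to a legal cell.\<close>
        have t0: "t = 0" if "c = 0" using lg that by (simp add: r_lg_def t_def)
        have tq: "t < q" using t t0 False by (cases "c = 0") auto
        have xt: "x - q + t < S * S" "x - q + t < L" "x - q + t < W" using tq q lt SS_W[of "x - q + t"] by auto
        have kt: "?A 19 (x - q + t) < L" using hk xt by (auto simp: has_keys_def)
        have "q \<le> S * S" using q sb3(2) less_exp[of sb] by linarith
        then have pwt: "?A 22 t = 2 ^ t" "t < L" "q < L" using pw tq q SS_W[of t] SS_W[of q] by (auto simp: r_pow_def)
        have cL: "c < L" "c + 2 ^ q < W" using cS SS_W by auto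
        show ?thesis
        proof (cases "0 < c \<and> key ?A x \<le> key ?A (x - q + t)")
          case True
          have "cok x (c mod 2 ^ t)" unfolding cok_def q_def[symmetric]
          proof (intro impI conjI allI)
            show "c mod 2 ^ t < 2 ^ q" using C(1) by (meson le_less_trans mod_less_eq_dividend)
            fix j show "sfx ?A (x - q) (q - 1) j" if "bit (c mod 2 ^ t) j" using C(2) that by (simp add: bit_pop)
            assume j: "sfx ?A (x - q) (q - 1) j \<and> \<not> bit (c mod 2 ^ t) j"
            show "key ?A x \<le> key ?A (x - q + j)"
            proof (cases "bit c j")
              case b: True
              then have "j < Suc t" using t(2) True bit_above by blast
              moreover have "\<not> j < t" using j b by (simp add: bit_pop)
              ultimately have "j = t" by simp
              then show ?thesis using True by simp
            qed (use C j in auto)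
          qed
          moreover have "{j. bit (c mod 2 ^ t) j} \<subset> {j. bit c j}" using t(1) True by (auto simp: bit_pop)
          then have "card {j. bit (c mod 2 ^ t) j} < card {j. bit c j}" by (intro psubset_card_mono) auto
          ultimately show ?thesis using True False I(2) lt xL xt kt kx pwt cL
            by (simp add: maskBody_def r x_def[symmetric] q_def[symmetric] c_def[symmetric] t_def[symmetric] I' m_def key_def not_less)
        next
          case nt: False
          have "bit (c + 2 ^ q) j \<longleftrightarrow> sfx ?A (x - q) q j" for j
          proof
            assume "bit (c + 2 ^ q) j"
            then consider "bit c j" | "j = q" using bit_push[OF C(1)] by auto
            then show "sfx ?A (x - q) q j"
            proof cases
              case 1
              then have "0 < c" by (metis bit_0_eq bot_apply bot_bool_def gr0I)
              note t = t[OF this]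
              have kt: "key ?A (x - q + t) < key ?A x" using nt \<open>0 < c\<close> by auto
              have sj: "sfx ?A (x - q) (q - 1) j" using C(2) 1 by simp
              have "j \<le> t" using 1 t(2) bit_above by (metis less_Suc_eq_le)
              then have "key ?A (x - q + j) < key ?A x"
                using sj kt tq unfolding sfx_def by (cases "j = t") (auto dest!: spec[of _ t])
              moreover have "x - q + q = x" using q by simp
              ultimately show ?thesis using sj unfolding sfx_def
                by (metis Suc_pred' False bot_nat_0.not_eq_extremum le_Suc_eq le_SucI)
            qed (simp add: sfx_def)
          next
            assume s: "sfx ?A (x - q) q j"
            show "bit (c + 2 ^ q) j"
            proof (cases "j = q")
              case False
              then have jq: "j < q" using s by (simp add: sfx_def)
              then have "key ?A (x - q + j) < key ?A x" using s q unfolding sfx_def by (auto dest!: spec[of _ q])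
              moreover have "sfx ?A (x - q) (q - 1) j" using s jq unfolding sfx_def by auto
              ultimately have "bit c j" using C(3) by (meson not_less)
              then show ?thesis using bit_push[OF C(1)] by simp
            qed (use bit_push[OF C(1)] in simp)
          qed
          from push[OF this] have p: "cok (Suc x) (c + 2 ^ q)" "mok ((arr s1)(24 := (arr s1 24)(x := c + 2 ^ q))) (Suc x)" by auto
          have "{j. bit (c + 2 ^ q) j} = insert q {j. bit c j}" using bit_push[OF C(1)] by auto
          then have cd: "card {j. bit (c + 2 ^ q) j} \<le> Suc (card {j. bit c j})" by (simp add: card_insert_le_m1 card_insert_if)
          show ?thesis using nt False p cd lt xL xt kt kx pwt pwq cL
            by (auto simp add: maskBody_def r x_def[symmetric] q_def[symmetric] c_def[symmetric] t_def[symmetric] I' m_def key_def not_less)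
        qed
      qed
    qed (simp add: maskBody_def)
  qed
  have "m ?s0 * (200 + exp_cost (Reg 5 .< Reg 3) + 1) + (exp_cost (Reg 5 .< Reg 3) + 1) \<le> 500 * (S * S)"
    using SS_ge S_ge by (simp add: m_def)
  then have w': "wp W L (While (Reg 5 .< Reg 3) maskBody) (500 * (S * S)) (\<lambda>s'. r_mask (arr s') sb) ?s0"
  proof (rule wp_mono[OF w], goal_cases)
    case (1 s')
    have a: "arr s' 13 = ?A 13" "arr s' 19 = ?A 19" "reg s' 3 = S * S" using 1(2) baseD[OF b] by (auto simp: fr_def)
    then have "\<not> reg s' 5 < S * S" using 1(3) by auto
    then have "reg s' 5 = S * S" "mok (arr s') (reg s' 5)" using 1(3) by (auto simp: I_def)
    then show ?case using sfx_cong[OF a(1,2)] by (simp add: r_mask_def mok_def)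
  qed
  have "vc W L (6 ::= Const 0) (wp W L (While (Reg 5 .< Reg 3) maskBody) (500 * (S * S)) (\<lambda>s'. r_mask (arr s') sb)) (s\<lparr>reg := (reg s)(5 := 0)\<rparr>)"
    using w' by simp
  from wp_vc_seq[OF this] have "vc W L (5 ::= Const 0) (wp W L (6 ::= Const 0 ;; While (Reg 5 .< Reg 3) maskBody) (cst (6 ::= Const 0) + 500 * (S * S)) (\<lambda>s'. r_mask (arr s') sb)) s"
    by simp
  from wp_vc_seq[OF this] show ?thesis unfolding mask_com_def by (rule wp_mono) (use SS_ge S_ge in auto)
qed

text \<open>Shifting the mask of \<open>p\<close> by the offset of \<open>l\<close> discards
  everything before \<open>l\<close>; the lowest remaining bit is the first suffix minimum from
  \<open>l\<close> on, hence a minimum of the range.\<close>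

lemma mask_min:
  assumes sb: "r_sb sb" and mk: "r_mask A sb" and cz: "r_ctz A"
    and p: "p < S * S" "l \<le> p" "l div sb = p div sb"
  shows "A 24 p div 2 ^ (l mod sb) < S * S" "minv A l (Suc p) (A 19 (l + A 23 (A 24 p div 2 ^ (l mod sb))))"
    "l + A 23 (A 24 p div 2 ^ (l mod sb)) \<le> p"
proof -
  define q where "q = p mod sb"
  define bs where "bs = p - q"
  define lq where "lq = l mod sb"
  have sb3: "3 \<le> sb" "2 ^ sb < S * S" using sb by (auto simp: r_sb_def)
  have pe: "p = p div sb * sb + q" and le: "l = l div sb * sb + lq" by (simp_all add: q_def lq_def)
  have bl: "bs = p div sb * sb" using pe by (simp add: bs_def)
  have q34: "l = bs + lq" "p = bs + q" using pe le bl p(3) by auto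
  then have q: "q < sb" "lq \<le> q" "l = bs + lq" "p = bs + q" using sb3 p(2) by (auto simp: q_def)
  define m where "m = A 24 p div 2 ^ lq"
  have bm: "bit m j \<longleftrightarrow> sfx A bs q (lq + j)" for j
    using mk p(1) unfolding m_def bit_shift by (simp add: r_mask_def q_def bs_def)
  have "A 24 p < 2 ^ sb"
  proof (rule ccontr)
    assume "\<not> A 24 p < 2 ^ sb"
    then have "A 24 p div 2 ^ sb \<noteq> 0" by (metis div_eq_0_iff power_eq_0_iff zero_neq_numeral)
    then obtain j where "bit (A 24 p div 2 ^ sb) j" using bit_nonzero by blast
    then have "bit (A 24 p) (sb + j)" unfolding bit_shift .
    then have "sfx A (p - p mod sb) (p mod sb) (sb + j)" using mk p(1) by (simp add: r_mask_def)
    then have "sb + j \<le> q" by (simp add: sfx_def q_def)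
    then show False using q(1) by simp
  qed
  then show mS: "A 24 p div 2 ^ (l mod sb) < S * S"
    using sb3 div_le_dividend[of "A 24 p" "2 ^ (l mod sb)"] by linarith
  have m0: "0 < m" using bm[of "q - lq"] q bit_nonzero[of m] by (auto simp: sfx_def)
  define c where "c = A 23 m"
  have c: "bit m c" "\<forall>j<c. \<not> bit m j" using cz m0 mS by (auto simp: r_ctz_def c_def m_def lq_def)
  have cs: "sfx A bs q (lq + c)" using c(1) bm by simp
  \<comment> \<open>Induction from the right end: a cell that is not a suffix minimum has a later
    one with a key at most as large, and before \<open>lq + c\<close> there are no suffix
    minima.\<close>
  have "\<forall>j. lq \<le> j \<and> j \<le> q \<longrightarrow> key A (bs + (lq + c)) \<le> key A (bs + j)"
  proof -
    define K where "K = key A (bs + (lq + c))"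
    have "K \<le> key A (bs + j)" if "lq \<le> j" "j \<le> q" for j
      using that
    proof (induction "q - j" arbitrary: j rule: less_induct)
      case less
      show ?case
      proof (rule ccontr)
        assume lt: "\<not> K \<le> key A (bs + j)"
        have "lq + c \<noteq> j" using lt by (auto simp: K_def)
        moreover have "\<not> lq + c < j" using cs lt less.prems by (auto simp: sfx_def K_def)
        ultimately have jl: "j < lq + c" by simp
        then have "\<not> sfx A bs q j" using c(2) bm[of "j - lq"] less.prems by auto
        then obtain j' where j': "j < j'" "j' \<le> q" "key A (bs + j') \<le> key A (bs + j)"
          using less.prems by (auto simp: sfx_def not_less)
        have "K \<le> key A (bs + j')" by (rule less.hyps) (use j' less.prems in auto)
        then show False using lt j' by simp
      qed
    qed
    then show ?thesis by (simp add: K_def)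
  qed
  then have mn: "key A (l + c) \<le> key A p'" if "l \<le> p'" "p' \<le> p" for p'
    using that q by (auto simp: add.assoc dest!: spec[of _ "p' - bs"])
  have lc: "l + c \<le> p" using cs q by (auto simp: sfx_def)
  then show "l + A 23 (A 24 p div 2 ^ (l mod sb)) \<le> p" by (simp add: c_def m_def lq_def)
  have "minv A l (Suc p) (A 19 (l + c))"
    using mn lc unfolding minv_def key_def by (auto simp: less_Suc_eq_le intro!: exI[of _ "l + c"])
  then show "minv A l (Suc p) (A 19 (l + A 23 (A 24 p div 2 ^ (l mod sb))))" by (simp add: c_def m_def lq_def)
qed

lemma minv_cong: "A' 13 = A 13 \<Longrightarrow> A' 19 = A 19 \<Longrightarrow> minv A' = minv A"
  by (simp add: minv_def key_def fun_eq_iff)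

lemma blocks: "0 < sb \<Longrightarrow> i < S * S div sb \<Longrightarrow> i * sb + sb \<le> S * S"
proof -
  assume "0 < sb" "i < S * S div sb"
  then have "Suc i * sb \<le> S * S div sb * sb" by (intro mult_right_mono) auto
  also have "\<dots> \<le> S * S" by simp
  finally show ?thesis by simp
qed

lemma wp_block_min_com:
  assumes b: "base s" and sb: "r_sb sb" "reg s 10 = sb" and cz: "r_ctz (arr s)" and mk: "r_mask (arr s) sb"
    and hk: "has_keys (arr s)"
  shows "wp W L block_min_com (1000 * (S * S))
    (\<lambda>s'. reg s' 11 = S * S div sb \<and> (\<forall>i<S * S div sb. minv (arr s') (i * sb) ((i + 1) * sb) (arr s' 25 i))) s"
proof -
  let ?A = "arr s"
  define NB where "NB = S * S div sb"
  have sb3: "3 \<le> sb" "sb < S * S" using sb(1) less_exp[of sb] unfolding r_sb_def by linarith+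
  let ?I = "\<lambda>i A. \<forall>j<i. minv ?A (j * sb) ((j + 1) * sb) (A 25 j)"
  let ?c = "6 ::= Reg 5 .* Reg 10 ;; 7 ::= Reg 6 .+ (Reg 10 .- Const 1) ;;
       Write 25 (Reg 5) (Read 19 (Reg 6 .+ Read 23 (Read 24 (Reg 7))))"
  let ?s1 = "s\<lparr>reg := (reg s)(11 := NB)\<rparr>"
  have "wp W L (For 5 11 ?c) (500 * (S * S))
     (\<lambda>s'. reg s' 11 = NB \<and> (\<forall>i<NB. minv (arr s') (i * sb) ((i + 1) * sb) (arr s' 25 i))) ?s1"
  proof (rule wp_mono[OF wp_ForA[where I = ?I and T = 100 and N = NB]], goal_cases)
    case (6 i s1)
    have f: "arr s1 19 = ?A 19" "arr s1 23 = ?A 23" "arr s1 24 = ?A 24" "reg s1 10 = sb" "reg s1 5 = i"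
      using 6 sb by (auto simp: fr_def)
    define p where "p = i * sb + (sb - 1)"
    have p: "p < S * S" "Suc p = (i + 1) * sb" "i * sb \<le> p" "i * sb div sb = p div sb" "i * sb mod sb = 0"
    proof -
      have "p div sb = i" unfolding p_def using sb3 by (subst div_mult_self3) auto
      then show "i * sb div sb = p div sb" using sb3 by simp
    qed (use blocks[of sb i] 6(1) sb3 in \<open>auto simp: p_def NB_def\<close>)
    note mm = mask_min[OF sb(1) mk cz p(1,3,4), unfolded p(5)]
    have mmS: "?A 24 p < S * S" using mm(1) by simp
    define c where "c = ?A 23 (?A 24 p)"
    have c: "minv ?A (i * sb) ((i + 1) * sb) (?A 19 (i * sb + c))" "i * sb + c \<le> p" using mm(2,3) p(2) by (auto simp: c_def)
    have ip: "i \<le> p" using p(3) sb3 mult_le_mono2[of 1 sb i] by linarith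
    have lt: "i < L" "i * sb < W" "p < W" "p < L" "i * sb + c < W" "i * sb + c < L" "?A 24 p < L"
      using SS_W[of p] SS_W[of "i * sb"] SS_W[of "i * sb + c"] SS_W[of "?A 24 p"] SS_W[of i] mmS p(1,3) c(2) ip by auto
    show ?case
    proof (rule wp_vc)
      show "vc W L ?c (\<lambda>s''. ?I (Suc i) (arr s'')) s1"
        using 6(5) c(1) lt by (auto simp: f p_def[symmetric, unfolded One_nat_def] c_def[symmetric] less_Suc_eq)
    qed simp
  next
    case 7
    show ?case by (rule For_le) (auto simp: NB_def)
  next
    case (8 s')
    have a: "arr s' 13 = ?A 13" "arr s' 19 = ?A 19" "reg s' 11 = NB" using 8(2) by (auto simp: fr_def)
    show ?case using 8(3) minv_cong[OF a(1,2)] a(3) by simp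
  qed auto
  then have "vc W L (11 ::= Reg 3 .div Reg 10) (wp W L (For 5 11 ?c) (500 * (S * S))
     (\<lambda>s'. reg s' 11 = NB \<and> (\<forall>i<NB. minv (arr s') (i * sb) ((i + 1) * sb) (arr s' 25 i)))) s"
    using sb baseD[OF b] by (simp add: NB_def)
  from wp_vc_seq[OF this] show ?thesis unfolding block_min_com_def NB_def by (rule wp_mono) (use SS_ge S_ge in auto)
qed

text \<open>Entry \<open>i\<close> of row \<open>k\<close> covers \<open>2 ^ k\<close> whole blocks
  from block \<open>i\<close> on and is obtained from two entries of the previous row. An incomplete
  last block is left out.\<close>

lemma wp_sparse_com:
  assumes b: "base s" and sb: "r_sb sb" and NB: "reg s 11 = S * S div sb" and lg: "r_lg (arr s)" and pw: "r_pow (arr s) sb"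
    and hk: "has_keys (arr s)" and sp: "\<forall>i<S * S div sb. minv (arr s) (i * sb) ((i + 1) * sb) (arr s 25 i)"
  shows "wp W L sparse_com (1000 * (S * S)) (\<lambda>s'. r_sp (arr s') sb) s"
proof -
  let ?A = "arr s"
  define B where "B = S * S div sb"
  define g where "g = ?A 21 B"
  have sb3: "3 \<le> sb" "2 ^ sb < S * S" "S * S \<le> 2 ^ Suc sb" "sb < S * S" using sb less_exp[of sb] unfolding r_sb_def by linarith+
  have Bsb: "B * sb \<le> S * S" by (simp add: B_def)
  have B3: "3 * B \<le> S * S" using Bsb sb3(1) mult_le_mono2[of 3 sb B] by linarith
  have B0: "0 < B" using sb3 by (simp add: B_def div_greater_zero_iff)
  have BS: "B < S * S" using B3 B0 by linarith
  have g: "2 ^ g \<le> B" "B < 2 ^ Suc g" using lg B0 BS by (auto simp: r_lg_def g_def)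
  \<comment> \<open>Blocks have length at least 3, so there are at most \<open>S * S div 3\<close>
    of them, while \<open>2 ^ sb\<close> is at least half of \<open>S * S\<close>. Hence there are
    at most \<open>sb\<close> rows, and the whole table has at most \<open>S * S\<close>
    cells.\<close>
  have gs: "g < sb"
  proof (rule ccontr)
    assume "\<not> g < sb"
    then have "(2::nat) ^ sb \<le> 2 ^ g" by (intro power_increasing) auto
    moreover have "(2::nat) ^ Suc sb = 2 * 2 ^ sb" by simp
    ultimately show False using g(1) B3 sb3(3) B0 by linarith
  qed
  have gB: "Suc g * B \<le> S * S" using Bsb gs mult_le_mono1[of "Suc g" sb B] by (simp add: mult.commute)
  let ?I = "\<lambda>k i A. \<forall>k' i'. i' + 2 ^ k' \<le> B \<longrightarrow> k' \<le> k \<or> k' = Suc k \<and> i' < i \<longrightarrow>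
     minv ?A (i' * sb) ((i' + 2 ^ k') * sb) (A 25 (k' * B + i'))"
  let ?s1 = "s\<lparr>reg := (reg s)(12 := g)\<rparr>"
  have "wp W L (For 5 12 (For 6 11 spBody)) (900 * (S * S)) (\<lambda>s'. r_sp (arr s') sb) ?s1"
  proof (rule wp_mono[OF wp_For2A[where I = ?I and T = 100 and N = g and M = B]], goal_cases)
    case (12 k i s1)
    have f: "arr s1 19 = ?A 19" "arr s1 22 = ?A 22" "arr s1 13 = ?A 13" "reg s1 11 = B" "reg s1 5 = k" "reg s1 6 = i"
      using 12 NB by (auto simp: fr_def B_def)
    have I: "?I k i (arr s1)" using 12 by simp
    have ki: "k < g" "i < B" using 12 by auto
    have pk: "?A 22 (Suc k) = 2 ^ Suc k" "?A 22 k = 2 ^ k" using pw ki gs by (auto simp: r_pow_def)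
    have kW: "Suc k < L" "k < L" "Suc k < W" using ki gs sb3 SS_W[of "Suc k"] SS_W[of k] by auto
    have "(2::nat) ^ Suc k \<le> 2 ^ g" using ki by (intro power_increasing) auto
    then have p2: "2 ^ Suc k \<le> B" using g by linarith
    have w1: "i + 2 * 2 ^ k < W" using ki p2 B3 SS_W[of "i + 2 * 2 ^ k"] by simp
    have "Suc (Suc k) * B \<le> Suc g * B" using ki by (intro mult_right_mono) auto
    then have kB: "k * B + B + B \<le> S * S" using gB by simp
    show ?case
    proof (rule wp_vc)
      define J where "J A \<longleftrightarrow> ?I k (Suc i) A" for A :: "nat \<Rightarrow> nat \<Rightarrow> nat"
      have "vc W L spBody (\<lambda>s''. J (arr s'')) s1"
      proof (cases "B < i + 2 * 2 ^ k")
        case True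
        have "J (arr s1)" unfolding J_def
        proof (intro allI impI)
          fix k' i' assume a: "i' + 2 ^ k' \<le> B" "k' \<le> k \<or> k' = Suc k \<and> i' < Suc i"
          then have "k' \<le> k \<or> k' = Suc k \<and> i' < i" using True by (auto simp: less_Suc_eq)
          then show "minv ?A (i' * sb) ((i' + 2 ^ k') * sb) (arr s1 25 (k' * B + i'))" using I a by blast
        qed
        then show ?thesis using True kW w1 by (simp add: spBody_def f pk)
      next
        case False
        define v where "v = arr s1 25 (k * B + i)"
        define w where "w = arr s1 25 (k * B + i + 2 ^ k)"
        have v: "minv ?A (i * sb) ((i + 2 ^ k) * sb) v" using I[rule_format, of i k] False by (simp add: v_def)
        have w: "minv ?A ((i + 2 ^ k) * sb) ((i + 2 ^ k + 2 ^ k) * sb) w"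
          using I[rule_format, of "i + 2 ^ k" k] False by (simp add: w_def add.assoc)
        have i2: "i + 2 ^ k + 2 ^ k \<le> B" using False by simp
        have lt: "k * B < W" "k * B + i < W" "k * B + i < L" "k * B + i + 2 ^ k < W" "k * B + i + 2 ^ k < L"
          "k * B + i + B < W" "k * B + i + B < L"
          using kB ki i2 by (auto intro!: SS_W)
        define z where "z = (if ?A 13 w < ?A 13 v then w else v)"
        have z: "minv ?A (i * sb) ((i + 2 ^ k + 2 ^ k) * sb) z"
          using minv_union[OF v w] unfolding z_def by simp
        have "v \<le> n" "w \<le> n"
        proof -
          have "x < S * S" if "x < (i + 2 ^ k + 2 ^ k) * sb" for x
            using that i2 Bsb mult_le_mono1[OF i2, of sb] by linarith
          moreover have "(i + 2 ^ k) * sb \<le> (i + 2 ^ k + 2 ^ k) * sb" by simp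
          ultimately show "v \<le> n" "w \<le> n" using v w hk unfolding minv_def has_keys_def by (metis less_le_trans)+
        qed
        then have vw: "v < L" "w < L" by auto
        have "J ((arr s1)(25 := (arr s1 25)(k * B + i + B := z)))" unfolding J_def
        proof (intro allI impI)
          fix k' i' assume a: "i' + 2 ^ k' \<le> B" "k' \<le> k \<or> k' = Suc k \<and> i' < Suc i"
          have "(0::nat) < 2 ^ k'" by simp
          then have i': "i' < B" using a(1) by linarith
          have e: "k' * B + i' = k * B + i + B \<longleftrightarrow> k' = Suc k \<and> i' = i"
            using index_eq[OF i' ki(2), of k' "Suc k"] by (simp add: ac_simps)
          show "minv ?A (i' * sb) ((i' + 2 ^ k') * sb) (((arr s1)(25 := (arr s1 25)(k * B + i + B := z))) 25 (k' * B + i'))"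
          proof (cases "k' = Suc k \<and> i' = i")
            case True
            have "minv ?A (i * sb) ((i + 2 * 2 ^ k) * sb) z" using z by (simp add: mult_2 add.assoc)
            then show ?thesis using True e by simp
          next
            case False
            then have "k' \<le> k \<or> k' = Suc k \<and> i' < i" using a by auto
            then have "minv ?A (i' * sb) ((i' + 2 ^ k') * sb) (arr s1 25 (k' * B + i'))" using I a(1) by blast
            then show ?thesis using e False by simp
          qed
        qed
        then show ?thesis using False kW w1 lt vw
          by (cases "?A 13 w < ?A 13 v") (simp_all add: spBody_def f pk v_def[symmetric] w_def[symmetric] z_def)
      qed
      then show "vc W L spBody (\<lambda>s''. ?I k (Suc i) (arr s'')) s1" unfolding J_def .
    qed (simp add: spBody_def)
  next
    case 13
    have "g * B \<le> S * S" using gB by simp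
    moreover have "g \<le> S * S" using gs sb3 by linarith
    moreover have "g * ((B * (100 + 8) + 6) + 8) + 6 = 108 * (g * B) + 14 * g + 6" by (simp add: algebra_simps)
    ultimately show ?case using SS_ge by linarith
  next
    case (14 s')
    have a: "arr s' 13 = ?A 13" "arr s' 19 = ?A 19" using 14(2) by (auto simp: fr_def)
    have "k \<le> g" if "i + 2 ^ k \<le> B" for i k :: nat
    proof (rule ccontr)
      assume "\<not> k \<le> g"
      then have "(2::nat) ^ Suc g \<le> 2 ^ k" by (intro power_increasing) auto
      then show False using that g by linarith
    qed
    then show ?case using 14(3) minv_cong[OF a] unfolding r_sp_def B_def[symmetric] by simp
  next
    case (11 i A)
    show ?case
    proof (intro allI impI)
      fix k' i' assume a: "i' + 2 ^ k' \<le> B" "k' \<le> Suc i \<or> k' = Suc (Suc i) \<and> i' < 0"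
      have "(0::nat) < 2 ^ k'" by simp
      then have "i' < B" using a(1) by linarith
      then have "k' \<le> i \<or> k' = Suc i \<and> i' < B" using a(2) by auto
      then show "minv ?A (i' * sb) ((i' + 2 ^ k') * sb) (A 25 (k' * B + i'))"
        using 11(2) a(1) by blast
    qed
  next
    case 10
    then show ?case using sp by (auto simp: B_def[symmetric])
  qed (use NB in \<open>auto simp: B_def\<close>)
  then have "vc W L (12 ::= Read 21 (Reg 11)) (wp W L (For 5 12 (For 6 11 spBody)) (900 * (S * S)) (\<lambda>s'. r_sp (arr s') sb)) s"
    using NB BS SS_W[of B] by (simp add: g_def B_def)
  from wp_vc_seq[OF this] show ?thesis unfolding sparse_com_def by (rule wp_mono) (use SS_ge S_ge in auto)
qed

end

section \<open>Rerooting\<close>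

definition subTest :: exp where
  "subTest = (Read 13 (Ix (Reg 6) (Reg 8)) .+ Read 13 (Reg 6) .= Read 13 (Reg 8))"

definition reroot_leaf :: com where
  "reroot_leaf = 29 ::= Ix (Reg 8) (Reg 7) ;; If subTest (LDQ 15 29) NIL ;; STQ 26 8"

text \<open>Children come before parents. Before the pair of vertex \<open>i\<close> is merged into
  that of its parent, the current pair of the parent is saved in arrays 30 to 33; it accounts for
  the parent and the siblings with larger numbers.\<close>

definition reroot_up :: com where
  "reroot_up = 9 ::= Reg 4 .- Reg 8 ;; 13 ::= Read 8 (Reg 9) ;;
     LDQ 26 13 ;; STQ 30 9 ;; INSP 26 9 1 ;; STQ 26 13"

text \<open>The saved suffix and the current prefix of the parent, both moved across the edge, give
  everything outside the subtree of the vertex. Then its own subtree is added to the prefix for the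
  next sibling.\<close>

definition reroot_down :: com where
  "reroot_down = 9 ::= Reg 8 .+ Const 1 ;; 13 ::= Read 8 (Reg 9) ;;
     NIL ;; INSP 30 9 1 ;; INSP 34 13 1 ;; STQ 34 9 ;; LDQ 34 13 ;; INSP 26 9 1 ;; STQ 34 13"

definition reroot_com :: com where
  "reroot_com = For 8 0 reroot_leaf ;; For 8 4 reroot_up ;; (NIL ;; 9 ::= Const 0 ;; STQ 34 9) ;; For 8 4 reroot_down"

lemma wr_X [simp]:
  "wrr reroot_leaf = {20, 21, 22, 23, 29}" "wra reroot_leaf = {26, 27, 28, 29}"
  "wrr reroot_up = {9, 13, 20, 21, 22, 23, 24, 25, 26, 27, 28}" "wra reroot_up = {26, 27, 28, 29, 30, 31, 32, 33}"
  "wrr reroot_down = {9, 13, 20, 21, 22, 23, 24, 25, 26, 27, 28}" "wra reroot_down = {34, 35, 36, 37}"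
  "wrr reroot_com = {8, 9, 13, 20, 21, 22, 23, 24, 25, 26, 27, 28, 29}"
  "wra reroot_com = {26, 27, 28, 29, 30, 31, 32, 33, 34, 35, 36, 37}"
  by (auto simp: reroot_leaf_def reroot_up_def reroot_down_def reroot_com_def)

lemma fr_arr: "fr c s s' \<Longrightarrow> wra c = {} \<Longrightarrow> arr s' = arr s"
  by (auto simp: fr_def fun_eq_iff)

lemma fr_reg: "fr c s s' \<Longrightarrow> r \<notin> wrr c \<Longrightarrow> reg s' r = reg s r"
  by (auto simp: fr_def)

lemma fr_arr1: "fr c s s' \<Longrightarrow> a \<notin> wra c \<Longrightarrow> arr s' a = arr s a"
  by (auto simp: fr_def)

lemma quada_fr: "fr c s s' \<Longrightarrow> wra c \<inter> {b, b + 1, b + 2, b + 3} = {} \<Longrightarrow> quada (arr s') b = quada (arr s) b"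
  by (auto simp: fr_def quada_def fun_eq_iff)

context tree_machine
begin

definition crs :: "nat \<Rightarrow> nat \<Rightarrow> nat \<Rightarrow> bool" where
  "crs a x y \<longleftrightarrow> x \<in> sub a \<and> N x y \<and> y \<notin> sub a"

text \<open>The crossing edges whose lower endpoint is in \<open>R\<close>, as seen from
  \<open>i\<close>: the point is the upper endpoint, its weight the distance from the lower endpoint
  to \<open>i\<close>.\<close>

definition PT :: "nat \<Rightarrow> nat \<Rightarrow> nat set \<Rightarrow> (nat \<times> nat) set" where
  "PT a i R = {(y, d x i) | x y. x \<in> R \<and> crs a x y}"

lemma crs_less: "crs a x y \<Longrightarrow> x < n \<and> y < n"
  using N_less by (auto simp: crs_def)

lemma PT_un: "PT a i (R \<union> R') = PT a i R \<union> PT a i R'"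
  by (auto simp: PT_def)

lemma wf_PT: "i < n \<Longrightarrow> wf_pts (PT a i R)"
  unfolding wf_pts_def PT_def using crs_less d_lt_n by (fastforce intro: less_imp_le)

lemma PT_shift:
  assumes "\<And>x. x \<in> R \<Longrightarrow> x < n \<Longrightarrow> d x p = Suc (d x i)"
  shows "shift 1 (PT a i R) = PT a p R"
proof -
  have *: "d x p = Suc (d x i)" if "x \<in> R" "crs a x y" for x y using assms that crs_less by blast
  show ?thesis
  proof (intro set_eqI iffI)
    fix z assume "z \<in> shift 1 (PT a i R)"
    then obtain x y where "x \<in> R" "crs a x y" "z = (y, d x i + 1)" by (auto simp: shift_def PT_def)
    then have "z = (y, d x p)" "x \<in> R" "crs a x y" using *[of x y] by auto
    then show "z \<in> PT a p R" unfolding PT_def by blast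
  next
    fix z assume "z \<in> PT a p R"
    then obtain x y where "x \<in> R" "crs a x y" "z = (y, d x p)" by (auto simp: PT_def)
    then show "z \<in> shift 1 (PT a i R)" using *[of x y] unfolding shift_def PT_def
      by (intro image_eqI[of _ _ "(y, d x i)"]) auto
  qed
qed

lemma PT_up: "0 < i \<Longrightarrow> i < n \<Longrightarrow> R \<subseteq> sub i \<Longrightarrow> shift 1 (PT a i R) = PT a (par i) R"
proof (rule PT_shift)
  fix x assume "0 < i" "i < n" "R \<subseteq> sub i" "x \<in> R" "x < n"
  then show "d x (par i) = Suc (d x i)" using d_sub[of i x] d_sym[of x i] d_sym[of x "par i"] by auto
qed

lemma PT_down: "0 < i \<Longrightarrow> i < n \<Longrightarrow> R \<inter> sub i = {} \<Longrightarrow> shift 1 (PT a (par i) R) = PT a i R"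
proof (rule PT_shift)
  fix x assume "0 < i" "i < n" "R \<inter> sub i = {}" "x \<in> R" "x < n"
  then show "d x i = Suc (d x (par i))" using d_nsub[of i x] d_sym[of x i] d_sym[of x "par i"] by auto
qed

text \<open>The only source is \<open>u\<close> itself, at distance 0, so this is an entry of the
  precomputed table by level.\<close>

lemma PT_single: "0 < a \<Longrightarrow> a < n \<Longrightarrow> u \<in> sub a \<Longrightarrow> PT a u {u} = BS u (dep a - 1)"
proof -
  assume a: "0 < a" "a < n" "u \<in> sub a"
  have "y \<notin> sub a \<longleftrightarrow> ld u y \<le> dep a - 1" if "N u y" for y
    using sub_iff_ld[of a u y] a that N_less dep_par[of a] by auto
  then show ?thesis using a by (auto simp: PT_def crs_def BS_def)
qed

lemma PT_single_out: "u \<notin> sub a \<Longrightarrow> PT a u {u} = {}"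
  by (auto simp: PT_def crs_def)

definition kids :: "nat \<Rightarrow> (nat \<Rightarrow> bool) \<Rightarrow> nat set" where
  "kids p P = (\<Union>j\<in>{j. 0 < j \<and> j < n \<and> par j = p \<and> P j}. sub j)"

lemma kids_all: "p < n \<Longrightarrow> {p} \<union> kids p (\<lambda>_. True) = sub p"
proof -
  assume p: "p < n"
  have "x \<in> sub p" if "x \<in> kids p (\<lambda>_. True)" for x
    using that sub_child by (auto simp: kids_def)
  moreover have "x \<in> kids p (\<lambda>_. True)" if "x \<in> sub p" "x \<noteq> p" for x
    using sub_children[OF that p] by (auto simp: kids_def)
  ultimately show ?thesis using p by auto
qed

lemma kids_cong: "(\<And>j. 0 < j \<Longrightarrow> j < n \<Longrightarrow> par j = p \<Longrightarrow> P j = P' j) \<Longrightarrow> kids p P = kids p P'"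
  by (auto simp: kids_def)

lemma kids_Un: "kids p P \<union> kids p P' = kids p (\<lambda>j. P j \<or> P' j)"
  unfolding kids_def by blast

lemma kids_insert: "0 < i \<Longrightarrow> i < n \<Longrightarrow> par i = p \<Longrightarrow> kids p (\<lambda>j. P j \<or> j = i) = kids p P \<union> sub i"
  by (auto simp: kids_def)

lemma kids_other: "p \<noteq> par i \<Longrightarrow> kids p (\<lambda>j. P j \<or> j = i) = kids p P"
  by (auto simp: kids_def)

text \<open>The part of the subtree of \<open>p\<close> collected after \<open>x\<close> steps of
  the upward loop.\<close>

definition accR :: "nat \<Rightarrow> nat \<Rightarrow> nat set" where
  "accR p x = {p} \<union> kids p (\<lambda>j. n - 1 < j + x)"

text \<open>Together with \<open>preR\<close> this is the complement of the subtree of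
  \<open>i\<close>. Siblings are split by their numbers because a diametral pair cannot be freed
  from the points of one child.\<close>

definition sufR :: "nat \<Rightarrow> nat set" where
  "sufR i = {par i} \<union> kids (par i) (\<lambda>j. i < j)"

definition preR :: "nat \<Rightarrow> nat \<Rightarrow> nat set" where
  "preR p x = ({..<n} - sub p) \<union> kids p (\<lambda>j. j \<le> x)"

lemma preR_sufR: "0 < i \<Longrightarrow> i < n \<Longrightarrow> i = Suc x \<Longrightarrow> sufR i \<union> preR (par i) x = {..<n} - sub i"
proof -
  assume i: "0 < i" "i < n" "i = Suc x"
  have 1: "y \<notin> sub i" if "y \<in> kids (par i) (\<lambda>j. j \<noteq> i)" for y
  proof -
    obtain j where j: "0 < j" "j < n" "par j = par i" "j \<noteq> i" "y \<in> sub j" using \<open>y \<in> _\<close> by (auto simp: kids_def)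
    then have "sub i \<inter> sub j = {}" using sub_disjoint[of i j] i by simp
    then show ?thesis using j by blast
  qed
  have 2: "y \<in> kids (par i) (\<lambda>j. j \<noteq> i)" if y: "y \<in> sub (par i)" "y \<notin> sub i" "y \<noteq> par i" for y
  proof -
    obtain j where j: "0 < j" "j < n" "par j = par i" "y \<in> sub j" using sub_children[OF y(1,3) par_lt[OF i(1,2)]] by blast
    moreover have "j \<noteq> i" using j y by auto
    ultimately show ?thesis unfolding kids_def by blast
  qed
  have 3: "kids (par i) (\<lambda>j. i < j) \<union> kids (par i) (\<lambda>j. j \<le> x) = kids (par i) (\<lambda>j. j \<noteq> i)"
    unfolding kids_Un by (rule kids_cong) (use i(3) in auto)
  have 4: "y < n" if "y \<in> kids p P" for y p P using that sub_less by (auto simp: kids_def)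
  have "sufR i \<union> preR (par i) x = {par i} \<union> ({..<n} - sub (par i)) \<union> kids (par i) (\<lambda>j. j \<noteq> i)"
    unfolding sufR_def preR_def 3[symmetric] by blast
  also have "\<dots> = {..<n} - sub i"
  proof (intro set_eqI iffI)
    fix y assume "y \<in> {par i} \<union> ({..<n} - sub (par i)) \<union> kids (par i) (\<lambda>j. j \<noteq> i)"
    then show "y \<in> {..<n} - sub i"
      using 1[of y] 4[of y] par_nsub[OF i(1,2)] sub_child[OF i(1,2)] par_lt[OF i(1,2)] by auto
  next
    fix y assume "y \<in> {..<n} - sub i"
    then show "y \<in> {par i} \<union> ({..<n} - sub (par i)) \<union> kids (par i) (\<lambda>j. j \<noteq> i)"
      using 2[of y] by auto
  qed
  finally show ?thesis .
qed

lemma vc_If: "vc W L (If b c1 c2) Q s \<longleftrightarrow> ok W L s b \<and> (if ev s b \<noteq> 0 then vc W L c1 Q s else vc W L c2 Q s)"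
  by simp

lemma subTest_ok:
  assumes "base s" "has_d s" "reg s 6 = a" "reg s 8 = i" "a < n" "i < n"
  shows "ok W L s subTest" "ev s subTest \<noteq> 0 \<longleftrightarrow> i \<in> sub a"
proof -
  have w: "d a i + dep a < W" using d_lt_n[of a i] d_lt_n[of 0 a] assms n_pos by (intro small_W(2)) linarith
  have r: "reg s 2 = S" using assms by (simp add: base_def)
  show "ok W L s subTest" using assms w by (simp add: subTest_def r has_dD[OF assms(2)])
  show "ev s subTest \<noteq> 0 \<longleftrightarrow> i \<in> sub a" using assms by (simp add: subTest_def r has_dD[OF assms(2)] sub_def)
qed

lemma exp_cost_subTest [simp]: "exp_cost subTest = 12"
  by (simp add: subTest_def)

lemma wp_reroot_leaf:
  assumes b: "base s" "has_d s" "has_ball (arr s)" and a: "0 < a" "a < n" "reg s 6 = a" "reg s 7 = dep a - 1"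
  shows "wp W L (For 8 0 reroot_leaf) (200 * S) (\<lambda>s'. \<forall>i<n. diam_pair (PT a i {i}) (quada (arr s') 26 i)) s"
proof -
  let ?I = "\<lambda>x A. \<forall>i<x. diam_pair (PT a i {i}) (quada A 26 i)"
  have dn: "dep a - 1 < n" using d_lt_n[of 0 a] a n_pos by simp
  show ?thesis
  proof (rule wp_mono[OF wp_ForA[where I = ?I and T = 100 and N = n]], goal_cases)
    case (6 i s1)
    note f = \<open>fr _ s s1\<close>
    have b1: "base s1" "has_d s1" using b base_fr[OF f] has_d_fr[OF f] by auto
    have r: "reg s1 8 = i" "reg s1 6 = a" "reg s1 7 = dep a - 1" "reg s1 2 = S"
      using 6 a f b1 by (auto simp: fr_def base_def)
    have q15: "quada (arr s1) 15 = quada (arr s) 15" using quada_fr[OF f] by simp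
    define Q where "Q = (\<lambda>s'' :: ram_state. ?I (Suc i) (arr s''))"
    define j where "j = i * S + (dep a - 1)"
    have jL: "j < L" "j < W" using 6 dn by (auto simp: j_def)
    let ?s2 = "s1\<lparr>reg := (reg s1)(29 := j)\<rparr>"
    have b2: "base ?s2" "has_d ?s2" "reg ?s2 6 = a" "reg ?s2 8 = i" using b1 r by (auto simp: base_def has_d_def)
    have st: "vc W L (STQ 26 8) Q s3"
      if s3: "reg s3 8 = i" "arr s3 = arr s1" "diam_pair (PT a i {i}) (quadr s3)" for s3
    proof (rule vc_STQ, goal_cases)
      case 1
      then show ?case using s3 \<open>i < n\<close> by simp
    next
      case (2 s4)
      then show ?case using s3 6(5) by (auto simp: Q_def less_Suc_eq)
    qed
    have "vc W L (If subTest (LDQ 15 29) NIL) (vc W L (STQ 26 8) Q) ?s2"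
    proof (cases "i \<in> sub a")
      case True
      have "vc W L (LDQ 15 29) (vc W L (STQ 26 8) Q) ?s2"
      proof (rule vc_LDQ, goal_cases)
        case (3 s3)
        have "quadr s3 = quada (arr s) 15 j" using 3 q15 by simp
        then have "diam_pair (PT a i {i}) (quadr s3)"
          using PT_single[OF a(1,2) True] b(3) 6(1) dn by (simp add: has_ball_def j_def)
        then show ?case using st[of s3] 3 r by (simp add: fr_arr fr_reg)
      qed (use jL in auto)
      then show ?thesis using subTest_ok[OF b2(1-4) a(2) 6(1)] True by (simp add: vc_If del: vc.simps)
    next
      case False
      have "vc W L NIL (vc W L (STQ 26 8) Q) ?s2"
      proof (rule vc_NIL[OF b2(1)], goal_cases)
        case (1 s3)
        then show ?case using st[of s3] r PT_single_out[OF False] by (simp add: fr_arr fr_reg)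
      qed
      then show ?thesis using subTest_ok[OF b2(1-4) a(2) 6(1)] False by (simp add: vc_If del: vc.simps)
    qed
    then have "wp W L reroot_leaf 100 Q s1"
      by (intro wp_vc) (use 6(1) dn jL in \<open>simp_all add: reroot_leaf_def vc_Seq r j_def del: vc.simps(5)\<close>)
    then show ?case unfolding Q_def .
  next
    case 7
    show ?case by (rule For_le1) auto
  qed (use baseD[OF b(1)] in auto)
qed

lemma wp_reroot_up:
  assumes b: "base s" "has_d s" "has_par s"
    and q: "\<forall>i<n. diam_pair (PT a i {i}) (quada (arr s) 26 i)"
  shows "wp W L (For 8 4 reroot_up) (600 * S) (\<lambda>s'. (\<forall>i<n. diam_pair (PT a i (sub i)) (quada (arr s') 26 i)) \<and>
     (\<forall>i<n. 0 < i \<longrightarrow> diam_pair (PT a (par i) (sufR i)) (quada (arr s') 30 i))) s"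
proof -
  let ?I = "\<lambda>x A. (\<forall>i<n. diam_pair (PT a i (accR i x)) (quada A 26 i)) \<and>
     (\<forall>i<n. n - 1 < i + x \<longrightarrow> diam_pair (PT a (par i) (sufR i)) (quada A 30 i))"
  have acc0: "accR i 0 = {i}" for i by (auto simp: accR_def kids_def)
  have acc1: "accR i (n - 1) = sub i" if "i < n" for i
  proof -
    have "kids i (\<lambda>j. n - 1 < j + (n - 1)) = kids i (\<lambda>_. True)" by (rule kids_cong) auto
    then show ?thesis using kids_all[OF that] by (simp add: accR_def)
  qed
  show ?thesis
  proof (rule wp_mono[OF wp_ForA[where I = ?I and T = 500 and N = "n - 1"]], goal_cases)
    case (6 x s1)
    note f = \<open>fr _ s s1\<close>
    have b1: "base s1" "has_d s1" "has_par s1" using b base_fr[OF f] has_d_fr[OF f] has_par_fr[OF f] by auto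
    define i where "i = n - 1 - x"
    define p where "p = par i"
    have i: "0 < i" "i < n" "p < n" "p < i" "arr s1 8 i = p"
      using 6(1) b1(3) par_less[of i] by (auto simp: i_def p_def has_par_def)
    have r: "reg s1 8 = x" "reg s1 4 = n - 1" using 6 b1 by (auto simp: base_def)
    have I: "?I x (arr s1)" using 6 by simp
    have ai: "accR i x = sub i"
    proof -
      have "kids i (\<lambda>j. n - 1 < j + x) = kids i (\<lambda>_. True)"
      proof (rule kids_cong)
        fix j assume "0 < j" "j < n" "par j = i"
        then have "i < j" using par_less[of j] by simp
        then show "(n - 1 < j + x) = True" using 6(1) by (simp add: i_def)
      qed
      then show ?thesis using kids_all[OF i(2)] by (simp add: accR_def)
    qed
    have ap: "accR p x = sufR i"
    proof -
      have "kids p (\<lambda>j. n - 1 < j + x) = kids p (\<lambda>j. i < j)"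
        by (rule kids_cong) (use 6(1) in \<open>auto simp: i_def\<close>)
      then show ?thesis by (simp add: accR_def sufR_def p_def)
    qed
    have aS: "accR c (Suc x) = (if c = p then accR p x \<union> sub i else accR c x)" for c
    proof -
      have "kids c (\<lambda>j. n - 1 < j + Suc x) = kids c (\<lambda>j. n - 1 < j + x \<or> j = i)"
        by (rule kids_cong) (use 6(1) in \<open>auto simp: i_def\<close>)
      then show ?thesis using kids_insert[OF i(1,2), of c] kids_other[of c i] by (auto simp: accR_def p_def)
    qed
    have dp: "diam_pair (PT a p (sufR i)) (quada (arr s1) 26 p)" "diam_pair (PT a i (sub i)) (quada (arr s1) 26 i)"
      using I[THEN conjunct1, rule_format, OF i(3)] I[THEN conjunct1, rule_format, OF i(2)] ai ap by auto
    have sh: "shift 1 (PT a i (sub i)) = PT a p (sub i)" using PT_up[OF i(1,2)] by (simp add: p_def)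
    define Q where "Q = (\<lambda>s'' :: ram_state. ?I (Suc x) (arr s''))"
    let ?s2 = "s1\<lparr>reg := (reg s1)(9 := i, 13 := p)\<rparr>"
    have b2: "base ?s2" "has_d ?s2" using b1 by (auto simp: base_def has_d_def)
    have "vc W L (LDQ 26 13) (vc W L (STQ 30 9) (vc W L (INSP 26 9 1) (vc W L (STQ 26 13) Q))) ?s2"
    proof (rule vc_LDQ, goal_cases)
      case (3 s3)
      note f3 = 3(1)
      have r3: "reg s3 9 = i" "reg s3 13 = p" "arr s3 = arr s1" using fr_reg[OF f3] fr_arr[OF f3] by auto
      have q3: "quadr s3 = quada (arr s1) 26 p" using 3 by simp
      have b3: "base s3" "has_d s3" using base_fr[OF f3] has_d_fr[OF f3] b2 by auto
      show ?case
      proof (rule vc_STQ, goal_cases)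
        case (2 s4)
        note f4 = 2(1)
        have b4: "base s4" "has_d s4" using base_fr[OF f4] has_d_fr[OF f4] b3 by auto
        have r4: "reg s4 9 = i" "reg s4 13 = p" using fr_reg[OF f4] r3 by auto
        have q4: "quadr s4 = quada (arr s1) 26 p" using q3 fr_reg[OF f4] by (simp add: quadr_def)
        have a4: "quada (arr s4) 26 = quada (arr s1) 26" using quada_fr[OF f4] r3 by simp
        have c4: "quada (arr s4) 30 j = (if j = i then quada (arr s1) 26 p else quada (arr s1) 30 j)" for j
          using 2(2)[of j] r3 q3 by simp
        show ?case
        proof (rule vc_INSP[OF b4, where X = "PT a p (sufR i)" and Y = "PT a i (sub i)"], goal_cases)
          case 1 show ?case using dp q4 by simp
        next
          case 2 show ?case using dp a4 r4 by simp
        next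
          case 3 show ?case unfolding sh using wf_PT i by simp
        next
          case (7 s5)
          note f5 = 7(1)
          have r5: "reg s5 13 = p" "arr s5 = arr s4" using fr_reg[OF f5] fr_arr[OF f5] r4 by auto
          have q5: "diam_pair (PT a p (accR p (Suc x))) (quadr s5)"
            using 7(2) unfolding sh PT_un[symmetric] by (simp add: aS ap)
          show ?case
          proof (rule vc_STQ, goal_cases)
            case (2 s6)
            have "quada (arr s6) 30 = quada (arr s4) 30" using quada_fr[OF 2(1)] r5 by simp
            then have c6: "diam_pair (PT a (par j) (sufR j)) (quada (arr s6) 30 j)" if "j < n" "n - 1 < j + Suc x" for j
              using c4[of j] dp(1) I that 6(1) by (cases "j = i") (auto simp: p_def i_def)
            have "diam_pair (PT a j (accR j (Suc x))) (quada (arr s6) 26 j)" if "j < n" for j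
              using 2(2)[of j] r5 a4 q5 I that by (cases "j = p") (auto simp: aS)
            then show ?case using c6 by (simp add: Q_def)
          qed (use r5 i in auto)
        qed (use r4 i in auto)
      qed (use r3 i in auto)
    qed (use i in auto)
    then have "wp W L reroot_up 500 Q s1"
      by (intro wp_vc) (use 6(1) i in \<open>simp_all add: reroot_up_def vc_Seq r i_def[symmetric, unfolded One_nat_def] i_def[symmetric, simplified]\<close>)
    then show ?case unfolding Q_def .
  next
    case 7
    show ?case by (rule For_le1) auto
  next
    case (8 s')
    have "n - 1 < i + (n - 1)" if "0 < i" for i using that by simp
    then show ?case using 8(3) acc1 by simp
  qed (use baseD[OF b(1)] q in \<open>auto simp: acc0\<close>)
qed

lemma wp_reroot_down:
  assumes b: "base s" "has_d s" "has_par s"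
    and acc: "\<forall>i<n. diam_pair (PT a i (sub i)) (quada (arr s) 26 i)"
    and suf: "\<forall>i<n. 0 < i \<longrightarrow> diam_pair (PT a (par i) (sufR i)) (quada (arr s) 30 i)"
    and pre0: "diam_pair {} (quada (arr s) 34 0)"
  shows "wp W L (For 8 4 reroot_down) (1100 * S) (\<lambda>s'. \<forall>i<n. diam_pair (PT a i ({..<n} - {i})) (quada (arr s') 34 i)) s"
proof -
  let ?I = "\<lambda>x A. \<forall>i\<le>x. diam_pair (PT a i (preR i x)) (quada A 34 i)"
  have pre_0: "preR 0 0 = {}" by (auto simp: preR_def kids_def)
  have pre1: "preR i (n - 1) = {..<n} - {i}" if "i < n" for i
  proof -
    have "kids i (\<lambda>j. j \<le> n - 1) = kids i (\<lambda>_. True)" by (rule kids_cong) auto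
    moreover have "i \<notin> kids i (\<lambda>_. True)" using par_nsub by (auto simp: kids_def)
    ultimately have "kids i (\<lambda>j. j \<le> n - 1) = sub i - {i}" using kids_all[OF that] by blast
    then show ?thesis using that sub_less by (auto simp: preR_def)
  qed
  show ?thesis
  proof (rule wp_mono[OF wp_ForA[where I = ?I and T = 1000 and N = "n - 1"]], goal_cases)
    case (6 x s1)
    note f = \<open>fr _ s s1\<close>
    have b1: "base s1" "has_d s1" "has_par s1" using b base_fr[OF f] has_d_fr[OF f] has_par_fr[OF f] by auto
    define i where "i = Suc x"
    define p where "p = par i"
    have i: "0 < i" "i < n" "p < n" "p < i" "p \<le> x" "arr s1 8 i = p" "i < W"
    proof -
      show i: "0 < i" "i < n" using 6(1) by (auto simp: i_def)
      show "p < i" using par_less[OF i] by (simp add: p_def)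
      then show "p \<le> x" "p < n" using i by (auto simp: i_def)
      show "arr s1 8 i = p" using b1(3) i by (simp add: has_par_def p_def)
      show "i < W" using i by (intro small_W(2)) linarith
    qed
    have r: "reg s1 8 = x" using 6 by auto
    have I: "?I x (arr s1)" using 6 by simp
    have q1: "quada (arr s1) 26 = quada (arr s) 26" "quada (arr s1) 30 = quada (arr s) 30"
      using quada_fr[OF f] by auto
    have pi: "preR i (Suc x) = {..<n} - sub i"
    proof -
      have "kids i (\<lambda>j. j \<le> Suc x) = kids i (\<lambda>_. False)"
      proof (rule kids_cong)
        fix j assume "0 < j" "j < n" "par j = i"
        then have "i < j" using par_less[of j] by simp
        then show "(j \<le> Suc x) = False" by (simp add: i_def)
      qed
      then show ?thesis by (simp add: preR_def kids_def)
    qed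
    have pS: "preR c (Suc x) = (if c = p then preR p x \<union> sub i else preR c x)" for c
    proof -
      have "kids c (\<lambda>j. j \<le> Suc x) = kids c (\<lambda>j. j \<le> x \<or> j = i)"
        by (rule kids_cong) (auto simp: i_def)
      then show ?thesis using kids_insert[OF i(1,2), of c] kids_other[of c i] by (auto simp: preR_def p_def)
    qed
    have dp: "diam_pair (PT a p (preR p x)) (quada (arr s1) 34 p)" "diam_pair (PT a i (sub i)) (quada (arr s1) 26 i)"
      "diam_pair (PT a p (sufR i)) (quada (arr s1) 30 i)"
      using I i acc suf q1 by (auto simp: p_def)
    have un: "sufR i \<union> preR p x = {..<n} - sub i" using preR_sufR[OF i(1,2)] by (simp add: i_def p_def)
    have sh1: "shift 1 (PT a i (sub i)) = PT a p (sub i)" using PT_up[OF i(1,2)] by (simp add: p_def)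
    have sh2: "shift 1 (PT a p (sufR i)) = PT a i (sufR i)" "shift 1 (PT a p (preR p x)) = PT a i (preR p x)"
      using PT_down[OF i(1,2)] un by (auto simp: p_def)
    define Q where "Q = (\<lambda>s'' :: ram_state. ?I (Suc x) (arr s''))"
    let ?s2 = "s1\<lparr>reg := (reg s1)(9 := i, 13 := p)\<rparr>"
    have b2: "base ?s2" "has_d ?s2" using b1 by (auto simp: base_def has_d_def)
    have tail: "vc W L (STQ 34 9) (vc W L (LDQ 34 13) (vc W L (INSP 26 9 1) (vc W L (STQ 34 13) Q))) s5"
      if b5: "base s5" "has_d s5" and r5: "reg s5 9 = i" "reg s5 13 = p" "arr s5 = arr s1"
        and q5: "diam_pair (PT a i ({..<n} - sub i)) (quadr s5)" for s5
    proof (rule vc_STQ, goal_cases)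
      case (2 s6)
      note f6 = 2(1)
      have b6: "base s6" "has_d s6" using base_fr[OF f6] has_d_fr[OF f6] b5 by auto
      have r6: "reg s6 9 = i" "reg s6 13 = p" using fr_reg[OF f6] r5 by auto
      have a6: "quada (arr s6) 26 = quada (arr s1) 26" using quada_fr[OF f6] r5 by simp
      have c6: "quada (arr s6) 34 j = (if j = i then quadr s5 else quada (arr s1) 34 j)" for j
        using 2(2)[of j] r5 by simp
      show ?case
      proof (rule vc_LDQ, goal_cases)
        case (3 s7)
        note f7 = 3(1)
        have b7: "base s7" "has_d s7" using base_fr[OF f7] has_d_fr[OF f7] b6 by auto
        have r7: "reg s7 9 = i" "reg s7 13 = p" "arr s7 = arr s6" using fr_reg[OF f7] fr_arr[OF f7] r6 by auto
        have q7: "quadr s7 = quada (arr s1) 34 p" using 3(2) c6[of p] i r6 by simp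
        show ?case
        proof (rule vc_INSP[OF b7, where X = "PT a p (preR p x)" and Y = "PT a i (sub i)"], goal_cases)
          case 1 show ?case using dp q7 by simp
        next
          case 2 show ?case using dp a6 r7 by simp
        next
          case 3 show ?case unfolding sh1 using wf_PT i by simp
        next
          case (7 s8)
          note f8 = 7(1)
          have r8: "reg s8 13 = p" "arr s8 = arr s6" using fr_reg[OF f8] fr_arr[OF f8] r7 by auto
          have q8: "diam_pair (PT a p (preR p (Suc x))) (quadr s8)"
            using 7(2) unfolding sh1 PT_un[symmetric] by (simp add: pS)
          show ?case
          proof (rule vc_STQ, goal_cases)
            case (2 s9)
            note st9 = 2(2)
            have "diam_pair (PT a j (preR j (Suc x))) (quada (arr s9) 34 j)" if j: "j \<le> Suc x" for j
            proof -
              consider "j = p" | "j = i" "j \<noteq> p" | "j \<noteq> i" "j \<noteq> p" "j \<le> x" using j le_Suc_eq[of j x] unfolding i_def by blast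
              then show ?thesis
              proof cases
                case 1
                then show ?thesis using st9[of j] r8 q8 by simp
              next
                case 2
                then have "quada (arr s9) 34 j = quadr s5" using st9[of j] r8 c6[of j] by simp
                then show ?thesis using q5 pi 2 by simp
              next
                case 3
                then have "quada (arr s9) 34 j = quada (arr s1) 34 j" using st9[of j] r8 c6[of j] by simp
                then show ?thesis using I 3 by (simp add: pS)
              qed
            qed
            then show ?case by (simp add: Q_def)
          qed (use r8 i in auto)
        qed (use r7 i in auto)
      qed (use r6 i in auto)
    qed (use r5 i in auto)
    have "vc W L NIL (vc W L (INSP 30 9 1) (vc W L (INSP 34 13 1)
        (vc W L (STQ 34 9) (vc W L (LDQ 34 13) (vc W L (INSP 26 9 1) (vc W L (STQ 34 13) Q)))))) ?s2"
    proof (rule vc_NIL[OF b2(1)], goal_cases)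
      case (1 s3)
      note f3 = 1(1)
      have b3: "base s3" "has_d s3" using base_fr[OF f3] has_d_fr[OF f3] b2 by auto
      have r3: "reg s3 9 = i" "reg s3 13 = p" "arr s3 = arr s1" using fr_reg[OF f3] fr_arr[OF f3] by auto
      show ?case
      proof (rule vc_INSP[OF b3, where X = "{}" and Y = "PT a p (sufR i)"], goal_cases)
        case 1 show ?case using \<open>diam_pair {} (quadr s3)\<close> .
      next
        case 2 show ?case using dp r3 by simp
      next
        case 3 show ?case unfolding sh2 using wf_PT i by simp
      next
        case (7 s4)
        note f4 = 7(1)
        have b4: "base s4" "has_d s4" using base_fr[OF f4] has_d_fr[OF f4] b3 by auto
        have r4: "reg s4 9 = i" "reg s4 13 = p" "arr s4 = arr s1" using fr_reg[OF f4] fr_arr[OF f4] r3 by auto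
        show ?case
        proof (rule vc_INSP[OF b4, where X = "PT a i (sufR i)" and Y = "PT a p (preR p x)"], goal_cases)
          case 1 show ?case using 7(2) unfolding sh2 by simp
        next
          case 2 show ?case using dp r4 by simp
        next
          case 3 show ?case unfolding sh2 using wf_PT i by simp
        next
          case (7 s5)
          note f5 = 7(1)
          show ?case
          proof (rule tail)
            show "base s5" "has_d s5" using base_fr[OF f5] has_d_fr[OF f5] b4 by auto
            show "reg s5 9 = i" "reg s5 13 = p" "arr s5 = arr s1" using fr_reg[OF f5] fr_arr[OF f5] r4 by auto
            show "diam_pair (PT a i ({..<n} - sub i)) (quadr s5)"
              using 7(2) unfolding sh2 PT_un[symmetric] un .
          qed
        qed (use r4 i in auto)
      qed (use r3 i in auto)
    qed
    then have "wp W L reroot_down 1000 Q s1"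
      by (intro wp_vc) (use i in \<open>simp_all add: reroot_down_def vc_Seq r i_def[symmetric]\<close>)
    then show ?case unfolding Q_def .
  next
    case 7
    show ?case by (rule For_le1) auto
  next
    case (8 s')
    have "diam_pair (PT a i (preR i (n - 1))) (quada (arr s') 34 i)" if "i < n" for i
      using 8(3) that by simp
    then show ?case using pre1 by simp
  next
    case 5
    then show ?case using pre0 by (simp add: pre_0 PT_def)
  qed (use baseD[OF b(1)] in auto)
qed

text \<open>The source \<open>i\<close> itself is still absent from the result; its own pair is
  already in the table by level and is added by \<open>swap_from\<close>.\<close>

lemma wp_reroot_com:
  assumes b: "base s" "has_d s" "has_par s" "has_ball (arr s)"
    and a: "0 < a" "a < n" "reg s 6 = a" "reg s 7 = dep a - 1"
  shows "wp W L reroot_com (2000 * S) (\<lambda>s'. \<forall>i<n. diam_pair (PT a i ({..<n} - {i})) (quada (arr s') 34 i)) s"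
proof -
  let ?Q = "\<lambda>s'. \<forall>i<n. diam_pair (PT a i ({..<n} - {i})) (quada (arr s') 34 i)"
  let ?R = "(NIL ;; 9 ::= Const 0 ;; STQ 34 9) ;; For 8 4 reroot_down"
  have "wp W L (For 8 0 reroot_leaf) (200 * S) (wp W L (For 8 4 reroot_up ;; ?R) (600 * S + (30 + 1100 * S)) ?Q) s"
  proof (rule wp_mono[OF wp_reroot_leaf[OF b(1,2,4) a]], goal_cases)
    case (2 s1)
    note f1 = 2(2)
    have b1: "base s1" "has_d s1" "has_par s1" using b base_fr[OF f1] has_d_fr[OF f1] has_par_fr[OF f1] by auto
    have "wp W L (For 8 4 reroot_up) (600 * S) (wp W L ?R (30 + 1100 * S) ?Q) s1"
    proof (rule wp_mono[OF wp_reroot_up[OF b1 2(3)]], goal_cases)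
      case (2 s2)
      note f2 = 2(2)
      have b2: "base s2" "has_d s2" "has_par s2" using b1 base_fr[OF f2] has_d_fr[OF f2] has_par_fr[OF f2] by auto
      have "vc W L NIL (vc W L (9 ::= Const 0) (vc W L (STQ 34 9) (wp W L (For 8 4 reroot_down) (1100 * S) ?Q))) s2"
      proof (rule vc_NIL[OF b2(1)], goal_cases)
        case (1 s3)
        note f3 = 1(1)
        let ?s4 = "s3\<lparr>reg := (reg s3)(9 := 0)\<rparr>"
        have "vc W L (STQ 34 9) (wp W L (For 8 4 reroot_down) (1100 * S) ?Q) ?s4"
        proof (rule vc_STQ, goal_cases)
          case (2 s5)
          note f5 = 2(1)
          show ?case
          proof (rule wp_reroot_down)
            have fa: "fr (NIL ;; 9 ::= Const 0 ;; STQ 34 9) s2 s5" using f3 f5 by (auto simp: fr_def)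
            show "base s5" "has_d s5" "has_par s5" using b2 base_fr[OF fa] has_d_fr[OF fa] has_par_fr[OF fa] by auto
            have "quada (arr s5) 26 = quada (arr s2) 26" "quada (arr s5) 30 = quada (arr s2) 30" using quada_fr[OF fa] by auto
            then show "\<forall>i<n. diam_pair (PT a i (sub i)) (quada (arr s5) 26 i)"
              "\<forall>i<n. 0 < i \<longrightarrow> diam_pair (PT a (par i) (sufR i)) (quada (arr s5) 30 i)"
              using \<open>(\<forall>i<n. diam_pair (PT a i (sub i)) (quada (arr s2) 26 i)) \<and> _\<close> by auto
            show "diam_pair {} (quada (arr s5) 34 0)" using 2(2)[of 0] 1(2) by (simp add: quadr_def)
          qed
        qed (use n_pos in auto)
        then show ?case by simp
      qed
      then have "wp W L (NIL ;; 9 ::= Const 0 ;; STQ 34 9) 30 (wp W L (For 8 4 reroot_down) (1100 * S) ?Q) s2"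
        by (intro wp_vc) (simp_all add: vc_Seq)
      then show ?case by (rule wp_seq)
    qed simp
    then show ?case by (rule wp_seq)
  qed simp
  from wp_seq[OF this] show ?thesis unfolding reroot_com_def by (rule wp_mono) (use S_ge in auto)
qed

end

section \<open>Best swap edges\<close>

text \<open>Evaluates the candidate in register 24 by the diametral pair of the current lower
  endpoint and updates the best value and edge in registers 14 to 16. The missing vertex has value
  at least \<open>2 * n\<close> and never wins.\<close>

definition CONS :: com where
  "CONS = 25 ::= Read 13 (Ix (Reg 20) (Reg 24)) .+ Reg 21 ;; 26 ::= Read 13 (Ix (Reg 22) (Reg 24)) .+ Reg 23 ;;
     If (Reg 25 .< Reg 26) (25 ::= Reg 26) Skip ;;
     If (Reg 25 .< Reg 14) (14 ::= Reg 25 ;; 15 ::= Reg 8 ;; 16 ::= Reg 24) Skip"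

text \<open>The minima of the at most four pieces of the range are not compared by key; each is
  evaluated as a candidate at once.\<close>

definition RQ :: com where
  "RQ = 27 ::= Reg 17 .div Reg 10 ;; 28 ::= Reg 18 .div Reg 10 ;;
     If (Reg 27 .= Reg 28)
       (24 ::= Read 19 (Reg 17 .+ Read 23 (Read 24 (Reg 18) .div Read 22 (Reg 17 .mod Reg 10))) ;; CONS)
       (19 ::= Reg 27 .* Reg 10 .+ (Reg 10 .- Const 1) ;;
        24 ::= Read 19 (Reg 17 .+ Read 23 (Read 24 (Reg 19) .div Read 22 (Reg 17 .mod Reg 10))) ;; CONS ;;
        24 ::= Read 19 (Reg 28 .* Reg 10 .+ Read 23 (Read 24 (Reg 18))) ;; CONS ;;
        19 ::= Reg 28 .- Reg 27 .- Const 1 ;;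
        If (Reg 19)
          (9 ::= Read 21 (Reg 19) ;; 13 ::= Reg 9 .* Reg 11 .+ (Reg 27 .+ Const 1) ;;
           24 ::= Read 25 (Reg 13) ;; CONS ;;
           13 ::= Reg 9 .* Reg 11 .+ (Reg 28 .- Read 22 (Reg 9)) ;;
           24 ::= Read 25 (Reg 13) ;; CONS) Skip)"

text \<open>Register 17 is the distance of the centre from the first point, register 18 the level
  where the path between the two points turns; the test is that of \<open>point\<close>.\<close>

definition CEN :: "nat \<Rightarrow> com" where
  "CEN c = 17 ::= (Read 13 (Ix (Reg 20) (Reg 22)) .+ Reg 23 .+ Const c .- Reg 21) .div Const 2 ;;
     18 ::= (Read 13 (Reg 20) .+ Read 13 (Reg 22) .- Read 13 (Ix (Reg 20) (Reg 22))) .div Const 2 ;;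
     If (Read 13 (Reg 20) .< Reg 17 .+ Reg 18)
       (19 ::= Read 14 (Ix (Reg 22) (Read 13 (Ix (Reg 20) (Reg 22)) .- Reg 17)))
       (19 ::= Read 14 (Ix (Reg 20) (Reg 17)))"

definition QRY :: "nat \<Rightarrow> com" where
  "QRY c = CEN c ;; 24 ::= Read 20 (Ix (Reg 8) (Reg 19)) ;; CONS ;;
     17 ::= (Read 13 (Reg 8) .+ Read 13 (Reg 19) .- Read 13 (Ix (Reg 8) (Reg 19))) .div Const 2 .+ Const 1 ;;
     If (Reg 7 .< Reg 17) Skip (17 ::= Ix (Reg 8) (Reg 17) ;; 18 ::= Ix (Reg 8) (Reg 7) ;; RQ)"

definition swap_from :: com where
  "swap_from = If subTest (LDQ 34 8 ;; 29 ::= Ix (Reg 8) (Reg 7) ;; INSP 15 29 0 ;; QRY 0 ;; QRY 1) Skip"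

lemma wr_Q [simp]:
  "wrr CONS = {14, 15, 16, 25, 26}" "wra CONS = {}"
  "wrr RQ = {9, 13, 14, 15, 16, 19, 24, 25, 26, 27, 28}" "wra RQ = {}"
  "wrr (CEN c) = {17, 18, 19}" "wra (CEN c) = {}"
  "wrr (QRY c) = {9, 13, 14, 15, 16, 17, 18, 19, 24, 25, 26, 27, 28}" "wra (QRY c) = {}"
  "wrr swap_from = {9, 13, 14, 15, 16, 17, 18, 19, 20, 21, 22, 23, 24, 25, 26, 27, 28, 29}" "wra swap_from = {}"
  by (auto simp: CONS_def RQ_def CEN_def QRY_def swap_from_def)

context machine
begin

lemma sp_index:
  assumes "r_sb sb" "i + 2 ^ k \<le> S * S div sb"
  shows "k < sb" "k * (S * S div sb) + i < S * S"
proof -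
  define B where "B = S * S div sb"
  have sb3: "3 \<le> sb" "S * S \<le> 2 ^ Suc sb" using assms(1) by (auto simp: r_sb_def)
  have Bsb: "B * sb \<le> S * S" by (simp add: B_def)
  have B3: "3 * B \<le> S * S" using Bsb sb3(1) mult_le_mono2[of 3 sb B] by linarith
  have iB: "i + 2 ^ k \<le> B" using assms(2) by (simp add: B_def)
  have p: "(0::nat) < 2 ^ k" by simp
  show k: "k < sb"
  proof (rule ccontr)
    assume "\<not> k < sb"
    then have "(2::nat) ^ sb \<le> 2 ^ k" by (intro power_increasing) auto
    moreover have "(2::nat) ^ Suc sb = 2 * 2 ^ sb" by simp
    ultimately show False using iB B3 sb3(2) p by linarith
  qed
  have "Suc k * B \<le> sb * B" using k by (intro mult_right_mono) auto
  then have "k * B + B \<le> S * S" using Bsb by (simp add: mult.commute)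
  then show "k * (S * S div sb) + i < S * S" using iB p unfolding B_def[symmetric] by linarith
qed

end

context tree_machine
begin

definition K :: "nat \<Rightarrow> nat \<Rightarrow> nat \<Rightarrow> nat" where
  "K a u v = Max {d x u + d y v | x y. crs a x y}"

lemma crs_sum: "crs a x y \<Longrightarrow> u < n \<Longrightarrow> v < n \<Longrightarrow> d x u + d y v < 2 * n"
  using crs_less[of a x y] d_lt_n[of x u] d_lt_n[of y v] by auto

lemma K_set: "u < n \<Longrightarrow> v < n \<Longrightarrow> finite {d x u + d y v | x y. crs a x y}"
proof (rule finite_subset)
  assume "u < n" "v < n"
  then show "{d x u + d y v | x y. crs a x y} \<subseteq> {..<2 * n}" using crs_sum by auto
qed simp

lemma ecc_K:
  assumes q: "diam_pair (PT a u {..<n}) q" and ne: "PT a u {..<n} \<noteq> {}" and uv: "u < n" "v < n"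
  shows "ecc q v = K a u v"
proof -
  let ?M = "{d x u + d y v | x y. crs a x y}"
  have in1: "d (fst r) v + snd r \<in> ?M" if "r \<in> PT a u {..<n}" for r
  proof -
    obtain x y where "crs a x y" "r = (y, d x u)" using \<open>r \<in> _\<close> by (auto simp: PT_def)
    then have "crs a x y" "d (fst r) v + snd r = d x u + d y v" by auto
    then show ?thesis by blast
  qed
  have "ecc q v \<in> ?M"
    using in1[of "fst q"] in1[of "snd q"] diam_pair_in[OF q ne] unfolding ecc_def by (simp add: max_def)
  moreover have "z \<le> ecc q v" if z: "z \<in> ?M" for z
  proof -
    obtain x y where xy: "crs a x y" "z = d x u + d y v" using z by auto
    then have "(y, d x u) \<in> PT a u {..<n}" using crs_less by (auto simp: PT_def)
    from ecc_ge[OF q this uv(2)] show ?thesis using xy by simp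
  qed
  ultimately show ?thesis unfolding K_def using K_set[OF uv] by (intro Max_eqI[symmetric]) auto
qed

lemma K_less: "crs a x y \<Longrightarrow> u < n \<Longrightarrow> v < n \<Longrightarrow> K a u v < 2 * n"
proof -
  assume a: "crs a x y" "u < n" "v < n"
  have "K a u v \<in> {d x u + d y v | x y. crs a x y}" unfolding K_def using K_set a by (intro Max_in) auto
  then show ?thesis using crs_sum a by auto
qed

text \<open>\<open>Z\<close> collects the pairs tried so far. The initial value \<open>2 * n\<close>
  means that none has been found; it exceeds every \<open>K\<close> by
  \<open>K_less\<close>.\<close>

definition Bst :: "nat \<Rightarrow> ram_state \<Rightarrow> (nat \<times> nat) set \<Rightarrow> bool" where
  "Bst a s Z \<longleftrightarrow> reg s 14 \<le> 2 * n \<and> (\<forall>(u, v)\<in>Z. reg s 14 \<le> K a u v) \<and>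
     (reg s 14 < 2 * n \<longrightarrow> crs a (reg s 15) (reg s 16) \<and> K a (reg s 15) (reg s 16) = reg s 14)"

definition cx :: "nat \<Rightarrow> nat \<Rightarrow> ram_state \<Rightarrow> bool" where
  "cx a u s \<longleftrightarrow> base s \<and> has_d s \<and> u \<in> sub a \<and> reg s 8 = u \<and> diam_pair (PT a u {..<n}) (quadr s) \<and> PT a u {..<n} \<noteq> {}"

lemma cx_fr: "fr c s s' \<Longrightarrow> wrr c \<inter> {0, 2, 3, 4, 8, 20, 21, 22, 23} = {} \<Longrightarrow> 13 \<notin> wra c \<Longrightarrow> cx a u s \<Longrightarrow> cx a u s'"
  using base_fr[of c s s'] has_d_fr[of c s s'] by (auto simp: cx_def quadr_def fr_reg)

lemma cx_upd [simp]: "r \<notin> {0, 2, 3, 4, 8, 20, 21, 22, 23} \<Longrightarrow> cx a u (s\<lparr>reg := (reg s)(r := v)\<rparr>) = cx a u s"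
  by (simp add: cx_def base_def has_d_def quadr_def)

lemma Bst_upd [simp]: "r \<notin> {14, 15, 16} \<Longrightarrow> Bst a (s\<lparr>reg := (reg s)(r := v)\<rparr>) Z = Bst a s Z"
  by (simp add: Bst_def)

lemma cx_less:
  assumes "cx a u s"
  shows "reg s 20 < n" "reg s 22 < n" "reg s 21 \<le> n" "reg s 23 \<le> n" "u < n" "reg s 2 = S" "reg s 0 = n"
proof -
  have q: "diam_pair (PT a u {..<n}) (quadr s)" "PT a u {..<n} \<noteq> {}" using assms by (auto simp: cx_def)
  show "u < n" "reg s 2 = S" "reg s 0 = n" using assms sub_less by (auto simp: cx_def base_def)
  then have wf: "wf_pts (PT a u {..<n})" using wf_PT by simp
  show "reg s 20 < n" "reg s 22 < n" "reg s 21 \<le> n" "reg s 23 \<le> n"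
    using diam_pair_in[OF q] wf by (auto simp: wf_pts_def quadr_def)
qed

lemma vc_CONS:
  assumes cx: "cx a u s" and B: "Bst a s Z" and v: "reg s 24 = v" "v = n \<or> crs a u v"
    and Q: "\<And>s'. fr CONS s s' \<Longrightarrow> Bst a s' (Z \<union> {u} \<times> ({v} - {n})) \<Longrightarrow> Q s'"
  shows "vc W L CONS Q s"
proof -
  note lt = cx_less[OF cx]
  have hd: "has_d s" and r8: "reg s 8 = u" using cx by (auto simp: cx_def)
  have vn: "v \<le> n" "v < S" using v crs_less by (auto simp: less_imp_le)
  define e1 where "e1 = dt (reg s 20) v + reg s 21"
  define e2 where "e2 = dt (reg s 22) v + reg s 23"
  have d1: "arr s 13 (reg s 20 * S + v) + reg s 21 = e1" "arr s 13 (reg s 22 * S + v) + reg s 23 = e2"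
    using has_dD(2)[OF hd lt(1) vn(1)] has_dD(2)[OF hd lt(2) vn(1)] by (auto simp: e1_def e2_def)
  have w: "e1 < W" "e2 < W" using dt_le[OF lt(1) vn(1)] dt_le[OF lt(2) vn(1)] lt(3,4)
    by (auto simp: e1_def e2_def intro!: small_W(2))
  define e where "e = max e1 e2"
  have "vc W L CONS (\<lambda>s'. if e < reg s 14 then reg s' 14 = e \<and> reg s' 15 = u \<and> reg s' 16 = v
     else reg s' 14 = reg s 14 \<and> reg s' 15 = reg s 15 \<and> reg s' 16 = reg s 16) s"
    using lt vn(2) w by (auto simp: CONS_def v(1) d1 r8 e_def max_def)
  then show ?thesis
  proof (rule vc_mono)
    fix s' assume f: "fr CONS s s'" and p: "if e < reg s 14 then reg s' 14 = e \<and> reg s' 15 = u \<and> reg s' 16 = v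
     else reg s' 14 = reg s 14 \<and> reg s' 15 = reg s 15 \<and> reg s' 16 = reg s 16"
    have "Bst a s' (Z \<union> {u} \<times> ({v} - {n}))"
    proof (cases "v = n")
      case True
      then have "2 * n \<le> e" by (auto simp: e_def e1_def dt_def)
      then have "\<not> e < reg s 14" using B by (auto simp: Bst_def)
      then show ?thesis using p B True by (auto simp: Bst_def)
    next
      case False
      then have c: "crs a u v" "v < n" using v vn by auto
      have "e = ecc (quadr s) v" using False by (simp add: e_def e1_def e2_def ecc_def quadr_def dt_def)
      also have "\<dots> = K a u v" using cx c lt by (intro ecc_K) (auto simp: cx_def)
      finally have e: "e = K a u v" .
      show ?thesis
      proof (cases "e < reg s 14")
        case True
        then show ?thesis using p B c e by (fastforce simp: Bst_def)
      next
        case ge: False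
        then show ?thesis using p B e False by (auto simp: Bst_def)
      qed
    qed
    then show "Q s'" using Q f by blast
  qed
qed

definition has_rmq :: "ram_state \<Rightarrow> bool" where
  "has_rmq s \<longleftrightarrow> r_lg (arr s) \<and> r_sb (reg s 10) \<and> reg s 11 = S * S div reg s 10 \<and> r_pow (arr s) (reg s 10) \<and>
     r_ctz (arr s) \<and> r_mask (arr s) (reg s 10) \<and> r_sp (arr s) (reg s 10) \<and> has_keys (arr s)"

lemma has_rmq_fr:
  assumes "fr c s s'" "wrr c \<inter> {10, 11} = {}" "wra c \<inter> {13, 19, 21, 22, 23, 24, 25} = {}"
  shows "has_rmq s' = has_rmq s"
proof -
  have a: "arr s' 13 = arr s 13" "arr s' 19 = arr s 19" "arr s' 21 = arr s 21" "arr s' 22 = arr s 22"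
    "arr s' 23 = arr s 23" "arr s' 24 = arr s 24" "arr s' 25 = arr s 25" "reg s' 10 = reg s 10" "reg s' 11 = reg s 11"
    using assms by (auto simp: fr_def)
  show ?thesis unfolding has_rmq_def r_lg_def r_pow_def r_ctz_def r_mask_def r_sp_def has_keys_def
    using sfx_cong[OF a(1,2)] minv_cong[OF a(1,2)] by (simp add: a)
qed

lemma has_rmq_upd [simp]: "r \<notin> {10, 11} \<Longrightarrow> has_rmq (s\<lparr>reg := (reg s)(r := v)\<rparr>) = has_rmq s"
  by (rule has_rmq_fr[of "Assign r (Const 0)"]) (auto simp: fr_def)

text \<open>The missing vertex has key \<open>2 * n\<close>, above all depths, so it is a minimum
  only of ranges without any vertex.\<close>

lemma minv_dep:
  assumes "has_d s" "has_keys (arr s)" "minv (arr s) lo hi v" "lo \<le> p" "p < hi" "hi \<le> S * S" "arr s 19 p \<noteq> n"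
  shows "v \<noteq> n" "dep v \<le> dep (arr s 19 p)"
proof -
  have p: "arr s 19 p \<le> n" using assms by (auto simp: has_keys_def)
  obtain p' where p': "p' < hi" "v = arr s 19 p'" using assms(3) by (auto simp: minv_def)
  then have v: "v \<le> n" using assms by (auto simp: has_keys_def)
  have "arr s 13 v \<le> arr s 13 (arr s 19 p)" using assms by (auto simp: minv_def key_def)
  then have le: "dt 0 v \<le> dt 0 (arr s 19 p)" using has_dD(4)[OF assms(1)] v p by simp
  have "dt 0 (arr s 19 p) < 2 * n" using p assms(7) d_lt_n[of 0 "arr s 19 p"] n_pos by (simp add: dt_def)
  then show "v \<noteq> n" using le by (auto simp: dt_def)
  then show "dep v \<le> dep (arr s 19 p)" using le assms(7) by (simp add: dt_def)
qed

end

context tree_machine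
begin

lemma Bst_sub: "Bst a s Z \<Longrightarrow> Z' \<subseteq> Z \<Longrightarrow> Bst a s Z'"
  by (auto simp: Bst_def)

lemma vc_CONS':
  assumes cx: "cx a u s" and B: "Bst a s (Z \<union> {u} \<times> V)" and v: "reg s 24 = v" "v = n \<or> crs a u v"
    and Q: "\<And>s'. fr CONS s s' \<Longrightarrow> cx a u s' \<Longrightarrow> Bst a s' (Z \<union> {u} \<times> (V \<union> ({v} - {n}))) \<Longrightarrow> Q s'"
  shows "vc W L CONS Q s"
proof (rule vc_CONS[OF cx B v])
  fix s' assume f: "fr CONS s s'" and B': "Bst a s' (Z \<union> {u} \<times> V \<union> {u} \<times> ({v} - {n}))"
  have "Bst a s' (Z \<union> {u} \<times> (V \<union> ({v} - {n})))" by (rule Bst_sub[OF B']) auto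
  then show "Q s'" using Q f cx_fr[OF f] cx by simp
qed

text \<open>For the optimum it suffices that the set \<open>V\<close> of tried vertices contains,
  for each vertex of the range, one that is at least as high; so the minimum itself is never singled
  out.\<close>

lemma vc_RQ:
  assumes cx: "cx a u s" and B: "Bst a s Z" and rm: "has_rmq s"
    and lr: "reg s 17 = l" "reg s 18 = r" "l \<le> r" "r < S * S"
    and val: "\<And>p. l \<le> p \<Longrightarrow> p \<le> r \<Longrightarrow> arr s 19 p = n \<or> crs a u (arr s 19 p)"
    and Q: "\<And>s' V. fr RQ s s' \<Longrightarrow> Bst a s' (Z \<union> {u} \<times> V) \<Longrightarrow> V \<subseteq> {arr s 19 p | p. l \<le> p \<and> p \<le> r} - {n} \<Longrightarrow>
       (\<And>p. l \<le> p \<Longrightarrow> p \<le> r \<Longrightarrow> arr s 19 p \<noteq> n \<Longrightarrow> \<exists>w\<in>V. dep w \<le> dep (arr s 19 p)) \<Longrightarrow> Q s'"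
  shows "vc W L RQ Q s"
proof -
  define sb where "sb = reg s 10"
  define NB where "NB = S * S div sb"
  define X where "X = arr s 19"
  define rng where "rng = {X p | p. l \<le> p \<and> p \<le> r}"
  have R: "r_lg (arr s)" "r_sb sb" "reg s 11 = NB" "r_pow (arr s) sb" "r_ctz (arr s)" "r_mask (arr s) sb"
    "r_sp (arr s) sb" "has_keys (arr s)" using rm by (auto simp: has_rmq_def sb_def NB_def)
  have hd: "has_d s" using cx by (simp add: cx_def)
  have sb3: "3 \<le> sb" "sb < S * S" using R(2) less_exp[of sb] unfolding r_sb_def by linarith+
  define bl where "bl = l div sb"
  define br where "br = r div sb"
  have blr: "bl \<le> br" using lr(3) by (simp add: bl_def br_def div_le_mono)
  have crsR: "v = n \<or> crs a u v" if "v \<in> rng" for v using that val by (auto simp: rng_def X_def)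
  have lS: "l < S * S" using lr by simp
  have pow: "arr s 22 k = 2 ^ k" "k < L" if "k \<le> sb" for k
    using R(4) that sb3 SS_W(2)[of k] by (auto simp: r_pow_def)
  have lmod: "l mod sb < sb" using sb3 by simp
  have minR: "v \<in> rng" if "minv (arr s) lo hi v" "l \<le> lo" "hi \<le> Suc r" for v lo hi
    using that unfolding minv_def rng_def X_def by fastforce
  \<comment> \<open>\<open>P\<close> describes the positions covered so far. Each further piece adds
    its interval to \<open>P\<close> and its minimum to \<open>V\<close>.\<close>
  define good where "good V P \<longleftrightarrow> V \<subseteq> rng - {n} \<and> (\<forall>p. P p \<and> X p \<noteq> n \<longrightarrow> (\<exists>w\<in>V. dep w \<le> dep (X p)))" for V P
  have good0: "good {} (\<lambda>_. False)" by (simp add: good_def)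
  have goodI: "good (V \<union> ({v} - {n})) (\<lambda>p. P p \<or> lo \<le> p \<and> p < hi)"
    if "good V P" "minv (arr s) lo hi v" "l \<le> lo" "hi \<le> Suc r" for V P v lo hi
  proof -
    have hi: "hi \<le> S * S" using that lr by simp
    have "v \<noteq> n \<and> dep v \<le> dep (X p)" if "lo \<le> p" "p < hi" "X p \<noteq> n" for p
      using minv_dep[OF hd R(8) \<open>minv (arr s) lo hi v\<close> that(1,2) hi] that(3) by (simp add: X_def)
    then show ?thesis using that(1) minR[OF that(2-4)] unfolding good_def by blast
  qed
  have fin: "Q s'" if "fr RQ s s'" "Bst a s' (Z \<union> {u} \<times> V)" "good V P" "\<And>p. l \<le> p \<Longrightarrow> p \<le> r \<Longrightarrow> P p" for s' V P
  proof (rule Q[OF that(1,2)])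
    show "V \<subseteq> {arr s 19 p | p. l \<le> p \<and> p \<le> r} - {n}" using that(3) by (auto simp: good_def rng_def X_def)
    show "\<exists>w\<in>V. dep w \<le> dep (arr s 19 p)" if "l \<le> p" "p \<le> r" "arr s 19 p \<noteq> n" for p
      using that \<open>good V P\<close> \<open>\<And>p. l \<le> p \<Longrightarrow> p \<le> r \<Longrightarrow> P p\<close> by (auto simp: good_def X_def)
  qed
  let ?s1 = "s\<lparr>reg := (reg s)(27 := bl, 28 := br)\<rparr>"
  have cx1: "cx a u (s\<lparr>reg := (reg s)(27 := x, 28 := y, 24 := z)\<rparr>)"
    "Bst a (s\<lparr>reg := (reg s)(27 := x, 28 := y, 24 := z)\<rparr>) (Z \<union> {u} \<times> {})" for x y z
    using cx B cx_upd[of 27 a u s x] cx_upd[of 28 a u "s\<lparr>reg := (reg s)(27 := x)\<rparr>" y]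
      cx_upd[of 24 a u "s\<lparr>reg := (reg s)(27 := x, 28 := y)\<rparr>" z] by (auto simp: Bst_def)
  show ?thesis
  proof (cases "bl = br")
    case True
    note mm = mask_min[OF R(2,6,5) lr(4,3) True[unfolded bl_def br_def]]
    define m where "m = arr s 24 r div 2 ^ (l mod sb)"
    define c where "c = arr s 23 m"
    define v where "v = X (l + c)"
    have m: "m < L" "l + c \<le> r" "minv (arr s) l (Suc r) v"
      using mm SS_W(2)[of m] by (auto simp: m_def c_def v_def X_def)
    have lt: "r < L" "l + c < L" "l + c < W" using lr m(2) SS_W by auto
    have "vc W L CONS Q (s\<lparr>reg := (reg s)(27 := br, 28 := br, 24 := v)\<rparr>)"
    proof (rule vc_CONS'[where V = "{}" and v = v and a = a and u = u and Z = Z], goal_cases)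
      case 1
      show ?case by (rule cx1)
    next
      case 2
      show ?case by (rule cx1)
    next
      case (5 s')
      show ?case
      proof (rule fin)
        show "fr RQ s s'" using 5(1) by (auto simp: fr_def)
        show "Bst a s' (Z \<union> {u} \<times> ({} \<union> ({v} - {n})))" by (rule 5(3))
        show "good ({} \<union> ({v} - {n})) (\<lambda>p. False \<or> l \<le> p \<and> p < Suc r)" by (rule goodI[OF good0 m(3)]) auto
      qed auto
    qed (use crsR[OF minR[OF m(3)]] in auto)
    then show ?thesis using True lmod pow[of "l mod sb"] m lt
      by (simp add: RQ_def vc_Seq lr sb_def[symmetric] bl_def[symmetric] br_def[symmetric] X_def[symmetric]
          m_def[symmetric] c_def[symmetric] v_def[symmetric])
  next
    case False
    then have blr: "bl < br" using blr by simp
    \<comment> \<open>Equality is possible if \<open>r\<close> lies in the incomplete last block.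
      The sparse table is asked only about blocks strictly before \<open>br\<close>, which are
      complete.\<close>
    have brB: "br \<le> NB" using lr(4) by (simp add: br_def NB_def div_le_mono)
    have lbl: "l = bl * sb + l mod sb" by (simp add: bl_def)
    have le: "l < (bl + 1) * sb" "bl * sb \<le> l" 
    proof -
      have "(bl + 1) * sb = bl * sb + sb" by simp
      then show "l < (bl + 1) * sb" "bl * sb \<le> l" using lbl lmod by linarith+
    qed
    have re: "br * sb \<le> r" by (simp add: br_def)
    define e where "e = bl * sb + (sb - 1)"
    have eS: "Suc e = (bl + 1) * sb" using sb3 by (simp add: e_def)
    have "(bl + 1) * sb \<le> br * sb" using blr by (intro mult_right_mono) auto
    then have er: "Suc e \<le> br * sb" "e < S * S" "l \<le> e" using eS re lr le by auto
    have ediv: "e div sb = bl" unfolding e_def using sb3 by (subst div_mult_self3) auto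
    note mm1 = mask_min[OF R(2,6,5) er(2,3)] mask_min[OF R(2,6,5) lr(4) re]
    define m1 where "m1 = arr s 24 e div 2 ^ (l mod sb)"
    define v1 where "v1 = X (l + arr s 23 m1)"
    have m1: "m1 < S * S" "l + arr s 23 m1 \<le> e" "minv (arr s) l (Suc e) v1"
      using mm1(1-3) ediv by (auto simp: bl_def m1_def v1_def X_def)
    define m2 where "m2 = arr s 24 r"
    define v2 where "v2 = X (br * sb + arr s 23 m2)"
    have "br * sb div sb = r div sb" "br * sb mod sb = 0" using sb3 by (auto simp: br_def)
    then have m2: "m2 < S * S" "br * sb + arr s 23 m2 \<le> r" "minv (arr s) (br * sb) (Suc r) v2"
      using mm1(4-6) by (auto simp: m2_def v2_def X_def)
    have lt: "e < L" "e < W" "m1 < L" "l + arr s 23 m1 < L" "l + arr s 23 m1 < W" "r < L" "m2 < L"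
      "br * sb < W" "br * sb + arr s 23 m2 < L" "br * sb + arr s 23 m2 < W" "bl * sb < W"
      using er m1(1,2) m2(1,2) lr(4) re le(2) lS by (auto intro!: SS_W)
    let ?s2 = "s\<lparr>reg := (reg s)(27 := bl, 28 := br, 19 := e, 24 := v1)\<rparr>"
    let ?tail3 = "If (Reg 19)
          (9 ::= Read 21 (Reg 19) ;; 13 ::= Reg 9 .* Reg 11 .+ (Reg 27 .+ Const 1) ;;
           24 ::= Read 25 (Reg 13) ;; CONS ;;
           13 ::= Reg 9 .* Reg 11 .+ (Reg 28 .- Read 22 (Reg 9)) ;;
           24 ::= Read 25 (Reg 13) ;; CONS) Skip"
    let ?tail2 = "24 ::= Read 19 (Reg 28 .* Reg 10 .+ Read 23 (Read 24 (Reg 18))) ;; CONS ;;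
        19 ::= Reg 28 .- Reg 27 .- Const 1 ;; ?tail3"
    define V1 where "V1 = {} \<union> ({v1} - {n})"
    define V2 where "V2 = V1 \<union> ({v2} - {n})"
    have g1: "good V1 (\<lambda>p. False \<or> l \<le> p \<and> p < Suc e)"
      unfolding V1_def by (rule goodI[OF good0 m1(3)]) (use er re in auto)
    have g2: "good V2 (\<lambda>p. (False \<or> l \<le> p \<and> p < Suc e) \<or> br * sb \<le> p \<and> p < Suc r)"
      unfolding V2_def by (rule goodI[OF g1 m2(3)]) (use er le eS in auto)
    have tail3: "vc W L ?tail3 Q s4"
      if s4: "fr RQ s s4" "cx a u s4" "Bst a s4 (Z \<union> {u} \<times> V2)" "reg s4 27 = bl" "reg s4 28 = br" "reg s4 19 = br - bl - 1" for s4
    proof (cases "br - bl - 1 = 0")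
      case True
      then have "br = bl + 1" using blr by simp
      then have cov: "(False \<or> l \<le> p \<and> p < Suc e) \<or> br * sb \<le> p \<and> p < Suc r" if "l \<le> p" "p \<le> r" for p
        using that eS by auto
      have "Q s4" by (rule fin[OF s4(1,3) g2 cov])
      then show ?thesis using True s4 by simp
    next
      case cnt: False
      define t where "t = br - bl - 1"
      have "NB \<le> S * S" by (simp add: NB_def)
      then have t: "0 < t" "t < S * S" "t + bl + 1 = br" using cnt brB blr unfolding t_def by linarith+
      \<comment> \<open>The largest power of two not above the number \<open>t\<close> of blocks in
        between; two windows of this length, one from each end, cover them all.\<close>
      define k where "k = arr s 21 t"
      have k: "2 ^ k \<le> t" "t < 2 ^ Suc k" using R(1) t by (auto simp: r_lg_def k_def)
      have i1: "bl + 1 + 2 ^ k \<le> NB" "br - 2 ^ k + 2 ^ k \<le> NB" using k t brB by auto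
      note sx = sp_index[OF R(2), of "bl + 1" k] sp_index[OF R(2), of "br - 2 ^ k" k]
      have sx': "k < sb" "k * NB + (bl + 1) < S * S" "k * NB + (br - 2 ^ k) < S * S"
        using sx i1 by (auto simp: NB_def)
      define v3 where "v3 = arr s 25 (k * NB + (bl + 1))"
      define v4 where "v4 = arr s 25 (k * NB + (br - 2 ^ k))"
      have v3: "minv (arr s) ((bl + 1) * sb) ((bl + 1 + 2 ^ k) * sb) v3"
        using R(7) i1(1) unfolding r_sp_def v3_def NB_def by blast
      have v4: "minv (arr s) ((br - 2 ^ k) * sb) ((br - 2 ^ k + 2 ^ k) * sb) v4"
        using R(7) i1(2) unfolding r_sp_def v4_def NB_def by blast
      have b2k: "br - 2 ^ k + 2 ^ k = br" using k t by simp
      have ineq: "(bl + 1 + 2 ^ k) * sb \<le> br * sb" "(bl + 1) * sb \<le> (br - 2 ^ k) * sb" "(br - 2 ^ k) * sb \<le> (bl + 1 + 2 ^ k) * sb"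
        by (rule mult_right_mono; use k t in \<open>simp; linarith?\<close>)+
      define V3 where "V3 = V2 \<union> ({v3} - {n})"
      define V4 where "V4 = V3 \<union> ({v4} - {n})"
      have g3: "good V3 (\<lambda>p. ((False \<or> l \<le> p \<and> p < Suc e) \<or> br * sb \<le> p \<and> p < Suc r) \<or> (bl + 1) * sb \<le> p \<and> p < (bl + 1 + 2 ^ k) * sb)"
        unfolding V3_def by (rule goodI[OF g2 v3]) (use le ineq re in auto)
      have g4: "good V4 (\<lambda>p. (((False \<or> l \<le> p \<and> p < Suc e) \<or> br * sb \<le> p \<and> p < Suc r) \<or> (bl + 1) * sb \<le> p \<and> p < (bl + 1 + 2 ^ k) * sb) \<or>
           (br - 2 ^ k) * sb \<le> p \<and> p < (br - 2 ^ k + 2 ^ k) * sb)"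
        unfolding V4_def by (rule goodI[OF g3 v4]) (use le ineq re b2k in auto)
      have cov: "(((False \<or> l \<le> p \<and> p < Suc e) \<or> br * sb \<le> p \<and> p < Suc r) \<or> (bl + 1) * sb \<le> p \<and> p < (bl + 1 + 2 ^ k) * sb) \<or>
           (br - 2 ^ k) * sb \<le> p \<and> p < (br - 2 ^ k + 2 ^ k) * sb" if "l \<le> p" "p \<le> r" for p
        using that eS ineq unfolding b2k by linarith
      have c3: "v3 = n \<or> crs a u v3" by (rule crsR, rule minR[OF v3]) (use le ineq re in auto)
      have c4: "v4 = n \<or> crs a u v4" by (rule crsR, rule minR[OF v4]) (use le ineq re b2k in auto)
      have a4: "arr s4 = arr s" using fr_arr[OF s4(1)] by simp
      have r4: "reg s4 11 = NB" using fr_reg[OF s4(1), of 11] R by simp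
      let ?s5 = "s4\<lparr>reg := (reg s4)(9 := k, 13 := k * NB + (bl + 1), 24 := v3)\<rparr>"
      have "vc W L CONS (vc W L (13 ::= Reg 9 .* Reg 11 .+ (Reg 28 .- Read 22 (Reg 9)) ;; 24 ::= Read 25 (Reg 13) ;; CONS) Q) ?s5"
      proof (rule vc_CONS'[where V = V2 and v = v3 and a = a and u = u and Z = Z], goal_cases)
        case 1
        show ?case using s4(2) by (simp add: cx_def base_def has_d_def quadr_def)
      next
        case 2
        show ?case using s4(3) by (simp add: Bst_def)
      next
        case (5 s6)
        have a6: "arr s6 = arr s" using fr_arr[OF 5(1)] a4 by simp
        have r6: "reg s6 9 = k" "reg s6 11 = NB" "reg s6 28 = br" using fr_reg[OF 5(1)] r4 s4 by auto
        let ?s7 = "s6\<lparr>reg := (reg s6)(13 := k * NB + (br - 2 ^ k), 24 := v4)\<rparr>"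
        have "vc W L CONS Q ?s7"
        proof (rule vc_CONS'[where V = V3 and v = v4 and a = a and u = u and Z = Z], goal_cases)
          case 1
          show ?case using 5(2) by (simp add: cx_def base_def has_d_def quadr_def)
        next
          case 2
          show ?case using 5(3) by (simp add: Bst_def V3_def)
        next
          case (5 s8)
          have f8: "fr RQ s s8" using 5(1) \<open>fr CONS ?s5 s6\<close> s4(1) by (auto simp: fr_def)
          have B8: "Bst a s8 (Z \<union> {u} \<times> V4)" using 5(3) by (simp add: V4_def)
          show ?case by (rule fin[OF f8 B8 g4 cov])
        qed (use c4 in auto)
        then show ?case using sx' pow[of k] SS_W[of "k * NB + (br - 2 ^ k)"] SS_W(1)[of "k * NB"] 
          by (simp add: vc_Seq a6 r6 v4_def)
      qed (use c3 in auto)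
      moreover have "bl + 1 < W" using sx'(2) SS_W(1)[of "bl + 1"] by simp
      moreover have tt: "br - Suc bl = t" "arr s 21 t = k" "arr s 25 (Suc (k * NB + bl)) = v3" by (auto simp: t_def k_def v3_def)
      moreover have "k * NB < W" "Suc (k * NB + bl) < W" "Suc (k * NB + bl) < L" "t < L"
        using sx'(2) t(2) by (auto intro!: SS_W)
      ultimately show ?thesis using t(1) s4(4-6)
        by (simp add: vc_Seq a4 r4)
    qed
    have "vc W L CONS (vc W L ?tail2 Q) ?s2"
    proof (rule vc_CONS'[where V = "{}" and v = v1 and a = a and u = u and Z = Z], goal_cases)
      case 1
      show ?case using cx by (simp add: cx_def base_def has_d_def quadr_def)
    next
      case 2
      show ?case using B by (simp add: Bst_def)
    next
      case (5 s3)
      have a3: "arr s3 = arr s" using fr_arr[OF 5(1)] by simp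
      have r3: "reg s3 27 = bl" "reg s3 28 = br" "reg s3 10 = sb" "reg s3 18 = r" using fr_reg[OF 5(1)] lr by (auto simp: sb_def)
      let ?s4 = "s3\<lparr>reg := (reg s3)(24 := v2)\<rparr>"
      have "vc W L CONS (vc W L (19 ::= Reg 28 .- Reg 27 .- Const 1 ;; ?tail3) Q) ?s4"
      proof (rule vc_CONS'[where V = V1 and v = v2 and a = a and u = u and Z = Z], goal_cases)
        case 1
        show ?case using 5(2) by simp
      next
        case 2
        show ?case using 5(3) by (simp add: V1_def)
      next
        case (5 s5)
        let ?s6 = "s5\<lparr>reg := (reg s5)(19 := br - bl - 1)\<rparr>"
        have r5: "reg s5 27 = bl" "reg s5 28 = br" using fr_reg[OF 5(1)] r3 by auto
        have "vc W L ?tail3 Q ?s6"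
        proof (rule tail3)
          show "fr RQ s ?s6" using 5(1) \<open>fr CONS ?s2 s3\<close> by (auto simp: fr_def)
          show "cx a u ?s6" using 5(2) by simp
          show "Bst a ?s6 (Z \<union> {u} \<times> V2)" using 5(3) by (simp add: V2_def)
        qed (use r5 in auto)
        then show ?case by (simp add: r5 del: vc.simps(5))
      qed (use crsR[OF minR[OF m2(3)]] er le eS in auto)
      then show ?case using lt
        by (simp add: vc_Seq r3 a3 m2_def[symmetric] X_def[symmetric] v2_def[symmetric] del: vc.simps(5))
    qed (use crsR[OF minR[OF m1(3)]] er re in auto)
    then have "vc W L (24 ::= Read 19 (Reg 17 .+ Read 23 (Read 24 (Reg 19) .div Read 22 (Reg 17 .mod Reg 10))))
        (vc W L CONS (vc W L ?tail2 Q)) (s\<lparr>reg := (reg s)(27 := bl, 28 := br, 19 := e)\<rparr>)"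
      using lmod pow[of "l mod sb"] lt by (simp add: lr sb_def[symmetric] X_def[symmetric] m1_def[symmetric] v1_def[symmetric])
    then have "vc W L (19 ::= Reg 27 .* Reg 10 .+ (Reg 10 .- Const 1))
       (vc W L (24 ::= Read 19 (Reg 17 .+ Read 23 (Read 24 (Reg 19) .div Read 22 (Reg 17 .mod Reg 10))))
        (vc W L CONS (vc W L ?tail2 Q))) ?s1"
      using lt by (simp add: sb_def[symmetric] e_def[symmetric] e_def[symmetric, unfolded One_nat_def] del: vc.simps(3-5))
    then show ?thesis using False
      by (simp add: RQ_def vc_Seq lr sb_def[symmetric] bl_def[symmetric] br_def[symmetric])
  qed
qed

end

section \<open>Queries for one lower endpoint and the loop over all tree edges\<close>

definition all_swaps_com :: com where
  "all_swaps_com = For 5 4 (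
     (6 ::= Reg 5 .+ Const 1 ;; 7 ::= Read 13 (Reg 6) .- Const 1) ;; reroot_com ;; (14 ::= Reg 0 .+ Reg 0) ;;
     For 8 0 swap_from ;;
     (9 ::= Read 10 (Reg 6) ;; Write 4 (Reg 9) (Read 7 (Reg 15)) ;; Write 5 (Reg 9) (Read 7 (Reg 16))))"

context tree_machine
begin

lemma has_anc_fr: "fr c s s' \<Longrightarrow> 14 \<notin> wra c \<Longrightarrow> has_anc s' = has_anc s"
  by (simp add: has_anc_def fr_def)

lemma nearest_neD: "nearest c X v \<Longrightarrow> x \<in> X \<Longrightarrow> v \<in> X \<and> d c v \<le> d c x"
  by (auto simp: nearest_def split: if_splits)

lemma vc_CEN:
  assumes cx: "cx a u s" and an: "has_anc s" and c: "c \<le> 1"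
    and Q: "\<And>s'. fr (CEN c) s s' \<Longrightarrow> reg s' 19 = centre (quadr s) c \<Longrightarrow> Q s'"
  shows "vc W L (CEN c) Q s"
proof -
  note lt = cx_less[OF cx]
  have hd: "has_d s" using cx by (simp add: cx_def)
  define x where "x = reg s 20"
  define y where "y = reg s 22"
  define D where "D = d x y"
  define k where "k = (D + reg s 23 + c - reg s 21) div 2"
  have xy: "x < n" "y < n" using lt by (auto simp: x_def y_def)
  have dd: "arr s 13 (x * S + y) = D" "arr s 13 x = dep x" "arr s 13 y = dep y" using has_dD[OF hd] xy by (auto simp: D_def)
  have Dn: "D < n" "dep x < n" "dep y < n" using d_lt_n xy n_pos by (auto simp: D_def)
  have ldxy: "(dep x + dep y - D) div 2 = ld x y" by (simp add: ld_def D_def)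
  have l2: "2 * ld x y + D = dep x + dep y" using ld2[OF xy] by (simp add: D_def)
  have kb: "k \<le> D + reg s 23 + 1" using c unfolding k_def by linarith
  have w: "D + reg s 23 < W" "D + reg s 23 + c < W" "c < W" "dep x + dep y < W" "k + ld x y < W"
    by (rule small_W(2); use Dn lt(3,4) c n_ge kb l2 in linarith)+
  have cen: "centre (quadr s) c = (if k + ld x y \<le> dep x then anc x k else anc y (D - k))"
    by (simp add: centre_def quadr_def point_def k_def D_def x_def y_def)
  have a1: "arr s 14 (x * S + k) = anc x k" "k < S" if "k + ld x y \<le> dep x"
    using an xy that Dn by (auto simp: has_anc_def)
  have a2: "arr s 14 (y * S + (D - k)) = anc y (D - k)" "D - k < S" if "\<not> k + ld x y \<le> dep x"
  proof -
    have "D - k \<le> dep y" using that l2 by linarith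
    then show "arr s 14 (y * S + (D - k)) = anc y (D - k)" "D - k < S" using an xy Dn by (auto simp: has_anc_def)
  qed
  have "vc W L (CEN c) (\<lambda>s'. reg s' 19 = centre (quadr s) c) s"
  proof (cases "k + ld x y \<le> dep x")
    case True
    then show ?thesis using a1 w xy
      by (simp add: CEN_def lt x_def[symmetric] y_def[symmetric] dd k_def[symmetric] ldxy cen)
  next
    case False
    then show ?thesis using a2 w xy
      by (simp add: CEN_def lt x_def[symmetric] y_def[symmetric] dd k_def[symmetric] ldxy cen)
  qed
  then show ?thesis by (rule vc_mono) (use Q in auto)
qed

text \<open>Candidates that meet \<open>u\<close> no deeper than the centre does are covered by the
  nearest-neighbour table, the remaining ones by a range of levels; the range is empty if the centre
  meets \<open>u\<close> at level \<open>dep a - 1\<close>.\<close>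

lemma vc_QRY:
  assumes cx: "cx a u s" and B: "Bst a s Z" and rm: "has_rmq s" and an: "has_anc s"
    and nn: "has_NN (arr s)" and hM: "has_M (arr s)" and c: "c \<le> 1" and a: "0 < a" "a < n" and r7: "reg s 7 = dep a - 1"
    and Q: "\<And>s' V. fr (QRY c) s s' \<Longrightarrow> Bst a s' (Z \<union> {u} \<times> V) \<Longrightarrow> V \<subseteq> {v. crs a u v} \<Longrightarrow>
       (\<And>v. crs a u v \<Longrightarrow> \<exists>w\<in>V. d (centre (quadr s) c) w \<le> d (centre (quadr s) c) v) \<Longrightarrow> Q s'"
  shows "vc W L (QRY c) Q s"
proof -
  define C where "C = centre (quadr s) c"
  define l2 where "l2 = dep a - 1"
  note r7 = r7[folded l2_def]
  note lt = cx_less[OF cx]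
  have q: "diam_pair (PT a u {..<n}) (quadr s)" "PT a u {..<n} \<noteq> {}" and u: "u \<in> sub a" "u < n"
    and hd: "has_d s" and r8: "reg s 8 = u" using cx sub_less by (auto simp: cx_def)
  have Cn: "C < n" using centre(2)[OF q c] by (simp add: C_def)
  \<comment> \<open>The centre lies on a path between two vertices outside the subtree of
    \<open>a\<close>, hence outside as well. Its level with \<open>u\<close> is therefore less than
    \<open>dep a\<close>, and so is that of the vertex found in the table.\<close>
  have "fst (fst (quadr s)) \<notin> sub a" "fst (snd (quadr s)) \<notin> sub a"
    using diam_pair_in[OF q] by (auto simp: PT_def crs_def)
  then have CB: "C \<notin> sub a"
    using between_nsub[OF a, of "fst (fst (quadr s))" "fst (snd (quadr s))" C] centre(3)[OF q c] lt Cn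
    by (simp add: C_def quadr_def)
  define lc where "lc = ld u C"
  have lcb: "lc < dep a" using sub_iff_ld[OF a(2) u(1) Cn] CB by (simp add: lc_def)
  have dn: "dep a < n" "dep u < n" "dep C < n" using d_lt_n a u Cn n_pos by auto
  have da: "dep a = Suc l2" using lcb by (simp add: l2_def)
  then have l2n: "l2 < n" using dn by simp
  have crs_ld: "crs a u v \<longleftrightarrow> N u v \<and> ld u v \<le> l2" for v
    using sub_iff_ld[OF a(2) u(1), of v] u N_less[of u v] da by (auto simp: crs_def)
  define v0 where "v0 = arr s 20 (u * S + C)"
  have nr: "nearest C {v. N u v \<and> ld u v \<le> lc} v0" using nn u Cn by (simp add: has_NN_def v0_def lc_def)
  have v0: "v0 = n \<or> crs a u v0" using nr lcb da by (auto simp: nearest_def crs_ld split: if_splits)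
  have v0': "v0 \<noteq> n \<and> d C v0 \<le> d C v" if "N u v" "ld u v \<le> lc" for v
  proof -
    have "N u v0" "d C v0 \<le> d C v" using nearest_neD[OF nr, of v] that by auto
    then show ?thesis using N_less[of u v0] by auto
  qed
  let ?r = "17 ::= (Read 13 (Reg 8) .+ Read 13 (Reg 19) .- Read 13 (Ix (Reg 8) (Reg 19))) .div Const 2 .+ Const 1 ;;
     If (Reg 7 .< Reg 17) Skip (17 ::= Ix (Reg 8) (Reg 17) ;; 18 ::= Ix (Reg 8) (Reg 7) ;; RQ)"
  have "vc W L (CEN c) (vc W L (24 ::= Read 20 (Ix (Reg 8) (Reg 19))) (vc W L CONS (vc W L ?r Q))) s"
  proof (rule vc_CEN[OF cx an c], goal_cases)
    case (1 s1)
    note f1 = 1(1)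
    have r1: "reg s1 19 = C" "reg s1 8 = u" "reg s1 2 = S" "arr s1 = arr s" using 1 fr_reg[OF f1] fr_arr[OF f1] r8 lt by (auto simp: C_def)
    have cx1: "cx a u s1" using cx_fr[OF f1] cx by simp
    have B1: "Bst a s1 Z" using B fr_reg[OF f1] by (simp add: Bst_def)
    let ?s2 = "s1\<lparr>reg := (reg s1)(24 := v0)\<rparr>"
    have "vc W L CONS (vc W L ?r Q) ?s2"
    proof (rule vc_CONS'[where V = "{}" and v = v0 and a = a and u = u and Z = Z], goal_cases)
      case 1
      show ?case using cx1 by simp
    next
      case 2
      show ?case using B1 by simp
    next
      case (5 s3)
      note f3 = 5(1)
      have r3: "reg s3 19 = C" "reg s3 8 = u" "reg s3 2 = S" "reg s3 7 = l2" "arr s3 = arr s"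
        using r1 fr_reg[OF f3] fr_arr[OF f3] fr_reg[OF f1] r7 by auto
      define V0 where "V0 = {v0} - {n}"
      have B3: "Bst a s3 (Z \<union> {u} \<times> V0)" using 5(3) by (simp add: V0_def)
      have hd3: "has_d s3" using 5(2) by (simp add: cx_def)
      have dd: "arr s 13 u = dep u" "arr s 13 C = dep C" "arr s 13 (u * S + C) = d u C" using has_dD[OF hd] u Cn by auto
      have ll: "(dep u + dep C - d u C) div 2 = lc" by (simp add: lc_def ld_def)
      have w: "dep u + dep C < W" "Suc lc < W" by (rule small_W(2); use dn lcb in linarith)+
      show ?case
      proof (cases "l2 < Suc lc")
        case True
        let ?s4 = "s3\<lparr>reg := (reg s3)(17 := Suc lc)\<rparr>"
        have "Q ?s4"
        proof (rule Q)
          show "fr (QRY c) s ?s4" using f1 f3 by (auto simp: fr_def)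
          show "Bst a ?s4 (Z \<union> {u} \<times> V0)" using B3 by simp
          show "V0 \<subseteq> {v. crs a u v}" using v0 by (auto simp: V0_def)
          show "\<exists>w\<in>V0. d (centre (quadr s) c) w \<le> d (centre (quadr s) c) v" if "crs a u v" for v
          proof -
            have "N u v" "ld u v \<le> lc" using that crs_ld[of v] True by auto
            then show ?thesis using v0'[of v] by (auto simp: V0_def C_def)
          qed
        qed
        then show ?thesis using True w u Cn by (simp add: r3 dd ll)
      next
        case False
        define l where "l = u * S + Suc lc"
        define r where "r = u * S + (l2)"
        let ?s4 = "s3\<lparr>reg := (reg s3)(17 := l, 18 := r)\<rparr>"
        have lr: "l \<le> r" "r < S * S" using False u l2n by (auto simp: l_def r_def)
        have X: "nearest 0 {v. N u v \<and> ld u v = p - u * S} (arr s 19 p)" if "l \<le> p" "p \<le> r" for p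
        proof -
          have "p - u * S < n" "u * S + (p - u * S) = p" using that l2n by (auto simp: l_def r_def)
          moreover have "nearest 0 {v. N u v \<and> ld u v = j} (arr s 19 (u * S + j))" if "j < n" for j
            using hM u that by (simp add: has_M_def)
          ultimately show ?thesis by metis
        qed
        have Xv: "N u w \<and> lc < ld u w \<and> ld u w \<le> l2" if "l \<le> p" "p \<le> r" "w = arr s 19 p" "w \<noteq> n" for p w
        proof -
          have "w \<in> {v. N u v \<and> ld u v = p - u * S}" using X[OF that(1,2)] that(3,4) by (auto simp: nearest_def split: if_splits)
          then show ?thesis using that(1,2) by (auto simp: l_def r_def)
        qed
        have "vc W L RQ Q ?s4"
        proof (rule vc_RQ[where a = a and u = u and Z = "Z \<union> {u} \<times> V0" and l = l and r = r], goal_cases)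
          case 1
          show ?case using 5(2) by (simp add: cx_def base_def has_d_def quadr_def)
        next
          case 2
          show ?case using B3 by (simp add: Bst_def)
        next
          case 3
          have "has_rmq s1" using has_rmq_fr[OF f1] rm by simp
          then have "has_rmq s3" using has_rmq_fr[OF f3] by simp
          then show ?case using has_rmq_fr[of "17 ::= Const 0 ;; 18 ::= Const 0" s3 ?s4] by (simp add: fr_def)
        next
          case (8 p)
          then show ?case using Xv[of p "arr s 19 p"] by (auto simp: r3 crs_ld)
        next
          case (9 s5 V)
          have V: "V \<subseteq> {arr s 19 p | p. l \<le> p \<and> p \<le> r} - {n}" using 9(3) by (simp add: r3)
          show ?case
          proof (rule Q)
            show "fr (QRY c) s s5" using f1 f3 9(1) by (auto simp: fr_def)
            show "Bst a s5 (Z \<union> {u} \<times> (V0 \<union> V))" by (rule Bst_sub[OF 9(2)]) auto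
            show "V0 \<union> V \<subseteq> {v. crs a u v}" using v0 V Xv by (fastforce simp: V0_def crs_ld)
            show "\<exists>w\<in>V0 \<union> V. d (centre (quadr s) c) w \<le> d (centre (quadr s) c) v" if cv: "crs a u v" for v
            proof (cases "ld u v \<le> lc")
              case True
              then show ?thesis using v0'[of v] cv crs_ld[of v] by (auto simp: V0_def C_def)
            next
              case gt: False
              have v: "N u v" "v < n" "ld u v \<le> l2" using cv crs_ld[of v] N_less by auto
              define p where "p = u * S + ld u v"
              have p: "l \<le> p" "p \<le> r" using gt v by (auto simp: p_def l_def r_def)
              have np: "nearest 0 {x. N u x \<and> ld u x = ld u v} (arr s 19 p)" using X[OF p] by (simp add: p_def)
              then have w0: "arr s 19 p \<noteq> n" "dep (arr s 19 p) \<le> dep v" 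
                using nearest_neD[OF np, of v] v N_less[of u "arr s 19 p"] by auto
              obtain w where w: "w \<in> V" "dep w \<le> dep (arr s 19 p)" using 9(4)[OF p] w0 by (auto simp: r3)
              obtain p' where p': "l \<le> p'" "p' \<le> r" "w = arr s 19 p'" "w \<noteq> n" using w V by auto
              have wl: "lc < ld u w" "w < n" using Xv[OF p'] N_less by auto
              \<comment> \<open>The ultrametric inequality, used twice: \<open>w\<close> meets
                \<open>C\<close> at level at least \<open>lc\<close>, \<open>v\<close> at level at
                most \<open>lc\<close>. So the smaller depth also means the smaller distance from
                \<open>C\<close>.\<close>
              have "min (ld C u) (ld u w) \<le> ld C w" using ld_ultra Cn u wl by simp
              then have 1: "lc \<le> ld C w" using ld_sym[of C u] Cn u wl by (simp add: lc_def)
              have "min (ld C v) (ld v u) \<le> ld C u" using ld_ultra Cn u v by simp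
              then have 2: "ld C v \<le> lc" using ld_sym[of C u] ld_sym[of v u] Cn u v gt by (simp add: lc_def)
              have "d C w \<le> d C v" using ld2[OF Cn wl(2)] ld2[OF Cn v(2)] 1 2 w w0 by linarith
              then show ?thesis using w by (auto simp: C_def)
            qed
          qed
        qed (use lr in auto)
        then have "vc W L (17 ::= Ix (Reg 8) (Reg 17) ;; 18 ::= Ix (Reg 8) (Reg 7) ;; RQ) Q (s3\<lparr>reg := (reg s3)(17 := Suc lc)\<rparr>)"
          using False u l2n by (simp add: vc_Seq r3 l_def r_def)
        then show ?thesis using False w u Cn by (simp add: r3 dd ll del: vc.simps(4)) (simp add: r3 dd ll)
      qed
    qed (use v0 in auto)
    then show ?case using u Cn by (simp add: r1 v0_def)
  qed
  then show ?thesis by (simp add: QRY_def vc_Seq)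
qed

lemma cst_CONS [simp]: "cst CONS = 36"
  by (simp add: CONS_def)

lemma cst_RQ [simp]: "cst RQ = 268"
  by (simp add: RQ_def)

lemma cst_QRY [simp]: "cst (QRY c) = 403"
  by (simp add: QRY_def CEN_def)

lemma cst_swap_from [simp]: "cst swap_from = 1048"
  by (simp add: swap_from_def)

definition ready :: "ram_state \<Rightarrow> bool" where
  "ready s \<longleftrightarrow> base s \<and> has_d s \<and> has_par s \<and> has_ball (arr s) \<and> has_anc s \<and> has_NN (arr s) \<and> has_M (arr s) \<and> has_rmq s"

lemma ready_fr:
  assumes f: "fr c s s'" and c: "wrr c \<inter> {0, 2, 3, 4, 10, 11} = {}"
    "wra c \<inter> {8, 13, 14, 15, 16, 17, 18, 19, 20, 21, 22, 23, 24, 25} = {}"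
    and s: "ready s"
  shows "ready s'"
proof -
  have a: "arr s' 19 = arr s 19" "arr s' 20 = arr s 20" "quada (arr s') 15 = quada (arr s) 15"
    using f c quada_fr[OF f, of 15] by (auto simp: fr_def)
  show ?thesis
    using s base_fr[OF f] has_d_fr[OF f] has_par_fr[OF f] has_anc_fr[OF f] has_rmq_fr[OF f] c
    unfolding ready_def has_ball_def has_NN_def has_M_def by (auto simp: a)
qed

lemma wp_swap_from:
  assumes rd: "ready s" and a: "0 < a" "a < n" "reg s 6 = a" "reg s 7 = dep a - 1"
    and pre: "\<forall>i<n. diam_pair (PT a i ({..<n} - {i})) (quada (arr s) 34 i)"
    and ex: "crs a x0 y0" and B: "Bst a s {}"
  shows "wp W L (For 8 0 swap_from) (2000 * S) (\<lambda>s'. Bst a s' {(u, v). crs a u v}) s"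
proof -
  let ?I = "\<lambda>i s'. Bst a s' {(u, v). u < i \<and> crs a u v}"
  show ?thesis
  proof (rule wp_mono[OF wp_For[where I = ?I and T = 1048 and N = n]], goal_cases)
    case (6 u s1)
    note f = \<open>fr _ s s1\<close>
    have rd1: "ready s1" by (rule ready_fr[OF f _ _ rd]) auto
    have b1: "base s1" "has_d s1" "has_ball (arr s1)" using rd1 by (auto simp: ready_def)
    have r: "reg s1 8 = u" "reg s1 6 = a" "reg s1 7 = dep a - 1" "reg s1 2 = S" "arr s1 = arr s"
      using 6 a b1 f by (auto simp: fr_def base_def fun_eq_iff)
    have u: "u < n" using 6 by simp
    define Z where "Z = {(u', v). u' < u \<and> crs a u' v}"
    have B1: "Bst a s1 Z" using 6 by (simp add: Z_def)
    define Q where "Q = (\<lambda>s'' :: ram_state. Bst a s'' {(u', v). u' < Suc u \<and> crs a u' v})"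
    define l2 where "l2 = dep a - 1"
    have l2n: "l2 < n" using d_lt_n[of 0 a] a n_pos by (simp add: l2_def)
    have jL: "u * S + l2 < L" "u * S + l2 < W" using u l2n by auto
    have "vc W L swap_from Q s1"
    proof (cases "u \<in> sub a")
      case False
      then have "{(u', v). u' < Suc u \<and> crs a u' v} = Z" by (auto simp: Z_def less_Suc_eq crs_def)
      then have "Q s1" using B1 by (simp add: Q_def)
      then show ?thesis using subTest_ok[OF b1(1,2) r(2,1) a(2) u] False by (simp add: swap_from_def)
    next
      case True
      have "vc W L (LDQ 34 8) (vc W L (29 ::= Ix (Reg 8) (Reg 7)) (vc W L (INSP 15 29 0) (vc W L (QRY 0) (vc W L (QRY 1) Q)))) s1"
      proof (rule vc_LDQ, goal_cases)
        case (3 s2)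
        note f2 = 3(1)
        have r2: "reg s2 8 = u" "reg s2 7 = l2" "reg s2 2 = S" "arr s2 = arr s" using fr_reg[OF f2] fr_arr[OF f2] r by (auto simp: l2_def)
        let ?s3 = "s2\<lparr>reg := (reg s2)(29 := u * S + l2)\<rparr>"
        have f3: "fr (LDQ 34 8 ;; 29 ::= Const 0) s1 ?s3" using f2 by (auto simp: fr_def)
        have rd3: "ready ?s3" by (rule ready_fr[OF f3 _ _ rd1]) auto
        have b3: "base ?s3" "has_d ?s3" using rd3 by (auto simp: ready_def)
        have q3: "diam_pair (PT a u ({..<n} - {u})) (quadr ?s3)" using 3(2) r pre u by (simp add: quadr_def)
        have PTu: "PT a u {u} = BS u l2" using PT_single[OF a(1,2) True] by (simp add: l2_def)
        have "vc W L (INSP 15 29 0) (vc W L (QRY 0) (vc W L (QRY 1) Q)) ?s3"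
        proof (rule vc_INSP[OF b3, where X = "PT a u ({..<n} - {u})" and Y = "BS u l2"], goal_cases)
          case 1 show ?case by (rule q3)
        next
          case 2 show ?case using b1(3) u l2n r2 r by (simp add: has_ball_def)
        next
          case 3 show ?case using wf_BS by simp
        next
          case (7 s4)
          note f4 = 7(1)
          have rd4: "ready s4" by (rule ready_fr[OF f4 _ _ rd3]) auto
          have r4: "reg s4 8 = u" "reg s4 7 = l2" using fr_reg[OF f4] r2 by auto
          have "PT a u ({..<n} - {u}) \<union> BS u l2 = PT a u {..<n}"
            unfolding PTu[symmetric] PT_un[symmetric] using u by (simp add: insert_absorb)
          then have q4: "diam_pair (PT a u {..<n}) (quadr s4)" using 7(2) by simp
          have ne: "PT a u {..<n} \<noteq> {}" using ex crs_less[OF ex] by (auto simp: PT_def)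
          have cx4: "cx a u s4" using rd4 True r4 q4 ne by (simp add: cx_def ready_def)
          have f14: "fr (LDQ 34 8 ;; 29 ::= Const 0 ;; INSP 15 29 0) s1 s4" using f3 f4 by (auto simp: fr_def)
          have B4: "Bst a s4 Z" using B1 fr_reg[OF f14] by (simp add: Bst_def)
          show ?case
          proof (rule vc_QRY[OF cx4 B4], goal_cases)
            case (9 s5 V0)
            note f5 = 9(1)
            have rd5: "ready s5" by (rule ready_fr[OF f5 _ _ rd4]) auto
            have cx5: "cx a u s5" using cx_fr[OF f5] cx4 by simp
            have q5: "quadr s5 = quadr s4" using fr_reg[OF f5] by (simp add: quadr_def)
            have V0: "\<And>v. crs a u v \<Longrightarrow> \<exists>w\<in>V0. d (centre (quadr s4) 0) w \<le> d (centre (quadr s4) 0) v" "V0 \<subseteq> {v. crs a u v}" using 9 by auto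
            show ?case
            proof (rule vc_QRY[OF cx5 9(2)], goal_cases)
              case (9 s6 V1)
              have V1: "\<And>v. crs a u v \<Longrightarrow> \<exists>w\<in>V1. d (centre (quadr s4) 1) w \<le> d (centre (quadr s4) 1) v" "V1 \<subseteq> {v. crs a u v}" using 9 q5 by auto
              have B6: "Bst a s6 (Z \<union> {u} \<times> V0 \<union> {u} \<times> V1)" using 9(2) .
              obtain R where R: "\<forall>v<n. ecc (quadr s4) v = min (d (centre (quadr s4) 0) v) (d (centre (quadr s4) 1) v) + R"
                using centre(1)[OF q4 ne] by blast
              have KR: "K a u v = min (d (centre (quadr s4) 0) v) (d (centre (quadr s4) 1) v) + R" if "crs a u v" for v
                using R ecc_K[OF q4 ne u, of v] crs_less[OF that] by simp
              \<comment> \<open>\<open>w0\<close> is at least as good as \<open>v\<close> seen from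
                one centre, \<open>w1\<close> seen from the other. As \<open>K\<close> is the
                minimum of both distances plus a constant, one of them is at least as good
                overall.\<close>
              have le: "reg s6 14 \<le> K a u v" if cv: "crs a u v" for v
              proof -
                obtain w0 w1 where w: "w0 \<in> V0" "d (centre (quadr s4) 0) w0 \<le> d (centre (quadr s4) 0) v"
                  "w1 \<in> V1" "d (centre (quadr s4) 1) w1 \<le> d (centre (quadr s4) 1) v" using V0(1)[OF cv] V1(1)[OF cv] by blast
                have c: "crs a u w0" "crs a u w1" using w V0(2) V1(2) by auto
                have "reg s6 14 \<le> K a u w0" "reg s6 14 \<le> K a u w1" using B6 w by (auto simp: Bst_def)
                then show ?thesis using KR[OF c(1)] KR[OF c(2)] KR[OF cv] w(2,4) by linarith
              qed
              show ?case unfolding Q_def Bst_def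
              proof (intro conjI)
                show "\<forall>(u', v)\<in>{(u', v). u' < Suc u \<and> crs a u' v}. reg s6 14 \<le> K a u' v"
                  using le B6 by (auto simp: Bst_def Z_def less_Suc_eq)
              qed (use B6 in \<open>auto simp: Bst_def\<close>)
            qed (use rd5 a(1,2) r4 fr_reg[OF f5] in \<open>auto simp: ready_def l2_def\<close>)
          qed (use rd4 a(1,2) r4 in \<open>auto simp: ready_def l2_def\<close>)
        qed (use jL in auto)
        then show ?case using u l2n by (simp add: r2)
      qed (use u r in auto)
      then show ?thesis using subTest_ok[OF b1(1,2) r(2,1) a(2) u] True by (simp add: swap_from_def vc_Seq)
    qed
    from vc_wp[OF this] have "wp W L swap_from 1048 Q s1" by simp
    then show ?case by (rule wp_mono) (auto simp: Q_def)
  next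
    case 7
    show ?case by (rule For_le1) auto
  next
    case (8 s')
    have "{(u, v). u < n \<and> crs a u v} = {(u, v). crs a u v}" using crs_less by blast
    then show ?case using 8(3) by simp
  next
    case 5
    show ?case using B by (simp add: Bst_def)
  qed (use rd in \<open>auto simp: ready_def base_def\<close>)
qed

definition best_pair :: "nat \<Rightarrow> nat \<Rightarrow> nat \<Rightarrow> bool" where
  "best_pair a u v \<longleftrightarrow> crs a u v \<and> (\<forall>u' v'. crs a u' v' \<longrightarrow> K a u v \<le> K a u' v')"

text \<open>Array 10 maps a vertex to the index of its parent edge in the input. Injectivity ensures
  that later iterations do not overwrite an answer.\<close>

lemma wp_all_swaps_com:
  assumes rd: "ready s" and ex: "\<And>a. 0 < a \<Longrightarrow> a < n \<Longrightarrow> \<exists>x y. crs a x y"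
    and ei: "inj_on (arr s 10) {0<..<n}" "\<And>i. 0 < i \<Longrightarrow> i < n \<Longrightarrow> arr s 10 i < L"
  shows "wp W L all_swaps_com (10000 * (S * S)) (\<lambda>s'. \<forall>a. 0 < a \<and> a < n \<longrightarrow>
     (\<exists>u v. best_pair a u v \<and> arr s' 4 (arr s 10 a) = arr s 7 u \<and> arr s' 5 (arr s 10 a) = arr s 7 v)) s"
proof -
  let ?P = "\<lambda>A a. \<exists>u v. best_pair a u v \<and> A 4 (arr s 10 a) = arr s 7 u \<and> A 5 (arr s 10 a) = arr s 7 v"
  let ?I = "\<lambda>i A. \<forall>a. 0 < a \<and> a \<le> i \<longrightarrow> ?P A a"
  let ?c0 = "6 ::= Reg 5 .+ Const 1 ;; 7 ::= Read 13 (Reg 6) .- Const 1"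
  let ?c1 = "14 ::= Reg 0 .+ Reg 0"
  let ?c2 = "9 ::= Read 10 (Reg 6) ;; Write 4 (Reg 9) (Read 7 (Reg 15)) ;; Write 5 (Reg 9) (Read 7 (Reg 16))"
  show ?thesis unfolding all_swaps_com_def
  proof (rule wp_mono[OF wp_ForA[where I = ?I and T = "20 + (2000 * S + (10 + (2000 * S + 30)))" and N = "n - 1"]], goal_cases)
    case (6 i s1)
    note f1 = 6(2)
    define a where "a = Suc i"
    have a: "0 < a" "a < n" using 6 by (auto simp: a_def)
    have rd1: "ready s1" by (rule ready_fr[OF f1 _ _ rd]) auto
    have a1: "arr s1 7 = arr s 7" "arr s1 10 = arr s 10" using f1 by (auto simp: fr_def)
    obtain x0 y0 where x0: "crs a x0 y0" using ex[OF a] by blast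
    have I1: "?I i (arr s1)" using 6 by simp
    have r1: "reg s1 5 = i" "reg s1 0 = n" using 6 rd1 by (auto simp: ready_def base_def)
    have hd1: "has_d s1" using rd1 by (simp add: ready_def)
    define Q where "Q = (\<lambda>s'' :: ram_state. ?I (Suc i) (arr s''))"
    let ?s2 = "s1\<lparr>reg := (reg s1)(6 := a, 7 := dep a - 1)\<rparr>"
    have f12: "fr ?c0 s1 ?s2" by (auto simp: fr_def)
    have rd2: "ready ?s2" by (rule ready_fr[OF f12 _ _ rd1]) auto
    have "wp W L reroot_com (2000 * S) (wp W L (?c1 ;; For 8 0 swap_from ;; ?c2) (10 + (2000 * S + 30)) Q) ?s2"
    proof (rule wp_mono[OF wp_reroot_com[of ?s2 a]], goal_cases)
      case (10 s3)
      note f3 = 10(2)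
      have rd3: "ready s3" by (rule ready_fr[OF f3 _ _ rd2]) auto
      let ?s4 = "s3\<lparr>reg := (reg s3)(14 := 2 * n)\<rparr>"
      have f34: "fr ?c1 s3 ?s4" by (auto simp: fr_def)
      have rd4: "ready ?s4" by (rule ready_fr[OF f34 _ _ rd3]) auto
      have "wp W L (For 8 0 swap_from) (2000 * S) (wp W L ?c2 30 Q) ?s4"
      proof (rule wp_mono[OF wp_swap_from[OF rd4 a _ _ _ x0]], goal_cases)
        case (6 s5)
        note f5 = 6(2)
        have a5: "arr s5 = arr s3" using fr_arr[OF f5] by simp
        have a3: "arr s3 a' = arr s1 a'" if "a' \<in> {4, 5, 7, 10}" for a' using f3 that by (auto simp: fr_def)
        have r5: "reg s5 6 = a" using fr_reg[OF f5] fr_reg[OF f3] by simp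
        have B5: "Bst a s5 {(u, v). crs a u v}" by (rule 6(3))
        define u where "u = reg s5 15"
        define v where "v = reg s5 16"
        have "reg s5 14 \<le> K a x0 y0" using B5 x0 by (auto simp: Bst_def)
        also have "\<dots> < 2 * n" using K_less[OF x0] crs_less[OF x0] by simp
        finally have bp: "best_pair a u v" using B5 by (auto simp: Bst_def best_pair_def u_def v_def)
        then have uv: "u < n" "v < n" using crs_less by (auto simp: best_pair_def)
        have eL: "arr s 10 a < L" using ei(2) a by simp
        have e_eq: "arr s 10 b = arr s 10 a \<longleftrightarrow> b = a" if "0 < b" "b \<le> a" for b
          using ei(1) a that by (auto simp: inj_on_def)
        have "?P ((arr s3)(4 := (arr s3 4)(arr s 10 a := arr s 7 u), 5 := (arr s3 5)(arr s 10 a := arr s 7 v))) b" if "0 < b" "b \<le> a" for b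
        proof (cases "b = a")
          case True
          then show ?thesis using bp by (intro exI[of _ u] exI[of _ v]) simp
        next
          case False
          then have "b \<le> i" using that by (simp add: a_def)
          then show ?thesis using I1 that False e_eq[OF that] a3 by simp
        qed
        then have "Q (s5\<lparr>reg := (reg s5)(9 := arr s 10 a), arr := (arr s3)(4 := (arr s3 4)(arr s 10 a := arr s 7 u), 5 := (arr s3 5)(arr s 10 a := arr s 7 v))\<rparr>)"
          unfolding Q_def a_def[symmetric] by simp
        then show ?case
          by (intro wp_vc) (use a uv eL in \<open>simp_all add: a5 r5 a3 a1 u_def[symmetric] v_def[symmetric]\<close>)
      qed (use fr_reg[OF f3] 10(3) in \<open>auto simp: Bst_def\<close>)
      then have w: "wp W L (For 8 0 swap_from ;; ?c2) (2000 * S + 30) Q ?s4" by (rule wp_seq)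
      have nW: "n + n < W" by (rule small_W(2)) simp
      have "reg s3 0 = n" using rd3 by (simp add: ready_def base_def)
      then have "vc W L ?c1 (wp W L (For 8 0 swap_from ;; ?c2) (2000 * S + 30) Q) s3" using w nW by (simp add: mult_2)
      from wp_vc_seq[OF this] show ?case by (rule wp_mono) auto
    qed (use rd2 a in \<open>auto simp: ready_def\<close>)
    then have w: "wp W L (reroot_com ;; ?c1 ;; For 8 0 swap_from ;; ?c2) (2000 * S + (10 + (2000 * S + 30))) Q ?s2" by (rule wp_seq)
    have aW: "a < W" "a < L" using a by (auto intro!: small_W(2))
    have da: "arr s1 13 a = dep a" using has_dD[OF hd1] a by simp
    have "vc W L ?c0 (wp W L (reroot_com ;; ?c1 ;; For 8 0 swap_from ;; ?c2) (2000 * S + (10 + (2000 * S + 30))) Q) s1"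
      using w aW by (simp add: r1 a_def[symmetric] da)
    from wp_vc_seq[OF this] show ?case unfolding Q_def by (rule wp_mono) auto
  next
    case 7
    show ?case by (rule For_le2[of _ _ 5000]) (use S_ge in auto)
  next
    case (8 s')
    then show ?case by auto
  qed (use rd in \<open>auto simp: ready_def base_def\<close>)
qed

end

section \<open>Reading the input\<close>

lemma walk_closed:
  "successively (\<lambda>u v. {u, v} \<in> F) p \<Longrightarrow> p \<noteq> [] \<Longrightarrow> hd p \<in> U \<Longrightarrow> set p \<subseteq> V \<Longrightarrow>
   (\<And>x y. x \<in> U \<Longrightarrow> y \<in> V \<Longrightarrow> {x, y} \<in> F \<Longrightarrow> y \<in> U) \<Longrightarrow> last p \<in> U"
proof (induction p)
  case (Cons x p)
  then show ?case by (cases p) (auto simp: successively_Cons)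
qed simp

text \<open>A connected graph has no proper nonempty set closed under edges; used for the
  completeness of the search and for the existence of swap edges.\<close>

lemma closed_all:
  assumes "graph_connected V F" "x0 \<in> U" "x0 \<in> V" "\<And>x y. x \<in> U \<Longrightarrow> y \<in> V \<Longrightarrow> {x, y} \<in> F \<Longrightarrow> y \<in> U"
  shows "V \<subseteq> U"
proof
  fix y assume "y \<in> V"
  then obtain p where "graph_path V F x0 p y" using assms(1,3) by (auto simp: graph_connected_def)
  then show "y \<in> U" using walk_closed[of F p U V] assms by (auto simp: graph_path_def)
qed

definition init_com :: com where
  "init_com = 2 ::= Reg 0 .+ Const 1 ;; 3 ::= Reg 2 .* Reg 2 ;; 4 ::= Reg 0 .- Const 1"

text \<open>Entries are edge indices plus one, 0 meaning no edge. The loop runs past the end of the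
  edge list; there both endpoints read as 0, so only the diagonal cell of vertex 0 is spoilt, about
  which \<open>has_T\<close> says nothing.\<close>

definition tree_edges_com :: com where
  "tree_edges_com = For 5 3 (6 ::= Read 2 (Reg 5) ;; 7 ::= Read 3 (Reg 5) ;; 8 ::= Reg 5 .+ Const 1 ;;
     Write 6 (Ix (Reg 6) (Reg 7)) (Reg 8) ;; Write 6 (Ix (Reg 7) (Reg 6)) (Reg 8))"

text \<open>Array 7 is both the queue and the final numbering, register 8 its length. Array 9 holds
  the position plus one and thus doubles as visited mark.\<close>

definition bfsBody :: com where
  "bfsBody = 9 ::= Read 6 (Ix (Reg 6) (Reg 7)) ;;
     If (Reg 9)
       (If (Read 9 (Reg 7)) Skip
          (Write 7 (Reg 8) (Reg 7) ;; Write 8 (Reg 8) (Reg 5) ;; Write 10 (Reg 8) (Reg 9 .- Const 1) ;;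
           8 ::= Reg 8 .+ Const 1 ;; Write 9 (Reg 7) (Reg 8)))
       Skip"

definition bfs_com :: com where
  "bfs_com = (Write 9 (Const 0) (Const 1) ;; 8 ::= Const 1) ;;
     For 5 0 (6 ::= Read 7 (Reg 5) ;; For 7 0 bfsBody)"

definition nontree_com :: com where
  "nontree_com = For 5 1 (6 ::= Read 0 (Reg 5) ;; 7 ::= Read 1 (Reg 5) ;;
     If (Read 6 (Ix (Reg 6) (Reg 7))) Skip
       (6 ::= Read 9 (Reg 6) .- Const 1 ;; 7 ::= Read 9 (Reg 7) .- Const 1 ;;
        Write 12 (Ix (Reg 6) (Reg 7)) (Const 1) ;; Write 12 (Ix (Reg 7) (Reg 6)) (Const 1)))"

lemma wr_input [simp]:
  "wrr init_com = {2, 3, 4}" "wra init_com = {}"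
  "wrr tree_edges_com = {5, 6, 7, 8}" "wra tree_edges_com = {6}"
  "wrr bfsBody = {8, 9}" "wra bfsBody = {7, 8, 9, 10}"
  "wrr bfs_com = {5, 6, 7, 8, 9}" "wra bfs_com = {7, 8, 9, 10}"
  "wrr nontree_com = {5, 6, 7}" "wra nontree_com = {12}"
  by (auto simp: init_com_def tree_edges_com_def bfsBody_def bfs_com_def nontree_com_def)

locale graph_input = machine +
  fixes E F :: "nat set set" and es ts :: "(nat \<times> nat) list"
  assumes sg: "simple_graph {..<n} E" and tec: "two_edge_connected {..<n} E"
    and st: "graph_spanning_tree {..<n} E F" and les: "edge_listing es E" and lts: "edge_listing ts F"
begin

lemma edge2: "e \<in> E \<Longrightarrow> \<exists>x y. e = {x, y} \<and> x \<noteq> y \<and> x < n \<and> y < n"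
proof -
  assume "e \<in> E"
  then have "e \<subseteq> {..<n}" "card e = 2" using sg by (auto simp: simple_graph_def)
  then show ?thesis by (auto simp: card_2_iff)
qed

lemma F_E: "F \<subseteq> E" using st by (simp add: graph_spanning_tree_def)

lemma edgeD: "{x, y} \<in> E \<Longrightarrow> x \<noteq> y \<and> x < n \<and> y < n"
  using edge2[of "{x, y}"] by (auto simp: doubleton_eq_iff)

lemma edge_listing_length:
  assumes "edge_listing xs D" "D \<subseteq> E"
  shows "length xs \<le> S * S"
proof -
  have "length xs = card (set (map edge_of xs))" 
    using assms(1) distinct_card[of "map edge_of xs"] unfolding edge_listing_def by simp
  also have "\<dots> = card D" using assms(1) by (simp add: edge_listing_def)
  also have "\<dots> \<le> card ((\<lambda>(x, y). {x, y}) ` ({..<n} \<times> {..<n}))"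
  proof (rule card_mono)
    show "D \<subseteq> (\<lambda>(x, y). {x, y}) ` ({..<n} \<times> {..<n})" using assms(2) edge2 by fast
  qed simp
  also have "\<dots> \<le> card ({..<n} \<times> {..<n})" by (rule card_image_le) simp
  also have "\<dots> = n * n" by simp
  also have "\<dots> \<le> S * S" by (rule mult_mono) auto
  finally show ?thesis .
qed

lemma listing_nth:
  assumes "edge_listing xs D" "D \<subseteq> E" "i < length xs"
  shows "edge_of (xs ! i) \<in> D" "fst (xs ! i) < n" "snd (xs ! i) < n" "fst (xs ! i) \<noteq> snd (xs ! i)"
proof -
  show *: "edge_of (xs ! i) \<in> D" using assms by (auto simp: edge_listing_def)
  have "{fst (xs ! i), snd (xs ! i)} \<in> E" using * assms(2) unfolding edge_of_def by blast
  from edgeD[OF this] show "fst (xs ! i) < n" "snd (xs ! i) < n" "fst (xs ! i) \<noteq> snd (xs ! i)" by auto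
qed

lemma listing_inj: "edge_listing xs D \<Longrightarrow> i < length xs \<Longrightarrow> j < length xs \<Longrightarrow> edge_of (xs ! i) = edge_of (xs ! j) \<Longrightarrow> i = j"
  using nth_eq_iff_index_eq[of "map edge_of xs" i j] by (simp add: edge_listing_def)

lemma n0: "0 < n" using n_ge by simp

definition has_in :: "ram_state \<Rightarrow> bool" where
  "has_in s \<longleftrightarrow> reg s 1 = length es \<and> arr s 0 = array_of (map fst es) \<and> arr s 1 = array_of (map snd es) \<and>
     arr s 2 = array_of (map fst ts) \<and> arr s 3 = array_of (map snd ts)"

definition has_T :: "(nat \<Rightarrow> nat \<Rightarrow> nat) \<Rightarrow> bool" where
  "has_T A \<longleftrightarrow> (\<forall>x<n. \<forall>y<n. x \<noteq> y \<longrightarrow> (A 6 (x * S + y) \<noteq> 0 \<longleftrightarrow> {x, y} \<in> F) \<and>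
     (A 6 (x * S + y) \<noteq> 0 \<longrightarrow> A 6 (x * S + y) - 1 < length ts \<and> edge_of (ts ! (A 6 (x * S + y) - 1)) = {x, y}))"

lemma wp_init_com:
  assumes "reg s 0 = n"
  shows "wp W L init_com 100 base s"
proof (rule wp_vc)
  have "Suc n < W" using n_ge by (intro small_W(2)) linarith
  then show "vc W L init_com base s" using assms SS_W(1)[of "S * S"]
    by (simp add: init_com_def base_def S_eq[symmetric])
qed (simp add: init_com_def)

lemma wp_tree_edges_com:
  assumes b: "base s" and i: "has_in s" and z: "arr s 6 = (\<lambda>_. 0)"
  shows "wp W L tree_edges_com (1000 * (S * S)) (\<lambda>s'. has_T (arr s')) s"
proof -
  define x where "x j = arr s 2 j" for j
  define y where "y j = arr s 3 j" for j
  have xy: "x j < n" "y j < n" for j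
    using i listing_nth[OF lts F_E, of j] n0 by (auto simp: x_def y_def has_in_def array_of_def)
  have out: "x j = 0" "y j = 0" if "\<not> j < length ts" for j
    using i that by (auto simp: x_def y_def has_in_def array_of_def)
  have inn: "edge_of (ts ! j) = {x j, y j}" if "j < length ts" for j
    using i that by (auto simp: x_def y_def has_in_def array_of_def edge_of_def)
  let ?I = "\<lambda>j A. \<forall>u<n. \<forall>v<n. (A 6 (u * S + v) \<noteq> 0 \<longleftrightarrow> (\<exists>k<j. {x k, y k} = {u, v})) \<and>
     (A 6 (u * S + v) \<noteq> 0 \<longrightarrow> {x (A 6 (u * S + v) - 1), y (A 6 (u * S + v) - 1)} = {u, v})"
  show ?thesis unfolding tree_edges_com_def
  proof (rule wp_mono[OF wp_ForA[where I = ?I and T = 100 and N = "S * S"]], goal_cases)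
    case (6 j s1)
    have r: "reg s1 5 = j" "reg s1 2 = S" "arr s1 2 j = x j" "arr s1 3 j = y j"
      using 6 baseD[OF b] by (auto simp: fr_def x_def y_def)
    have I: "?I j (arr s1)" using 6 by simp
    have jL: "j < L" "Suc j < W" using 6(1) SS_W by auto
    define Q where "Q = (\<lambda>s'' :: ram_state. ?I (Suc j) (arr s''))"
    let ?A = "(arr s1)(6 := (arr s1 6)(x j * S + y j := Suc j, y j * S + x j := Suc j))"
    have "?I (Suc j) ?A"
    proof (intro allI impI)
      fix u v assume uv: "u < n" "v < n"
      have e: "u * S + v = x j * S + y j \<longleftrightarrow> u = x j \<and> v = y j" "u * S + v = y j * S + x j \<longleftrightarrow> u = y j \<and> v = x j"
        using uv xy[of j] by (simp_all add: index_eq)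
      show "(?A 6 (u * S + v) \<noteq> 0 \<longleftrightarrow> (\<exists>k<Suc j. {x k, y k} = {u, v})) \<and>
        (?A 6 (u * S + v) \<noteq> 0 \<longrightarrow> {x (?A 6 (u * S + v) - 1), y (?A 6 (u * S + v) - 1)} = {u, v})"
      proof (cases "{x j, y j} = {u, v}")
        case True
        then have "u * S + v = x j * S + y j \<or> u * S + v = y j * S + x j" unfolding e by (auto simp: doubleton_eq_iff)
        then have "?A 6 (u * S + v) = Suc j" by auto
        then show ?thesis using True by auto
      next
        case False
        then have "\<not> (u = x j \<and> v = y j)" "\<not> (u = y j \<and> v = x j)" by (auto simp: doubleton_eq_iff)
        then have ne: "u * S + v \<noteq> x j * S + y j" "u * S + v \<noteq> y j * S + x j" using e by blast+
        have "?A 6 (u * S + v) = arr s1 6 (u * S + v)" by (simp only: fun_upd_same fun_upd_apply ne if_False simp_thms)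
        then show ?thesis using I[rule_format, OF uv] False by (auto simp: less_Suc_eq)
      qed
    qed
    then have Q: "Q (s1\<lparr>reg := (reg s1)(6 := x j, 7 := y j, 8 := Suc j), arr := ?A\<rparr>)" unfolding Q_def by simp
    have "vc W L (6 ::= Read 2 (Reg 5) ;; 7 ::= Read 3 (Reg 5) ;; 8 ::= Reg 5 .+ Const 1 ;;
     Write 6 (Ix (Reg 6) (Reg 7)) (Reg 8) ;; Write 6 (Ix (Reg 7) (Reg 6)) (Reg 8)) Q s1"
      using Q jL xy[of j] by (simp add: r)
    from wp_vc[OF this] show ?case unfolding Q_def by simp
  next
    case 7
    show ?case by (rule For_le) auto
  next
    case (8 s')
    show ?case unfolding has_T_def
    proof (intro allI impI)
      fix u v assume uv: "u < n" "v < n" "u \<noteq> v"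
      have lenb: "length ts \<le> S * S" using edge_listing_length[OF lts F_E] .
      have ts_in: "k < length ts" if "{x k, y k} = {u, v}" for k
        using that uv(3) out[of k] by (cases "k < length ts") auto
      have "(\<exists>k<S * S. {x k, y k} = {u, v}) \<longleftrightarrow> {u, v} \<in> F"
      proof
        assume "\<exists>k<S * S. {x k, y k} = {u, v}"
        then obtain k where k: "{x k, y k} = {u, v}" by blast
        then show "{u, v} \<in> F" using listing_nth(1)[OF lts F_E ts_in[OF k]] inn[OF ts_in[OF k]] by simp
      next
        assume "{u, v} \<in> F"
        then obtain k where "k < length ts" "edge_of (ts ! k) = {u, v}"
          using lts unfolding edge_listing_def by (metis (no_types, lifting) in_set_conv_nth length_map nth_map)
        then show "\<exists>k<S * S. {x k, y k} = {u, v}" using inn[of k] lenb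
          by (intro exI[of _ k]) auto
      qed
      then show "(arr s' 6 (u * S + v) \<noteq> 0 \<longleftrightarrow> {u, v} \<in> F) \<and>
         (arr s' 6 (u * S + v) \<noteq> 0 \<longrightarrow> arr s' 6 (u * S + v) - 1 < length ts \<and> edge_of (ts ! (arr s' 6 (u * S + v) - 1)) = {u, v})"
        using 8(3)[rule_format, OF uv(1,2)] ts_in inn by auto
    qed
  qed (use baseD[OF b] z in auto)
qed

definition bfs :: "(nat \<Rightarrow> nat \<Rightarrow> nat) \<Rightarrow> nat \<Rightarrow> bool" where
  "bfs A c \<longleftrightarrow> 0 < c \<and> c \<le> n \<and> inj_on (A 7) {..<c} \<and> (\<forall>k<c. A 7 k < n \<and> A 9 (A 7 k) = Suc k) \<and>
     (\<forall>y<n. y \<notin> A 7 ` {..<c} \<longrightarrow> A 9 y = 0) \<and> A 7 0 = 0 \<and> A 8 0 = 0 \<and>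
     (\<forall>k. 0 < k \<and> k < c \<longrightarrow> A 8 k < k \<and> A 10 k < length ts \<and> {A 7 k, A 7 (A 8 k)} = edge_of (ts ! A 10 k))"

text \<open>All tree neighbours inspected so far, those of the first \<open>i\<close> queue entries
  and those below \<open>y\<close> of entry \<open>i\<close>, are in the queue.\<close>

definition scanned :: "(nat \<Rightarrow> nat \<Rightarrow> nat) \<Rightarrow> nat \<Rightarrow> nat \<Rightarrow> nat \<Rightarrow> bool" where
  "scanned A c i y \<longleftrightarrow> (\<forall>k z. z < n \<and> {A 7 k, z} \<in> F \<and> k < c \<and> (k < i \<or> k = i \<and> z < y) \<longrightarrow> z \<in> A 7 ` {..<c})"

lemma F_conn: "graph_connected {..<n} F"
  using st by (simp add: graph_spanning_tree_def graph_tree_def)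

text \<open>Once every queue entry is scanned, the queue is closed under tree edges and contains
  vertex 0, so it is everything by connectedness.\<close>

lemma bfs_full:
  assumes b: "bfs A c" and sc: "scanned A c i 0" and ci: "c \<le> i"
  shows "c = n"
proof -
  have "{..<n} \<subseteq> A 7 ` {..<c}"
  proof (rule closed_all[OF F_conn])
    show "0 \<in> A 7 ` {..<c}" using b by (force simp: bfs_def)
    show "(0::nat) \<in> {..<n}" using n0 by simp
    show "y \<in> A 7 ` {..<c}" if "x \<in> A 7 ` {..<c}" "y \<in> {..<n}" "{x, y} \<in> F" for x y
    proof -
      obtain k where k: "k < c" "x = A 7 k" using \<open>x \<in> _\<close> by auto
      then show ?thesis using sc[unfolded scanned_def, rule_format, of y k] that(2,3) ci by simp
    qed
  qed
  then have "n \<le> c" using card_mono[of "A 7 ` {..<c}" "{..<n}"] card_image_le[of "{..<c}" "A 7"] by simp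
  then show ?thesis using b by (simp add: bfs_def)
qed

lemma wp_bfs_com:
  assumes b: "base s" and T: "has_T (arr s)" and z: "arr s 7 = (\<lambda>_. 0)" "arr s 8 = (\<lambda>_. 0)" "arr s 9 = (\<lambda>_. 0)"
  shows "wp W L bfs_com (1000 * (S * S)) (\<lambda>s'. bfs (arr s') n) s"
proof -
  let ?I = "\<lambda>i s'. bfs (arr s') (reg s' 8) \<and> scanned (arr s') (reg s' 8) i 0"
  let ?c0 = "Write 9 (Const 0) (Const 1) ;; 8 ::= Const 1"
  let ?s0 = "s\<lparr>arr := (arr s)(9 := (arr s 9)(0 := 1)), reg := (reg s)(8 := 1)\<rparr>"
  have w: "wp W L (For 5 0 (6 ::= Read 7 (Reg 5) ;; For 7 0 bfsBody)) (900 * (S * S)) (\<lambda>s'. bfs (arr s') n) ?s0"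
  proof (rule wp_mono[OF wp_For[where I = ?I and T = "500 * S" and N = n]], goal_cases)
    case (6 i s1)
    note f1 = 6(2)
    have r1: "reg s1 2 = S" "reg s1 0 = n" "reg s1 5 = i" using 6 fr_reg[OF f1] baseD[OF b] by auto
    have a1: "arr s1 6 = arr s 6" using f1 by (auto simp: fr_def)
    define c1 where "c1 = reg s1 8"
    have b1: "bfs (arr s1) c1" "scanned (arr s1) c1 i 0" using 6 by (auto simp: c1_def)
    \<comment> \<open>The queue cannot run empty early: if all its entries were scanned, it would
      already contain all \<open>n\<close> vertices, and \<open>i < n\<close>.\<close>
    have ic: "i < c1" using bfs_full[OF b1] 6(1) by (cases "c1 \<le> i") auto
    define x where "x = arr s1 7 i"
    have x: "x < n" using b1 ic by (auto simp: bfs_def x_def)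
    let ?J = "\<lambda>y s'. bfs (arr s') (reg s' 8) \<and> scanned (arr s') (reg s' 8) i y \<and> i < reg s' 8 \<and> arr s' 7 i = x"
    let ?s2 = "s1\<lparr>reg := (reg s1)(6 := x)\<rparr>"
    have w2: "wp W L (For 7 0 bfsBody) (400 * S) (\<lambda>s'. ?I (Suc i) (s'\<lparr>reg := (reg s')(5 := Suc i)\<rparr>)) ?s2"
    proof (rule wp_mono[OF wp_For[where I = ?J and T = 300 and N = n]], goal_cases)
      case (6 y s3)
      note f3 = 6(2)
      have r3: "reg s3 2 = S" "reg s3 5 = i" "reg s3 6 = x" "reg s3 7 = y" using 6 fr_reg[OF f3] r1 by auto
      have a3: "arr s3 6 = arr s 6" using f3 a1 by (auto simp: fr_def)
      have y: "y < n" using 6 by simp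
      define c where "c = reg s3 8"
      define A where "A = arr s3"
      have J: "bfs A c" "scanned A c i y" "i < c" "A 7 i = x" using 6 by (auto simp: c_def A_def)
      have a3': "A 6 = arr s 6" using a3 by (simp add: A_def)
      define v where "v = arr s 6 (x * S + y)"
      have vis: "A 9 y \<noteq> 0 \<longleftrightarrow> y \<in> A 7 ` {..<c}" using J(1) y by (auto simp: bfs_def)
      have xv: "x \<in> A 7 ` {..<c}" using J by auto
      define Q where "Q = (\<lambda>s'' :: ram_state. ?J (Suc y) (s''\<lparr>reg := (reg s'')(7 := Suc y)\<rparr>))"
      have "vc W L bfsBody Q s3"
      proof (cases "v \<noteq> 0 \<and> y \<notin> A 7 ` {..<c}")
        case False
        have sc: "scanned A c i (Suc y)" unfolding scanned_def
        proof (intro allI impI)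
          fix k z assume kz: "z < n \<and> {A 7 k, z} \<in> F \<and> k < c \<and> (k < i \<or> k = i \<and> z < Suc y)"
          show "z \<in> A 7 ` {..<c}"
          proof (cases "k = i \<and> z = y")
            case True
            then have "{x, y} \<in> F" using kz J by simp
            moreover have "x \<noteq> y" using edgeD[of x y] calculation F_E by auto
            ultimately have "v \<noteq> 0" using T x y by (simp add: has_T_def v_def)
            then show ?thesis using False True by simp
          next
            case F: False
            then show ?thesis using J(2) kz unfolding scanned_def by (metis less_Suc_eq)
          qed
        qed
        have "Q (s3\<lparr>reg := (reg s3)(9 := v)\<rparr>)" using J sc by (simp add: Q_def c_def A_def)
        moreover have "v = 0 \<or> A 9 y \<noteq> 0" using False vis by blast
        ultimately show ?thesis using x y
          by (cases "v = 0") (simp_all add: bfsBody_def r3 a3' v_def[symmetric] A_def[symmetric])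
      next
        case True
        have xy: "x \<noteq> y" using True xv by auto
        have Fxy: "{x, y} \<in> F" "v - 1 < length ts" "edge_of (ts ! (v - 1)) = {x, y}"
          using T x y xy True by (auto simp: has_T_def v_def)
        have cn: "c < n"
        proof -
          have "card (insert y (A 7 ` {..<c})) \<le> card {..<n}" using J(1) y by (intro card_mono) (auto simp: bfs_def)
          moreover have "card (A 7 ` {..<c}) = c" using J(1) by (simp add: bfs_def card_image)
          ultimately show ?thesis using True by simp
        qed
        define B where "B = A(7 := (A 7)(c := y), 8 := (A 8)(c := i), 10 := (A 10)(c := v - 1), 9 := (A 9)(y := Suc c))"
        have im: "B 7 ` {..<Suc c} = insert y (A 7 ` {..<c})" by (auto simp: B_def lessThan_Suc)
        have bB: "bfs B (Suc c)" unfolding bfs_def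
        proof (intro conjI)
          show "inj_on (B 7) {..<Suc c}" using J(1) True by (auto simp: B_def bfs_def inj_on_def lessThan_Suc)
          show "\<forall>k<Suc c. B 7 k < n \<and> B 9 (B 7 k) = Suc k" using J(1) True y by (auto simp: B_def bfs_def less_Suc_eq)
          show "\<forall>y<n. y \<notin> B 7 ` {..<Suc c} \<longrightarrow> B 9 y = 0" unfolding im using J(1) by (auto simp: B_def bfs_def)
          show "B 7 0 = 0" "B 8 0 = 0" using J(1) by (auto simp: B_def bfs_def)
          show "\<forall>k. 0 < k \<and> k < Suc c \<longrightarrow> B 8 k < k \<and> B 10 k < length ts \<and> {B 7 k, B 7 (B 8 k)} = edge_of (ts ! B 10 k)"
          proof (intro allI impI)
            fix k assume k: "0 < k \<and> k < Suc c"
            show "B 8 k < k \<and> B 10 k < length ts \<and> {B 7 k, B 7 (B 8 k)} = edge_of (ts ! B 10 k)"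
            proof (cases "k = c")
              case True
              then show ?thesis using Fxy J(3,4) by (auto simp: B_def insert_commute)
            next
              case False
              then have "k < c" using k by simp
              moreover from this have "A 8 k < k" using J(1) k by (simp add: bfs_def)
              ultimately show ?thesis using J(1) k by (auto simp: B_def bfs_def)
            qed
          qed
        qed (use cn in auto)
        have sB: "scanned B (Suc c) i (Suc y)" unfolding scanned_def im
        proof (intro allI impI)
          fix k z assume kz: "z < n \<and> {B 7 k, z} \<in> F \<and> k < Suc c \<and> (k < i \<or> k = i \<and> z < Suc y)"
          then have k: "k < c" "B 7 k = A 7 k" using J(3) by (auto simp: B_def)
          show "z \<in> insert y (A 7 ` {..<c})"
            using J(2) kz k unfolding scanned_def by (metis insert_iff less_Suc_eq)
        qed
        have "Q (s3\<lparr>reg := (reg s3)(9 := v, 8 := Suc c), arr := B\<rparr>)"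
          using bB sB J(3,4) by (simp add: Q_def) (simp add: B_def)
        moreover have "c < L" "Suc c < W" using cn by (auto intro!: small_W(2))
        ultimately show ?thesis using True x y vis
          by (simp add: bfsBody_def r3 a3' v_def[symmetric] A_def[symmetric] c_def[symmetric] B_def)
      qed
      from wp_vc[OF this, of 300] show ?case unfolding Q_def by (simp add: bfsBody_def)
    next
      case 7
      show ?case by (rule For_le1) auto
    next
      case (8 s')
      have "scanned (arr s') (reg s' 8) (Suc i) 0" using 8(3) unfolding scanned_def by (auto simp: less_Suc_eq)
      then show ?case using 8(3) by simp
    next
      case 5
      show ?case using b1 ic by (simp add: c1_def x_def)
    qed (use r1 in auto)
    then have "vc W L (6 ::= Read 7 (Reg 5)) (wp W L (For 7 0 bfsBody) (400 * S) (\<lambda>s'. ?I (Suc i) (s'\<lparr>reg := (reg s')(5 := Suc i)\<rparr>))) s1"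
      using 6(1) by (simp add: r1 x_def)
    from wp_vc_seq[OF this] show ?case by (rule wp_mono) (use S_ge in auto)
  next
    case 7
    show ?case by (rule For_le2) auto
  next
    case (8 s')
    then have "reg s' 8 \<le> n" by (auto simp: bfs_def)
    then show ?case using bfs_full[of "arr s'" "reg s' 8" n] 8(3) by auto
  next
    case 5
    show ?case using z n0 by (auto simp: bfs_def scanned_def lessThan_Suc)
  qed (use baseD[OF b] in auto)
  have "0 < L" using SS_W(2)[of 0] by simp
  then have "vc W L ?c0 (wp W L (For 5 0 (6 ::= Read 7 (Reg 5) ;; For 7 0 bfsBody)) (900 * (S * S)) (\<lambda>s'. bfs (arr s') n)) s"
    using w by simp
  from wp_vc_seq[OF this] show ?thesis unfolding bfs_com_def by (rule wp_mono) (use SS_ge S_ge in auto)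
qed

lemma wp_nontree_com:
  assumes b: "base s" and i: "has_in s" and T: "has_T (arr s)" and bf: "bfs (arr s) n" and z: "arr s 12 = (\<lambda>_. 0)"
  shows "wp W L nontree_com (1000 * (S * S)) (\<lambda>s'. \<forall>u<n. \<forall>v<n. arr s' 12 (u * S + v) \<noteq> 0 \<longleftrightarrow> {arr s 7 u, arr s 7 v} \<in> E - F) s"
proof -
  define lab where "lab = arr s 7"
  define pos where "pos w = arr s 9 w - 1" for w
  have lab: "inj_on lab {..<n}" "\<And>k. k < n \<Longrightarrow> lab k < n" "\<And>k. k < n \<Longrightarrow> pos (lab k) = k"
    using bf by (auto simp: bfs_def lab_def pos_def)
  have "lab ` {..<n} = {..<n}"
    using lab by (intro card_subset_eq) (auto simp: card_image)
  then have onto: "pos w < n" "lab (pos w) = w" if "w < n" for w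
    using that lab(3) by (metis imageE lessThan_iff)+
  define x where "x j = arr s 0 j" for j
  define y where "y j = arr s 1 j" for j
  have xy: "x j < n" "y j < n" "x j \<noteq> y j" "edge_of (es ! j) = {x j, y j}" if "j < length es" for j
    using that i listing_nth[OF les order.refl, of j] by (auto simp: x_def y_def has_in_def array_of_def edge_of_def)
  let ?I = "\<lambda>j A. \<forall>u<n. \<forall>v<n. A 12 (u * S + v) \<noteq> 0 \<longleftrightarrow> (\<exists>k<j. {x k, y k} = {lab u, lab v} \<and> {x k, y k} \<notin> F)"
  let ?c = "6 ::= Read 0 (Reg 5) ;; 7 ::= Read 1 (Reg 5) ;;
     If (Read 6 (Ix (Reg 6) (Reg 7))) Skip
       (6 ::= Read 9 (Reg 6) .- Const 1 ;; 7 ::= Read 9 (Reg 7) .- Const 1 ;;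
        Write 12 (Ix (Reg 6) (Reg 7)) (Const 1) ;; Write 12 (Ix (Reg 7) (Reg 6)) (Const 1))"
  show ?thesis unfolding nontree_com_def
  proof (rule wp_mono[OF wp_ForA[where I = ?I and T = 100 and N = "length es"]], goal_cases)
    case (6 j s1)
    note f = 6(2)
    have r: "reg s1 5 = j" "reg s1 2 = S" "arr s1 0 j = x j" "arr s1 1 j = y j" "arr s1 6 = arr s 6" "arr s1 9 = arr s 9"
      "arr s1 (Suc 0) j = y j"
      using 6 baseD[OF b] by (auto simp: fr_def x_def y_def)
    have I: "?I j (arr s1)" using 6 by simp
    note xj = xy[OF 6(1)]
    have "j < S * S" using 6(1) edge_listing_length[OF les order.refl] by simp
    then have jL: "j < L" using SS_W by simp
    have tF: "arr s 6 (x j * S + y j) \<noteq> 0 \<longleftrightarrow> {x j, y j} \<in> F" using T xj by (simp add: has_T_def)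
    define p where "p = pos (x j)"
    define q where "q = pos (y j)"
    have pq: "p < n" "q < n" "lab p = x j" "lab q = y j" using onto xj by (auto simp: p_def q_def)
    define Q where "Q = (\<lambda>s'' :: ram_state. ?I (Suc j) (arr s''))"
    have "vc W L ?c Q s1"
    proof (cases "{x j, y j} \<in> F")
      case True
      have "(\<exists>k<Suc j. {x k, y k} = {lab u, lab v} \<and> {x k, y k} \<notin> F) \<longleftrightarrow>
          (\<exists>k<j. {x k, y k} = {lab u, lab v} \<and> {x k, y k} \<notin> F)" for u v using True less_Suc_eq by auto
      then have "Q (s1\<lparr>reg := (reg s1)(6 := x j, 7 := y j)\<rparr>)" unfolding Q_def using I by simp
      then show ?thesis using True tF xj jL by (simp add: r)
    next
      case False
      let ?A = "(arr s1)(12 := (arr s1 12)(p * S + q := 1, q * S + p := 1))"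
      have "?I (Suc j) ?A"
      proof (intro allI impI)
        fix u v assume uv: "u < n" "v < n"
        have e: "u * S + v = p * S + q \<longleftrightarrow> u = p \<and> v = q" "u * S + v = q * S + p \<longleftrightarrow> u = q \<and> v = p"
          using uv pq by (simp_all add: index_eq)
        have "lab u = lab w \<longleftrightarrow> u = w" "lab v = lab w \<longleftrightarrow> v = w" if "w < n" for w
          using lab(1) uv that by (auto simp: inj_on_def)
        then have l: "{x j, y j} = {lab u, lab v} \<longleftrightarrow> (u = p \<and> v = q) \<or> (u = q \<and> v = p)"
          using pq by (metis doubleton_eq_iff)
        show "(?A 12 (u * S + v) \<noteq> 0) \<longleftrightarrow> (\<exists>k<Suc j. {x k, y k} = {lab u, lab v} \<and> {x k, y k} \<notin> F)"
        proof (cases "{x j, y j} = {lab u, lab v}")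
          case True
          then have "u * S + v = p * S + q \<or> u * S + v = q * S + p" using l e by blast
          then have "?A 12 (u * S + v) \<noteq> 0" by auto
          then show ?thesis using True False by auto
        next
          case F: False
          then have ne: "u * S + v \<noteq> p * S + q" "u * S + v \<noteq> q * S + p" using l e by blast+
          have "?A 12 (u * S + v) = arr s1 12 (u * S + v)" by (simp only: fun_upd_same fun_upd_apply ne if_False simp_thms)
          then show ?thesis using I[rule_format, OF uv] F by (auto simp: less_Suc_eq)
        qed
      qed
      then have "Q (s1\<lparr>reg := (reg s1)(6 := p, 7 := q), arr := ?A\<rparr>)" by (simp add: Q_def)
      then show ?thesis using False tF xj jL pq by (simp add: r p_def q_def pos_def)
    qed
    from wp_vc[OF this] show ?case unfolding Q_def by simp
  next
    case 7
    show ?case by (rule For_le) (use edge_listing_length[OF les order.refl] in auto)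
  next
    case (8 s')
    have "(\<exists>k<length es. {x k, y k} = {lab u, lab v} \<and> {x k, y k} \<notin> F) \<longleftrightarrow> {lab u, lab v} \<in> E - F" for u v
    proof
      assume "\<exists>k<length es. {x k, y k} = {lab u, lab v} \<and> {x k, y k} \<notin> F"
      then obtain k where k: "k < length es" "{x k, y k} = {lab u, lab v}" "{x k, y k} \<notin> F" by blast
      then show "{lab u, lab v} \<in> E - F" using listing_nth(1)[OF les order.refl k(1)] xy(4)[OF k(1)] by simp
    next
      assume e: "{lab u, lab v} \<in> E - F"
      then obtain k where "k < length es" "edge_of (es ! k) = {lab u, lab v}"
        using les unfolding edge_listing_def by (metis (no_types, lifting) DiffD1 in_set_conv_nth length_map nth_map)
      then show "\<exists>k<length es. {x k, y k} = {lab u, lab v} \<and> {x k, y k} \<notin> F" using xy(4)[of k] e by auto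
    qed
    then show ?case using 8(3) by (simp add: lab_def)
  qed (use i z in \<open>auto simp: has_in_def\<close>)
qed

end

section \<open>Distances in trees and stretch factors\<close>

text \<open>Following the steps that lower \<open>r\<close> gives a path of exactly this length,
  without repetitions because \<open>r\<close> decreases. The set \<open>U\<close> confines the
  steps, for instance to one side of a removed edge.\<close>

lemma descending_path:
  assumes "U \<subseteq> V" "z \<in> U" "\<And>x. x \<in> U \<Longrightarrow> x \<noteq> z \<Longrightarrow> \<exists>y\<in>U. {x, y} \<in> F \<and> r x = Suc (r y)" "x \<in> U" "r z = (0::nat)"
  shows "\<exists>p. graph_path V F x p z \<and> length p = Suc (r x)"
proof -
  have "\<exists>p. graph_path V F x p z \<and> length p = Suc k \<and> (\<forall>v\<in>set p. r v \<le> k)" if "x \<in> U" "r x = k" for x k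
    using that
  proof (induction k arbitrary: x)
    case 0
    then have "x = z" using assms(3)[of x] by fastforce
    then have "graph_path V F x [x] z" using 0 assms(1) by (auto simp: graph_path_def)
    then show ?case using 0 by (intro exI[of _ "[x]"]) auto
  next
    case (Suc k)
    then have "x \<noteq> z" using assms(5) by auto
    then obtain y where y: "y \<in> U" "{x, y} \<in> F" "r y = k" using assms(3)[of x] Suc by auto
    then obtain p where p: "graph_path V F y p z" "length p = Suc k" "\<forall>v\<in>set p. r v \<le> k" using Suc.IH by blast
    have "graph_path V F x (x # p) z"
      using p y Suc.prems assms(1) by (auto simp: graph_path_def successively_Cons)
    then show ?case using p Suc.prems by (intro exI[of _ "x # p"]) auto
  qed
  then show ?thesis using assms(4) by blast
qed

lemma path_lower:
  "successively (\<lambda>u v. {u, v} \<in> F) p \<Longrightarrow> p \<noteq> [] \<Longrightarrow> set p \<subseteq> V \<Longrightarrow> last p = z \<Longrightarrow> r z = 0 \<Longrightarrow>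
   (\<And>x y. x \<in> V \<Longrightarrow> y \<in> V \<Longrightarrow> {x, y} \<in> F \<Longrightarrow> r x \<le> Suc (r y)) \<Longrightarrow> r (hd p) < length p"
proof (induction p)
  case (Cons x p)
  show ?case
  proof (cases p)
    case (Cons y q)
    then have "r y < length p" using Cons.prems Cons.IH by (auto simp: successively_Cons)
    moreover have "r x \<le> Suc (r y)" using Cons.prems Cons by (auto simp: successively_Cons)
    ultimately show ?thesis by simp
  qed (use Cons.prems in auto)
qed simp

text \<open>A function that vanishes at \<open>z\<close>, changes by at most one upwards along an
  edge and can always be lowered by a step is the distance to \<open>z\<close>.\<close>

lemma graph_dist_eq:
  assumes "z \<in> V" "r z = 0"
    and "\<And>x y. x \<in> V \<Longrightarrow> y \<in> V \<Longrightarrow> {x, y} \<in> F \<Longrightarrow> r x \<le> Suc (r y)"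
    and "\<And>x. x \<in> V \<Longrightarrow> x \<noteq> z \<Longrightarrow> \<exists>y\<in>V. {x, y} \<in> F \<and> r x = Suc (r y)" and "x \<in> V"
  shows "graph_dist V F x z = r x"
  unfolding graph_dist_def
proof (rule Least_equality)
  show "\<exists>p. graph_path V F x p z \<and> length p = Suc (r x)" by (rule descending_path[of V V z F r x]) (use assms in auto)
  fix k assume "\<exists>p. graph_path V F x p z \<and> length p = Suc k"
  then obtain p where p: "graph_path V F x p z" "length p = Suc k" by blast
  have "r (hd p) < length p" by (rule path_lower[of F p V z r]) (use p assms in \<open>auto simp: graph_path_def\<close>)
  then show "r x \<le> k" using p by (auto simp: graph_path_def)
qed

lemma graph_dist_path:
  assumes "graph_path V F x p y"
  shows "\<exists>q. graph_path V F x q y \<and> length q = Suc (graph_dist V F x y)"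
proof -
  have "\<exists>k p. graph_path V F x p y \<and> length p = Suc k"
    using assms by (metis Suc_pred graph_path_def length_greater_0_conv)
  then show ?thesis unfolding graph_dist_def by (rule LeastI_ex)
qed

lemma graph_dist_edge: "x \<in> V \<Longrightarrow> y \<in> V \<Longrightarrow> {x, y} \<in> F \<Longrightarrow> x \<noteq> y \<Longrightarrow> graph_dist V F x y = 1"
  unfolding graph_dist_def
proof (rule Least_equality)
  assume "x \<in> V" "y \<in> V" "{x, y} \<in> F" "x \<noteq> y"
  then show "\<exists>p. graph_path V F x p y \<and> length p = Suc 1"
    by (intro exI[of _ "[x, y]"]) (auto simp: graph_path_def)
next
  fix k assume "x \<noteq> y" "\<exists>p. graph_path V F x p y \<and> length p = Suc k"
  then show "1 \<le> k" by (cases k) (auto simp: graph_path_def length_Suc_conv)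
qed

section \<open>The stretch of a swapped tree in terms of \<open>tdist\<close>\<close>

locale lab_tree = ptree +
  fixes lab :: "nat \<Rightarrow> nat" and E F :: "nat set set"
  assumes lab: "bij_betw lab {..<n} {..<n}" and sgE: "simple_graph {..<n} E" and te: "two_edge_connected {..<n} E"
    and sp: "graph_spanning_tree {..<n} E F"
    and parF: "\<And>i. 0 < i \<Longrightarrow> i < n \<Longrightarrow> {lab i, lab (par i)} \<in> F"
begin

lemma lab_lt: "i < n \<Longrightarrow> lab i < n" using lab by (auto simp: bij_betw_def)

lemma lab_eq: "i < n \<Longrightarrow> j < n \<Longrightarrow> lab i = lab j \<longleftrightarrow> i = j"
  using lab by (auto simp: bij_betw_def inj_on_def)

lemma lab_ex: "x < n \<Longrightarrow> \<exists>i<n. x = lab i"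
  using lab unfolding bij_betw_def by (metis imageE lessThan_iff)

definition pos :: "nat \<Rightarrow> nat" where "pos x = (THE i. i < n \<and> lab i = x)"

lemma pos_lab [simp]: "i < n \<Longrightarrow> pos (lab i) = i"
  unfolding pos_def using lab_eq by (intro the_equality) auto

lemma F_sub: "F \<subseteq> E" using sp by (simp add: graph_spanning_tree_def)

lemma E_edge: "{x, y} \<in> E \<Longrightarrow> x < n \<and> y < n \<and> x \<noteq> y"
  using sgE by (force simp: simple_graph_def)

lemma adj_F: "i < n \<Longrightarrow> j < n \<Longrightarrow> d i j = 1 \<Longrightarrow> {lab i, lab j} \<in> F"
  using adjacent_iff[of i j] parF[of i] parF[of j] by (auto simp: insert_commute)

text \<open>A tree edge that is not a parent edge would close a cycle with the path in the parent tree.\<close>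
lemma F_adj:
  assumes "{lab i, lab j} \<in> F" "i < n" "j < n"
  shows "d i j = 1"
proof (rule ccontr)
  assume ne: "d i j \<noteq> 1"
  have ij: "i \<noteq> j" using E_edge[of "lab i" "lab j"] F_sub assms by auto
  let ?V = "{..<n}"
  let ?r = "\<lambda>x. d j (pos x)"
  have "\<exists>p. graph_path ?V F (lab i) p (lab j) \<and> length p = Suc (?r (lab i))"
  proof (rule descending_path[of ?V])
    fix x assume "x \<in> ?V" "x \<noteq> lab j"
    then obtain k where k: "k < n" "x = lab k" "k \<noteq> j" using lab_ex[of x] by auto
    then obtain y where "y < n" "d k y = 1" "d j k = Suc (d j y)" using step_towards[of k j] assms by auto
    then show "\<exists>y\<in>?V. {x, y} \<in> F \<and> ?r x = Suc (?r y)"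
      using k adj_F[of k y] lab_lt by (intro bexI[of _ "lab y"]) auto
  qed (use assms lab_lt in auto)
  then obtain p where p: "graph_path ?V F (lab i) p (lab j)" "length p = Suc (d j i)" using assms by auto
  have "2 \<le> d j i" using ne d_pos[of i j] d_sym[of i j] ij assms by simp
  then have "graph_cycle ?V F p" using p assms by (auto simp: graph_cycle_def graph_path_def insert_commute)
  then show False using sp by (auto simp: graph_spanning_tree_def graph_tree_def)
qed

lemma F_iff: "i < n \<Longrightarrow> j < n \<Longrightarrow> {lab i, lab j} \<in> F \<longleftrightarrow> d i j = 1"
  using F_adj adj_F by blast

definition eF :: "nat \<Rightarrow> nat set" where "eF a = {lab a, lab (par a)}"

lemma same_side:
  assumes "0 < a" "a < n" "i < n" "j < n" "d i j = 1" "{lab i, lab j} \<noteq> eF a"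
  shows "i \<in> sub a \<longleftrightarrow> j \<in> sub a"
proof -
  have *: False if "x \<in> sub a" "y \<notin> sub a" "x < n" "y < n" "d x y = 1" "{lab x, lab y} \<noteq> eF a" for x y
  proof -
    have "d x y = Suc (d a x + d (par a) y)" using d_cross assms that by simp
    then have "d a x = 0" "d (par a) y = 0" using that by auto
    then have "x = a" "y = par a" using assms that by auto
    then show False using that by (simp add: eF_def)
  qed
  show ?thesis using *[of i j] *[of j i] assms d_sym[of i j] by (auto simp: insert_commute)
qed

text \<open>The only tree edge between the sides is \<open>eF a\<close>; crossing it would lead away
  from \<open>z\<close>, which lies on the side of \<open>x\<close>.\<close>

lemma step_same_side:
  assumes a: "0 < a" "a < n" and x: "x < n" "z < n" "x \<noteq> z" "x \<in> sub a \<longleftrightarrow> z \<in> sub a"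
  shows "\<exists>y<n. {lab x, lab y} \<in> F - {eF a} \<and> (y \<in> sub a \<longleftrightarrow> x \<in> sub a) \<and> d z x = Suc (d z y)"
proof -
  obtain y where y: "y < n" "d x y = 1" "d z x = Suc (d z y)" using step_towards[OF x(1,2,3)] by auto
  have "{lab x, lab y} \<noteq> eF a"
  proof
    assume "{lab x, lab y} = eF a"
    then have c: "(x = a \<and> y = par a) \<or> (x = par a \<and> y = a)"
      using a x y lab_eq[of x a] lab_eq[of y a] lab_eq[of x "par a"] lab_eq[of y "par a"] par_lt[OF a]
      by (auto simp: eF_def doubleton_eq_iff)
    show False
    proof (cases "z \<in> sub a")
      case True
      then have "x = a" "y = par a" using c x par_nsub[OF a] by auto
      then show False using d_sub[OF a True] y d_sym[of z a] d_sym[of z "par a"] a x by auto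
    next
      case False
      then have "x = par a" "y = a" using c x a by auto
      then show False using d_nsub[OF a x(2) False] y d_sym[of z a] d_sym[of z "par a"] a x by auto
    qed
  qed
  then show ?thesis using y same_side[OF a x(1) y(1,2)] adj_F[of x y] x by blast
qed

lemma component_side:
  assumes a: "0 < a" "a < n" and x: "x < n"
  shows "graph_component {..<n} (F - {eF a}) (lab x) = {lab y | y. y < n \<and> (y \<in> sub a \<longleftrightarrow> x \<in> sub a)}"
proof (intro set_eqI iffI)
  fix w assume "w \<in> graph_component {..<n} (F - {eF a}) (lab x)"
  then obtain p where p: "w < n" "graph_path {..<n} (F - {eF a}) (lab x) p w" by (auto simp: graph_component_def)
  let ?U = "{lab y | y. y < n \<and> (y \<in> sub a \<longleftrightarrow> x \<in> sub a)}"
  have "last p \<in> ?U"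
  proof (rule walk_closed[of "F - {eF a}" p ?U "{..<n}"])
    fix u v assume u: "u \<in> ?U" "v \<in> {..<n}" "{u, v} \<in> F - {eF a}"
    then obtain i where i: "i < n" "u = lab i" "i \<in> sub a \<longleftrightarrow> x \<in> sub a" by auto
    obtain j where j: "j < n" "v = lab j" using u lab_ex by auto
    have "d i j = 1" "{lab i, lab j} \<noteq> eF a" using u i j F_iff by auto
    then have "j \<in> sub a \<longleftrightarrow> i \<in> sub a" using same_side[OF a i(1) j(1)] by simp
    then show "v \<in> ?U" using i j by auto
  qed (use p x in \<open>auto simp: graph_path_def\<close>)
  then show "w \<in> ?U" using p by (simp add: graph_path_def)
next
  fix w assume "w \<in> {lab y | y. y < n \<and> (y \<in> sub a \<longleftrightarrow> x \<in> sub a)}"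
  then obtain y where y: "y < n" "w = lab y" "y \<in> sub a \<longleftrightarrow> x \<in> sub a" by auto
  let ?U = "{lab i | i. i < n \<and> (i \<in> sub a \<longleftrightarrow> y \<in> sub a)}"
  have "\<exists>p. graph_path {..<n} (F - {eF a}) (lab x) p w \<and> length p = Suc (d y (pos (lab x)))"
  proof (rule descending_path[of ?U])
    fix u assume "u \<in> ?U" "u \<noteq> w"
    then obtain i where i: "i < n" "u = lab i" "i \<in> sub a \<longleftrightarrow> y \<in> sub a" "i \<noteq> y" using y by auto
    then obtain j where "j < n" "{lab i, lab j} \<in> F - {eF a}" "j \<in> sub a \<longleftrightarrow> i \<in> sub a" "d y i = Suc (d y j)"
      using step_same_side[OF a, of i y] y by auto
    then show "\<exists>v\<in>?U. {u, v} \<in> F - {eF a} \<and> d y (pos u) = Suc (d y (pos v))"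
      using i by (intro bexI[of _ "lab j"]) auto
  qed (use x y lab_lt in auto)
  then show "w \<in> graph_component {..<n} (F - {eF a}) (lab x)" using y lab_lt by (auto simp: graph_component_def)
qed

definition cross :: "nat \<Rightarrow> nat \<Rightarrow> nat \<Rightarrow> bool" where
  "cross a x y \<longleftrightarrow> x \<in> sub a \<and> y < n \<and> y \<notin> sub a \<and> {lab x, lab y} \<in> E - F"

lemma cross_ltD: "cross a x y \<Longrightarrow> x < n \<and> y < n"
  using sub_less by (auto simp: cross_def)

lemma edge_cross:
  assumes a: "0 < a" "a < n" and e: "{lab x, lab y} \<in> E - {eF a}" "x < n" "y < n" "x \<in> sub a" "y \<notin> sub a"
  shows "cross a x y"
proof -
  have "{lab x, lab y} \<notin> F"
  proof
    assume "{lab x, lab y} \<in> F"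
    then have "d x y = 1" using F_iff e by simp
    then show False using same_side[OF a e(2,3)] e by auto
  qed
  then show ?thesis using e by (simp add: cross_def)
qed

lemma swap_edges_cross:
  assumes a: "0 < a" "a < n"
  shows "swap_edges {..<n} E F (eF a) = {{lab x, lab y} | x y. cross a x y}"
proof (intro set_eqI iffI)
  fix f assume "f \<in> swap_edges {..<n} E F (eF a)"
  then obtain p q where f: "f \<in> E - {eF a}" "f = {p, q}"
    "graph_component {..<n} (F - {eF a}) p \<noteq> graph_component {..<n} (F - {eF a}) q" by (auto simp: swap_edges_def)
  have pq: "p < n" "q < n" using E_edge[of p q] f by auto
  obtain x where x: "x < n" "p = lab x" using lab_ex[OF pq(1)] by auto
  obtain y where y: "y < n" "q = lab y" using lab_ex[OF pq(2)] by auto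
  note xy = x(1) y(1) x(2) y(2)
  have "(x \<in> sub a) \<noteq> (y \<in> sub a)"
    using f(3) component_side[OF a xy(1)] component_side[OF a xy(2)] xy by auto
  then consider "x \<in> sub a" "y \<notin> sub a" | "y \<in> sub a" "x \<notin> sub a" by blast
  then show "f \<in> {{lab x, lab y} | x y. cross a x y}"
  proof cases
    case 1
    then have "cross a x y" using edge_cross[OF a, of x y] f xy by simp
    then show ?thesis using f xy by blast
  next
    case 2
    then have "cross a y x" using edge_cross[OF a, of y x] f xy by (simp add: insert_commute)
    then show ?thesis using f xy by (auto simp: insert_commute)
  qed
next
  fix f assume "f \<in> {{lab x, lab y} | x y. cross a x y}"
  then obtain x y where f: "f = {lab x, lab y}" "cross a x y" by blast
  have lt: "x < n" "y < n" using cross_ltD[OF f(2)] by auto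
  have "eF a \<in> F" using parF[OF a] by (simp add: eF_def)
  then have "f \<in> E - {eF a}" using f by (auto simp: cross_def)
  moreover have "lab x \<in> graph_component {..<n} (F - {eF a}) (lab x)" "lab x \<notin> graph_component {..<n} (F - {eF a}) (lab y)"
    using component_side[OF a lt(1)] component_side[OF a lt(2)] lt f(2) lab_eq by (auto simp: cross_def)
  then have "graph_component {..<n} (F - {eF a}) (lab x) \<noteq> graph_component {..<n} (F - {eF a}) (lab y)" by blast
  ultimately show "f \<in> swap_edges {..<n} E F (eF a)" using f by (auto simp: swap_edges_def)
qed

text \<open>The distance in the swapped tree: unchanged within a side, through the edge between
  \<open>u\<close> and \<open>v\<close> otherwise.\<close>

definition sd :: "nat \<Rightarrow> nat \<Rightarrow> nat \<Rightarrow> nat \<Rightarrow> nat \<Rightarrow> nat" where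
  "sd a u v z x = (if x \<in> sub a then (if z \<in> sub a then d z x else Suc (d u x + d v z))
     else (if z \<in> sub a then Suc (d v x + d u z) else d z x))"

lemma sd_refl [simp]: "sd a u v z z = 0" by (simp add: sd_def)

lemma sd_tri:
  assumes "u < n" "v < n" "x < n" "y < n" "z < n"
  shows "sd a u v z x \<le> sd a u v z y + sd a u v y x"
proof -
  have tri: "d z x \<le> d z y + d y x" "d u x \<le> d u y + d y x" "d v x \<le> d v y + d y x" "d u z \<le> d u y + d z y"
      "d v z \<le> d v y + d z y" "d z x \<le> d u z + d u x" "d z x \<le> d v z + d v x"
    using d_tri[of z y x] d_tri[of u y x] d_tri[of v y x] d_tri[of u y z] d_tri[of v y z] d_tri[of z u x] d_tri[of z v x]
      d_sym[of z u] d_sym[of z v] d_sym[of y z] assms by simp_all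
  show ?thesis
    using tri unfolding sd_def by (cases "x \<in> sub a"; cases "y \<in> sub a"; cases "z \<in> sub a") simp_all
qed

text \<open>By \<open>sd_tri\<close> the Lipschitz condition needs to be checked only for single
  edges. The descent goes towards \<open>z\<close> within its side, and otherwise towards the
  endpoint of the swap edge on the own side.\<close>

lemma swap_dist:
  assumes a: "0 < a" "a < n" and f: "cross a u v" and xz: "x < n" "z < n"
  shows "graph_dist {..<n} (swap_tree F (eF a) {lab u, lab v}) (lab x) (lab z) = sd a u v z x"
proof -
  let ?V = "{..<n}"
  let ?T = "swap_tree F (eF a) {lab u, lab v}"
  have uv: "u \<in> sub a" "v \<notin> sub a" "u < n" "v < n" using f cross_ltD[OF f] by (auto simp: cross_def)
  have "graph_dist ?V ?T (lab x) (lab z) = sd a u v z (pos (lab x))"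
  proof (rule graph_dist_eq[where r = "\<lambda>w. sd a u v z (pos w)"])
    fix p q assume pq: "p \<in> ?V" "q \<in> ?V" "{p, q} \<in> ?T"
    obtain i where i: "i < n" "p = lab i" using lab_ex[of p] pq by auto
    obtain j where j: "j < n" "q = lab j" using lab_ex[of q] pq by auto
    note ij = i(1) j(1) i(2) j(2)
    have "sd a u v j i \<le> 1"
    proof (cases "{p, q} = {lab u, lab v}")
      case True
      then have "(i = u \<and> j = v) \<or> (i = v \<and> j = u)" using ij uv lab_eq[of i u] lab_eq[of i v] lab_eq[of j u] lab_eq[of j v] by (auto simp: doubleton_eq_iff)
      then show ?thesis using uv by (auto simp: sd_def)
    next
      case False
      then have "{lab i, lab j} \<in> F - {eF a}" using pq ij by (auto simp: swap_tree_def)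
      then have "d i j = 1" "{lab i, lab j} \<noteq> eF a" using F_iff ij by auto
      then show ?thesis using same_side[OF a ij(1,2)] d_sym[of i j] ij by (auto simp: sd_def)
    qed
    then show "sd a u v z (pos p) \<le> Suc (sd a u v z (pos q))"
      using sd_tri[OF uv(3,4) ij(1,2) xz(2), of a] ij by simp
  next
    fix p assume p: "p \<in> ?V" "p \<noteq> lab z"
    then obtain i where i: "i < n" "p = lab i" "i \<noteq> z" using lab_ex[of p] by auto
    have "\<exists>j<n. {lab i, lab j} \<in> ?T \<and> sd a u v z i = Suc (sd a u v z j)"
    proof (cases "i \<in> sub a \<longleftrightarrow> z \<in> sub a")
      case True
      then obtain j where "j < n" "{lab i, lab j} \<in> F - {eF a}" "j \<in> sub a \<longleftrightarrow> i \<in> sub a" "d z i = Suc (d z j)"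
        using step_same_side[OF a i(1) xz(2) i(3)] by auto
      then show ?thesis using True by (intro exI[of _ j]) (auto simp: sd_def swap_tree_def)
    next
      case False
      define w where "w = (if i \<in> sub a then u else v)"
      define w' where "w' = (if i \<in> sub a then v else u)"
      have w: "w < n" "i \<in> sub a \<longleftrightarrow> w \<in> sub a" using uv by (auto simp: w_def)
      show ?thesis
      proof (cases "i = w")
        case True
        then show ?thesis using False uv d_sym[of u z] d_sym[of v z] xz
          by (intro exI[of _ w']) (auto simp: sd_def swap_tree_def w_def w'_def insert_commute split: if_splits)
      next
        case ne: False
        then obtain j where "j < n" "{lab i, lab j} \<in> F - {eF a}" "j \<in> sub a \<longleftrightarrow> i \<in> sub a" "d w i = Suc (d w j)"
          using step_same_side[OF a i(1) w(1) ne w(2)] by auto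
        then show ?thesis using False by (intro exI[of _ j]) (auto simp: sd_def swap_tree_def w_def split: if_splits)
      qed
    qed
    then obtain j where "j < n" "{lab i, lab j} \<in> ?T" "sd a u v z i = Suc (sd a u v z j)" by auto
    then show "\<exists>q\<in>?V. {p, q} \<in> ?T \<and> sd a u v z (pos p) = Suc (sd a u v z (pos q))"
      using i lab_lt[of j] by (intro bexI[of _ "lab j"]) auto
  qed (use xz lab_lt in auto)
  then show ?thesis using xz by simp
qed

text \<open>Adding up the edges of a path: a bound for edges bounds the stretch of all pairs, so
  only edges matter.\<close>

lemma path_stretch:
  assumes uv: "u < n" "v < n"
    and M: "\<And>i j. i < n \<Longrightarrow> j < n \<Longrightarrow> {lab i, lab j} \<in> H \<Longrightarrow> real (sd a u v j i) \<le> M"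
  shows "successively (\<lambda>x y. {x, y} \<in> H) p \<Longrightarrow> p \<noteq> [] \<Longrightarrow> set p \<subseteq> {..<n} \<Longrightarrow>
     real (sd a u v (pos (last p)) (pos (hd p))) \<le> real (length p - 1) * M"
proof (induction p)
  case (Cons x p)
  show ?case
  proof (cases "p = []")
    case False
    then have IH: "real (sd a u v (pos (last p)) (pos (hd p))) \<le> real (length p - 1) * M"
      using Cons by (auto simp: successively_Cons)
    have "hd p \<in> set p" "last p \<in> set p" using False by auto
    then have lt: "x < n" "hd p < n" "last p < n" using Cons.prems by auto
    obtain i where i: "i < n" "x = lab i" using lab_ex[OF lt(1)] by auto
    obtain j where j: "j < n" "hd p = lab j" using lab_ex[OF lt(2)] by auto
    obtain k where k: "k < n" "last p = lab k" using lab_ex[OF lt(3)] by auto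
    note ij = i(1) j(1) k(1) i(2) j(2) k(2)
    have "{lab i, lab j} \<in> H" using Cons.prems False ij by (auto simp: successively_Cons)
    then have "real (sd a u v j i) \<le> M" using M ij by simp
    moreover have "sd a u v k i \<le> sd a u v k j + sd a u v j i" using sd_tri uv ij by simp
    moreover have "real (length p) * M = real (length p - 1) * M + M"
      using False by (cases p) (auto simp: algebra_simps)
    ultimately have "real (sd a u v k i) \<le> real (length p) * M" using IH ij by simp
    then show ?thesis using False ij by simp
  qed simp
qed simp

text \<open>With \<open>f\<close> a crossing edge has distance at most \<open>Suc \<kappa>\<close>,
  and with any other swap edge some crossing edge has at least that. Edges within a side cost the
  same in both trees, so every bound for the edges of the other tree also holds for this
  one.\<close>

lemma best_swap:
  assumes a: "0 < a" "a < n" and f: "cross a u v"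
    and up: "\<And>x y. cross a x y \<Longrightarrow> d x u + d y v \<le> \<kappa>"
    and lo: "\<And>u' v'. cross a u' v' \<Longrightarrow> \<exists>x y. cross a x y \<and> \<kappa> \<le> d x u' + d y v'"
  shows "best_swap_edge {..<n} E F (eF a) {lab u, lab v}"
proof -
  let ?V = "{..<n}"
  let ?H = "E - {eF a}"
  let ?st = "\<lambda>g. stretch ?V ?H (swap_tree F (eF a) g)"
  have eE: "eF a \<in> E" using parF[OF a] F_sub by (auto simp: eF_def)
  have conn: "graph_connected ?V ?H" using te eE by (simp add: two_edge_connected_def)
  have uv: "u < n" "v < n" "u \<in> sub a" "v \<notin> sub a" using f cross_ltD[OF f] by (auto simp: cross_def)
  have le: "?st {lab u, lab v} \<le> ?st {lab u', lab v'}" if g: "cross a u' v'" for u' v'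
  proof -
    define M where "M = ?st {lab u', lab v'}"
    have uv': "u' < n" "v' < n" "u' \<in> sub a" "v' \<notin> sub a" using g cross_ltD[OF g] by (auto simp: cross_def)
    have fin: "finite {real (graph_dist ?V T x y) / real (graph_dist ?V ?H x y) | x y. x \<in> ?V \<and> y \<in> ?V \<and> x \<noteq> y}" for T
    proof (rule finite_subset)
      show "{real (graph_dist ?V T x y) / real (graph_dist ?V ?H x y) | x y. x \<in> ?V \<and> y \<in> ?V \<and> x \<noteq> y}
        \<subseteq> (\<lambda>(x, y). real (graph_dist ?V T x y) / real (graph_dist ?V ?H x y)) ` (?V \<times> ?V)" by auto
    qed simp
    have Mg: "real (sd a u' v' j i) \<le> M" if "i < n" "j < n" "{lab i, lab j} \<in> ?H" for i j
    proof -
      have ne: "lab i \<noteq> lab j" using E_edge[of "lab i" "lab j"] that by auto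
      have d1: "graph_dist ?V ?H (lab i) (lab j) = 1" by (rule graph_dist_edge) (use that ne lab_lt in auto)
      have "real (graph_dist ?V (swap_tree F (eF a) {lab u', lab v'}) (lab i) (lab j)) / real (graph_dist ?V ?H (lab i) (lab j)) \<le> M"
        unfolding M_def stretch_def by (rule Max_ge[OF fin]) (use that ne lab_lt in blast)
      then show ?thesis using swap_dist[OF a g that(1,2)] d1 by simp
    qed
    \<comment> \<open>The stretch \<open>M\<close> of the competitor bounds each edge of the graph
      in the new tree; \<open>path_stretch\<close> then carries it over to all pairs.\<close>
    have Mf: "real (sd a u v j i) \<le> M" if ij: "i < n" "j < n" "{lab i, lab j} \<in> ?H" for i j
    proof (cases "i \<in> sub a \<longleftrightarrow> j \<in> sub a")
      case True
      then have "sd a u v j i = sd a u' v' j i" by (auto simp: sd_def)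
      then show ?thesis using Mg[OF ij] by simp
    next
      case False
      obtain x y where xy: "cross a x y" "\<kappa> \<le> d x u' + d y v'" using lo[OF g] by blast
      have "sd a u v j i \<le> Suc \<kappa>"
      proof (cases "i \<in> sub a")
        case True
        then have "cross a i j" using edge_cross[OF a ij(3,1,2)] False by simp
        then show ?thesis using up[of i j] True False d_sym[of u i] d_sym[of v j] uv ij by (simp add: sd_def)
      next
        case i: False
        then have "cross a j i" using edge_cross[OF a _ ij(2,1)] ij(3) False by (simp add: insert_commute)
        then show ?thesis using up[of j i] i False d_sym[of u j] d_sym[of v i] uv ij by (simp add: sd_def)
      qed
      also have "Suc \<kappa> \<le> sd a u' v' y x"
        using xy cross_ltD[OF xy(1)] d_sym[of u' x] d_sym[of v' y] uv' by (auto simp: sd_def cross_def)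
      finally have "real (sd a u v j i) \<le> real (sd a u' v' y x)" by simp
      also have "\<dots> \<le> M"
      proof (rule Mg)
        show "x < n" "y < n" using cross_ltD[OF xy(1)] by auto
        have "eF a \<in> F" using parF[OF a] by (simp add: eF_def)
        then show "{lab x, lab y} \<in> ?H" using xy(1) by (auto simp: cross_def)
      qed
      finally show ?thesis .
    qed
    have "?st {lab u, lab v} \<le> M" unfolding stretch_def[of _ _ "swap_tree F (eF a) {lab u, lab v}"]
    proof (subst Max_le_iff[OF fin])
      have "lab 0 \<noteq> lab a" "lab 0 < n" "lab a < n" using lab_eq[of 0 a] lab_lt a n_pos by auto
      then show "{real (graph_dist ?V (swap_tree F (eF a) {lab u, lab v}) x y) / real (graph_dist ?V ?H x y) | x y. x \<in> ?V \<and> y \<in> ?V \<and> x \<noteq> y} \<noteq> {}"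
        by blast
      show "\<forall>t\<in>{real (graph_dist ?V (swap_tree F (eF a) {lab u, lab v}) x y) / real (graph_dist ?V ?H x y) | x y. x \<in> ?V \<and> y \<in> ?V \<and> x \<noteq> y}. t \<le> M"
      proof
        fix t assume "t \<in> {real (graph_dist ?V (swap_tree F (eF a) {lab u, lab v}) x y) / real (graph_dist ?V ?H x y) | x y. x \<in> ?V \<and> y \<in> ?V \<and> x \<noteq> y}"
        then obtain x y where t: "x < n" "y < n" "x \<noteq> y"
          "t = real (graph_dist ?V (swap_tree F (eF a) {lab u, lab v}) x y) / real (graph_dist ?V ?H x y)" by auto
        obtain i where i: "i < n" "x = lab i" using lab_ex[of x] t by auto
        obtain j where j: "j < n" "y = lab j" using lab_ex[of y] t by auto
        note ij = i(1) j(1) i(2) j(2)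
        have "x \<in> ?V" "y \<in> ?V" using t by auto
        then have "\<exists>p. graph_path ?V ?H x p y" using conn unfolding graph_connected_def by blast
        then obtain p0 where p0: "graph_path ?V ?H x p0 y" by (elim exE)
        obtain p where p: "graph_path ?V ?H x p y" "length p = Suc (graph_dist ?V ?H x y)"
          using graph_dist_path[OF p0] by (elim exE conjE)
        have pos: "0 < graph_dist ?V ?H x y"
        proof (rule ccontr)
          assume "\<not> 0 < graph_dist ?V ?H x y"
          then have "length p = 1" using p by simp
          then show False using p(1) t(3) by (auto simp: graph_path_def length_Suc_conv)
        qed
        have "real (sd a u v (pos (last p)) (pos (hd p))) \<le> real (length p - 1) * M"
          by (rule path_stretch[where H = ?H, OF uv(1,2) Mf]) (use p(1) in \<open>simp_all add: graph_path_def\<close>)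
        then have "real (sd a u v j i) \<le> real (graph_dist ?V ?H x y) * M" using p ij by (simp add: graph_path_def)
        then show "t \<le> M" using t(4) swap_dist[OF a f ij(1,2)] ij pos by (simp add: divide_le_eq mult.commute)
      qed
    qed
    then show ?thesis by (simp add: M_def)
  qed
  show ?thesis unfolding best_swap_edge_def is_arg_min_def swap_edges_cross[OF a]
  proof (intro conjI notI)
    show "{lab u, lab v} \<in> {{lab x, lab y} | x y. cross a x y}" using f by blast
    assume "\<exists>g. g \<in> {{lab x, lab y} | x y. cross a x y} \<and> ?st g < ?st {lab u, lab v}"
    then obtain x y where "cross a x y" "?st {lab x, lab y} < ?st {lab u, lab v}" by auto
    then show False using le[of x y] by simp
  qed
qed

text \<open>Without a crossing edge the subtree of \<open>a\<close> would be closed in the graph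
  minus the tree edge, against 2-edge-connectedness.\<close>

lemma cross_ex:
  assumes a: "0 < a" "a < n"
  shows "\<exists>x y. cross a x y"
proof (rule ccontr)
  assume no: "\<not> (\<exists>x y. cross a x y)"
  have eE: "eF a \<in> E" using parF[OF a] F_sub by (auto simp: eF_def)
  have conn: "graph_connected {..<n} (E - {eF a})" using te eE by (simp add: two_edge_connected_def)
  have "{..<n} \<subseteq> lab ` sub a"
  proof (rule closed_all[OF conn])
    show "lab a \<in> lab ` sub a" "lab a \<in> {..<n}" using a lab_lt by auto
    fix p q assume pq: "p \<in> lab ` sub a" "q \<in> {..<n}" "{p, q} \<in> E - {eF a}"
    obtain x where x: "x \<in> sub a" "p = lab x" using pq by auto
    obtain y where y: "y < n" "q = lab y" using pq lab_ex by auto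
    show "q \<in> lab ` sub a"
    proof (rule ccontr)
      assume "q \<notin> lab ` sub a"
      then have "cross a x y" using edge_cross[OF a, of x y] pq x y sub_less by auto
      then show False using no by blast
    qed
  qed
  moreover have "lab (par a) \<notin> lab ` sub a"
    using par_nsub[OF a] lab_eq[of "par a"] par_lt[OF a] sub_less by auto
  ultimately show False using lab_lt[OF par_lt[OF a]] by auto
qed

end

section \<open>Assembling the phases and the resource bounds\<close>

lemma wp_then:
  assumes "wp W L c1 T1 Q s" "\<And>s1. Q s1 \<Longrightarrow> wp W L c2 T2 R s1"
  shows "wp W L (c1 ;; c2) (T1 + T2) R s"
  by (rule wp_seq, rule wp_mono[OF assms(1)]) (use assms(2) in auto)

definition solve_com :: com where
  "solve_com = dist_com ;; anc_com ;; ball_init_com ;; ball_edges_com ;; ball_prefix_com ;; meet_min_com ;; near_init_com ;; near_up_com ;; near_down_com ;;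
     log_com ;; pow_com ;; ctz_com ;; mask_com ;; block_min_com ;; sparse_com ;; all_swaps_com"

context tree_machine
begin

lemma has_ball_fr: "fr c s s' \<Longrightarrow> wra c \<inter> {15, 16, 17, 18} = {} \<Longrightarrow> has_ball (arr s') = has_ball (arr s)"
  using quada_fr[of c s s' 15] by (simp add: has_ball_def)

lemma has_M_fr: "fr c s s' \<Longrightarrow> 19 \<notin> wra c \<Longrightarrow> has_M (arr s') = has_M (arr s)"
  by (simp add: has_M_def fr_arr1)

lemma has_NN_fr: "fr c s s' \<Longrightarrow> 20 \<notin> wra c \<Longrightarrow> has_NN (arr s') = has_NN (arr s)"
  by (simp add: has_NN_def fr_arr1)

lemma r_lg_fr: "fr c s s' \<Longrightarrow> 21 \<notin> wra c \<Longrightarrow> r_lg (arr s') = r_lg (arr s)"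
  by (simp add: r_lg_def fr_arr1)

lemma r_pow_fr: "fr c s s' \<Longrightarrow> 22 \<notin> wra c \<Longrightarrow> r_pow (arr s') = r_pow (arr s)"
  by (simp add: r_pow_def fr_arr1 fun_eq_iff)

lemma r_ctz_fr: "fr c s s' \<Longrightarrow> 23 \<notin> wra c \<Longrightarrow> r_ctz (arr s') = r_ctz (arr s)"
  by (simp add: r_ctz_def fr_arr1)

lemma r_mask_fr: "fr c s s' \<Longrightarrow> wra c \<inter> {13, 19, 24} = {} \<Longrightarrow> r_mask (arr s') = r_mask (arr s)"
  using sfx_cong[of "arr s'" "arr s"] by (simp add: r_mask_def fr_arr1 fun_eq_iff)

lemma has_M_keys: "has_M A \<Longrightarrow> has_keys A"
  by (simp add: has_M_def has_keys_def)

lemmas frs = base_fr has_par_fr has_N_fr has_d_fr has_anc_fr has_ball_fr has_M_fr has_NN_fr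
  r_lg_fr r_pow_fr r_ctz_fr r_mask_fr

text \<open>The fifteen preparatory phases cost \<open>1000 * (S * S)\<close> each, the final loop
  \<open>10000 * (S * S)\<close>. The predicates \<open>C0\<close> to \<open>C15\<close> record what
  has been established at each stage.\<close>

lemma wp_solve_com:
  assumes s0: "base s" "has_par s" "has_N s" and l: "arr s 7 = lab" and e: "arr s 10 = eix"
    and ex: "\<And>a. 0 < a \<Longrightarrow> a < n \<Longrightarrow> \<exists>x y. crs a x y"
    and ei: "inj_on eix {0<..<n}" "\<And>i. 0 < i \<Longrightarrow> i < n \<Longrightarrow> eix i < L"
  shows "wp W L solve_com (25000 * (S * S)) (\<lambda>s'. \<forall>a. 0 < a \<and> a < n \<longrightarrow>
     (\<exists>u v. best_pair a u v \<and> arr s' 4 (eix a) = lab u \<and> arr s' 5 (eix a) = lab v)) s"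
proof -
  let ?T = "1000 * (S * S)"
  define C0 where "C0 s \<longleftrightarrow> base s \<and> has_par s \<and> has_N s \<and> arr s 7 = lab \<and> arr s 10 = eix" for s :: ram_state
  define C1 where "C1 s \<longleftrightarrow> C0 s \<and> has_d s" for s :: ram_state
  define C2 where "C2 s \<longleftrightarrow> C1 s \<and> has_anc s" for s :: ram_state
  define X where "X s \<longleftrightarrow> (\<forall>p<S*S. arr s 19 p = n)" for s :: ram_state
  define B where "B s \<longleftrightarrow> (\<forall>u<n. \<forall>l<n. diam_pair (BE u l) (quada (arr s) 15 (u * S + l)))" for s :: ram_state
  define C6 where "C6 s \<longleftrightarrow> C2 s \<and> has_ball (arr s) \<and> has_M (arr s)" for s :: ram_state
  define N0 where "N0 s \<longleftrightarrow> (\<forall>u<n. \<forall>c<n. nearest c {v. N u v \<and> v = c} (arr s 20 (u * S + c)))" for s :: ram_state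
  define N1 where "N1 s \<longleftrightarrow> (\<forall>u<n. \<forall>c<n. nearest c {v. N u v \<and> v \<in> sub c \<and> ld u v \<le> ld u c} (arr s 20 (u * S + c)))" for s :: ram_state
  define C9 where "C9 s \<longleftrightarrow> C6 s \<and> has_NN (arr s)" for s :: ram_state
  define C10 where "C10 s \<longleftrightarrow> C9 s \<and> r_lg (arr s)" for s :: ram_state
  define C11 where "C11 s \<longleftrightarrow> C10 s \<and> r_sb (reg s 10) \<and> r_pow (arr s) (reg s 10)" for s :: ram_state
  define C12 where "C12 s \<longleftrightarrow> C11 s \<and> r_ctz (arr s)" for s :: ram_state
  define C13 where "C13 s \<longleftrightarrow> C12 s \<and> r_mask (arr s) (reg s 10)" for s :: ram_state
  define C14 where "C14 s \<longleftrightarrow> C13 s \<and> reg s 11 = S * S div reg s 10" for s :: ram_state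
  define Z where "Z s \<longleftrightarrow> (\<forall>i<S * S div reg s 10. minv (arr s) (i * reg s 10) ((i + 1) * reg s 10) (arr s 25 i))" for s :: ram_state
  define C15 where "C15 s \<longleftrightarrow> ready s \<and> arr s 7 = lab \<and> arr s 10 = eix" for s :: ram_state
  have X_fr: "X s' = X s" if "fr c s s'" "19 \<notin> wra c" for c s s' using that by (simp add: X_def fr_arr1)
  note C = C0_def C1_def C2_def C6_def C9_def C10_def C11_def C12_def C13_def C14_def
  note f = frs X_fr fr_arr1 fr_reg
  have c1: "wp W L dist_com ?T C1 s" if "C0 s" for s
    by (rule wp_mono[OF wp_dist_com]) (use that in \<open>simp_all add: C f\<close>)
  have c2: "wp W L anc_com ?T C2 s" if "C1 s" for s
    by (rule wp_mono[OF wp_anc_com]) (use that in \<open>simp_all add: C f\<close>)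
  have c3: "wp W L ball_init_com ?T (\<lambda>s. C2 s \<and> all_nil (arr s)) s" if "C2 s" for s
    by (rule wp_mono[OF wp_ball_init_com]) (use that in \<open>simp_all add: C f\<close>)
  have c4: "wp W L ball_edges_com ?T (\<lambda>s. C2 s \<and> X s \<and> B s) s" if "C2 s \<and> all_nil (arr s)" for s
  proof -
    have "X s" using that by (simp add: X_def all_nil_def)
    then show ?thesis by (intro wp_mono[OF wp_ball_edges_com]) (use that in \<open>simp_all add: C f B_def\<close>)
  qed
  have c5: "wp W L ball_prefix_com ?T (\<lambda>s. C2 s \<and> X s \<and> has_ball (arr s)) s" if "C2 s \<and> X s \<and> B s" for s
    by (rule wp_mono[OF wp_ball_prefix_com]) (use that in \<open>simp_all add: C f B_def\<close>)
  have c6: "wp W L meet_min_com ?T C6 s" if "C2 s \<and> X s \<and> has_ball (arr s)" for s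
  proof -
    have "\<forall>p<S*S. arr s 19 p = n" using that by (simp add: X_def)
    then show ?thesis by (intro wp_mono[OF wp_meet_min_com]) (use that in \<open>simp_all add: C f\<close>)
  qed
  have c7: "wp W L near_init_com ?T (\<lambda>s. C6 s \<and> N0 s) s" if "C6 s" for s
    by (rule wp_mono[OF wp_near_init_com]) (use that in \<open>simp_all add: C f N0_def\<close>)
  have c8: "wp W L near_up_com ?T (\<lambda>s. C6 s \<and> N1 s) s" if "C6 s \<and> N0 s" for s
    by (rule wp_mono[OF wp_near_up_com]) (use that in \<open>simp_all add: C f N0_def N1_def\<close>)
  have c9: "wp W L near_down_com ?T C9 s" if "C6 s \<and> N1 s" for s
    by (rule wp_mono[OF wp_near_down_com]) (use that in \<open>simp_all add: C f N1_def\<close>)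
  have c10: "wp W L log_com ?T C10 s" if "C9 s" for s
    by (rule wp_mono[OF wp_log_com]) (use that in \<open>simp_all add: C f\<close>)
  have c11: "wp W L pow_com ?T C11 s" if "C10 s" for s
    by (rule wp_mono[OF wp_pow_com]) (use that in \<open>simp_all add: C f\<close>)
  have c12: "wp W L ctz_com ?T C12 s" if "C11 s" for s
    by (rule wp_mono[OF wp_ctz_com]) (use that in \<open>simp_all add: C f\<close>)
  have c13: "wp W L mask_com ?T C13 s" if "C12 s" for s
    by (rule wp_mono[OF wp_mask_com[of s "reg s 10"]]) (use that in \<open>simp_all add: C f has_M_keys\<close>)
  have c14: "wp W L block_min_com ?T (\<lambda>s. C14 s \<and> Z s) s" if "C13 s" for s
    by (rule wp_mono[OF wp_block_min_com[of s "reg s 10"]]) (use that in \<open>simp_all add: C f has_M_keys Z_def\<close>)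
  have c15: "wp W L sparse_com ?T C15 s" if "C14 s \<and> Z s" for s
    by (rule wp_mono[OF wp_sparse_com[of s "reg s 10"]])
      (use that in \<open>simp_all add: C f has_M_keys Z_def C15_def ready_def has_rmq_def\<close>)
  have c16: "wp W L all_swaps_com (10000 * (S * S)) (\<lambda>s'. \<forall>a. 0 < a \<and> a < n \<longrightarrow>
     (\<exists>u v. best_pair a u v \<and> arr s' 4 (eix a) = lab u \<and> arr s' 5 (eix a) = lab v)) s" if "C15 s" for s
    using wp_all_swaps_com[of s] that ex ei by (simp add: C15_def)
  have C0: "C0 s" using s0 l e by (simp add: C0_def)
  show ?thesis unfolding solve_com_def
    by (rule wp_mono, rule wp_then[OF c1[OF C0]], (erule wp_then[OF c2] wp_then[OF c3] wp_then[OF c4] wp_then[OF c5] wp_then[OF c6]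
      wp_then[OF c7] wp_then[OF c8] wp_then[OF c9] wp_then[OF c10] wp_then[OF c11] wp_then[OF c12] wp_then[OF c13]
      wp_then[OF c14] wp_then[OF c15])+, erule c16) simp_all
qed

end

definition best_swaps_com :: com where
  "best_swaps_com = init_com ;; tree_edges_com ;; bfs_com ;; nontree_com ;; solve_com"

context graph_input
begin

text \<open>Each tree edge is the parent edge of some vertex, by \<open>F_iff\<close> and
  \<open>adjacent_iff\<close>, and the stored index identifies it in the input list. Minimality of
  \<open>K\<close> is exactly the hypothesis of \<open>best_swap\<close>.\<close>

lemma wp_solve_com_swap:
  assumes b: "base s" and bf: "bfs (arr s) n"
    and NE: "\<forall>u<n. \<forall>v<n. arr s 12 (u * S + v) \<noteq> 0 \<longleftrightarrow> {arr s 7 u, arr s 7 v} \<in> E - F"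
  shows "wp W L solve_com (25000 * (S * S))
     (\<lambda>s'. \<forall>i<length ts. best_swap_edge {..<n} E F (edge_of (ts ! i)) (output_edge s' i)) s"
proof -
  define lab where "lab = arr s 7"
  define par where "par = arr s 8"
  define eix where "eix = arr s 10"
  define N where "N u v \<longleftrightarrow> u < n \<and> v < n \<and> {lab u, lab v} \<in> E - F" for u v
  have par: "par k < k" "eix k < length ts" "{lab k, lab (par k)} = edge_of (ts ! eix k)" if "0 < k" "k < n" for k
    using bf that by (auto simp: bfs_def lab_def par_def eix_def)
  have inj: "inj_on lab {..<n}" and ran: "\<And>k. k < n \<Longrightarrow> lab k < n" and par0: "par 0 = 0"
    using bf by (auto simp: bfs_def lab_def par_def)
  have "lab ` {..<n} = {..<n}"
    by (rule card_subset_eq) (use ran in \<open>auto simp: card_image[OF inj]\<close>)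
  then have bij: "bij_betw lab {..<n} {..<n}" using inj by (simp add: bij_betw_def)
  interpret t: tree_machine W L n S par N
    by unfold_locales (use n0 par(1) in \<open>auto simp: N_def insert_commute\<close>)
  have parF: "{lab k, lab (par k)} \<in> F" if "0 < k" "k < n" for k
    using par(3)[OF that] listing_nth(1)[OF lts F_E par(2)[OF that]] by simp
  interpret l: lab_tree n par lab E F
    by unfold_locales (fact bij sg tec st parF)+
  have cross: "t.crs a x y \<longleftrightarrow> l.cross a x y" for a x y
    using t.sub_less[of x a] by (auto simp: t.crs_def l.cross_def N_def)
  have edge: "edge_of (ts ! eix a) = l.eF a" if "0 < a" "a < n" for a
    using par(3)[OF that] by (simp add: l.eF_def)
  have "wp W L solve_com (25000 * (S * S)) (\<lambda>s'. \<forall>a. 0 < a \<and> a < n \<longrightarrow>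
     (\<exists>u v. t.best_pair a u v \<and> arr s' 4 (eix a) = lab u \<and> arr s' 5 (eix a) = lab v)) s"
  proof (rule t.wp_solve_com)
    show "t.has_par s" using par(1) par0 n0 unfolding t.has_par_def par_def[symmetric]
      by (metis gr0I less_trans)
    show "t.has_N s" using NE by (auto simp: t.has_N_def N_def lab_def)
    show "\<exists>x y. t.crs a x y" if "0 < a" "a < n" for a using l.cross_ex[OF that] by (simp add: cross)
    show "inj_on eix {0<..<n}"
    proof (rule inj_onI)
      fix i j assume ij: "i \<in> {0<..<n}" "j \<in> {0<..<n}" "eix i = eix j"
      then have "{lab i, lab (par i)} = {lab j, lab (par j)}" using par(3)[of i] par(3)[of j] by simp
      moreover have "par i < n" "par j < n" using ij par(1)[of i] par(1)[of j] by auto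
      ultimately have "i = j \<or> (i = par j \<and> par i = j)"
        using ij l.lab_eq[of i j] l.lab_eq[of i "par j"] l.lab_eq[of "par i" j] by (auto simp: doubleton_eq_iff)
      then show "i = j" using ij par(1)[of i] par(1)[of j] by auto
    qed
    show "eix i < L" if "0 < i" "i < n" for i
      using par(2)[OF that] edge_listing_length[OF lts F_E] L_ge by simp
  qed (simp_all add: b lab_def eix_def)
  then show ?thesis
  proof (rule wp_mono)
    fix s' :: ram_state assume R: "\<forall>a. 0 < a \<and> a < n \<longrightarrow>
     (\<exists>u v. t.best_pair a u v \<and> arr s' 4 (eix a) = lab u \<and> arr s' 5 (eix a) = lab v)"
    show "\<forall>i<length ts. best_swap_edge {..<n} E F (edge_of (ts ! i)) (output_edge s' i)"
    proof (intro allI impI)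
      fix i assume i: "i < length ts"
      obtain x y where xy: "edge_of (ts ! i) = {lab x, lab y}" "x < n" "y < n"
        using l.lab_ex[OF listing_nth(2)[OF lts F_E i]] l.lab_ex[OF listing_nth(3)[OF lts F_E i]]
        by (auto simp: edge_of_def)
      then have "tdist par x y = 1" using l.F_iff[of x y] listing_nth(1)[OF lts F_E i] by simp
      then obtain a where a: "0 < a" "a < n" "edge_of (ts ! i) = l.eF a"
        using t.adjacent_iff[of x y] xy by (auto simp: l.eF_def insert_commute)
      have ia: "eix a = i" using listing_inj[OF lts par(2)[OF a(1,2)] i] edge a by simp
      obtain u v where uv: "t.best_pair a u v" "arr s' 4 i = lab u" "arr s' 5 i = lab v" using R a ia by auto
      have c: "t.crs a u v" "\<And>u' v'. t.crs a u' v' \<Longrightarrow> t.K a u v \<le> t.K a u' v'"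
        using uv(1) by (auto simp: t.best_pair_def)
      have lt: "x < n" "y < n" if "t.crs a x y" for x y using l.cross_ltD that cross by auto
      have "best_swap_edge {..<n} E F (l.eF a) {lab u, lab v}"
      proof (rule l.best_swap[OF a(1,2), where \<kappa> = "t.K a u v"])
        show "l.cross a u v" using c by (simp add: cross)
        show "tdist par x u + tdist par y v \<le> t.K a u v" if "l.cross a x y" for x y
          unfolding t.K_def using that cross lt[OF c(1)] by (intro Max_ge t.K_set) auto
        fix u' v' assume g: "l.cross a u' v'"
        then have g': "t.crs a u' v'" by (simp add: cross)
        have "t.K a u' v' \<in> {tdist par x u' + tdist par y v' | x y. t.crs a x y}"
          unfolding t.K_def using g' lt[OF g'] by (intro Max_in t.K_set) auto
        then obtain x y where "l.cross a x y" "t.K a u v \<le> tdist par x u' + tdist par y v'"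
          using c(2)[OF g'] by (auto simp: cross)
        then show "\<exists>x y. l.cross a x y \<and> t.K a u v \<le> tdist par x u' + tdist par y v'" by blast
      qed
      then show "best_swap_edge {..<n} E F (edge_of (ts ! i)) (output_edge s' i)"
        using a uv by (simp add: output_edge_def)
    qed
  qed simp
qed

lemma wp_best_swaps_com:
  assumes r: "reg s 0 = n" and i: "has_in s"
    and z: "\<And>a. a \<in> {6, 7, 8, 9, 12} \<Longrightarrow> arr s a = (\<lambda>_. 0)"
  shows "wp W L best_swaps_com (30000 * (S * S))
     (\<lambda>s'. \<forall>i<length ts. best_swap_edge {..<n} E F (edge_of (ts ! i)) (output_edge s' i)) s"
proof -
  let ?T = "1000 * (S * S)"
  define z where "z s x \<longleftrightarrow> arr s x = (\<lambda>_. 0)" for s :: ram_state and x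
  define I0 where "I0 s \<longleftrightarrow> has_in s \<and> z s 7 \<and> z s 8 \<and> z s 9 \<and> z s 12" for s :: ram_state
  define I1 where "I1 s \<longleftrightarrow> base s \<and> has_in s \<and> z s 12 \<and> has_T (arr s)" for s :: ram_state
  define NE where "NE s \<longleftrightarrow> (\<forall>u<n. \<forall>v<n. arr s 12 (u * S + v) \<noteq> 0 \<longleftrightarrow> {arr s 7 u, arr s 7 v} \<in> E - F)" for s :: ram_state
  have z_fr: "z s' x = z s x" if "fr c s s'" "x \<notin> wra c" for c s s' x using that by (simp add: z_def fr_arr1)
  have in_fr: "has_in s' = has_in s" if "fr c s s'" "wra c \<inter> {0, 1, 2, 3} = {}" "1 \<notin> wrr c" for c s s'
    using that by (simp add: has_in_def fr_arr1 fr_reg)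
  have T_fr: "has_T (arr s') = has_T (arr s)" if "fr c s s'" "6 \<notin> wra c" for c s s'
    using that by (simp add: has_T_def fr_arr1)
  have bfs_fr: "bfs (arr s') n = bfs (arr s) n" if "fr c s s'" "wra c \<inter> {7, 8, 9, 10} = {}" for c s s'
    using that by (simp add: bfs_def fr_arr1)
  note f = base_fr z_fr in_fr T_fr bfs_fr
  have z0: "z s 6" "I0 s" using z i by (simp_all add: z_def I0_def)
  have c1: "wp W L init_com ?T (\<lambda>s. base s \<and> I0 s \<and> z s 6) s"
    by (rule wp_mono[OF wp_init_com[OF r]]) (use z0 S_eq in \<open>auto simp: f I0_def\<close>)
  have c2: "wp W L tree_edges_com ?T (\<lambda>s. I1 s \<and> z s 7 \<and> z s 8 \<and> z s 9) s" if "base s \<and> I0 s \<and> z s 6" for s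
    by (rule wp_mono[OF wp_tree_edges_com]) (use that in \<open>simp_all add: f I0_def I1_def, simp_all add: z_def\<close>)
  have c3: "wp W L bfs_com ?T (\<lambda>s. I1 s \<and> bfs (arr s) n) s" if "I1 s \<and> z s 7 \<and> z s 8 \<and> z s 9" for s
    by (rule wp_mono[OF wp_bfs_com]) (use that in \<open>simp_all add: f I0_def I1_def, simp_all add: z_def\<close>)
  have c4: "wp W L nontree_com ?T (\<lambda>s. base s \<and> bfs (arr s) n \<and> NE s) s" if "I1 s \<and> bfs (arr s) n" for s
    by (rule wp_mono[OF wp_nontree_com])
      (use that in \<open>simp_all add: f I0_def I1_def NE_def fr_arr1, simp_all add: z_def\<close>)
  have c5: "wp W L solve_com (25000 * (S * S))
     (\<lambda>s'. \<forall>i<length ts. best_swap_edge {..<n} E F (edge_of (ts ! i)) (output_edge s' i)) s"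
    if "base s \<and> bfs (arr s) n \<and> NE s" for s
    using wp_solve_com_swap[of s] that by (simp add: NE_def)
  show ?thesis unfolding best_swaps_com_def
    by (rule wp_mono, rule wp_then[OF c1], (erule wp_then[OF c2] wp_then[OF c3] wp_then[OF c4])+, erule c5) simp_all
qed

lemma bse_run:
  assumes W: "L < W"
  shows "\<exists>t s. run W L best_swaps_com (input_state n es ts) t s \<and> t \<le> 30000 * (S * S) \<and>
     (\<forall>i<length ts. best_swap_edge {..<n} E F (edge_of (ts ! i)) (output_edge s i))"
proof -
  let ?s = "input_state n es ts"
  have nW: "n < W" "1 < W" using S_eq n_ge L_ge W by (auto intro: less_le_trans)
  have len: "length es < W" using edge_listing_length[OF les] L_ge W by simp
  have "array_of (map g xs) i < W" if "edge_listing xs D" "D \<subseteq> E" "g = fst \<or> g = snd" for g xs D i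
    using listing_nth(2,3)[OF that(1,2), of i] that(3) nW by (auto simp: array_of_def)
  then have "bnd W ?s" using nW len les lts F_E by (auto simp: bnd_def input_state_def)
  moreover have "wp W L best_swaps_com (30000 * (S * S))
     (\<lambda>s'. \<forall>i<length ts. best_swap_edge {..<n} E F (edge_of (ts ! i)) (output_edge s' i)) ?s"
    by (rule wp_best_swaps_com) (auto simp: has_in_def input_state_def)
  ultimately show ?thesis by (simp add: wp_def)
qed

end

lemma quadratic_bigo: "(\<lambda>n. real (a + b * (Suc n * Suc n))) \<in> O(\<lambda>n. real n ^ 2)"
proof (rule landau_o.bigI)
  show "0 < real (a + 4 * b) + 1" by simp
  show "\<forall>\<^sub>F n in sequentially. norm (real (a + b * (Suc n * Suc n))) \<le> (real (a + 4 * b) + 1) * norm (real n ^ 2)"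
    using eventually_gt_at_top[of 0]
  proof eventually_elim
    case (elim n)
    then have "Suc n * Suc n \<le> (2 * n) * (2 * n)" by (intro mult_le_mono) auto
    then have "b * (Suc n * Suc n) \<le> b * ((2 * n) * (2 * n))" by (rule mult_le_mono2)
    moreover have "a \<le> a * n\<^sup>2" using elim by simp
    ultimately have "a + b * (Suc n * Suc n) \<le> a * n\<^sup>2 + b * ((2 * n) * (2 * n))" by (intro add_mono)
    also have "\<dots> \<le> (a + 4 * b + 1) * n\<^sup>2" by (simp add: algebra_simps power2_eq_square)
    finally have "a + b * (Suc n * Suc n) \<le> (a + 4 * b + 1) * n\<^sup>2" .
    then have "real (a + b * (Suc n * Suc n)) \<le> real ((a + 4 * b + 1) * n\<^sup>2)" by (rule of_nat_mono)
    also have "\<dots> = (real (a + 4 * b) + 1) * norm (real n ^ 2)" by (simp add: algebra_simps)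
    finally show ?case by (simp del: of_nat_add of_nat_mult)
  qed
qed

theorem theorem10:
  shows "\<exists>(P :: com) (k :: nat) (time :: nat \<Rightarrow> nat) (space :: nat \<Rightarrow> nat).
     (\<lambda>n. real (time n)) \<in> O(\<lambda>n. real n ^ 2) \<and>
     (\<lambda>n. real (space n)) \<in> O(\<lambda>n. real n ^ 2) \<and>
     (\<forall>(n :: nat) (E :: nat set set) (F :: nat set set) es ts.
        simple_graph {..<n} E \<and> two_edge_connected {..<n} E \<and>
        graph_spanning_tree {..<n} E F \<and> edge_listing es E \<and> edge_listing ts F \<longrightarrow>
        (\<exists>L t s. run (n ^ k) L P (input_state n es ts) t s \<and>
           t \<le> time n \<and> com_space P L \<le> space n \<and>
           (\<forall>i < length ts.
              best_swap_edge {..<n} E F (edge_of (ts ! i)) (output_edge s i))))"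
proof -
  let ?time = "\<lambda>n. 0 + 30000 * (Suc n * Suc n)"
  let ?space = "\<lambda>n. card (com_regs best_swaps_com) + (card (com_arrs best_swaps_com) * 16) * (Suc n * Suc n)"
  have "\<exists>L t s. run (n ^ 10) L best_swaps_com (input_state n es ts) t s \<and> t \<le> ?time n \<and> com_space best_swaps_com L \<le> ?space n \<and>
      (\<forall>i < length ts. best_swap_edge {..<n} E F (edge_of (ts ! i)) (output_edge s i))"
    if G: "simple_graph {..<n} E" "two_edge_connected {..<n} E" "graph_spanning_tree {..<n} E F"
      "edge_listing es E" "edge_listing ts F" for n E F es ts
  proof -
    define L where "L = 16 * (Suc n * Suc n)"
    have n: "2 \<le> n" using G(2) by (simp add: two_edge_connected_def)
    \<comment> \<open>The exponent 10 suffices for all \<open>n \<ge> 2\<close>: the array length is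
      at most \<open>64 * n ^ 2\<close>, and \<open>n ^ 8\<close> is at least 256.\<close>
    then have "(2::nat) ^ 8 \<le> n ^ 8" by (rule power_mono) simp
    then have "256 * (n * n) \<le> n ^ 8 * (n * n)" by (intro mult_le_mono1) simp
    moreover have "n ^ 10 = n ^ 8 * (n * n)" by (simp add: numeral_eq_Suc)
    moreover have "Suc n * Suc n \<le> (2 * n) * (2 * n)" using n by (intro mult_le_mono) auto
    moreover have "0 < n * n" using n by simp
    ultimately have W: "L < n ^ 10" unfolding L_def by linarith
    interpret graph_input "n ^ 10" L n "Suc n" E F es ts
      by unfold_locales (use n W G in \<open>simp_all add: L_def\<close>)
    have "com_space best_swaps_com L \<le> ?space n" by (simp only: com_space_def L_def mult.assoc order_refl)
    then show ?thesis using bse_run[OF W] by auto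
  qed
  then show ?thesis
    by (intro exI[of _ best_swaps_com] exI[of _ 10] exI[of _ ?time] exI[of _ ?space] conjI quadratic_bigo) blast
qed

end
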